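(* Let $n>1$ be even and $f\in\widetilde{C}^\infty_{0e}(\mathbb{R}^n)$, and put $F=\mathcal{U}f$. Then (i) $F\in\widetilde{C}^\infty_{e}(\mathbb{R}^n)$ (as a function of $(x',t)$), and the function $(x',\tau)\mapsto H(\tau)\,F(x',\sqrt{\tau})/\sqrt{\tau}$ on $\mathbb{R}^n$ belongs to the Sobolev space $H^s(\mathbb{R}^n)$ for every real $s$; (ii) for every $j\ge 0$ and every multi-index $\alpha$ there is a constant $C_{j,\alpha}$ with $|\partial_{x'}^\alpha\partial_t^jF(x',t)|\le C_{j,\alpha}(1+|t|)^{-(n-1)/2}$ for all $(x',t)\in\mathbb{R}^n$. Moreover, the range of the extension of $\mathcal{U}$ to $L^2_{e,w}(\mathbb{R}^n)$ is a closed subspace of $L^2_{e,w}(\mathbb{R}^n)$.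
   Context: Points of $\mathbb{R}^n$ are written $x=(x',x_n)$ with $x'\in\mathbb{R}^{n-1}$. $\widetilde{C}^\infty_{e}(\mathbb{R}^n)$ is the set of smooth functions on $\mathbb{R}^n$ that are even in the last variable and vanish to infinite order on the hyperplane where the last variable is $0$; $\widetilde{C}^\infty_{0e}(\mathbb{R}^n)$ is its subspace of compactly supported functions. $L^2_{e,w}(\mathbb{R}^n)$ is the Hilbert space of measurable functions, even in the last variable, with $\int|f(x)|^2|x_n|^{-1}dx<\infty$. For $f\in\widetilde{C}^\infty_{0e}(\mathbb{R}^n)$ let $u$ solve $u_{tt}-\Delta u=0$ on $\mathbb{R}^n\times\mathbb{R}$, $u(x,0)=f$, $u_t(x,0)=0$, and set $(\mathcal{U}f)(x',t):=u(x',0,t)$. $\mathcal{U}$ satisfies $\int|f|^2/|x_n|=\int|\mathcal{U}f|^2/|t|$ and hence extends to an isometry of $L^2_{e,w}(\mathbb{R}^n)$. $H$ is the Heaviside function. *)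

theory Defs
  imports "HOL-Analysis.Analysis"
begin

definition pdir :: "'a::euclidean_space \<Rightarrow> ('a \<Rightarrow> 'b::real_normed_vector) \<Rightarrow> 'a \<Rightarrow> 'b" where
  "pdir v f x = vector_derivative (\<lambda>s::real. f (x + s *\<^sub>R v)) (at 0)"

fun iter_pd :: "'a::euclidean_space list \<Rightarrow> ('a \<Rightarrow> 'b::real_normed_vector) \<Rightarrow> 'a \<Rightarrow> 'b" where
  "iter_pd [] f = f"
| "iter_pd (v # vs) f = pdir v (iter_pd vs f)"

definition smooth :: "('a::euclidean_space \<Rightarrow> 'b::real_normed_vector) \<Rightarrow> bool" where
  "smooth f \<longleftrightarrow> (\<forall>vs \<in> lists Basis.
      continuous_on UNIV (iter_pd vs f) \<and>
      (\<forall>v\<in>Basis. \<forall>x. ((\<lambda>s. iter_pd vs f (x + s *\<^sub>R v))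
            has_vector_derivative pdir v (iter_pd vs f) x) (at 0)))"

text \<open>Points of R^n are pairs (x', x_n) with x' :: real^'n, so n = CARD('n) + 1.\<close>

definition even_last :: "((real^'n) \<times> real \<Rightarrow> 'b) \<Rightarrow> bool" where
  "even_last f \<longleftrightarrow> (\<forall>x' y. f (x', - y) = f (x', y))"

definition Ce_tilde :: "((real^'n) \<times> real \<Rightarrow> real) set" where
  "Ce_tilde = {f. smooth f \<and> even_last f \<and>
      (\<forall>vs \<in> lists Basis. \<forall>x'. iter_pd vs f (x', 0) = 0)}"

definition C0e_tilde :: "((real^'n) \<times> real \<Rightarrow> real) set" where
  "C0e_tilde = {f. f \<in> Ce_tilde \<and> bounded {x. f x \<noteq> 0}}"

definition wdist2 :: "((real^'n) \<times> real \<Rightarrow> real) \<Rightarrow> ((real^'n) \<times> real \<Rightarrow> real) \<Rightarrow> ennreal" where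
  "wdist2 g h = (\<integral>\<^sup>+ x. ennreal ((g x - h x)\<^sup>2 / \<bar>snd x\<bar>) \<partial>lborel)"

definition L2ew :: "((real^'n) \<times> real \<Rightarrow> real) set" where
  "L2ew = {g. g \<in> borel_measurable lborel \<and> even_last g \<and> wdist2 g (\<lambda>_. 0) < \<infinity>}"

text \<open>Space-time points are ((x', x_n), t).\<close>
definition wave_solution :: "((real^'n) \<times> real \<Rightarrow> real) \<Rightarrow> (((real^'n) \<times> real) \<times> real \<Rightarrow> real) \<Rightarrow> bool" where
  "wave_solution f u \<longleftrightarrow> smooth u \<and>
     (\<forall>p. iter_pd [(0,1),(0,1)] u p - (\<Sum>e\<in>Basis. iter_pd [(e,0),(e,0)] u p) = 0) \<and>
     (\<forall>x. u (x, 0) = f x) \<and>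
     (\<forall>x. iter_pd [(0,1)] u (x, 0) = 0)"

definition wave_U :: "((real^'n) \<times> real \<Rightarrow> real) \<Rightarrow> ((real^'n) \<times> real \<Rightarrow> real)" where
  "wave_U f = (let u = (THE u. wave_solution f u) in (\<lambda>(x', t). u ((x', 0), t)))"

text \<open>Range of the continuous (isometric) extension of U to L2ew.\<close>
definition U_ext_range :: "((real^'n) \<times> real \<Rightarrow> real) set" where
  "U_ext_range = {g. g \<in> L2ew \<and> (\<exists>f fk. f \<in> L2ew \<and> (\<forall>k. fk k \<in> C0e_tilde) \<and>
       (\<lambda>k. wdist2 (fk k) f) \<longlonglongrightarrow> 0 \<and> (\<lambda>k. wdist2 (wave_U (fk k)) g) \<longlonglongrightarrow> 0)}"

definition heaviside :: "real \<Rightarrow> real" where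
  "heaviside t = (if t \<ge> 0 then 1 else 0)"

definition test_fun :: "('a::euclidean_space \<Rightarrow> complex) \<Rightarrow> bool" where
  "test_fun \<phi> \<longleftrightarrow> smooth \<phi> \<and> bounded {x. \<phi> x \<noteq> 0}"

definition fourier :: "('a::euclidean_space \<Rightarrow> complex) \<Rightarrow> 'a \<Rightarrow> complex" where
  "fourier \<phi> x = (\<integral> \<xi>. \<phi> \<xi> * cis (- (x \<bullet> \<xi>)) \<partial>lborel)"

text \<open>g \<in> H^s: the distributional Fourier transform of g (defined by duality against
  Fourier transforms of test functions) is a function G with (1+|xi|^2)^(s/2) G in L2.\<close>
definition sobolev :: "real \<Rightarrow> ('a::euclidean_space \<Rightarrow> real) \<Rightarrow> bool" where
  "sobolev s g \<longleftrightarrow>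
     (\<forall>\<phi>. test_fun \<phi> \<longrightarrow> integrable lborel (\<lambda>x. complex_of_real (g x) * fourier \<phi> x)) \<and>
     (\<exists>G :: 'a \<Rightarrow> complex. G \<in> borel_measurable lborel \<and>
        (\<integral>\<^sup>+ \<xi>. ennreal ((1 + (norm \<xi>)\<^sup>2) powr s * (cmod (G \<xi>))\<^sup>2) \<partial>lborel) < \<infinity> \<and>
        (\<forall>\<phi>. test_fun \<phi> \<longrightarrow>
           (\<integral> x. complex_of_real (g x) * fourier \<phi> x \<partial>lborel) = (\<integral> \<xi>. G \<xi> * \<phi> \<xi> \<partial>lborel)))"

end

(*
Let g(x', z) = f(x', sqrt z) / sqrt z for z > 0 and g = 0 for z <= 0, and let G arise in the same way
from F. Averaging the wave equation over t with the weight exp (- p t^2) yields solutions of the heat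
equation: up to a power of sqrt (pi / p), the integral of exp (- p t^2) F(x', t) over t is the integral of
exp (- p |v|^2) f((x', 0) + v) over v, for all p with positive real part. Substituting z = t^2, the
Laplace transforms of G and g in z differ by the factor exp (- |xi|^2 / (4 p)) on the Fourier side in x'.
As p tends to the imaginary axis, G turns out to be the Fourier multiplier of g with the unimodular symbol
exp (i |xi|^2 / (4 sigma)). Since f is even and flat, g is smooth with compact support, so G lies in every
Sobolev space, and the Plancherel identity gives the isometry.

For n = 2 nu the powers of p combine to p^nu, hence G is pi^(-nu) times the integral of the nu-th z-derivative
of g over the paraboloid {(x' + w', tau - |w|^2)}. At tau = t^2 this paraboloid meets the support of g in a
set of parameters w of measure O(t^(-1/2)), and invariance of the Lebesgue measure under dilations of w trades each
z-derivative for a factor 1 / t. Thus F = t G(x', t^2) is O(t^(1 - 1/2 - nu)) = O(t^(-(n - 1) / 2)).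
Space derivatives and even time derivatives of F are traces of derivatives of f, and the mean value theorem
takes care of odd time derivatives. The range is closed because the isometry maps a Cauchy sequence of
images back to a Cauchy sequence in a complete space.
*)
theory Submission
  imports Defs "HOL-Probability.Probability"
begin

section \<open>Integrals depending on a parameter\<close>

text \<open>\<open>wave_U\<close> picks the solution by definite description, so nothing is known
  about it before existence and uniqueness are settled. No growth at infinity is assumed, so
  uniqueness needs an energy estimate localised in a light cone. The solution is a superposition of
  waves exp (i (x . \<xi> + t |\<xi>|)), whose phase is not smooth at the origin; smoothness
  therefore rests on decay of the amplitude, not on regularity of the phase. The same obstacle
  returns in the limit symbol, which is singular at \<sigma> = 0. On the imaginary axis neither the
  Gaussians nor F in t need be integrable, hence the detour through Re p > 0: there all integrals
  converge absolutely, and |exp (- |\<xi>|^2 / (4 p))| is at most 1, a bound independent of p. No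
  branch of sqrt (pi / p) is ever chosen: \<open>gaussian_const p\<close> stays an integral, and
  only its square is computed. Parity matters for this reason: for even n the n-th power is a whole
  power of pi / p, so whole z-derivatives appear. The divisor sqrt z comes from the weight: dz = 2 y
  dy turns |y|^(-1) dy on the half line into a multiple of the Lebesgue measure for f / y.\<close>

lemma tendsto_integral_at_within:
  fixes f :: "'p::metric_space \<Rightarrow> 'a \<Rightarrow> 'b::{banach,second_countable_topology}"
  assumes lim: "AE x in M. ((\<lambda>p. f p x) \<longlongrightarrow> g x) (at p0 within U)"
    and meas: "\<And>p. p \<in> U \<Longrightarrow> f p \<in> borel_measurable M" "g \<in> borel_measurable M"
    and bound: "eventually (\<lambda>p. AE x in M. norm (f p x) \<le> w x) (at p0 within U)"
    and w: "integrable M w"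
  shows "((\<lambda>p. \<integral>x. f p x \<partial>M) \<longlongrightarrow> (\<integral>x. g x \<partial>M)) (at p0 within U)"
  unfolding tendsto_at_iff_sequentially
proof (intro allI impI)
  fix X assume X: "\<forall>i. X i \<in> U - {p0}" "X \<longlonglongrightarrow> p0"
  have fl: "filterlim X (at p0 within U) sequentially"
    using X by (auto simp: filterlim_at intro!: always_eventually)
  \<comment> \<open>Domination holds only near \<open>p0\<close>; \<open>N\<close> is the index from
    which the test sequence stays there, and the shift by \<open>N\<close> discards the
    rest.\<close>
  have "eventually (\<lambda>i. AE x in M. norm (f (X i) x) \<le> w x) sequentially"
    using bound fl by (rule eventually_compose_filterlim)
  then obtain N where N: "\<And>i. i \<ge> N \<Longrightarrow> AE x in M. norm (f (X i) x) \<le> w x"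
    unfolding eventually_sequentially by blast
  have "(\<lambda>i. \<integral>x. f (X (i + N)) x \<partial>M) \<longlonglongrightarrow> (\<integral>x. g x \<partial>M)"
  proof (rule integral_dominated_convergence[where w=w])
    show "AE x in M. (\<lambda>i. f (X (i + N)) x) \<longlonglongrightarrow> g x"
      using lim
    proof eventually_elim
      case (elim x)
      have "(\<lambda>i. f (X i) x) \<longlonglongrightarrow> g x" by (rule filterlim_compose[OF elim fl])
      then show ?case by (rule LIMSEQ_ignore_initial_segment)
    qed
  qed (use X meas N w in auto)
  then show "((\<lambda>p. \<integral>x. f p x \<partial>M) \<circ> X) \<longlonglongrightarrow> (\<integral>x. g x \<partial>M)"
    unfolding comp_def by (rule LIMSEQ_offset)
qed

lemma continuous_on_integral_dominated:
  fixes f :: "'p::metric_space \<Rightarrow> 'a \<Rightarrow> 'b::{banach,second_countable_topology}"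
  assumes cont: "\<And>x. x \<in> space M \<Longrightarrow> continuous_on U (\<lambda>p. f p x)"
    and meas: "\<And>p. p \<in> U \<Longrightarrow> f p \<in> borel_measurable M"
    and bound: "\<And>p0. p0 \<in> U \<Longrightarrow> \<exists>w d. 0 < d \<and> integrable M w \<and>
      (\<forall>p\<in>U. dist p p0 < d \<longrightarrow> (\<forall>x\<in>space M. norm (f p x) \<le> w x))"
  shows "continuous_on U (\<lambda>p. \<integral>x. f p x \<partial>M)"
  unfolding continuous_on_def
proof
  fix p0 assume p0: "p0 \<in> U"
  from bound[OF this] obtain w d where w: "0 < d" "integrable M w"
    "\<And>p x. p \<in> U \<Longrightarrow> dist p p0 < d \<Longrightarrow> x \<in> space M \<Longrightarrow> norm (f p x) \<le> w x" by blast
  show "((\<lambda>p. \<integral>x. f p x \<partial>M) \<longlongrightarrow> (\<integral>x. f p0 x \<partial>M)) (at p0 within U)"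
  proof (rule tendsto_integral_at_within[where w=w])
    show "AE x in M. ((\<lambda>p. f p x) \<longlongrightarrow> f p0 x) (at p0 within U)"
      using cont p0 by (auto simp: continuous_on_def)
    show "\<forall>\<^sub>F p in at p0 within U. AE x in M. norm (f p x) \<le> w x"
      unfolding eventually_at using w by (intro exI[of _ d]) auto
  qed (use meas p0 w in auto)
qed

text \<open>Difference quotients are the form of differentiability to which dominated convergence
  applies directly.\<close>

lemma has_vector_derivative_iff_slope:
  "(f has_vector_derivative D) (at x within S) \<longleftrightarrow>
    ((\<lambda>y. (f y - f x) /\<^sub>R (y - x)) \<longlongrightarrow> D) (at x within S)"
proof -
  have *: "norm ((1 / norm (y - x)) *\<^sub>R (f y - (f x + (y - x) *\<^sub>R D)))
      = norm ((f y - f x) /\<^sub>R (y - x) - D)" if "y \<noteq> x" for y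
  proof -
    have "f y - (f x + (y - x) *\<^sub>R D) = (y - x) *\<^sub>R ((f y - f x) /\<^sub>R (y - x) - D)"
      using that by (simp add: scaleR_diff_right)
    then show ?thesis using that by simp
  qed
  have "(f has_vector_derivative D) (at x within S) \<longleftrightarrow>
      ((\<lambda>y. norm ((1 / norm (y - x)) *\<^sub>R (f y - (f x + (y - x) *\<^sub>R D)))) \<longlongrightarrow> 0) (at x within S)"
    unfolding has_vector_derivative_def has_derivative_within tendsto_norm_zero_iff
    by (simp add: bounded_linear_scaleR_left)
  also have "\<dots> \<longleftrightarrow> ((\<lambda>y. norm ((f y - f x) /\<^sub>R (y - x) - D)) \<longlongrightarrow> 0) (at x within S)"
  proof (rule tendsto_cong)
    show "\<forall>\<^sub>F y in at x within S. norm ((1 / norm (y - x)) *\<^sub>R (f y - (f x + (y - x) *\<^sub>R D)))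
        = norm ((f y - f x) /\<^sub>R (y - x) - D)"
      unfolding eventually_at_filter by (rule always_eventually) (use * in blast)
  qed
  finally show ?thesis
    unfolding tendsto_norm_zero_iff LIM_zero_iff .
qed

text \<open>A bound on the derivative on a whole interval bounds all difference quotients by the
  mean value inequality; dominated convergence with the same \<open>w\<close> does the rest.\<close>

lemma has_vector_derivative_integral:
  fixes f :: "real \<Rightarrow> 'a \<Rightarrow> 'b::{banach,second_countable_topology}"
  assumes d: "0 < d"
    and int: "\<And>s. \<bar>s - s0\<bar> < d \<Longrightarrow> integrable M (f s)"
    and deriv: "\<And>s x. \<bar>s - s0\<bar> < d \<Longrightarrow> x \<in> space M \<Longrightarrow>
        ((\<lambda>s. f s x) has_vector_derivative f' s x) (at s)"
    and meas: "f' s0 \<in> borel_measurable M"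
    and bound: "\<And>s x. \<bar>s - s0\<bar> < d \<Longrightarrow> x \<in> space M \<Longrightarrow> norm (f' s x) \<le> w x"
    and w: "integrable M w"
  shows "((\<lambda>s. \<integral>x. f s x \<partial>M) has_vector_derivative (\<integral>x. f' s0 x \<partial>M)) (at s0)"
proof -
  define U where "U = ball s0 d"
  have U: "s \<in> U \<longleftrightarrow> \<bar>s - s0\<bar> < d" for s by (auto simp: U_def dist_real_def)
  have opU: "open U" and cU: "convex U" and s0U: "s0 \<in> U" using d by (auto simp: U_def)
  define q where "q s x = (f s x - f s0 x) /\<^sub>R (s - s0)" for s x
  have qw: "norm (q s x) \<le> w x" if "s \<in> U" "x \<in> space M" for s x
  proof -
    have "norm (f s x - f s0 x) \<le> w x * norm (s - s0)"
    proof (rule differentiable_bound[OF cU, where f'="\<lambda>s h. h *\<^sub>R f' s x"])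
      show "((\<lambda>s. f s x) has_derivative (\<lambda>h. h *\<^sub>R f' t x)) (at t within U)" if "t \<in> U" for t
        using deriv[of t x] that \<open>x \<in> space M\<close> U
        by (auto simp: has_vector_derivative_def intro: has_derivative_at_withinI)
      show "onorm (\<lambda>h. h *\<^sub>R f' t x) \<le> w x" if "t \<in> U" for t
        using bound[of t x] that \<open>x \<in> space M\<close> U
        by (intro onorm_bound) (auto simp: mult.commute intro: mult_left_mono order_trans[OF norm_ge_zero])
    qed (use that s0U in auto)
    moreover have "0 \<le> w x" using bound[of s0 x] that d by (auto intro: order_trans[OF norm_ge_zero])
    ultimately show ?thesis
      by (cases "s = s0") (auto simp: q_def divide_simps)
  qed
  have "((\<lambda>s. \<integral>x. q s x \<partial>M) \<longlongrightarrow> (\<integral>x. f' s0 x \<partial>M)) (at s0 within U)"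
  proof (rule tendsto_integral_at_within[where w=w])
    show "AE x in M. ((\<lambda>s. q s x) \<longlongrightarrow> f' s0 x) (at s0 within U)"
    proof (rule AE_I2)
      fix x assume "x \<in> space M"
      then have "((\<lambda>s. f s x) has_vector_derivative f' s0 x) (at s0 within U)"
        using deriv[of s0 x] d by (auto intro: has_vector_derivative_at_within)
      then show "((\<lambda>s. q s x) \<longlongrightarrow> f' s0 x) (at s0 within U)"
        unfolding has_vector_derivative_iff_slope q_def .
    qed
    show "q s \<in> borel_measurable M" if "s \<in> U" for s
      using int[of s] int[of s0] that d U unfolding q_def by (auto intro!: borel_measurable_integrable)
    show "\<forall>\<^sub>F s in at s0 within U. AE x in M. norm (q s x) \<le> w x"
      using qw by (auto simp: eventually_at_filter)
  qed (use meas w in auto)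
  then have *: "((\<lambda>s. \<integral>x. q s x \<partial>M) \<longlongrightarrow> (\<integral>x. f' s0 x \<partial>M)) (at s0)"
    unfolding at_within_open[OF s0U opU] .
  have "((\<lambda>s. ((\<integral>x. f s x \<partial>M) - (\<integral>x. f s0 x \<partial>M)) /\<^sub>R (s - s0)) \<longlongrightarrow> (\<integral>x. f' s0 x \<partial>M)) (at s0)"
  proof (rule Lim_transform_eventually[OF *])
    have "\<forall>\<^sub>F s in at s0. s \<in> U" by (rule eventually_at_in_open'[OF opU s0U])
    then show "\<forall>\<^sub>F s in at s0. (\<integral>x. q s x \<partial>M) = ((\<integral>x. f s x \<partial>M) - (\<integral>x. f s0 x \<partial>M)) /\<^sub>R (s - s0)"
    proof eventually_elim
      case (elim s)
      have i: "integrable M (f s)" "integrable M (f s0)" using elim int U d by auto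
      show ?case unfolding q_def integral_scaleR_right Bochner_Integration.integral_diff[OF i] ..
    qed
  qed
  then show ?thesis unfolding has_vector_derivative_iff_slope .
qed


section \<open>Changes of variables\<close>

lemma
  fixes f :: "'a::euclidean_space \<Rightarrow> 'b::{banach,second_countable_topology}"
  shows lborel_integral_translate: "(\<integral>x. f (t + x) \<partial>lborel) = (\<integral>x. f x \<partial>lborel)"
    and lborel_integrable_translate: "integrable lborel (\<lambda>x. f (t + x)) \<longleftrightarrow> integrable lborel f"
proof -
  have eq: "lborel = distr lborel borel (\<lambda>x::'a. t + x)"
    using lborel_affine[of 1 t] by (simp add: density_1)
  have bm: "(\<lambda>x::'a. t + x) \<in> measurable lborel borel" by simp
  show 1: "integrable lborel (\<lambda>x. f (t + x)) \<longleftrightarrow> integrable lborel f" 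
  proof
    assume "integrable lborel (\<lambda>x. f (t + x))"
    moreover from this have "(\<lambda>x. f (t + (- t + x))) \<in> borel_measurable borel"
      by (intro measurable_compose[of "\<lambda>x. -t + x" borel borel "\<lambda>x. f (t + x)"]) auto
    ultimately show "integrable lborel f" by (subst eq, subst integrable_distr_eq) auto
  next
    assume "integrable lborel f"
    then show "integrable lborel (\<lambda>x. f (t + x))"
      by (subst (asm) eq, subst (asm) integrable_distr_eq) auto
  qed
  show "(\<integral>x. f (t + x) \<partial>lborel) = (\<integral>x. f x \<partial>lborel)"
  proof (cases "integrable lborel f")
    case True
    then show ?thesis by (subst (2) eq, subst integral_distr) auto
  qed (use 1 in \<open>simp add: not_integrable_integral_eq\<close>)
qed

lemma
  fixes f :: "'a::euclidean_space \<Rightarrow> 'b::{banach,second_countable_topology}"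
  assumes c: "c \<noteq> 0" and f: "f \<in> borel_measurable borel"
  shows lborel_integral_scale: "(\<integral>x. f x \<partial>lborel) = \<bar>c\<bar> ^ DIM('a) *\<^sub>R (\<integral>x. f (c *\<^sub>R x) \<partial>lborel)"
    and lborel_integrable_scale: "integrable lborel (\<lambda>x. f (c *\<^sub>R x)) \<longleftrightarrow> integrable lborel f"
proof -
  have eq: "lborel = density (distr lborel borel (\<lambda>x::'a. c *\<^sub>R x)) (\<lambda>_. ennreal (\<bar>c\<bar> ^ DIM('a)))"
    using lborel_affine[OF c, of 0] by (simp add: ennreal_power)
  note [measurable] = f
  show "(\<integral>x. f x \<partial>lborel) = \<bar>c\<bar> ^ DIM('a) *\<^sub>R (\<integral>x. f (c *\<^sub>R x) \<partial>lborel)"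
    by (subst eq) (simp add: integral_density integral_distr)
  show "integrable lborel (\<lambda>x. f (c *\<^sub>R x)) \<longleftrightarrow> integrable lborel f"
  proof -
    have "integrable lborel f \<longleftrightarrow> integrable lborel (\<lambda>x. \<bar>c\<bar> ^ DIM('a) *\<^sub>R f (c *\<^sub>R x))"
      by (subst eq, subst integrable_density) (auto simp: integrable_distr_eq)
    also have "\<dots> \<longleftrightarrow> integrable lborel (\<lambda>x. f (c *\<^sub>R x))"
      using c integrable_scaleR_right[of "inverse (\<bar>c\<bar> ^ DIM('a))" lborel "\<lambda>x. \<bar>c\<bar> ^ DIM('a) *\<^sub>R f (c *\<^sub>R x)"]
      by auto
    finally show ?thesis by simp
  qed
qed

lemma lborel_integral_uminus:
  fixes f :: "'a::euclidean_space \<Rightarrow> 'b::{banach,second_countable_topology}"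
  assumes "f \<in> borel_measurable borel"
  shows "(\<integral>x. f (- x) \<partial>lborel) = (\<integral>x. f x \<partial>lborel)"
  using lborel_integral_scale[of "-1" f] assms by simp

text \<open>Compact intervals exhaust the half line: [0, k] is mapped onto [0, k^2], and monotone
  convergence is applied on both sides.\<close>

lemma nn_integral_square_substitution:
  fixes h :: "real \<Rightarrow> ennreal"
  assumes [measurable]: "h \<in> borel_measurable borel"
  shows "(\<integral>\<^sup>+z\<in>{0<..}. h z \<partial>lborel) = (\<integral>\<^sup>+y\<in>{0<..}. h (y\<^sup>2) * ennreal (2 * y) \<partial>lborel)"
proof -
  define F where "F k y = h (y\<^sup>2) * ennreal (2 * y) * indicator {0..real k} y" for k :: nat and y
  define G where "G k z = h z * indicator {0..(real k)\<^sup>2} z" for k :: nat and z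
  have [measurable]: "F k \<in> borel_measurable borel" "G k \<in> borel_measurable borel" for k
    unfolding F_def G_def by measurable
  \<comment> \<open>The substitution rule wants a nondegenerate interval, so the exhaustion below
    runs over \<open>Suc k\<close>.\<close>
  have FG: "integral\<^sup>N lborel (G k) = integral\<^sup>N lborel (F k)" if "k > 0" for k
  proof -
    have "(\<integral>\<^sup>+z\<in>{0\<^sup>2..(real k)\<^sup>2}. h z \<partial>lborel) = (\<integral>\<^sup>+y\<in>{0..real k}. h (y\<^sup>2) * ennreal (2 * y) \<partial>lborel)"
      by (rule nn_integral_substitution_aux) (use that in \<open>auto intro!: derivative_eq_intros continuous_intros\<close>)
    then show ?thesis by (simp add: F_def[abs_def] G_def[abs_def])
  qed
  have "(\<integral>\<^sup>+z\<in>{0<..}. h z \<partial>lborel) = (\<integral>\<^sup>+z. (SUP k. G (Suc k) z) \<partial>lborel)"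
  proof (rule nn_integral_cong_AE)
    show "AE z in lborel. h z * indicator {0<..} z = (SUP k. G (Suc k) z)"
      using AE_lborel_singleton[of 0]
    proof eventually_elim
      case (elim z)
      show ?case
      proof (cases "z > 0")
        case True
        obtain k where "z < real k" using reals_Archimedean2 by blast
        moreover have "real k \<le> (real (Suc k))\<^sup>2"
          using zero_le_square[of "real k"] by (simp add: power2_eq_square algebra_simps)
        ultimately have "z \<le> (real (Suc k))\<^sup>2" by linarith
        then have "G (Suc k) z = h z" using True by (simp add: G_def)
        then have "h z \<le> (SUP k. G (Suc k) z)" by (metis SUP_upper UNIV_I)
        moreover have "(SUP k. G (Suc k) z) \<le> h z" by (rule SUP_least) (auto simp: G_def indicator_def)
        ultimately show ?thesis using True by (simp add: order_antisym)
      qed (use elim in \<open>auto simp: G_def\<close>)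
    qed
  qed
  also have "\<dots> = (SUP k. integral\<^sup>N lborel (G (Suc k)))"
  proof (rule nn_integral_monotone_convergence_SUP)
    show "incseq (\<lambda>k. G (Suc k))"
      unfolding incseq_def le_fun_def G_def
    proof (intro allI impI)
      fix i j :: nat and z :: real assume "i \<le> j"
      then have "(real (Suc i))\<^sup>2 \<le> (real (Suc j))\<^sup>2" by (intro power_mono) auto
      then have "z \<le> (real (Suc i))\<^sup>2 \<Longrightarrow> z \<le> (real (Suc j))\<^sup>2" by linarith
      then show "h z * indicator {0..(real (Suc i))\<^sup>2} z \<le> h z * indicator {0..(real (Suc j))\<^sup>2} z"
        unfolding indicator_def by (auto simp del: of_nat_Suc)
    qed
  qed auto
  also have "\<dots> = (SUP k. integral\<^sup>N lborel (F (Suc k)))" by (simp add: FG)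
  also have "\<dots> = (\<integral>\<^sup>+y. (SUP k. F (Suc k) y) \<partial>lborel)"
  proof (rule nn_integral_monotone_convergence_SUP[symmetric])
    show "incseq (\<lambda>k. F (Suc k))"
      unfolding incseq_def le_fun_def F_def by (auto simp: indicator_def)
  qed auto
  also have "\<dots> = (\<integral>\<^sup>+y\<in>{0<..}. h (y\<^sup>2) * ennreal (2 * y) \<partial>lborel)"
  proof (rule nn_integral_cong)
    fix y :: real
    show "(SUP k. F (Suc k) y) = h (y\<^sup>2) * ennreal (2 * y) * indicator {0<..} y"
    proof (cases "y > 0")
      case True
      obtain k where "y < real k" using reals_Archimedean2 by blast
      then have "F (Suc k) y = h (y\<^sup>2) * ennreal (2 * y)" using True by (simp add: F_def)
      then have "h (y\<^sup>2) * ennreal (2 * y) \<le> (SUP k. F (Suc k) y)" by (metis SUP_upper UNIV_I)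
      moreover have "(SUP k. F (Suc k) y) \<le> h (y\<^sup>2) * ennreal (2 * y)"
        by (rule SUP_least) (auto simp: F_def indicator_def)
      ultimately show ?thesis using True by (simp add: order_antisym)
    next
      case False
      then have "F (Suc k) y = 0" for k by (cases "y = 0") (auto simp: F_def)
      then show ?thesis using False by simp
    qed
  qed
  finally show ?thesis .
qed

text \<open>As an equality of measures the substitution serves Bochner integrals and integrability
  at the same time.\<close>

lemma square_distr_density:
  "distr (density lborel (\<lambda>y. ennreal (2 * y) * indicator {0<..} y)) borel (\<lambda>y::real. y\<^sup>2)
    = density lborel (indicator {0<..})" (is "?A = ?B")
proof (rule measure_eqI)
  fix X :: "real set" assume "X \<in> sets ?A"
  then have [measurable]: "X \<in> sets borel" by simp
  have "emeasure ?A X = (\<integral>\<^sup>+y\<in>{0<..}. indicator X (y\<^sup>2) * ennreal (2 * y) \<partial>lborel)"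
    using measurable_sets_borel[of "\<lambda>y::real. y\<^sup>2" borel X]
    by (subst emeasure_distr, simp, simp, subst emeasure_density)
      (auto intro!: nn_integral_cong split: split_indicator)
  also have "\<dots> = (\<integral>\<^sup>+z\<in>{0<..}. indicator X z \<partial>lborel)"
    by (rule nn_integral_square_substitution[symmetric]) auto
  also have "\<dots> = emeasure ?B X" by (auto simp: emeasure_density mult_ac intro!: nn_integral_cong)
  finally show "emeasure ?A X = emeasure ?B X" .
qed auto

lemma
  fixes f :: "real \<Rightarrow> 'b::{banach,second_countable_topology}"
  assumes [measurable]: "f \<in> borel_measurable borel"
  shows set_integral_square_substitution:
      "(\<integral>z. indicator {0<..} z *\<^sub>R f z \<partial>lborel) = (\<integral>y. (indicator {0<..} y * (2 * y)) *\<^sub>R f (y\<^sup>2) \<partial>lborel)"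
    and set_integrable_square_substitution:
      "integrable lborel (\<lambda>z. indicator {0<..} z *\<^sub>R f z) \<longleftrightarrow>
       integrable lborel (\<lambda>y. (indicator {0<..} y * (2 * y)) *\<^sub>R f (y\<^sup>2))"
proof -
  have A: "density lborel (\<lambda>y. ennreal (2 * y) * indicator {0<..} y) =
      density lborel (\<lambda>y. ennreal (indicator {0<..} y * (2 * y)))"
    by (rule density_cong) (auto split: split_indicator)
  have B: "density lborel (indicator {0<..}) = density lborel (\<lambda>y::real. ennreal (indicator {0<..} y))"
    by (rule density_cong) (auto split: split_indicator)
  have nn: "AE y in lborel. 0 \<le> indicator {0<..} y * (2 * y::real)" "AE y in lborel. 0 \<le> (indicator {0::real<..} y::real)"
    by (auto split: split_indicator)
  show "(\<integral>z. indicator {0<..} z *\<^sub>R f z \<partial>lborel) = (\<integral>y. (indicator {0<..} y * (2 * y)) *\<^sub>R f (y\<^sup>2) \<partial>lborel)"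
    using arg_cong[OF square_distr_density, of "\<lambda>M. integral\<^sup>L M f"] unfolding A B
    using nn by (simp add: integral_distr integral_density)
  show "integrable lborel (\<lambda>z. indicator {0<..} z *\<^sub>R f z) \<longleftrightarrow>
       integrable lborel (\<lambda>y. (indicator {0<..} y * (2 * y)) *\<^sub>R f (y\<^sup>2))"
    using arg_cong[OF square_distr_density, of "\<lambda>M. integrable M f"] unfolding A B
    using nn by (simp add: integrable_distr_eq integrable_density)
qed

lemma integral_even_function:
  fixes f :: "real \<Rightarrow> 'b::{banach,second_countable_topology}"
  assumes f: "integrable lborel f" and even: "\<And>y. f (- y) = f y"
  shows "(\<integral>y. f y \<partial>lborel) = 2 *\<^sub>R (\<integral>y. indicator {0<..} y *\<^sub>R f y \<partial>lborel)"
proof -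
  have i: "integrable lborel (\<lambda>y. indicator {0<..} y *\<^sub>R f y)" "integrable lborel (\<lambda>y. indicator {..<0} y *\<^sub>R f y)"
    using f by (auto intro: integrable_mult_indicator)
  have "(\<integral>y. f y \<partial>lborel) = (\<integral>y. indicator {0<..} y *\<^sub>R f y + indicator {..<0} y *\<^sub>R f y \<partial>lborel)"
  proof (rule integral_cong_AE)
    show "AE y in lborel. f y = indicator {0<..} y *\<^sub>R f y + indicator {..<0} y *\<^sub>R f y"
      using AE_lborel_singleton[of 0] by eventually_elim (auto split: split_indicator)
  qed (use f in auto)
  also have "\<dots> = (\<integral>y. indicator {0<..} y *\<^sub>R f y \<partial>lborel) + (\<integral>y. indicator {..<0} y *\<^sub>R f y \<partial>lborel)"
    using i by simp
  also have "(\<integral>y. indicator {..<0} y *\<^sub>R f y \<partial>lborel) = (\<integral>y. indicator {..<0} (- y) *\<^sub>R f (- y) \<partial>lborel)"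
    by (rule lborel_integral_uminus[symmetric]) (use i in auto)
  also have "\<dots> = (\<integral>y. indicator {0<..} y *\<^sub>R f y \<partial>lborel)"
    by (intro Bochner_Integration.integral_cong) (auto simp: even split: split_indicator)
  finally show ?thesis by (simp add: scaleR_2)
qed

section \<open>Product integrals\<close>

lemma
  fixes f :: "'a::euclidean_space \<times> 'b::euclidean_space \<Rightarrow> 'c::{banach,second_countable_topology}"
  assumes "integrable lborel f"
  shows integral_lborel_pair: "(\<integral>z. f z \<partial>lborel) = (\<integral>x. (\<integral>y. f (x, y) \<partial>lborel) \<partial>lborel)"
    and integral_lborel_pair_swap: "(\<integral>z. f z \<partial>lborel) = (\<integral>y. (\<integral>x. f (x, y) \<partial>lborel) \<partial>lborel)"
    and integrable_lborel_fst: "integrable lborel (\<lambda>x. \<integral>y. f (x, y) \<partial>lborel)"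
    and integrable_lborel_snd: "integrable lborel (\<lambda>y. \<integral>x. f (x, y) \<partial>lborel)"
proof -
  have f: "integrable (lborel \<Otimes>\<^sub>M lborel) (case_prod (\<lambda>x y. f (x, y)))" using assms by (simp add: lborel_prod)
  show "(\<integral>z. f z \<partial>lborel) = (\<integral>x. (\<integral>y. f (x, y) \<partial>lborel) \<partial>lborel)"
    using lborel_pair.integral_fst'[of f] assms by (simp add: lborel_prod)
  show "(\<integral>z. f z \<partial>lborel) = (\<integral>y. (\<integral>x. f (x, y) \<partial>lborel) \<partial>lborel)"
    using lborel_pair.integral_snd[OF f] by (simp add: lborel_prod)
  show "integrable lborel (\<lambda>x. \<integral>y. f (x, y) \<partial>lborel)"
    using lborel_pair.integrable_fst'[of f] assms by (simp add: lborel_prod)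
  show "integrable lborel (\<lambda>y. \<integral>x. f (x, y) \<partial>lborel)"
    using lborel_pair.integrable_snd[OF f] by (simp add: lborel_prod)
qed

text \<open>Tonelli's criterion with a majorant for the inner integral of the norm, which is easier
  to supply than that integral itself.\<close>

lemma integrable_lborel_pairI:
  fixes f :: "'a::euclidean_space \<times> 'b::euclidean_space \<Rightarrow> 'c::{banach,second_countable_topology}"
  assumes "f \<in> borel_measurable borel"
    and "\<And>x. integrable lborel (\<lambda>y. f (x, y))"
    and "\<And>x. (\<integral>y. norm (f (x, y)) \<partial>lborel) \<le> w x" "integrable lborel w"
  shows "integrable lborel f"
proof -
  have m: "f \<in> borel_measurable (lborel \<Otimes>\<^sub>M lborel)" using assms(1) by (simp add: lborel_prod)
  have "integrable lborel (\<lambda>x. \<integral>y. norm (f (x, y)) \<partial>lborel)"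
  proof (rule Bochner_Integration.integrable_bound[OF assms(4)])
    show "(\<lambda>x. \<integral>y. norm (f (x, y)) \<partial>lborel) \<in> borel_measurable lborel"
      using m by (intro lborel.borel_measurable_lebesgue_integral) (simp add: split_beta')
    show "AE x in lborel. norm (\<integral>y. norm (f (x, y)) \<partial>lborel) \<le> norm (w x)"
      using order_trans[OF assms(3) abs_ge_self] by (auto simp: abs_of_nonneg)
  qed
  then show ?thesis
    using lborel_pair.Fubini_integrable[OF m] assms(2) by (simp add: lborel_prod)
qed

lemma integrable_lborel_pair_mult:
  fixes f g :: "_ \<Rightarrow> 'c::{real_normed_field,banach,second_countable_topology}"
  assumes f: "integrable lborel (f :: 'a::euclidean_space \<Rightarrow> 'c)" and g: "integrable lborel (g :: 'b::euclidean_space \<Rightarrow> 'c)"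
  shows "integrable lborel (\<lambda>z. f (fst z) * g (snd z))"
proof (rule integrable_lborel_pairI[where w="\<lambda>x. norm (f x) * (\<integral>y. norm (g y) \<partial>lborel)"])
  have [measurable]: "f \<in> borel_measurable borel" "g \<in> borel_measurable borel" using f g by auto
  show "(\<lambda>z. f (fst z) * g (snd z)) \<in> borel_measurable borel"
    unfolding borel_prod[symmetric] by measurable
qed (use f g in \<open>auto simp: norm_mult\<close>)

text \<open>The Lebesgue measure is the image of a product measure under the coordinate map, so
  products of functions of single coordinates integrate factor by factor.\<close>

lemma
  fixes f :: "'a::euclidean_space \<Rightarrow> real \<Rightarrow> 'c::{real_normed_field,banach,second_countable_topology}"
  assumes f: "\<And>b. b \<in> Basis \<Longrightarrow> integrable lborel (f b)"
  shows integrable_lborel_prod_Basis: "integrable lborel (\<lambda>x::'a. \<Prod>b\<in>Basis. f b (x \<bullet> b))"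
    and integral_lborel_prod_Basis: "(\<integral>x. (\<Prod>b\<in>Basis. f b (x \<bullet> b)) \<partial>(lborel :: 'a measure)) = (\<Prod>b\<in>Basis. \<integral>r. f b r \<partial>lborel)"
proof -
  interpret product_sigma_finite "\<lambda>_::'a. lborel :: real measure" by unfold_locales
  have [measurable]: "f b \<in> borel_measurable borel" if "b \<in> Basis" for b using f[OF that] by auto
  note eq = lborel_eq[where 'a='a]
  have bm: "(\<lambda>f. \<Sum>b\<in>Basis. f b *\<^sub>R b) \<in> measurable (\<Pi>\<^sub>M b\<in>Basis. lborel) (borel::'a measure)"
    by measurable
  have fm: "(\<lambda>x::'a. \<Prod>b\<in>Basis. f b (x \<bullet> b)) \<in> borel_measurable borel" by measurable
  show "integrable lborel (\<lambda>x::'a. \<Prod>b\<in>Basis. f b (x \<bullet> b))"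
    unfolding eq[THEN arg_cong[of _ _ "\<lambda>M. integrable M _"]] integrable_distr_eq[OF bm fm]
    using product_integrable_prod[OF finite_Basis f]
    by (rule Bochner_Integration.integrable_cong[THEN iffD1, rotated -1]) (auto intro!: prod.cong)
  show "(\<integral>x. (\<Prod>b\<in>Basis. f b (x \<bullet> b)) \<partial>(lborel :: 'a measure)) = (\<Prod>b\<in>Basis. \<integral>r. f b r \<partial>lborel)"
    unfolding eq[THEN arg_cong[of _ _ "\<lambda>M. integral\<^sup>L M _"]] integral_distr[OF bm fm]
    by (subst product_integral_prod[OF finite_Basis f, symmetric])
       (auto intro!: Bochner_Integration.integral_cong prod.cong)
qed

section \<open>Smooth functions\<close>

lemma pdir_eqI: "((\<lambda>s. f (x + s *\<^sub>R v)) has_vector_derivative D) (at 0) \<Longrightarrow> pdir v f x = D"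
  unfolding pdir_def by (rule vector_derivative_at)

lemma iter_pd_append: "iter_pd (us @ vs) f = iter_pd us (iter_pd vs f)"
  by (induction us) auto

lemma smooth_continuous: "smooth f \<Longrightarrow> continuous_on UNIV f"
  unfolding smooth_def by (metis iter_pd.simps(1) lists.Nil)

lemma smooth_iter_pd: "smooth f \<Longrightarrow> vs \<in> lists Basis \<Longrightarrow> smooth (iter_pd vs f)"
  unfolding smooth_def by (metis append_in_lists_conv iter_pd_append)

lemma smooth_pdir: "smooth f \<Longrightarrow> v \<in> Basis \<Longrightarrow> smooth (pdir v f)"
  using smooth_iter_pd[of f "[v]"] by simp

lemma has_pdir_at_0:
  "smooth f \<Longrightarrow> v \<in> Basis \<Longrightarrow> ((\<lambda>s. f (x + s *\<^sub>R v)) has_vector_derivative pdir v f x) (at 0)"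
  unfolding smooth_def by (metis iter_pd.simps(1) lists.Nil)

text \<open>Smoothness speaks of derivatives at parameter 0 only; moving the base point along the
  line recovers every other parameter.\<close>

lemma has_vector_derivative_shift_0:
  fixes f :: "'a::real_vector \<Rightarrow> 'b::real_normed_vector"
  assumes "((\<lambda>r. f (x + s *\<^sub>R v + r *\<^sub>R v)) has_vector_derivative D) (at 0)"
  shows "((\<lambda>s. f (x + s *\<^sub>R v)) has_vector_derivative D) (at s)"
proof -
  have "((\<lambda>t. t - s) has_vector_derivative 1) (at s)" by (auto intro!: derivative_eq_intros)
  from vector_diff_chain_at[OF this, of "\<lambda>r. f (x + s *\<^sub>R v + r *\<^sub>R v)" D] assms
  have "((\<lambda>r. f (x + s *\<^sub>R v + r *\<^sub>R v)) \<circ> (\<lambda>t. t - s) has_vector_derivative D) (at s)" by simp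
  moreover have "(\<lambda>r. f (x + s *\<^sub>R v + r *\<^sub>R v)) \<circ> (\<lambda>t. t - s) = (\<lambda>t. f (x + t *\<^sub>R v))"
    by (auto simp: fun_eq_iff scaleR_left.diff)
  ultimately show ?thesis by simp
qed

lemma has_pdir:
  assumes "smooth f" "v \<in> Basis"
  shows "((\<lambda>s. f (x + s *\<^sub>R v)) has_vector_derivative pdir v f (x + s *\<^sub>R v)) (at s)"
  by (rule has_vector_derivative_shift_0) (rule has_pdir_at_0[OF assms])

text \<open>Smoothness as a greatest fixed point: a class of continuous functions that is closed
  under partial derivatives consists of smooth functions. Closure proofs replace inductions over
  lists of directions.\<close>

lemma smooth_coinduct:
  assumes "P f"
    and step: "\<And>f. P f \<Longrightarrow> continuous_on UNIV f \<and>
      (\<forall>v\<in>Basis. \<exists>f'. P f' \<and> (\<forall>x. ((\<lambda>s. f (x + s *\<^sub>R v)) has_vector_derivative f' x) (at 0)))"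
  shows "smooth f"
proof -
  have pd: "P (pdir v h) \<and> (\<forall>x. ((\<lambda>s. h (x + s *\<^sub>R v)) has_vector_derivative pdir v h x) (at 0))"
    if "P h" and "v \<in> Basis" for h v
  proof -
    obtain h' where h': "P h'" "\<forall>x. ((\<lambda>s. h (x + s *\<^sub>R v)) has_vector_derivative h' x) (at 0)"
      using step[OF \<open>P h\<close>] \<open>v \<in> Basis\<close> by blast
    then have "pdir v h = h'" by (auto intro!: pdir_eqI)
    then show ?thesis using h' by simp
  qed
  have "P (iter_pd vs f)" if "vs \<in> lists Basis" for vs
    using that by (induction vs) (use assms(1) pd in auto)
  then show ?thesis
    unfolding smooth_def using step pd by blast
qed

lemma
  fixes f :: "'a::euclidean_space \<Rightarrow> 'b::real_normed_vector"
  assumes L: "bounded_linear L" and f: "smooth f"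
  shows smooth_bounded_linear: "smooth (\<lambda>x. L (f x))"
    and pdir_bounded_linear: "v \<in> Basis \<Longrightarrow> pdir v (\<lambda>x. L (f x)) = (\<lambda>x. L (pdir v f x))"
proof -
  have d: "((\<lambda>s. L (f (x + s *\<^sub>R v))) has_vector_derivative L (pdir v f x)) (at 0)" if "smooth f" "v \<in> Basis" for x v and f :: "'a \<Rightarrow> 'b"
    by (rule bounded_linear.has_vector_derivative[OF L has_pdir_at_0[OF that]])
  show "smooth (\<lambda>x. L (f x))"
  proof (rule smooth_coinduct[where P="\<lambda>h. \<exists>f :: 'a \<Rightarrow> 'b. smooth f \<and> h = (\<lambda>x. L (f x))"])
    fix h assume "\<exists>f :: 'a \<Rightarrow> 'b. smooth f \<and> h = (\<lambda>x. L (f x))"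
    then obtain f :: "'a \<Rightarrow> 'b" where f: "smooth f" "h = (\<lambda>x. L (f x))" by blast
    show "continuous_on UNIV h \<and> (\<forall>v\<in>Basis. \<exists>f'. (\<exists>f :: 'a \<Rightarrow> 'b. smooth f \<and> f' = (\<lambda>x. L (f x)))
        \<and> (\<forall>x. ((\<lambda>s. h (x + s *\<^sub>R v)) has_vector_derivative f' x) (at 0)))"
    proof (intro conjI ballI)
      show "continuous_on UNIV h" unfolding f(2)
        by (intro bounded_linear.continuous_on[OF L] smooth_continuous f)
      fix v :: 'a assume v: "v \<in> Basis"
      show "\<exists>f'. (\<exists>f :: 'a \<Rightarrow> 'b. smooth f \<and> f' = (\<lambda>x. L (f x))) \<and> (\<forall>x. ((\<lambda>s. h (x + s *\<^sub>R v)) has_vector_derivative f' x) (at 0))"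
        using d[OF f(1) v] smooth_pdir[OF f(1) v] unfolding f(2) by blast
    qed
  qed (use f in blast)
  show "v \<in> Basis \<Longrightarrow> pdir v (\<lambda>x. L (f x)) = (\<lambda>x. L (pdir v f x))"
    using d f by (auto intro!: pdir_eqI)
qed

lemma iter_pd_bounded_linear:
  assumes L: "bounded_linear L" and f: "smooth f" and vs: "vs \<in> lists Basis"
  shows "iter_pd vs (\<lambda>x. L (f x)) = (\<lambda>x. L (iter_pd vs f x))"
  using vs by (induction vs) (auto simp: pdir_bounded_linear[OF L] smooth_iter_pd f)

lemma
  assumes f: "smooth f" and g: "smooth g"
  shows smooth_add: "smooth (\<lambda>x. f x + g x)"
    and pdir_add: "v \<in> Basis \<Longrightarrow> pdir v (\<lambda>x. f x + g x) = (\<lambda>x. pdir v f x + pdir v g x)"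
proof -
  have d: "((\<lambda>s. f (x + s *\<^sub>R v) + g (x + s *\<^sub>R v)) has_vector_derivative pdir v f x + pdir v g x) (at 0)"
    if "smooth f" "smooth g" "v \<in> Basis" for x v and f g :: "'a \<Rightarrow> 'b"
    by (intro has_vector_derivative_add has_pdir_at_0 that)
  show "smooth (\<lambda>x. f x + g x)"
  proof (rule smooth_coinduct[where P="\<lambda>h. \<exists>f g. smooth f \<and> smooth g \<and> h = (\<lambda>x. f x + g x)"])
    fix h :: "'a \<Rightarrow> 'b" assume "\<exists>f g. smooth f \<and> smooth g \<and> h = (\<lambda>x. f x + g x)"
    then obtain f g where f: "smooth f" and g: "smooth g" and h: "h = (\<lambda>x. f x + g x)" by blast
    show "continuous_on UNIV h \<and> (\<forall>v\<in>Basis. \<exists>f'. (\<exists>f g. smooth f \<and> smooth g \<and> f' = (\<lambda>x. f x + g x))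
        \<and> (\<forall>x. ((\<lambda>s. h (x + s *\<^sub>R v)) has_vector_derivative f' x) (at 0)))"
    proof (intro conjI ballI)
      show "continuous_on UNIV h" unfolding h by (intro continuous_intros smooth_continuous f g)
      fix v :: 'a assume v: "v \<in> Basis"
      show "\<exists>f'. (\<exists>f g. smooth f \<and> smooth g \<and> f' = (\<lambda>x. f x + g x)) \<and> (\<forall>x. ((\<lambda>s. h (x + s *\<^sub>R v)) has_vector_derivative f' x) (at 0))"
        using d[OF f g v] smooth_pdir[OF f v] smooth_pdir[OF g v] unfolding h by blast
    qed
  qed (use f g in blast)
  show "v \<in> Basis \<Longrightarrow> pdir v (\<lambda>x. f x + g x) = (\<lambda>x. pdir v f x + pdir v g x)"
    using d f g by (auto intro!: pdir_eqI)
qed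

lemma smooth_const: "smooth (\<lambda>_. c)"
  by (rule smooth_coinduct[where P="\<lambda>h. \<exists>c. h = (\<lambda>_. c)"]) (auto intro!: exI[of _ "\<lambda>_. 0"])

lemma smooth_sum:
  "finite I \<Longrightarrow> (\<And>i. i \<in> I \<Longrightarrow> smooth (f i)) \<Longrightarrow> smooth (\<lambda>x. \<Sum>i\<in>I. f i x)"
  by (induction I rule: finite_induct) (auto intro: smooth_add smooth_const)

lemma
  fixes f :: "'a::euclidean_space \<Rightarrow> 'b::real_normed_vector"
  assumes f: "smooth f"
  shows smooth_coordinate_mult: "smooth (\<lambda>x. (x \<bullet> c) *\<^sub>R f x)"
    and pdir_coordinate_mult: "v \<in> Basis \<Longrightarrow>
      pdir v (\<lambda>x. (x \<bullet> c) *\<^sub>R f x) = (\<lambda>x. (v \<bullet> c) *\<^sub>R f x + (x \<bullet> c) *\<^sub>R pdir v f x)"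
proof -
  have d: "((\<lambda>s. ((x + s *\<^sub>R v) \<bullet> c) *\<^sub>R f (x + s *\<^sub>R v)) has_vector_derivative
      (v \<bullet> c) *\<^sub>R f x + (x \<bullet> c) *\<^sub>R pdir v f x) (at 0)"
    if "smooth f" "v \<in> Basis" for x v and f :: "'a \<Rightarrow> 'b"
  proof -
    have "((\<lambda>s. (x + s *\<^sub>R v) \<bullet> c) has_real_derivative (v \<bullet> c)) (at 0)"
      by (auto intro!: derivative_eq_intros simp: inner_add_left)
    from has_vector_derivative_scaleR[OF this has_pdir_at_0[OF that, of x]]
    show ?thesis by (simp add: add.commute)
  qed
  show "smooth (\<lambda>x. (x \<bullet> c) *\<^sub>R f x)"
  \<comment> \<open>The summand \<open>g\<close> is needed for closure: differentiating the
    coordinate leaves the extra term \<open>(v \<bullet> c) *\<^sub>R f x\<close>.\<close>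
  proof (rule smooth_coinduct[where P="\<lambda>h. \<exists>f g. smooth f \<and> smooth g \<and> h = (\<lambda>x. g x + (x \<bullet> c) *\<^sub>R f x)"])
    fix h :: "'a \<Rightarrow> 'b" assume "\<exists>f g. smooth f \<and> smooth g \<and> h = (\<lambda>x. g x + (x \<bullet> c) *\<^sub>R f x)"
    then obtain f g where f: "smooth f" and g: "smooth g" and h: "h = (\<lambda>x. g x + (x \<bullet> c) *\<^sub>R f x)" by blast
    show "continuous_on UNIV h \<and> (\<forall>v\<in>Basis. \<exists>f'. (\<exists>f g. smooth f \<and> smooth g \<and> f' = (\<lambda>x. g x + (x \<bullet> c) *\<^sub>R f x))
        \<and> (\<forall>x. ((\<lambda>s. h (x + s *\<^sub>R v)) has_vector_derivative f' x) (at 0)))"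
    proof (intro conjI ballI)
      show "continuous_on UNIV h" unfolding h by (intro continuous_intros smooth_continuous f g)
      fix v :: 'a assume v: "v \<in> Basis"
      have "smooth (\<lambda>x. pdir v g x + (v \<bullet> c) *\<^sub>R f x)"
        by (intro smooth_add smooth_pdir g v smooth_bounded_linear[OF bounded_linear_scaleR_right] f)
      moreover have "((\<lambda>s. h (x + s *\<^sub>R v)) has_vector_derivative
          (pdir v g x + (v \<bullet> c) *\<^sub>R f x) + (x \<bullet> c) *\<^sub>R pdir v f x) (at 0)" for x
        using has_vector_derivative_add[OF has_pdir_at_0[OF g v, of x] d[OF f v, of x]] unfolding h
        by (simp add: add.assoc)
      ultimately show "\<exists>f'. (\<exists>f g. smooth f \<and> smooth g \<and> f' = (\<lambda>x. g x + (x \<bullet> c) *\<^sub>R f x)) \<and>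
          (\<forall>x. ((\<lambda>s. h (x + s *\<^sub>R v)) has_vector_derivative f' x) (at 0))"
        using smooth_pdir[OF f v] by blast
    qed
  next
    show "\<exists>fa g. smooth fa \<and> smooth g \<and> (\<lambda>x. (x \<bullet> c) *\<^sub>R f x) = (\<lambda>x. g x + (x \<bullet> c) *\<^sub>R fa x)"
      by (rule exI[of _ f], rule exI[of _ "\<lambda>_. 0"]) (use f smooth_const in auto)
  qed
  show "v \<in> Basis \<Longrightarrow> pdir v (\<lambda>x. (x \<bullet> c) *\<^sub>R f x) = (\<lambda>x. (v \<bullet> c) *\<^sub>R f x + (x \<bullet> c) *\<^sub>R pdir v f x)"
    using d f by (auto intro!: pdir_eqI)
qed

text \<open>Schwarz's theorem: the increment in \<open>t\<close> is the integral of the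
  \<open>v\<close>-derivative; differentiate it in \<open>s\<close> under the integral sign, and
  then in \<open>t\<close> by the fundamental theorem of calculus.\<close>

lemma pdir_commute:
  fixes f :: "'a::euclidean_space \<Rightarrow> 'b::banach"
  assumes f: "smooth f" and u: "u \<in> Basis" and v: "v \<in> Basis"
  shows "pdir u (pdir v f) x = pdir v (pdir u f) x"
proof -
  define p where "p s t = f (x + s *\<^sub>R u + t *\<^sub>R v)" for s t
  define pt where "pt s t = pdir v f (x + s *\<^sub>R u + t *\<^sub>R v)" for s t
  define pts where "pts s t = pdir u (pdir v f) (x + s *\<^sub>R u + t *\<^sub>R v)" for s t
  define ps where "ps s t = pdir u f (x + s *\<^sub>R u + t *\<^sub>R v)" for s t
  have cont: "continuous_on A (\<lambda>z. h (x + fst z *\<^sub>R u + snd z *\<^sub>R v))" if "smooth h" for A and h :: "'a \<Rightarrow> 'b"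
    by (intro continuous_on_compose2[OF smooth_continuous[OF that]] continuous_intros) auto
  have cont2: "continuous_on A (\<lambda>t. h (x + s *\<^sub>R u + t *\<^sub>R v))" if "smooth h" for A s and h :: "'a \<Rightarrow> 'b"
    by (intro continuous_on_compose2[OF smooth_continuous[OF that]] continuous_intros) auto
  have swap: "x + s *\<^sub>R u + t *\<^sub>R v = (x + t *\<^sub>R v) + s *\<^sub>R u" for s t by simp
  have ds: "((\<lambda>s. h (x + s *\<^sub>R u + t *\<^sub>R v)) has_vector_derivative pdir u h (x + s *\<^sub>R u + t *\<^sub>R v)) (at s)"
    if "smooth h" for h :: "'a \<Rightarrow> 'b" and s t
    unfolding swap by (rule has_pdir[OF that u])
  have eq: "ps 0 t - ps 0 0 = integral {0..t} (pts 0)" if t: "t \<in> {0..1}" for t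
  proof -
    have I: "p s t = p s 0 + integral (cbox 0 t) (pt s)" for s
    proof -
      have "(pt s has_integral (p s t - p s 0)) {0..t}"
        using t by (intro fundamental_theorem_of_calculus)
          (auto simp: pt_def p_def intro: has_vector_derivative_at_within[OF has_pdir[OF f v]])
      then show ?thesis by (simp add: integral_unique)
    qed
    have "((\<lambda>s. integral (cbox 0 t) (pt s)) has_vector_derivative integral (cbox 0 t) (pts 0)) (at 0 within UNIV)"
    proof (rule leibniz_rule_vector_derivative)
      show "((\<lambda>s. pt s r) has_vector_derivative pts s r) (at s within UNIV)" for s r
        unfolding pt_def pts_def by (rule has_vector_derivative_at_within[OF ds[OF smooth_pdir[OF f v]]])
      show "pt s integrable_on cbox 0 t" for s
        unfolding pt_def by (intro integrable_continuous cont2 smooth_pdir f v)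
      show "continuous_on (UNIV \<times> cbox 0 t) (\<lambda>(s, t). pts s t)"
        unfolding pts_def split_beta by (intro cont smooth_pdir f u v)
    qed auto
    moreover have "((\<lambda>s. p s 0) has_vector_derivative ps 0 0) (at 0)"
      unfolding p_def ps_def by (rule ds[OF f])
    ultimately have "((\<lambda>s. p s t) has_vector_derivative ps 0 0 + integral {0..t} (pts 0)) (at 0)"
      unfolding I by (auto intro: has_vector_derivative_add)
    moreover have "((\<lambda>s. p s t) has_vector_derivative ps 0 t) (at 0)"
      unfolding p_def ps_def by (rule ds[OF f])
    ultimately show ?thesis using vector_derivative_unique_at by force
  qed
  \<comment> \<open>The identity \<open>eq\<close> is available on \<open>{0..1}\<close> only, so
    one-sided derivatives at 0 are compared; they are still unique.\<close>
  have "((\<lambda>t. integral {0..t} (pts 0)) has_vector_derivative pts 0 0) (at 0 within {0..1})"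
    unfolding pts_def by (rule integral_has_vector_derivative) (intro cont2 smooth_pdir f u v, simp)
  then have "((\<lambda>t. ps 0 t - ps 0 0) has_vector_derivative pts 0 0) (at 0 within {0..1})"
    by (rule has_vector_derivative_transform[rotated 2]) (auto simp: eq)
  moreover have "((\<lambda>t. ps 0 t - ps 0 0) has_vector_derivative pdir v (pdir u f) x) (at 0 within {0..1})"
    using has_vector_derivative_diff[OF has_vector_derivative_at_within[OF has_pdir_at_0[OF smooth_pdir[OF f u] v, of x]]
      has_vector_derivative_const[of "ps 0 0" "at 0 within {0..1}"]]
    by (simp add: ps_def)
  ultimately have "pts 0 0 = pdir v (pdir u f) x"
    by (rule vector_derivative_unique_within[rotated]) (simp add: at_within_Icc_at_right trivial_limit_at_right_real)
  then show ?thesis by (simp add: pts_def)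
qed

section \<open>Compactly supported smooth functions\<close>

text \<open>The notion behind \<open>test_fun\<close>, with a free target space, so that it covers
  real data, their complex versions and all derivatives.\<close>

definition compact_smooth :: "('a::euclidean_space \<Rightarrow> 'b::real_normed_vector) \<Rightarrow> bool" where
  "compact_smooth f \<longleftrightarrow> smooth f \<and> bounded {x. f x \<noteq> 0}"

lemma test_fun_iff_compact_smooth: "test_fun \<phi> \<longleftrightarrow> compact_smooth \<phi>"
  by (simp add: test_fun_def compact_smooth_def)

lemma compact_smooth_smooth: "compact_smooth f \<Longrightarrow> smooth f"
  by (simp add: compact_smooth_def)

lemma compact_smooth_supportE:
  assumes "compact_smooth f"
  obtains R where "R > 0" "\<And>x. norm x > R \<Longrightarrow> f x = 0"
  using assms unfolding compact_smooth_def bounded_pos by (auto simp: not_le[symmetric])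

lemma compact_smoothI:
  "smooth f \<Longrightarrow> (\<And>x. norm x > R \<Longrightarrow> f x = 0) \<Longrightarrow> compact_smooth f"
  unfolding compact_smooth_def bounded_iff using linorder_not_less by blast

lemma pdir_eq_0_outside:
  assumes "\<And>x. norm x > R \<Longrightarrow> f x = 0" "norm x > R"
  shows "pdir v f x = 0"
proof (rule pdir_eqI)
  have "((\<lambda>s. norm (x + s *\<^sub>R v)) \<longlongrightarrow> norm (x + 0 *\<^sub>R v)) (at 0)" by (intro tendsto_intros)
  then have "eventually (\<lambda>s. norm (x + s *\<^sub>R v) > R) (at 0)"
    using assms(2) by (auto simp: order_tendsto_iff)
  then have ev: "eventually (\<lambda>s. 0 = f (x + s *\<^sub>R v)) (nhds 0)"
    using assms by (auto simp: eventually_at_filter eventually_mono elim!: eventually_mono)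
  show "((\<lambda>s. f (x + s *\<^sub>R v)) has_vector_derivative 0) (at 0)"
    by (subst has_vector_derivative_cong_ev[where g="\<lambda>_. 0"]) (use ev assms in \<open>auto elim: eventually_mono\<close>)
qed

lemma compact_smooth_pdir:
  assumes "compact_smooth f" "v \<in> Basis"
  shows "compact_smooth (pdir v f)"
proof -
  obtain R where R: "\<And>x. norm x > R \<Longrightarrow> f x = 0" using compact_smooth_supportE[OF assms(1)] by blast
  show ?thesis
    by (rule compact_smoothI[OF smooth_pdir[OF compact_smooth_smooth[OF assms(1)] assms(2)], of R])
      (rule pdir_eq_0_outside[OF R])
qed

lemma compact_smooth_iter_pd: "compact_smooth f \<Longrightarrow> vs \<in> lists Basis \<Longrightarrow> compact_smooth (iter_pd vs f)"
  by (induction vs) (auto intro: compact_smooth_pdir)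

lemma compact_smooth_bounded_linear:
  assumes L: "bounded_linear L" and f: "compact_smooth f"
  shows "compact_smooth (\<lambda>x. L (f x))"
proof -
  obtain R where R: "\<And>x. norm x > R \<Longrightarrow> f x = 0" using compact_smooth_supportE[OF f] by blast
  show ?thesis
    by (rule compact_smoothI[OF smooth_bounded_linear[OF L compact_smooth_smooth[OF f]], of R])
      (simp add: R linear_0[OF bounded_linear.linear[OF L]])
qed

lemma compact_smooth_add:
  assumes "compact_smooth f" "compact_smooth g"
  shows "compact_smooth (\<lambda>x. f x + g x)"
proof -
  obtain R where "\<And>x. norm x > R \<Longrightarrow> f x = 0" using compact_smooth_supportE[OF assms(1)] by blast
  moreover obtain S where "\<And>x. norm x > S \<Longrightarrow> g x = 0" using compact_smooth_supportE[OF assms(2)] by blast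
  ultimately show ?thesis
    by (intro compact_smoothI[OF smooth_add, of _ _ "max R S"] compact_smooth_smooth[OF assms(1)]
        compact_smooth_smooth[OF assms(2)]) simp
qed

lemma compact_smooth_coordinate_mult:
  assumes f: "compact_smooth f"
  shows "compact_smooth (\<lambda>x. (x \<bullet> c) *\<^sub>R f x)"
proof -
  obtain R where R: "\<And>x. norm x > R \<Longrightarrow> f x = 0" using compact_smooth_supportE[OF f] by blast
  show ?thesis
    by (rule compact_smoothI[OF smooth_coordinate_mult[OF compact_smooth_smooth[OF f]], of R]) (simp add: R)
qed

lemma compact_smooth_0: "compact_smooth (\<lambda>_. 0)"
  by (rule compact_smoothI) (auto simp: smooth_const)

lemma compact_smooth_sum:
  "finite I \<Longrightarrow> (\<And>i. i \<in> I \<Longrightarrow> compact_smooth (f i)) \<Longrightarrow> compact_smooth (\<lambda>x. \<Sum>i\<in>I. f i x)"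
  by (induction I rule: finite_induct) (auto intro: compact_smooth_add compact_smooth_0)

lemma
  fixes f :: "'a::euclidean_space \<Rightarrow> 'b::{banach,second_countable_topology}"
  assumes c: "continuous_on UNIV f" and R: "\<And>x. norm x > R \<Longrightarrow> f x = 0"
  shows integrable_continuous_bounded_support: "integrable lborel f"
    and bounded_continuous_bounded_support: "\<exists>C>0. \<forall>x. norm (f x) \<le> C * indicator (cball 0 R) x"
proof -
  have "(\<lambda>x. indicator (cball 0 R) x *\<^sub>R f x) = f" using R by (auto simp: fun_eq_iff indicator_def)
  then show "integrable lborel f"
    using borel_integrable_compact[OF compact_cball continuous_on_subset[OF c subset_UNIV], of 0 R] by metis
  have "compact (f ` cball 0 R)"
    by (rule compact_continuous_image[OF continuous_on_subset[OF c subset_UNIV] compact_cball])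
  then have "\<exists>C>0. \<forall>y\<in>f ` cball 0 R. norm y \<le> C"
    using compact_imp_bounded bounded_pos by metis
  then obtain C where C: "C > 0" "\<And>x. x \<in> cball 0 R \<Longrightarrow> norm (f x) \<le> C" by blast
  show "\<exists>C>0. \<forall>x. norm (f x) \<le> C * indicator (cball 0 R) x"
  proof (intro exI[of _ C] conjI allI)
    show "norm (f x) \<le> C * indicator (cball 0 R) x" for x
      using C(2)[of x] R[of x] by (cases "norm x \<le> R") auto
  qed (rule C)
qed

lemma compact_smooth_integrable:
  fixes f :: "'a::euclidean_space \<Rightarrow> 'b::{banach,second_countable_topology}"
  shows "compact_smooth f \<Longrightarrow> integrable lborel f"
  by (meson compact_smooth_supportE compact_smooth_smooth smooth_continuous integrable_continuous_bounded_support)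

lemma compact_smooth_boundE:
  fixes f :: "'a::euclidean_space \<Rightarrow> 'b::{banach,second_countable_topology}"
  assumes "compact_smooth f"
  obtains C R where "C > 0" "R > 0" "\<And>x. norm x > R \<Longrightarrow> f x = 0"
    "\<And>x. norm (f x) \<le> C * indicator (cball 0 R) x" "\<And>x. norm (f x) \<le> C"
proof -
  obtain R where R: "R > 0" "\<And>x. norm x > R \<Longrightarrow> f x = 0" using compact_smooth_supportE[OF assms] by blast
  then obtain C where C: "C > 0" "\<And>x. norm (f x) \<le> C * indicator (cball 0 R) x"
    using bounded_continuous_bounded_support[OF smooth_continuous[OF compact_smooth_smooth[OF assms]]] by blast
  have "norm (f x) \<le> C" for x using C(2)[of x] C(1) by (cases "norm x \<le> R") auto
  then show thesis using that C R by blast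
qed

text \<open>By translation invariance the integral of \<open>f (x + s *\<^sub>R e)\<close> is
  constant in \<open>s\<close>, and its derivative at 0 is the integral of \<open>f'\<close>. The
  integrations by parts with compact support rest on this.\<close>

lemma integral_directional_derivative_eq_0:
  fixes f :: "'a::euclidean_space \<Rightarrow> 'b::{banach,second_countable_topology}"
  assumes f: "continuous_on UNIV f" "\<And>x. norm x > R \<Longrightarrow> f x = 0"
    and f': "continuous_on UNIV f'" "\<And>x. norm x > R \<Longrightarrow> f' x = 0"
    and deriv: "\<And>x. ((\<lambda>s. f (x + s *\<^sub>R e)) has_vector_derivative f' x) (at 0)"
  shows "(\<integral>x. f' x \<partial>lborel) = 0"
proof -
  obtain C where C: "C > 0" "\<And>x. norm (f' x) \<le> C * indicator (cball 0 R) x"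
    using bounded_continuous_bounded_support[OF f'] by blast
  have int: "integrable lborel (\<lambda>x. f (x + s *\<^sub>R e))" for s
    using lborel_integrable_translate[where t="s *\<^sub>R e" and f=f] integrable_continuous_bounded_support[OF f]
    by (simp add: add.commute)
  have "((\<lambda>s. \<integral>x. f (x + s *\<^sub>R e) \<partial>lborel) has_vector_derivative (\<integral>x. f' (x + 0 *\<^sub>R e) \<partial>lborel)) (at 0)"
  proof (rule has_vector_derivative_integral[where d=1 and w="\<lambda>x. C * indicator (cball 0 (R + norm e)) x"])
    fix s :: real and x assume s: "\<bar>s - 0\<bar> < 1"
    show "integrable lborel (\<lambda>x. f (x + s *\<^sub>R e))" by (rule int)
    show "((\<lambda>s. f (x + s *\<^sub>R e)) has_vector_derivative f' (x + s *\<^sub>R e)) (at s)"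
      by (rule has_vector_derivative_shift_0) (rule deriv)
    \<comment> \<open>For |s| < 1 the support moves by at most \<open>norm e\<close>, whence the
      larger ball in the majorant.\<close>
    have "norm x \<le> R + norm e" if "norm (x + s *\<^sub>R e) \<le> R"
    proof -
      have "norm x \<le> norm (x + s *\<^sub>R e) + norm (s *\<^sub>R e)" by (metis add_diff_cancel norm_triangle_ineq4)
      also have "norm (s *\<^sub>R e) \<le> norm e" using s by (simp add: mult_left_le_one_le)
      finally show ?thesis using that by simp
    qed
    then show "norm (f' (x + s *\<^sub>R e)) \<le> C * indicator (cball 0 (R + norm e)) x"
      using C(2)[of "x + s *\<^sub>R e"] C(1) by (cases "norm (x + s *\<^sub>R e) \<le> R") auto
  next
    show "(\<lambda>x. f' (x + 0 *\<^sub>R e)) \<in> borel_measurable lborel"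
      using borel_measurable_continuous_onI[OF f'(1)] by simp
    show "integrable lborel (\<lambda>x. C * indicat_real (cball (0::'a) (R + norm e)) x)"
      using emeasure_lborel_cball_finite[of "0::'a" "R + norm e"] by (intro integrable_mult_right integrable_real_indicator) auto
  qed simp
  moreover have "(\<integral>x. f (x + s *\<^sub>R e) \<partial>lborel) = (\<integral>x. f x \<partial>lborel)" for s
    using lborel_integral_translate[where t="s *\<^sub>R e" and f=f] by (simp add: add.commute)
  ultimately have "((\<lambda>s::real. \<integral>x. f x \<partial>lborel) has_vector_derivative (\<integral>x. f' x \<partial>lborel)) (at 0)" by simp
  moreover have "((\<lambda>s::real. \<integral>x. f x \<partial>lborel) has_vector_derivative 0) (at 0)" by simp
  ultimately show ?thesis using vector_derivative_unique_at by blast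
qed

section \<open>Gaussian integrals\<close>

lemma integrable_bounded_mult:
  fixes f g :: "'a \<Rightarrow> complex"
  assumes f: "integrable M f" and g: "g \<in> borel_measurable M" and C: "\<And>x. x \<in> space M \<Longrightarrow> norm (g x) \<le> C"
  shows "integrable M (\<lambda>x. f x * g x)"
proof (rule Bochner_Integration.integrable_bound)
  show "integrable M (\<lambda>x. C * norm (f x))" using f by simp
  show "AE x in M. norm (f x * g x) \<le> norm (C * norm (f x))"
  proof (rule AE_I2)
    fix x assume x: "x \<in> space M"
    have "0 \<le> C" using C[OF x] norm_ge_zero order_trans by blast
    then show "norm (f x * g x) \<le> norm (C * norm (f x))"
      using mult_right_mono[OF C[OF x], of "norm (f x)"] by (simp add: norm_mult mult.commute)
  qed
qed (use f g in measurable)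

lemma norm_lebesgue_integral_le:
  fixes f :: "'a \<Rightarrow> 'b::{banach,second_countable_topology}"
  assumes f: "integrable M f" and g: "integrable M g" and le: "\<And>x. x \<in> space M \<Longrightarrow> norm (f x) \<le> g x"
  shows "norm (\<integral>x. f x \<partial>M) \<le> (\<integral>x. g x \<partial>M)"
proof -
  have "norm (\<integral>x. f x \<partial>M) \<le> (\<integral>x. norm (f x) \<partial>M)" by (rule integral_norm_bound)
  also have "\<dots> \<le> (\<integral>x. g x \<partial>M)" using assms by (intro integral_mono) auto
  finally show ?thesis .
qed

text \<open>Fubini in the form suited to Fourier integrals: \<open>h\<close> will be a phase of
  modulus 1, so the product of \<open>f\<close> and \<open>g\<close> is an integrable majorant up to
  the constant.\<close>

lemma integral_bounded_kernel_swap: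
  fixes f :: "'a::euclidean_space \<Rightarrow> complex" and g :: "'b::euclidean_space \<Rightarrow> complex"
  assumes f: "integrable lborel f" and g: "integrable lborel g"
    and h: "(\<lambda>z. h (fst z) (snd z)) \<in> borel_measurable borel" and C: "\<And>x y. norm (h x y) \<le> C"
  shows "(\<integral>x. f x * (\<integral>y. g y * h x y \<partial>lborel) \<partial>lborel) = (\<integral>y. g y * (\<integral>x. f x * h x y \<partial>lborel) \<partial>lborel)"
    and "integrable lborel (\<lambda>x. f x * (\<integral>y. g y * h x y \<partial>lborel))"
proof -
  have "integrable lborel (\<lambda>z. (f (fst z) * g (snd z)) * h (fst z) (snd z))"
    by (rule integrable_bounded_mult[OF integrable_lborel_pair_mult[OF f g]]) (use h C in auto)
  note i = integral_lborel_pair[OF this] integral_lborel_pair_swap[OF this] integrable_lborel_fst[OF this]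
  have 1: "(\<integral>y. (f x * g y) * h x y \<partial>lborel) = f x * (\<integral>y. g y * h x y \<partial>lborel)" for x
    by (simp add: mult.assoc)
  have 2: "(\<integral>x. (f x * g y) * h x y \<partial>lborel) = g y * (\<integral>x. f x * h x y \<partial>lborel)" for y
    by (simp add: mult.assoc mult.left_commute[of _ "g y"])
  show "(\<integral>x. f x * (\<integral>y. g y * h x y \<partial>lborel) \<partial>lborel) = (\<integral>y. g y * (\<integral>x. f x * h x y \<partial>lborel) \<partial>lborel)"
    using i(1,2) by (simp add: 1 2)
  show "integrable lborel (\<lambda>x. f x * (\<integral>y. g y * h x y \<partial>lborel))"
    using i(3) by (simp add: 1)
qed

lemma integral_derivative_real_line:
  fixes F :: "real \<Rightarrow> 'b::euclidean_space"
  assumes deriv: "\<And>v. (F has_vector_derivative f v) (at v)" and f: "integrable lborel f" "continuous_on UNIV f"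
    and lim: "(F \<longlongrightarrow> 0) at_top" "(F \<longlongrightarrow> 0) at_bot"
  shows "(\<integral>v. f v \<partial>lborel) = 0"
proof -
  have "(\<lambda>k. \<integral>v. indicator {- real k..real k} v *\<^sub>R f v \<partial>lborel) \<longlonglongrightarrow> (\<integral>v. f v \<partial>lborel)"
  proof (rule integral_dominated_convergence[where w="\<lambda>v. norm (f v)"])
    show "AE v in lborel. (\<lambda>k. indicator {- real k..real k} v *\<^sub>R f v) \<longlonglongrightarrow> f v"
    proof (rule AE_I2)
      fix v :: real
      obtain N where N: "\<bar>v\<bar> < real N" using reals_Archimedean2 by blast
      have "eventually (\<lambda>k. indicator {- real k..real k} v *\<^sub>R f v = f v) sequentially"
        using eventually_ge_at_top[of N] by eventually_elim (use N in \<open>auto simp: indicator_def\<close>)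
      then show "(\<lambda>k. indicator {- real k..real k} v *\<^sub>R f v) \<longlonglongrightarrow> f v"
        by (rule tendsto_eventually)
    qed
  qed (use f in \<open>auto simp: indicator_def\<close>)
  moreover have "(\<integral>v. indicator {- real k..real k} v *\<^sub>R f v \<partial>lborel) = F (real k) - F (- real k)" for k
    by (rule integral_FTC_Icc) (auto intro: continuous_on_subset[OF f(2)] has_vector_derivative_at_within deriv)
  ultimately have "(\<lambda>k. F (real k) - F (- real k)) \<longlonglongrightarrow> (\<integral>v. f v \<partial>lborel)" by simp
  moreover have "(\<lambda>k. F (real k) - F (- real k)) \<longlonglongrightarrow> 0 - 0"
    by (intro tendsto_diff filterlim_compose[OF lim(1)] filterlim_compose[OF lim(2)]
        filterlim_real_sequentially filterlim_uminus_at_bot_at_top[THEN filterlim_compose]) 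
  ultimately show ?thesis using LIMSEQ_unique by force
qed

lemma vector_derivative_zero_imp_eq:
  fixes f :: "real \<Rightarrow> 'b::real_normed_vector"
  assumes "\<And>x. (f has_vector_derivative 0) (at x)"
  shows "f x = f y"
proof (rule has_vector_derivative_zero_constant[of UNIV f])
  show "f x = f y" if "\<And>x. x \<in> UNIV \<Longrightarrow> f x = c" for c using that by simp
qed (use assms in auto)

lemma integrable_gaussian_moment:
  assumes e: "0 < e"
  shows "integrable lborel (\<lambda>v::real. v ^ k * exp (- e * v\<^sup>2))"
proof -
  \<comment> \<open>The standard deviation for which the exponent of the normal density is
    \<open>- e * v\<^sup>2\<close>.\<close>
  define s where "s = 1 / sqrt (2 * e)"
  have s: "s > 0" "s\<^sup>2 = 1 / (2 * e)" using e by (auto simp: s_def power_divide)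
  have "integrable lborel (\<lambda>v. sqrt (2 * pi * s\<^sup>2) * (normal_density 0 s v * (v - 0) ^ k))"
    by (intro integrable_mult_right integrable_normal_moment[OF s(1)])
  moreover have "sqrt (2 * pi * s\<^sup>2) * (normal_density 0 s v * (v - 0) ^ k) = v ^ k * exp (- e * v\<^sup>2)" for v
    using e by (simp add: normal_density_def s(2))
  ultimately show ?thesis by (simp only:)
qed

lemma integral_real_gaussian:
  assumes e: "0 < e"
  shows "(\<integral>v. exp (- e * v\<^sup>2) \<partial>lborel) = sqrt (pi / e)"
proof -
  define s where "s = 1 / sqrt (2 * e)"
  have s: "s > 0" "s\<^sup>2 = 1 / (2 * e)" using e by (auto simp: s_def power_divide)
  have "exp (- e * v\<^sup>2) = sqrt (pi / e) * normal_density 0 s v" for v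
    using e by (simp add: normal_density_def s(2))
  then have "(\<integral>v. exp (- e * v\<^sup>2) \<partial>lborel) = sqrt (pi / e) * (\<integral>v. normal_density 0 s v \<partial>lborel)" by simp
  then show ?thesis using s by (simp add: integral_normal_density)
qed

text \<open>This is sqrt (pi / p) with the branch that is positive for p > 0. As an integral it
  carries its branch with it.\<close>

definition gaussian_const :: "complex \<Rightarrow> complex" where
  "gaussian_const p = (\<integral>v. exp (- p * complex_of_real (v\<^sup>2)) \<partial>lborel)"

lemma norm_complex_gaussian: "norm (exp (- p * complex_of_real r)) = exp (- Re p * r)"
  by simp

lemma integrable_complex_gaussian_moment:
  assumes p: "0 < Re p"
  shows "integrable lborel (\<lambda>v::real. complex_of_real (v ^ k) * exp (- p * complex_of_real (v\<^sup>2)))"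
proof (rule Bochner_Integration.integrable_bound[OF integrable_gaussian_moment[OF p, of k]])
  show "(\<lambda>v. complex_of_real (v ^ k) * exp (- p * complex_of_real (v\<^sup>2))) \<in> borel_measurable lborel"
    by (auto intro!: borel_measurable_continuous_onI continuous_intros)
qed (auto simp: norm_mult norm_power abs_mult power_abs)

lemma integrable_complex_gaussian_cis:
  assumes p: "0 < Re p"
  shows "integrable lborel (\<lambda>v::real. complex_of_real (v ^ k) * exp (- p * complex_of_real (v\<^sup>2)) * cis (- (v * \<eta>)))"
  by (rule integrable_bounded_mult[OF integrable_complex_gaussian_moment[OF p], where C=1])
     (auto intro!: borel_measurable_continuous_onI continuous_intros continuous_on_cis)

lemma tendsto_gaussian_moment:
  assumes p: "0 < Re p"
  shows "((\<lambda>v. complex_of_real (v ^ k) * exp (- p * complex_of_real (v\<^sup>2)) * cis (- (v * \<eta>))) \<longlongrightarrow> 0) at_top"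
    and "((\<lambda>v. complex_of_real (v ^ k) * exp (- p * complex_of_real (v\<^sup>2)) * cis (- (v * \<eta>))) \<longlongrightarrow> 0) at_bot"
proof -
  \<comment> \<open>With y = e v^2 the majorant is y^k / exp y up to the factor e^k; for v >= 1 the
    power \<open>v ^ k\<close> is at most \<open>(v\<^sup>2) ^ k\<close>.\<close>
  have 1: "((\<lambda>v. v ^ k * exp (- (e * v\<^sup>2))) \<longlongrightarrow> 0) at_top" if e: "e > 0" for e :: real
  proof (rule tendsto_sandwich[where f="\<lambda>_. 0" and h="\<lambda>v. (e * v\<^sup>2) ^ k / exp (e * v\<^sup>2) / e ^ k"])
    have "filterlim (\<lambda>v::real. e * v\<^sup>2) at_top at_top"
      by (intro filterlim_tendsto_pos_mult_at_top[OF tendsto_const e] filterlim_pow_at_top filterlim_ident) simp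
    from tendsto_divide[OF filterlim_compose[OF tendsto_power_div_exp_0 this] tendsto_const, of "e ^ k" k]
    show "((\<lambda>v. (e * v\<^sup>2) ^ k / exp (e * v\<^sup>2) / e ^ k) \<longlongrightarrow> 0) at_top" using e by simp
    show "\<forall>\<^sub>F v in at_top. v ^ k * exp (- (e * v\<^sup>2)) \<le> (e * v\<^sup>2) ^ k / exp (e * v\<^sup>2) / e ^ k"
      using eventually_ge_at_top[of 1]
    proof eventually_elim
      case (elim v)
      have "v ^ k \<le> (v\<^sup>2) ^ k" using elim by (intro power_mono) (auto simp: power2_eq_square)
      then show ?case using e by (simp add: power_mult_distrib exp_minus field_simps)
    qed
    show "\<forall>\<^sub>F v in at_top. 0 \<le> v ^ k * exp (- (e * v\<^sup>2))"
      using eventually_ge_at_top[of 0] by eventually_elim simp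
  qed simp
  have eq: "norm (complex_of_real (v ^ k) * exp (- p * complex_of_real (v\<^sup>2)) * cis (- (v * \<eta>)))
      = \<bar>v\<bar> ^ k * exp (- (Re p * \<bar>v\<bar>\<^sup>2))" for v
    by (simp add: norm_mult norm_power)
  show "((\<lambda>v. complex_of_real (v ^ k) * exp (- p * complex_of_real (v\<^sup>2)) * cis (- (v * \<eta>))) \<longlongrightarrow> 0) at_top"
    by (rule tendsto_norm_zero_cancel, unfold eq) (rule filterlim_compose[OF 1[OF p] filterlim_abs_real])
  show "((\<lambda>v. complex_of_real (v ^ k) * exp (- p * complex_of_real (v\<^sup>2)) * cis (- (v * \<eta>))) \<longlongrightarrow> 0) at_bot"
  proof (rule tendsto_norm_zero_cancel, unfold eq, rule filterlim_compose[OF 1[OF p]])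
    show "filterlim (\<lambda>v::real. \<bar>v\<bar>) at_top at_bot"
      unfolding filterlim_at_bot_mirror using filterlim_abs_real by simp
  qed
qed

lemma has_vector_derivative_cis:
  "((\<lambda>x. cis (c * x)) has_vector_derivative \<i> * of_real c * cis (c * x)) (at x within S)"
proof -
  have "((\<lambda>x. exp (\<i> * of_real c * of_real x)) has_vector_derivative \<i> * of_real c * exp (\<i> * of_real c * of_real x)) (at x within S)"
    by (auto intro!: derivative_eq_intros has_vector_derivative_real_field)
  then show ?thesis by (simp add: cis_conv_exp mult.assoc)
qed

lemma has_vector_derivative_cis_minus:
  "((\<lambda>x. cis (- (x * c))) has_vector_derivative - \<i> * of_real c * cis (- (x * c))) (at x within S)"
  using has_vector_derivative_cis[of "- c" x S] by (simp add: mult.commute)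

lemma has_vector_derivative_gaussian:
  "((\<lambda>v. exp (- p * complex_of_real (v\<^sup>2))) has_vector_derivative
    - 2 * p * of_real v * exp (- p * complex_of_real (v\<^sup>2))) (at v within S)"
proof -
  have "((\<lambda>z. exp (- p * z\<^sup>2)) has_field_derivative - 2 * p * of_real v * exp (- p * (of_real v)\<^sup>2)) (at (of_real v))"
    by (auto intro!: derivative_eq_intros)
  from has_vector_derivative_real_field[OF this] show ?thesis
    by (simp add: of_real_power has_vector_derivative_at_within)
qed

text \<open>The derivative of the Gaussian times the phase integrates to zero over the line; its two
  terms are multiples of the two integrals.\<close>

lemma gaussian_cis_by_parts:
  assumes p: "0 < Re p"
  shows "(\<integral>v. complex_of_real v * exp (- p * complex_of_real (v\<^sup>2)) * cis (- (v * \<eta>)) \<partial>lborel)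
    = - (\<i> * of_real \<eta> / (2 * p)) * (\<integral>v. exp (- p * complex_of_real (v\<^sup>2)) * cis (- (v * \<eta>)) \<partial>lborel)" (is "?J = _ * ?I")
proof -
  let ?f = "\<lambda>v. - 2 * p * (complex_of_real v * exp (- p * complex_of_real (v\<^sup>2)) * cis (- (v * \<eta>)))
    - \<i> * of_real \<eta> * (exp (- p * complex_of_real (v\<^sup>2)) * cis (- (v * \<eta>)))"
  have i: "integrable lborel (\<lambda>v. complex_of_real v * exp (- p * complex_of_real (v\<^sup>2)) * cis (- (v * \<eta>)))"
      "integrable lborel (\<lambda>v. exp (- p * complex_of_real (v\<^sup>2)) * cis (- (v * \<eta>)))"
    using integrable_complex_gaussian_cis[OF p, of 1 \<eta>] integrable_complex_gaussian_cis[OF p, of 0 \<eta>] by auto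
  have "(\<integral>v. ?f v \<partial>lborel) = 0"
  proof (rule integral_derivative_real_line[where F="\<lambda>v. exp (- p * complex_of_real (v\<^sup>2)) * cis (- (v * \<eta>))"])
    show "((\<lambda>v. exp (- p * complex_of_real (v\<^sup>2)) * cis (- (v * \<eta>))) has_vector_derivative ?f v) (at v)" for v
      by (rule has_vector_derivative_eq_rhs[OF has_vector_derivative_mult[OF has_vector_derivative_gaussian
          has_vector_derivative_cis_minus]]) (simp add: algebra_simps)
    show "integrable lborel ?f" by (intro Bochner_Integration.integrable_diff integrable_mult_right i)
    show "continuous_on UNIV ?f" by (intro continuous_intros continuous_on_cis)
  qed (use tendsto_gaussian_moment[OF p, of 0 \<eta>] in auto)
  moreover have "(\<integral>v. ?f v \<partial>lborel) = - 2 * p * ?J - \<i> * of_real \<eta> * ?I"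
    using i by (subst Bochner_Integration.integral_diff) auto
  ultimately have "2 * p * ?J = - \<i> * of_real \<eta> * ?I" by (simp add: algebra_simps)
  moreover have "p \<noteq> 0" using p by auto
  ultimately show ?thesis by (simp add: field_simps)
qed

text \<open>Both sides solve I' = - (\<eta> / (2 p)) I in \<eta> with the value
  \<open>gaussian_const p\<close> at 0. Multiplication by the inverse exponential reduces uniqueness
  for this equation to a function with zero derivative.\<close>

lemma complex_gaussian_fourier_real:
  assumes p: "0 < Re p"
  shows "(\<integral>v. exp (- p * complex_of_real (v\<^sup>2)) * cis (- (v * \<eta>)) \<partial>lborel)
    = gaussian_const p * exp (- complex_of_real (\<eta>\<^sup>2) / (4 * p))"
proof -
  define I where "I \<eta> = (\<integral>v. exp (- p * complex_of_real (v\<^sup>2)) * cis (- (v * \<eta>)) \<partial>lborel)" for \<eta>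
  have p0: "p \<noteq> 0" using p by auto
  have dI: "(I has_vector_derivative - (of_real \<eta> / (2 * p)) * I \<eta>) (at \<eta>)" for \<eta>
  proof -
    have "(I has_vector_derivative (\<integral>v. - \<i> * (complex_of_real v * exp (- p * complex_of_real (v\<^sup>2)) * cis (- (v * \<eta>))) \<partial>lborel)) (at \<eta>)"
      unfolding I_def
    proof (rule has_vector_derivative_integral[where d=1 and w="\<lambda>v. norm (complex_of_real (v^1) * exp (- p * complex_of_real (v\<^sup>2)))"])
      fix s v :: real
      show "((\<lambda>s. exp (- p * complex_of_real (v\<^sup>2)) * cis (- (v * s))) has_vector_derivative
          - \<i> * (complex_of_real v * exp (- p * complex_of_real (v\<^sup>2)) * cis (- (v * s)))) (at s)"
        using has_vector_derivative_mult_right[OF has_vector_derivative_cis[of "- v" s UNIV], of "exp (- p * complex_of_real (v\<^sup>2))"]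
        by (simp add: algebra_simps)
      show "integrable lborel (\<lambda>v. exp (- p * complex_of_real (v\<^sup>2)) * cis (- (v * s)))"
        using integrable_complex_gaussian_cis[OF p, of 0 s] by simp
      show "integrable lborel (\<lambda>v. norm (complex_of_real (v^1) * exp (- p * complex_of_real (v\<^sup>2))))"
        by (intro integrable_norm integrable_complex_gaussian_moment p)
    qed (auto simp: norm_mult intro!: borel_measurable_continuous_onI continuous_intros continuous_on_cis)
    also have "(\<integral>v. - \<i> * (complex_of_real v * exp (- p * complex_of_real (v\<^sup>2)) * cis (- (v * \<eta>))) \<partial>lborel)
        = - (of_real \<eta> / (2 * p)) * I \<eta>"
      by (subst integral_mult_right_zero, subst gaussian_cis_by_parts[OF p]) (simp add: I_def mult.assoc)
    finally show ?thesis .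
  qed
  have dE: "((\<lambda>\<eta>. exp (complex_of_real (\<eta>\<^sup>2) / (4 * p))) has_vector_derivative
      (of_real \<eta> / (2 * p)) * exp (complex_of_real (\<eta>\<^sup>2) / (4 * p))) (at \<eta>)" for \<eta>
    using has_vector_derivative_gaussian[of "- 1 / (4 * p)" \<eta> UNIV] by (simp add: field_simps)
  have "((\<lambda>\<eta>. I \<eta> * exp (complex_of_real (\<eta>\<^sup>2) / (4 * p))) has_vector_derivative 0) (at \<eta>)" for \<eta>
    using has_vector_derivative_mult[OF dI[of \<eta>] dE[of \<eta>]] by (simp add: algebra_simps)
  from vector_derivative_zero_imp_eq[OF this, of \<eta> 0]
  have c: "I \<eta> * exp (complex_of_real (\<eta>\<^sup>2) / (4 * p)) = gaussian_const p" by (simp add: I_def gaussian_const_def)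
  then have "I \<eta> * exp (complex_of_real (\<eta>\<^sup>2) / (4 * p)) * exp (- complex_of_real (\<eta>\<^sup>2) / (4 * p))
      = gaussian_const p * exp (- complex_of_real (\<eta>\<^sup>2) / (4 * p))" using c by simp
  then have "I \<eta> = gaussian_const p * exp (- complex_of_real (\<eta>\<^sup>2) / (4 * p))"
    by (simp add: exp_minus field_simps)
  then show ?thesis unfolding I_def .
qed

lemma gaussian_const_of_real: "0 < e \<Longrightarrow> gaussian_const (of_real e) = of_real (sqrt (pi / e))"
proof -
  assume e: "0 < e"
  have "gaussian_const (of_real e) = (\<integral>v. complex_of_real (exp (- e * v\<^sup>2)) \<partial>lborel)"
    unfolding gaussian_const_def by (intro Bochner_Integration.integral_cong) (auto simp: exp_of_real[symmetric])
  also have "\<dots> = of_real (sqrt (pi / e))" by (simp only: integral_complex_of_real integral_real_gaussian[OF e])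
  finally show ?thesis .
qed

text \<open>Along the vertical line Re P = e one has G' = - i G / (2 P), so G^2 P is constant; at
  the real point it equals pi. Squaring replaces analytic continuation of a root.\<close>

lemma gaussian_const_square:
  assumes p: "0 < Re p"
  shows "(gaussian_const p)\<^sup>2 = of_real pi / p"
proof -
  define e where "e = Re p"
  have e: "e > 0" using p by (simp add: e_def)
  define P where "P s = Complex e s" for s
  have RP: "0 < Re (P s)" "P s \<noteq> 0" for s using e by (auto simp: P_def complex_eq_iff)
  define G where "G s = gaussian_const (P s)" for s
  \<comment> \<open>Integrate the derivative of v exp (- P v^2) over the line.\<close>
  have parts: "(\<integral>v. complex_of_real (v\<^sup>2) * exp (- P s * complex_of_real (v\<^sup>2)) \<partial>lborel) = G s / (2 * P s)" for s
  proof -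
    let ?f = "\<lambda>v. exp (- P s * complex_of_real (v\<^sup>2)) - 2 * P s * (complex_of_real (v\<^sup>2) * exp (- P s * complex_of_real (v\<^sup>2)))"
    have i: "integrable lborel (\<lambda>v. exp (- P s * complex_of_real (v\<^sup>2)))"
        "integrable lborel (\<lambda>v. complex_of_real (v\<^sup>2) * exp (- P s * complex_of_real (v\<^sup>2)))"
      using integrable_complex_gaussian_moment[OF RP(1), of 0 s] integrable_complex_gaussian_moment[OF RP(1), of 2 s] by auto
    have "(\<integral>v. ?f v \<partial>lborel) = 0"
    proof (rule integral_derivative_real_line[where F="\<lambda>v. of_real v * exp (- P s * complex_of_real (v\<^sup>2))"])
      show "((\<lambda>v. of_real v * exp (- P s * complex_of_real (v\<^sup>2))) has_vector_derivative ?f v) (at v)" for v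
      proof -
        have "(complex_of_real has_vector_derivative 1) (at v)"
          by (rule has_vector_derivative_eq_rhs, rule has_vector_derivative_of_real, rule DERIV_ident) simp
        from has_vector_derivative_mult[OF this has_vector_derivative_gaussian[of "P s" v UNIV]]
        show ?thesis by (simp add: algebra_simps power2_eq_square)
      qed
      show "integrable lborel ?f" by (intro Bochner_Integration.integrable_diff integrable_mult_right i)
      show "continuous_on UNIV ?f" by (intro continuous_intros)
    qed (use tendsto_gaussian_moment[OF RP(1), of 1 s 0] in auto)
    moreover have "(\<integral>v. ?f v \<partial>lborel) = G s - 2 * P s * (\<integral>v. complex_of_real (v\<^sup>2) * exp (- P s * complex_of_real (v\<^sup>2)) \<partial>lborel)"
      using i by (subst Bochner_Integration.integral_diff) (auto simp: G_def gaussian_const_def)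
    ultimately show ?thesis using RP(2)[of s] by (simp add: field_simps)
  qed
  have dG: "(G has_vector_derivative - \<i> * (G s / (2 * P s))) (at s)" for s
  proof -
    have "(G has_vector_derivative (\<integral>v. - \<i> * (complex_of_real (v\<^sup>2) * exp (- P s * complex_of_real (v\<^sup>2))) \<partial>lborel)) (at s)"
      unfolding G_def gaussian_const_def
    proof (rule has_vector_derivative_integral[where d=1 and w="\<lambda>v. v\<^sup>2 * exp (- e * v\<^sup>2)"])
      fix r v :: real
      have "((\<lambda>z. exp (- (of_real e + \<i> * z) * of_real (v\<^sup>2))) has_field_derivative
        - \<i> * (of_real (v\<^sup>2) * exp (- (of_real e + \<i> * of_real r) * of_real (v\<^sup>2)))) (at (of_real r))"
        by (auto intro!: derivative_eq_intros)
      from has_vector_derivative_real_field[OF this]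
      show "((\<lambda>s. exp (- P s * complex_of_real (v\<^sup>2))) has_vector_derivative
          - \<i> * (complex_of_real (v\<^sup>2) * exp (- P r * complex_of_real (v\<^sup>2)))) (at r)"
        by (simp add: P_def Complex_eq)
      show "integrable lborel (\<lambda>v. exp (- P r * complex_of_real (v\<^sup>2)))"
        using integrable_complex_gaussian_moment[OF RP(1), of 0 r] by simp
      show "integrable lborel (\<lambda>v. v\<^sup>2 * exp (- e * v\<^sup>2))" by (rule integrable_gaussian_moment[OF e])
    qed (auto simp: norm_mult P_def norm_power intro!: borel_measurable_continuous_onI continuous_intros)
    also have "(\<integral>v. - \<i> * (complex_of_real (v\<^sup>2) * exp (- P s * complex_of_real (v\<^sup>2))) \<partial>lborel) = - \<i> * (G s / (2 * P s))"
      by (subst integral_mult_right_zero, subst parts) simp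
    finally show ?thesis .
  qed
  have dP: "(P has_vector_derivative \<i>) (at s)" for s
  proof -
    have "((\<lambda>z. of_real e + \<i> * z) has_field_derivative \<i>) (at (of_real s))"
      by (auto intro!: derivative_eq_intros)
    from has_vector_derivative_real_field[OF this] show ?thesis
      by (simp add: P_def[abs_def] Complex_eq)
  qed
  have "((\<lambda>s. G s * G s * P s) has_vector_derivative 0) (at s)" for s
    using has_vector_derivative_mult[OF has_vector_derivative_mult[OF dG[of s] dG[of s]] dP[of s]] RP(2)[of s]
    by (simp add: field_simps)
  note c = vector_derivative_zero_imp_eq[OF this, of "Im p" 0]
  have "G 0 = of_real (sqrt (pi / e))" using gaussian_const_of_real[OF e] by (simp add: G_def P_def Complex_eq)
  moreover have "P 0 = of_real e" by (simp add: P_def Complex_eq)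
  ultimately have "G 0 * G 0 * P 0 = of_real (sqrt (pi / e) * sqrt (pi / e) * e)"
    by (simp only: of_real_mult)
  also have "sqrt (pi / e) * sqrt (pi / e) * e = pi" using e by (simp add: real_sqrt_mult_self)
  finally have "G (Im p) * G (Im p) * P (Im p) = of_real pi" using c by (simp only:)
  moreover have "P (Im p) = p" by (simp add: P_def e_def)
  moreover have "p \<noteq> 0" using p by auto
  ultimately show ?thesis by (simp add: G_def power2_eq_square field_simps)
qed

lemma
  fixes \<xi> :: "'a::euclidean_space"
  assumes p: "0 < Re p"
  shows complex_gaussian_fourier: "(\<integral>v. exp (- p * complex_of_real ((norm v)\<^sup>2)) * cis (- (v \<bullet> \<xi>)) \<partial>lborel)
      = gaussian_const p ^ DIM('a) * exp (- complex_of_real ((norm \<xi>)\<^sup>2) / (4 * p))"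
    and integrable_complex_gaussian:
      "integrable lborel (\<lambda>v::'a. exp (- p * complex_of_real ((norm v)\<^sup>2)))"
proof -
  have *: "exp (- p * complex_of_real ((norm v)\<^sup>2)) * cis (- (v \<bullet> \<xi>))
      = (\<Prod>b\<in>Basis. exp (- p * complex_of_real ((v \<bullet> b)\<^sup>2)) * cis (- ((v \<bullet> b) * (\<xi> \<bullet> b))))" for v \<xi> :: 'a
  proof -
    have "exp (- p * complex_of_real ((norm v)\<^sup>2)) = (\<Prod>b\<in>Basis. exp (- p * complex_of_real ((v \<bullet> b)\<^sup>2)))"
      unfolding exp_sum[OF finite_Basis, symmetric] sum_distrib_left[symmetric] of_real_sum[symmetric]
      by (subst norm_eq_sqrt_inner, subst euclidean_inner) (simp add: power2_eq_square sum_nonneg)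
    moreover have "cis (- (v \<bullet> \<xi>)) = (\<Prod>b\<in>Basis. cis (- ((v \<bullet> b) * (\<xi> \<bullet> b))))"
      unfolding cis_conv_exp exp_sum[OF finite_Basis, symmetric] sum_distrib_left[symmetric] of_real_sum[symmetric]
      by (subst euclidean_inner) (simp add: sum_negf)
    ultimately show ?thesis by (simp add: prod.distrib)
  qed
  have i: "integrable lborel (\<lambda>v. exp (- p * complex_of_real (v\<^sup>2)) * cis (- (v * \<eta>)))" for \<eta>
    using integrable_complex_gaussian_cis[OF p, of 0 \<eta>] by simp
  have e: "(\<Prod>b\<in>Basis. exp (- complex_of_real ((\<xi> \<bullet> b)\<^sup>2) / (4 * p))) = exp (- complex_of_real ((norm \<xi>)\<^sup>2) / (4 * p))"
    unfolding exp_sum[OF finite_Basis, symmetric] sum_divide_distrib[symmetric] sum_negf of_real_sum[symmetric]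
    by (subst norm_eq_sqrt_inner, subst euclidean_inner) (simp add: power2_eq_square sum_nonneg)
  show "(\<integral>v. exp (- p * complex_of_real ((norm v)\<^sup>2)) * cis (- (v \<bullet> \<xi>)) \<partial>lborel)
      = gaussian_const p ^ DIM('a) * exp (- complex_of_real ((norm \<xi>)\<^sup>2) / (4 * p))"
    unfolding * by (subst integral_lborel_prod_Basis[OF i])
      (simp only: complex_gaussian_fourier_real[OF p] prod.distrib e prod_constant)
  have "integrable lborel (\<lambda>v::'a. exp (- p * complex_of_real ((norm v)\<^sup>2)) * cis (- (v \<bullet> 0)))"
    unfolding * by (intro integrable_lborel_prod_Basis i)
  then show "integrable lborel (\<lambda>v::'a. exp (- p * complex_of_real ((norm v)\<^sup>2)))" by simp
qed


section \<open>Fourier inversion and the Plancherel identity\<close>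

lemma measurable_cis_continuous:
  "continuous_on UNIV f \<Longrightarrow> (\<lambda>x. cis (f x)) \<in> borel_measurable borel"
  by (intro borel_measurable_continuous_onI continuous_on_cis)

text \<open>The transform of a damping factor is a Gaussian in x - y of width proportional to
  \<open>d\<close>. The substitution y = x + 2 d v makes it a fixed Gaussian; each dimension
  contributes (sqrt pi / d) (2 d) = 2 sqrt pi.\<close>

lemma integral_gaussian_rescale:
  fixes \<phi> :: "'a::euclidean_space \<Rightarrow> complex"
  assumes d: "0 < d" and \<phi>: "\<phi> \<in> borel_measurable borel"
  shows "(\<integral>y. \<phi> y * (\<integral>\<xi>. exp (- of_real (d\<^sup>2) * complex_of_real ((norm \<xi>)\<^sup>2)) * cis ((x - y) \<bullet> \<xi>) \<partial>lborel) \<partial>lborel)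
    = of_real ((2 * sqrt pi) ^ DIM('a)) * (\<integral>v. \<phi> (x + (2 * d) *\<^sub>R v) * exp (- complex_of_real ((norm v)\<^sup>2)) \<partial>lborel)"
proof -
  have K: "(\<integral>\<xi>. exp (- of_real (d\<^sup>2) * complex_of_real ((norm \<xi>)\<^sup>2)) * cis ((x - y) \<bullet> \<xi>) \<partial>lborel)
      = of_real ((sqrt pi / d) ^ DIM('a)) * exp (- complex_of_real ((norm (x - y))\<^sup>2 / (4 * d\<^sup>2)))" for y
  proof -
    have "gaussian_const (of_real (d\<^sup>2)) = of_real (sqrt pi / d)"
      using d gaussian_const_of_real[of "d\<^sup>2"] by (simp add: real_sqrt_divide)
    then show ?thesis
      using complex_gaussian_fourier[of "of_real (d\<^sup>2)" "y - x"] d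
      by (simp add: inner_diff_left inner_diff_right inner_commute norm_minus_commute)
  qed
  have "(\<integral>y. \<phi> y * (\<integral>\<xi>. exp (- of_real (d\<^sup>2) * complex_of_real ((norm \<xi>)\<^sup>2)) * cis ((x - y) \<bullet> \<xi>) \<partial>lborel) \<partial>lborel)
      = of_real ((sqrt pi / d) ^ DIM('a)) * (\<integral>y. \<phi> y * exp (- complex_of_real ((norm (x - y))\<^sup>2 / (4 * d\<^sup>2))) \<partial>lborel)"
    unfolding K by (subst integral_mult_right_zero[symmetric]) (intro Bochner_Integration.integral_cong refl, simp add: mult_ac)
  also have "(\<integral>y. \<phi> y * exp (- complex_of_real ((norm (x - y))\<^sup>2 / (4 * d\<^sup>2))) \<partial>lborel)
      = (\<integral>z. \<phi> (x + z) * exp (- complex_of_real ((norm z)\<^sup>2 / (4 * d\<^sup>2))) \<partial>lborel)"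
    by (subst lborel_integral_translate[where t=x, symmetric]) simp
  also have "\<dots> = (2 * d) ^ DIM('a) *\<^sub>R (\<integral>v. \<phi> (x + (2 * d) *\<^sub>R v) * exp (- complex_of_real ((norm ((2 * d) *\<^sub>R v))\<^sup>2 / (4 * d\<^sup>2))) \<partial>lborel)"
  proof -
    have "(\<lambda>z. \<phi> (x + z) * exp (- complex_of_real ((norm z)\<^sup>2 / (4 * d\<^sup>2)))) \<in> borel_measurable borel"
      using \<phi> by measurable
    from lborel_integral_scale[OF _ this, of "2 * d"] d show ?thesis by simp
  qed
  also have "(\<integral>v. \<phi> (x + (2 * d) *\<^sub>R v) * exp (- complex_of_real ((norm ((2 * d) *\<^sub>R v))\<^sup>2 / (4 * d\<^sup>2))) \<partial>lborel)
      = (\<integral>v. \<phi> (x + (2 * d) *\<^sub>R v) * exp (- complex_of_real ((norm v)\<^sup>2)) \<partial>lborel)"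
  proof -
    have "(norm ((2 * d) *\<^sub>R v))\<^sup>2 / (4 * d\<^sup>2) = (norm v)\<^sup>2" for v :: 'a
      using d by (simp add: power_mult_distrib)
    then show ?thesis by (simp only:)
  qed
  also have "of_real ((sqrt pi / d) ^ DIM('a)) * ((2 * d) ^ DIM('a) *\<^sub>R (\<integral>v. \<phi> (x + (2 * d) *\<^sub>R v) * exp (- complex_of_real ((norm v)\<^sup>2)) \<partial>lborel))
      = of_real ((sqrt pi / d * (2 * d)) ^ DIM('a)) * (\<integral>v. \<phi> (x + (2 * d) *\<^sub>R v) * exp (- complex_of_real ((norm v)\<^sup>2)) \<partial>lborel)"
    by (simp only: scaleR_conv_of_real mult.assoc[symmetric] of_real_mult[symmetric] power_mult_distrib[symmetric])
  also have "sqrt pi / d * (2 * d) = 2 * sqrt pi" using d by simp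
  finally show ?thesis .
qed

lemma
  shows integral_standard_gaussian: "(\<integral>v. exp (- complex_of_real ((norm v)\<^sup>2)) \<partial>(lborel :: 'a::euclidean_space measure)) = of_real (sqrt pi ^ DIM('a))"
    and integrable_standard_gaussian: "integrable lborel (\<lambda>v::'a. exp (- complex_of_real ((norm v)\<^sup>2)))"
  using complex_gaussian_fourier[of 1 "0::'a"] integrable_complex_gaussian[of 1, where 'a='a] gaussian_const_of_real[of 1]
  by auto

text \<open>An approximate identity. Continuity is asked at the point \<open>x\<close> alone,
  because \<open>plancherel\<close> uses it at almost every point of a function that may have
  discontinuities.\<close>

lemma tendsto_integral_gaussian_rescaled:
  fixes \<phi> :: "'a::euclidean_space \<Rightarrow> complex"
  assumes \<phi>: "\<phi> \<in> borel_measurable borel" and C: "\<And>x. norm (\<phi> x) \<le> C" and x: "isCont \<phi> x" and d: "d \<longlonglongrightarrow> 0"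
  shows "(\<lambda>k. \<integral>v. \<phi> (x + (2 * d k) *\<^sub>R v) * exp (- complex_of_real ((norm v)\<^sup>2)) \<partial>lborel) \<longlonglongrightarrow> of_real (sqrt pi ^ DIM('a)) * \<phi> x"
proof -
  have "(\<lambda>k. \<integral>v. \<phi> (x + (2 * d k) *\<^sub>R v) * exp (- complex_of_real ((norm v)\<^sup>2)) \<partial>lborel)
      \<longlonglongrightarrow> (\<integral>v. \<phi> x * exp (- complex_of_real ((norm v)\<^sup>2)) \<partial>(lborel :: 'a measure))"
  proof (rule integral_dominated_convergence[where w="\<lambda>v::'a. C * norm (exp (- complex_of_real ((norm v)\<^sup>2)))"])
    show "AE v in lborel. (\<lambda>k. \<phi> (x + (2 * d k) *\<^sub>R v) * exp (- complex_of_real ((norm v)\<^sup>2)))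
        \<longlonglongrightarrow> \<phi> x * exp (- complex_of_real ((norm v)\<^sup>2))"
    proof (rule AE_I2)
      fix v :: 'a
      have "(\<lambda>k. x + (2 * d k) *\<^sub>R v) \<longlonglongrightarrow> x + (2 * 0) *\<^sub>R v" by (intro tendsto_intros d)
      then have "(\<lambda>k. \<phi> (x + (2 * d k) *\<^sub>R v)) \<longlonglongrightarrow> \<phi> x" using isCont_tendsto_compose[OF x] by simp
      then show "(\<lambda>k. \<phi> (x + (2 * d k) *\<^sub>R v) * exp (- complex_of_real ((norm v)\<^sup>2)))
        \<longlonglongrightarrow> \<phi> x * exp (- complex_of_real ((norm v)\<^sup>2))" by (rule tendsto_mult_right)
    qed
    show "integrable lborel (\<lambda>v::'a. C * norm (exp (- complex_of_real ((norm v)\<^sup>2))))"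
      by (intro integrable_mult_right integrable_norm integrable_standard_gaussian)
    show "AE v in lborel. norm (\<phi> (x + (2 * d k) *\<^sub>R v) * exp (- complex_of_real ((norm v)\<^sup>2)))
        \<le> C * norm (exp (- complex_of_real ((norm v)\<^sup>2)))" for k
      using C by (auto simp: norm_mult intro!: mult_right_mono)
  qed (use \<phi> in measurable)
  then show ?thesis
    by (simp add: integral_standard_gaussian integrable_standard_gaussian mult.commute del: of_real_power)
qed

text \<open>Insert Gaussian damping that tends to 1. The damped integral converges to the left side
  by domination, while Fubini rewrites it as an approximate identity acting on \<phi>. The constant
  is (2 sqrt pi)^n times the Gaussian mass (sqrt pi)^n.\<close>

theorem fourier_inversion:
  fixes \<phi> :: "'a::euclidean_space \<Rightarrow> complex"
  assumes int: "integrable lborel \<phi>" and cont: "continuous_on UNIV \<phi>" and C: "\<And>x. norm (\<phi> x) \<le> C"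
    and intF: "integrable lborel (fourier \<phi>)"
  shows "(\<integral>\<xi>. fourier \<phi> \<xi> * cis (x \<bullet> \<xi>) \<partial>lborel) = of_real ((2 * pi) ^ DIM('a)) * \<phi> x"
proof -
  define d where "d k = inverse (real (Suc k))" for k
  have d: "d \<longlonglongrightarrow> 0" "\<And>k. 0 < d k" unfolding d_def using LIMSEQ_inverse_real_of_nat by auto
  define g where "g k \<xi> = exp (- of_real ((d k)\<^sup>2) * complex_of_real ((norm \<xi>)\<^sup>2))" for k and \<xi> :: 'a
  have ng: "norm (g k \<xi>) \<le> 1" for k \<xi> by (simp add: g_def)
  have ig: "integrable lborel (g k)" for k
    unfolding g_def using d(2)[of k] by (intro integrable_complex_gaussian) simp
  have meas: "\<phi> \<in> borel_measurable borel" using cont by (rule borel_measurable_continuous_onI)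
  have lim: "(\<lambda>k. \<integral>\<xi>. fourier \<phi> \<xi> * cis (x \<bullet> \<xi>) * g k \<xi> \<partial>lborel) \<longlonglongrightarrow> (\<integral>\<xi>. fourier \<phi> \<xi> * cis (x \<bullet> \<xi>) \<partial>lborel)"
  proof (rule integral_dominated_convergence[where w="\<lambda>\<xi>. norm (fourier \<phi> \<xi>)"])
    show "AE \<xi> in lborel. (\<lambda>k. fourier \<phi> \<xi> * cis (x \<bullet> \<xi>) * g k \<xi>) \<longlonglongrightarrow> fourier \<phi> \<xi> * cis (x \<bullet> \<xi>)"
    proof (rule AE_I2)
      fix \<xi> :: 'a
      have "(\<lambda>k. g k \<xi>) \<longlonglongrightarrow> exp (- of_real (0\<^sup>2) * complex_of_real ((norm \<xi>)\<^sup>2))"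
        unfolding g_def by (intro tendsto_intros d)
      from tendsto_mult_left[OF this, of "fourier \<phi> \<xi> * cis (x \<bullet> \<xi>)"]
      show "(\<lambda>k. fourier \<phi> \<xi> * cis (x \<bullet> \<xi>) * g k \<xi>) \<longlonglongrightarrow> fourier \<phi> \<xi> * cis (x \<bullet> \<xi>)" by simp
    qed
    have c: "(\<lambda>\<xi>. cis (x \<bullet> \<xi>)) \<in> borel_measurable borel"
      by (intro measurable_cis_continuous continuous_intros)
    have f: "fourier \<phi> \<in> borel_measurable borel" using intF by auto
    show "(\<lambda>\<xi>. fourier \<phi> \<xi> * cis (x \<bullet> \<xi>)) \<in> borel_measurable lborel" using c f by simp
    show "(\<lambda>\<xi>. fourier \<phi> \<xi> * cis (x \<bullet> \<xi>) * g k \<xi>) \<in> borel_measurable lborel" for k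
      using c f ig[of k] by (auto intro!: borel_measurable_times)
    show "AE \<xi> in lborel. norm (fourier \<phi> \<xi> * cis (x \<bullet> \<xi>) * g k \<xi>) \<le> norm (fourier \<phi> \<xi>)" for k
      by (intro AE_I2) (simp add: norm_mult mult_left_le ng)
  qed (use intF in auto)
  have eq: "(\<integral>\<xi>. fourier \<phi> \<xi> * cis (x \<bullet> \<xi>) * g k \<xi> \<partial>lborel)
      = of_real ((2 * sqrt pi) ^ DIM('a)) * (\<integral>v. \<phi> (x + (2 * d k) *\<^sub>R v) * exp (- complex_of_real ((norm v)\<^sup>2)) \<partial>lborel)" for k
  proof -
    have "(\<integral>\<xi>. fourier \<phi> \<xi> * cis (x \<bullet> \<xi>) * g k \<xi> \<partial>lborel)
        = (\<integral>\<xi>. (g k \<xi> * cis (x \<bullet> \<xi>)) * (\<integral>y. \<phi> y * cis (- (\<xi> \<bullet> y)) \<partial>lborel) \<partial>lborel)"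
      by (simp add: fourier_def mult_ac)
    also have "\<dots> = (\<integral>y. \<phi> y * (\<integral>\<xi>. (g k \<xi> * cis (x \<bullet> \<xi>)) * cis (- (\<xi> \<bullet> y)) \<partial>lborel) \<partial>lborel)"
    proof (rule integral_bounded_kernel_swap(1)[where C=1])
      show "integrable lborel (\<lambda>\<xi>. g k \<xi> * cis (x \<bullet> \<xi>))"
        by (rule integrable_bounded_mult[OF ig, where C=1])
          (auto intro!: measurable_cis_continuous continuous_intros)
    qed (use int in \<open>auto intro!: measurable_cis_continuous continuous_intros\<close>)
    also have "\<dots> = (\<integral>y. \<phi> y * (\<integral>\<xi>. g k \<xi> * cis ((x - y) \<bullet> \<xi>) \<partial>lborel) \<partial>lborel)"
    proof -
      have "cis (x \<bullet> \<xi>) * cis (- (\<xi> \<bullet> y)) = cis ((x - y) \<bullet> \<xi>)" for y \<xi>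
        by (simp add: cis_mult inner_diff_left inner_commute[of y])
      then show ?thesis by (simp only: mult.assoc)
    qed
    also have "\<dots> = of_real ((2 * sqrt pi) ^ DIM('a)) * (\<integral>v. \<phi> (x + (2 * d k) *\<^sub>R v) * exp (- complex_of_real ((norm v)\<^sup>2)) \<partial>lborel)"
      unfolding g_def by (rule integral_gaussian_rescale[OF d(2) meas])
    finally show ?thesis .
  qed
  have "(\<lambda>k. \<integral>\<xi>. fourier \<phi> \<xi> * cis (x \<bullet> \<xi>) * g k \<xi> \<partial>lborel)
      \<longlonglongrightarrow> of_real ((2 * sqrt pi) ^ DIM('a)) * (of_real (sqrt pi ^ DIM('a)) * \<phi> x)"
    unfolding eq
    by (intro tendsto_mult_left tendsto_integral_gaussian_rescaled[OF meas C _ d(1)])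
       (use cont in \<open>simp add: continuous_on_eq_continuous_at\<close>)
  with lim have "(\<integral>\<xi>. fourier \<phi> \<xi> * cis (x \<bullet> \<xi>) \<partial>lborel) = of_real ((2 * sqrt pi) ^ DIM('a)) * (of_real (sqrt pi ^ DIM('a)) * \<phi> x)"
    by (rule LIMSEQ_unique)
  also have "\<dots> = of_real ((2 * sqrt pi * sqrt pi) ^ DIM('a)) * \<phi> x"
    by (simp add: power_mult_distrib)
  finally show ?thesis by (simp add: mult.assoc)
qed

text \<open>Stated for almost everywhere continuous \<open>b\<close>, because it is applied to
  \<open>trace_spectrum\<close>, whose phase is singular on a hyperplane. The transform
  \<open>B\<close> is not known to be square integrable beforehand: its square is damped, Fubini
  moves the damping to \<open>b\<close>, and the two sides pass to the limit by monotone and by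
  dominated convergence.\<close>

theorem plancherel:
  fixes b :: "'a::euclidean_space \<Rightarrow> complex"
  assumes int: "integrable lborel b" and C: "\<And>x. norm (b x) \<le> C" and cont: "AE x in lborel. isCont b x"
  shows "(\<integral>\<^sup>+x. ennreal ((norm (\<integral>\<xi>. b \<xi> * cis (x \<bullet> \<xi>) \<partial>lborel))\<^sup>2) \<partial>lborel)
    = ennreal ((2 * pi) ^ DIM('a)) * (\<integral>\<^sup>+\<xi>. ennreal ((norm (b \<xi>))\<^sup>2) \<partial>lborel)"
proof -
  define B where "B x = (\<integral>\<xi>. b \<xi> * cis (x \<bullet> \<xi>) \<partial>lborel)" for x
  define d where "d k = inverse (real (Suc k))" for k
  have d: "d \<longlonglongrightarrow> 0" "\<And>k. 0 < d k" unfolding d_def using LIMSEQ_inverse_real_of_nat by auto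
  define g where "g k \<xi> = exp (- of_real ((d k)\<^sup>2) * complex_of_real ((norm \<xi>)\<^sup>2))" for k and \<xi> :: 'a
  have gr: "g k x = of_real (exp (- ((d k)\<^sup>2 * (norm x)\<^sup>2)))" for k x by (simp add: g_def exp_of_real[symmetric])
  have ig: "integrable lborel (g k)" for k
    unfolding g_def using d(2)[of k] by (intro integrable_complex_gaussian) simp
  have C0: "0 \<le> C" using C[of 0] norm_ge_zero order_trans by blast
  have meas: "b \<in> borel_measurable borel" using int by auto
  have [measurable]: "(\<lambda>x. cnj (f x)) \<in> borel_measurable M"
    if "f \<in> borel_measurable M" for M :: "'a measure" and f :: "'a \<Rightarrow> complex"
    by (rule borel_measurable_continuous_on[OF _ that]) (intro continuous_intros)
  have Bcont: "continuous_on UNIV B"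
    unfolding B_def
  proof (rule continuous_on_integral_dominated)
    show "\<exists>w d. 0 < d \<and> integrable lborel w \<and> (\<forall>p\<in>UNIV. dist p p0 < d \<longrightarrow> (\<forall>x\<in>space lborel. norm (b x * cis (p \<bullet> x)) \<le> w x))" for p0
      by (intro exI[of _ "\<lambda>x. norm (b x)"] exI[of _ 1]) (use int in \<open>auto simp: norm_mult\<close>)
  qed (use meas in \<open>auto intro!: continuous_intros continuous_on_cis borel_measurable_times measurable_cis_continuous\<close>)
  have Bbound: "norm (B x) \<le> (\<integral>\<xi>. norm (b \<xi>) \<partial>lborel)" for x
    unfolding B_def using integral_norm_bound[of lborel "\<lambda>\<xi>. b \<xi> * cis (x \<bullet> \<xi>)"] by (simp add: norm_mult)
  have Bm: "B \<in> borel_measurable borel" using Bcont by (rule borel_measurable_continuous_onI)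
  have igB: "integrable lborel (\<lambda>x. g k x * cnj (B x))" for k
    by (rule integrable_bounded_mult[OF ig, where C="\<integral>\<xi>. norm (b \<xi>) \<partial>lborel"])
      (use Bcont Bbound in \<open>auto intro!: borel_measurable_continuous_onI continuous_on_cnj\<close>)
  \<comment> \<open>A smoothing of \<open>cnj b\<close> at scale \<open>d k\<close>, not normalised:
    its limit carries the mass (sqrt pi)^n of the Gaussian.\<close>
  define J where "J k \<xi> = (\<integral>v. cnj (b (\<xi> + (2 * d k) *\<^sub>R v)) * exp (- complex_of_real ((norm v)\<^sup>2)) \<partial>lborel)" for k \<xi>
  let ?c = "complex_of_real ((2 * sqrt pi) ^ DIM('a))"
  have inner: "(\<integral>x. (g k x * cnj (B x)) * cis (x \<bullet> \<xi>) \<partial>lborel) = ?c * J k \<xi>" for k \<xi>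
  proof -
    have cB: "cnj (B x) = (\<integral>\<eta>. cnj (b \<eta>) * cis (- (x \<bullet> \<eta>)) \<partial>lborel)" for x
    proof -
      have "integrable lborel (\<lambda>\<eta>. b \<eta> * cis (x \<bullet> \<eta>))"
        by (rule integrable_bounded_mult[OF int, where C=1])
          (auto intro!: measurable_cis_continuous continuous_intros)
      from integral_bounded_linear[OF bounded_linear_cnj this] show ?thesis by (simp add: B_def cis_cnj)
    qed
    have "(\<integral>x. (g k x * cnj (B x)) * cis (x \<bullet> \<xi>) \<partial>lborel)
        = (\<integral>x. (g k x * cis (x \<bullet> \<xi>)) * (\<integral>\<eta>. cnj (b \<eta>) * cis (- (x \<bullet> \<eta>)) \<partial>lborel) \<partial>lborel)"
      by (simp add: cB mult_ac)
    also have "\<dots> = (\<integral>\<eta>. cnj (b \<eta>) * (\<integral>x. (g k x * cis (x \<bullet> \<xi>)) * cis (- (x \<bullet> \<eta>)) \<partial>lborel) \<partial>lborel)"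
    proof (rule integral_bounded_kernel_swap(1)[where C=1])
      show "integrable lborel (\<lambda>x. g k x * cis (x \<bullet> \<xi>))"
        by (rule integrable_bounded_mult[OF ig, where C=1])
          (auto intro!: measurable_cis_continuous continuous_intros)
    qed (use int in \<open>auto intro!: measurable_cis_continuous continuous_intros\<close>)
    also have "\<dots> = (\<integral>\<eta>. cnj (b \<eta>) * (\<integral>x. g k x * cis ((\<xi> - \<eta>) \<bullet> x) \<partial>lborel) \<partial>lborel)"
    proof -
      have "cis (x \<bullet> \<xi>) * cis (- (x \<bullet> \<eta>)) = cis ((\<xi> - \<eta>) \<bullet> x)" for x \<eta>
        by (simp add: cis_mult inner_diff_left inner_commute[of x])
      then show ?thesis by (simp only: mult.assoc)
    qed
    also have "\<dots> = ?c * J k \<xi>"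
      unfolding g_def J_def by (rule integral_gaussian_rescale[OF d(2)]) (use meas in measurable)
    finally show ?thesis .
  qed
  have Jbound: "norm (J k \<xi>) \<le> C * sqrt pi ^ DIM('a)" for k \<xi>
  proof -
    have "norm (J k \<xi>) \<le> (\<integral>v. C * norm (exp (- complex_of_real ((norm (v::'a))\<^sup>2))) \<partial>lborel)"
      unfolding J_def
    proof (rule norm_lebesgue_integral_le)
      show i: "integrable lborel (\<lambda>v::'a. C * norm (exp (- complex_of_real ((norm v)\<^sup>2))))"
        by (intro integrable_mult_right integrable_norm integrable_standard_gaussian)
      show le: "norm (cnj (b (\<xi> + (2 * d k) *\<^sub>R v)) * exp (- complex_of_real ((norm v)\<^sup>2)))
          \<le> C * norm (exp (- complex_of_real ((norm v)\<^sup>2)))" for v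
        using C[of "\<xi> + (2 * d k) *\<^sub>R v"] by (auto simp: norm_mult intro!: mult_right_mono)
      show "integrable lborel (\<lambda>v. cnj (b (\<xi> + (2 * d k) *\<^sub>R v)) * exp (- complex_of_real ((norm v)\<^sup>2)))"
        by (rule Bochner_Integration.integrable_bound[OF i])
          (use meas in measurable, use order_trans[OF le abs_ge_self] in simp)
    qed
    also have "\<dots> = C * Re (\<integral>v. exp (- complex_of_real ((norm (v::'a))\<^sup>2)) \<partial>lborel)"
      unfolding integral_Re[OF integrable_standard_gaussian, symmetric]
      by (simp add: exp_of_real flip: of_real_minus of_real_power)
    finally show ?thesis unfolding integral_standard_gaussian by simp
  qed
  have outer: "of_real (\<integral>x. (norm (B x))\<^sup>2 * exp (- ((d k)\<^sup>2 * (norm x)\<^sup>2)) \<partial>lborel) = (\<integral>\<xi>. b \<xi> * (?c * J k \<xi>) \<partial>lborel)"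
    and outer_int: "integrable lborel (\<lambda>x. (norm (B x))\<^sup>2 * exp (- ((d k)\<^sup>2 * (norm x)\<^sup>2)))"
    and Jm: "integrable lborel (\<lambda>\<xi>. b \<xi> * (?c * J k \<xi>))" for k
  proof -
    have e: "complex_of_real ((norm (B x))\<^sup>2 * exp (- ((d k)\<^sup>2 * (norm x)\<^sup>2))) = (g k x * cnj (B x)) * (\<integral>\<xi>. b \<xi> * cis (x \<bullet> \<xi>) \<partial>lborel)" for x
      unfolding B_def[symmetric] gr of_real_mult complex_norm_square by (simp add: mult_ac)
    have m: "(\<lambda>z. cis (fst z \<bullet> snd z)) \<in> borel_measurable (borel :: ('a \<times> 'a) measure)"
      by (intro measurable_cis_continuous continuous_intros)
    have m': "(\<lambda>z. cis (snd z \<bullet> fst z)) \<in> borel_measurable (borel :: ('a \<times> 'a) measure)"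
      by (intro measurable_cis_continuous continuous_intros)
    note sw = integral_bounded_kernel_swap[OF igB int, where h="\<lambda>x \<xi>. cis (x \<bullet> \<xi>)" and C=1, OF m, simplified]
    have "of_real (\<integral>x. (norm (B x))\<^sup>2 * exp (- ((d k)\<^sup>2 * (norm x)\<^sup>2)) \<partial>lborel)
        = (\<integral>x. (g k x * cnj (B x)) * (\<integral>\<xi>. b \<xi> * cis (x \<bullet> \<xi>) \<partial>lborel) \<partial>lborel)"
      by (subst integral_complex_of_real[symmetric], subst e) simp
    also have "\<dots> = (\<integral>\<xi>. b \<xi> * (\<integral>x. (g k x * cnj (B x)) * cis (x \<bullet> \<xi>) \<partial>lborel) \<partial>lborel)"
      by (rule sw)
    finally show "of_real (\<integral>x. (norm (B x))\<^sup>2 * exp (- ((d k)\<^sup>2 * (norm x)\<^sup>2)) \<partial>lborel) = (\<integral>\<xi>. b \<xi> * (?c * J k \<xi>) \<partial>lborel)"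
      unfolding inner .
    have "integrable lborel (\<lambda>x. complex_of_real ((norm (B x))\<^sup>2 * exp (- ((d k)\<^sup>2 * (norm x)\<^sup>2))))"
      unfolding e by (rule sw)
    then show "integrable lborel (\<lambda>x. (norm (B x))\<^sup>2 * exp (- ((d k)\<^sup>2 * (norm x)\<^sup>2)))"
      unfolding complex_of_real_integrable_eq .
    show "integrable lborel (\<lambda>\<xi>. b \<xi> * (?c * J k \<xi>))"
      unfolding inner[symmetric]
      using integral_bounded_kernel_swap(2)[OF int igB, where h="\<lambda>\<xi> x. cis (x \<bullet> \<xi>)" and C=1, OF m'] by simp
  qed
  have ib2: "integrable lborel (\<lambda>\<xi>. (norm (b \<xi>))\<^sup>2)"
  proof (rule Bochner_Integration.integrable_bound)
    show "integrable lborel (\<lambda>\<xi>. C * norm (b \<xi>))" using int by simp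
    show "AE \<xi> in lborel. norm ((norm (b \<xi>))\<^sup>2) \<le> norm (C * norm (b \<xi>))"
      using C C0 by (auto simp: power2_eq_square abs_mult intro!: mult_right_mono)
  qed (use meas in measurable)
  have "(\<lambda>k. \<integral>\<xi>. b \<xi> * (?c * J k \<xi>) \<partial>lborel) \<longlonglongrightarrow> (\<integral>\<xi>. b \<xi> * (?c * (of_real (sqrt pi ^ DIM('a)) * cnj (b \<xi>))) \<partial>lborel)"
  proof (rule integral_dominated_convergence[where w="\<lambda>\<xi>. norm (b \<xi>) * (norm ?c * (C * sqrt pi ^ DIM('a)))"])
    show "AE \<xi> in lborel. (\<lambda>k. b \<xi> * (?c * J k \<xi>)) \<longlonglongrightarrow> b \<xi> * (?c * (of_real (sqrt pi ^ DIM('a)) * cnj (b \<xi>)))"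
      using cont
    proof eventually_elim
      case (elim \<xi>)
      have "(\<lambda>k. J k \<xi>) \<longlonglongrightarrow> of_real (sqrt pi ^ DIM('a)) * cnj (b \<xi>)"
        unfolding J_def
        by (rule tendsto_integral_gaussian_rescaled[where C=C]) (use meas C elim d in \<open>auto intro: isCont_cnj\<close>)
      then show ?case by (intro tendsto_mult_left)
    qed
    show "AE \<xi> in lborel. norm (b \<xi> * (?c * J k \<xi>)) \<le> norm (b \<xi>) * (norm ?c * (C * sqrt pi ^ DIM('a)))" for k
      unfolding norm_mult[of "b _"] norm_mult[of ?c] using Jbound by (intro AE_I2 mult_left_mono) auto
    show "(\<lambda>\<xi>. b \<xi> * (?c * (of_real (sqrt pi ^ DIM('a)) * cnj (b \<xi>)))) \<in> borel_measurable lborel"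
      using meas by measurable
    show "integrable lborel (\<lambda>\<xi>. norm (b \<xi>) * (norm ?c * (C * sqrt pi ^ DIM('a))))" using int by auto
  qed (use Jm borel_measurable_integrable in blast)
  moreover have "(\<integral>\<xi>. b \<xi> * (?c * (of_real (sqrt pi ^ DIM('a)) * cnj (b \<xi>))) \<partial>lborel)
      = of_real ((2 * pi) ^ DIM('a) * (\<integral>\<xi>. (norm (b \<xi>))\<^sup>2 \<partial>lborel))"
  proof -
    have "?c * of_real (sqrt pi ^ DIM('a)) = of_real ((2 * (sqrt pi * sqrt pi)) ^ DIM('a))"
      unfolding power_mult_distrib by simp
    then have c: "?c * of_real (sqrt pi ^ DIM('a)) = of_real ((2 * pi) ^ DIM('a))" by simp
    have "b \<xi> * (?c * (of_real (sqrt pi ^ DIM('a)) * cnj (b \<xi>))) = of_real ((2 * pi) ^ DIM('a) * (norm (b \<xi>))\<^sup>2)" for \<xi>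
      unfolding mult.assoc[symmetric, of ?c] c of_real_mult complex_norm_square by (simp only: mult_ac)
    then show ?thesis by (simp only: integral_complex_of_real integral_mult_right_zero)
  qed
  ultimately have "(\<lambda>k. complex_of_real (\<integral>x. (norm (B x))\<^sup>2 * exp (- ((d k)\<^sup>2 * (norm x)\<^sup>2)) \<partial>lborel))
      \<longlonglongrightarrow> of_real ((2 * pi) ^ DIM('a) * (\<integral>\<xi>. (norm (b \<xi>))\<^sup>2 \<partial>lborel))"
    by (simp only: outer)
  then have lim: "(\<lambda>k. \<integral>x. (norm (B x))\<^sup>2 * exp (- ((d k)\<^sup>2 * (norm x)\<^sup>2)) \<partial>lborel)
      \<longlonglongrightarrow> (2 * pi) ^ DIM('a) * (\<integral>\<xi>. (norm (b \<xi>))\<^sup>2 \<partial>lborel)"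
    by (rule tendsto_of_real_iff[THEN iffD1])
  \<comment> \<open>The damping increases to 1, so the limit exists in \<open>ennreal\<close>
    without finiteness of the square integral of \<open>B\<close>.\<close>
  have "(\<lambda>k. \<integral>\<^sup>+x. ennreal ((norm (B x))\<^sup>2 * exp (- ((d k)\<^sup>2 * (norm x)\<^sup>2))) \<partial>lborel)
      \<longlonglongrightarrow> (\<integral>\<^sup>+x. ennreal ((norm (B x))\<^sup>2) \<partial>lborel)"
  proof (rule nn_integral_LIMSEQ)
    show "incseq (\<lambda>k x. ennreal ((norm (B x))\<^sup>2 * exp (- ((d k)\<^sup>2 * (norm x)\<^sup>2))))"
      unfolding incseq_def le_fun_def
    proof (intro allI impI ennreal_leI mult_left_mono)
      fix i j :: nat and x :: 'a assume "i \<le> j"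
      then have "d j \<le> d i" by (simp add: d_def)
      then have "(d j)\<^sup>2 \<le> (d i)\<^sup>2" using d(2)[of j] by (intro power_mono) auto
      then show "exp (- ((d i)\<^sup>2 * (norm x)\<^sup>2)) \<le> exp (- ((d j)\<^sup>2 * (norm x)\<^sup>2))"
        by (simp add: mult_right_mono)
    qed simp
    show "(\<lambda>k. ennreal ((norm (B x))\<^sup>2 * exp (- ((d k)\<^sup>2 * (norm x)\<^sup>2)))) \<longlonglongrightarrow> ennreal ((norm (B x))\<^sup>2)" for x
    proof -
      have "(\<lambda>k. (norm (B x))\<^sup>2 * exp (- ((d k)\<^sup>2 * (norm x)\<^sup>2))) \<longlonglongrightarrow> (norm (B x))\<^sup>2 * exp (- (0\<^sup>2 * (norm x)\<^sup>2))"
        by (intro tendsto_intros d)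
      then show ?thesis by (intro tendsto_ennrealI) simp
    qed
  qed (use Bm in measurable)
  moreover have "(\<integral>\<^sup>+x. ennreal ((norm (B x))\<^sup>2 * exp (- ((d k)\<^sup>2 * (norm x)\<^sup>2))) \<partial>lborel)
      = ennreal (\<integral>x. (norm (B x))\<^sup>2 * exp (- ((d k)\<^sup>2 * (norm x)\<^sup>2)) \<partial>lborel)" for k
    by (rule nn_integral_eq_integral[OF outer_int]) auto
  ultimately have "(\<lambda>k. ennreal (\<integral>x. (norm (B x))\<^sup>2 * exp (- ((d k)\<^sup>2 * (norm x)\<^sup>2)) \<partial>lborel))
      \<longlonglongrightarrow> (\<integral>\<^sup>+x. ennreal ((norm (B x))\<^sup>2) \<partial>lborel)" by simp
  with tendsto_ennrealI[OF lim]
  have "(\<integral>\<^sup>+x. ennreal ((norm (B x))\<^sup>2) \<partial>lborel) = ennreal ((2 * pi) ^ DIM('a) * (\<integral>\<xi>. (norm (b \<xi>))\<^sup>2 \<partial>lborel))"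
    by (rule LIMSEQ_unique[symmetric])
  also have "\<dots> = ennreal ((2 * pi) ^ DIM('a)) * (\<integral>\<^sup>+\<xi>. ennreal ((norm (b \<xi>))\<^sup>2) \<partial>lborel)"
    by (subst nn_integral_eq_integral[OF ib2]) (auto simp: ennreal_mult)
  finally show ?thesis unfolding B_def .
qed

section \<open>Decay of Fourier transforms\<close>

lemma integrable_inverse_one_plus_square: "integrable lborel (\<lambda>x::real. 1 / (1 + x\<^sup>2))"
  using integrable_inverse_1_plus_square
  by (simp add: set_integrable_def inverse_eq_divide)

text \<open>Each of the DIM('a) factors 1 + (x . b)^2 is at most 1 + |x|^2, so a product of
  integrable one-dimensional weights is a majorant. This crude comparison explains the
  exponent.\<close>

lemma integrable_polynomial_weight:
  assumes k: "k \<ge> DIM('a::euclidean_space)"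
  shows "integrable lborel (\<lambda>x::'a. 1 / (1 + (norm x)\<^sup>2) ^ k)"
proof (rule Bochner_Integration.integrable_bound)
  show "integrable lborel (\<lambda>x::'a. \<Prod>b\<in>Basis. 1 / (1 + (x \<bullet> b)\<^sup>2))"
    by (rule integrable_lborel_prod_Basis) (rule integrable_inverse_one_plus_square)
  show "AE x::'a in lborel. norm (1 / (1 + (norm x)\<^sup>2) ^ k) \<le> norm (\<Prod>b\<in>Basis. 1 / (1 + (x \<bullet> b)\<^sup>2))"
  proof (rule AE_I2)
    fix x :: 'a
    have "(\<Prod>b\<in>(Basis::'a set). 1 + (x \<bullet> b)\<^sup>2) \<le> (\<Prod>b\<in>(Basis::'a set). 1 + (norm x)\<^sup>2)"
    proof (rule prod_mono)
      fix b :: 'a assume "b \<in> Basis"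
      then have "\<bar>x \<bullet> b\<bar> \<le> norm x" by (rule Basis_le_norm)
      then have "(x \<bullet> b)\<^sup>2 \<le> (norm x)\<^sup>2" by (metis abs_ge_zero power2_abs power_mono)
      then show "0 \<le> 1 + (x \<bullet> b)\<^sup>2 \<and> 1 + (x \<bullet> b)\<^sup>2 \<le> 1 + (norm x)\<^sup>2" by simp
    qed
    also have "\<dots> = (1 + (norm x)\<^sup>2) ^ DIM('a)" by simp
    also have "\<dots> \<le> (1 + (norm x)\<^sup>2) ^ k" using k by (intro power_increasing) auto
    finally have le: "(\<Prod>b\<in>(Basis::'a set). 1 + (x \<bullet> b)\<^sup>2) \<le> (1 + (norm x)\<^sup>2) ^ k" .
    have pos: "0 < (\<Prod>b\<in>(Basis::'a set). 1 + (x \<bullet> b)\<^sup>2)"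
      by (intro prod_pos) (auto simp: add_pos_nonneg)
    have "1 / (1 + (norm x)\<^sup>2) ^ k \<le> 1 / (\<Prod>b\<in>(Basis::'a set). 1 + (x \<bullet> b)\<^sup>2)"
      using le pos by (intro divide_left_mono mult_pos_pos) (auto intro: order_less_le_trans)
    also have "\<dots> = (\<Prod>b\<in>(Basis::'a set). 1 / (1 + (x \<bullet> b)\<^sup>2))" by (simp add: prod_dividef)
    finally show "norm (1 / (1 + (norm x)\<^sup>2) ^ k) \<le> norm (\<Prod>b\<in>Basis. 1 / (1 + (x \<bullet> b)\<^sup>2))"
      by (simp add: prod_nonneg)
  qed
qed (auto intro!: borel_measurable_continuous_onI continuous_intros simp: add_nonneg_eq_0_iff)

text \<open>Fourier transform in space, two-sided Laplace transform in the last variable. The strip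
  0 \<le> Re p \<le> 1 joins the region where Gaussian averages converge to the imaginary axis,
  where it is the full Fourier transform.\<close>

definition fourier_laplace :: "('e::euclidean_space \<times> real \<Rightarrow> complex) \<Rightarrow> 'e \<Rightarrow> complex \<Rightarrow> complex" where
  "fourier_laplace g \<xi> p = (\<integral>x. g x * (exp (- p * of_real (snd x)) * cis (- (fst x \<bullet> \<xi>))) \<partial>lborel)"

lemma fourier_eq_fourier_laplace: "fourier g (\<xi>, \<sigma>) = fourier_laplace g \<xi> (\<i> * of_real \<sigma>)"
proof -
  have "cis (- ((\<xi>, \<sigma>) \<bullet> x)) = exp (- (\<i> * of_real \<sigma>) * of_real (snd x)) * cis (- (fst x \<bullet> \<xi>))" for x
    by (cases x) (simp add: cis_conv_exp exp_add[symmetric] inner_commute, rule arg_cong[of _ _ exp], simp add: algebra_simps)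
  then show ?thesis by (simp add: fourier_def fourier_laplace_def)
qed

lemma fourier_laplace_dominated:
  fixes g :: "'e::euclidean_space \<times> real \<Rightarrow> complex"
  assumes g: "compact_smooth g"
  obtains w where "integrable lborel w" "\<And>x. 0 \<le> w x"
    "\<And>p \<xi> x. 0 \<le> Re p \<Longrightarrow> Re p \<le> 1 \<Longrightarrow> norm (g x * (exp (- p * of_real (snd x)) * cis (- (fst x \<bullet> \<xi>)))) \<le> w x"
proof -
  obtain C R where CR: "C > 0" "R > 0" "\<And>x. norm (g x) \<le> C * indicator (cball 0 R) x"
    using compact_smooth_boundE[OF g] by metis
  show thesis
  \<comment> \<open>On the support |snd x| \<le> R, and Re p \<le> 1, so the exponential is at most
    \<open>exp R\<close>.\<close>
  proof (rule that[of "\<lambda>x. C * exp R * indicator (cball 0 R) x"])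
    have "emeasure lborel (cball (0::'e \<times> real) R) < \<infinity>" by (rule emeasure_lborel_cball_finite)
    then show "integrable lborel (\<lambda>x. C * exp R * indicat_real (cball (0::'e \<times> real) R) x)"
      by (intro integrable_mult_right integrable_real_indicator) auto
    show "norm (g x * (exp (- p * of_real (snd x)) * cis (- (fst x \<bullet> \<xi>)))) \<le> C * exp R * indicator (cball 0 R) x"
      if p: "0 \<le> Re p" "Re p \<le> 1" for p \<xi> x
    proof (cases "norm x \<le> R")
      case True
      have "\<bar>snd x\<bar> \<le> R" using norm_snd_le[of "snd x" "fst x"] True by simp
      then have "- (Re p * snd x) \<le> R"
        using mult_mono[of "Re p" 1 "\<bar>snd x\<bar>" R] p CR(2) abs_mult[of "Re p" "snd x"] by auto
      then have "exp (- (Re p * snd x)) \<le> exp R" by simp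
      moreover have "norm (g x) \<le> C" using CR(3)[of x] True by simp
      ultimately show ?thesis using True CR(1) by (auto simp: norm_mult intro!: mult_mono)
    next
      case False
      then have "g x = 0" using CR(3)[of x] by simp
      then show ?thesis using CR by simp
    qed
  qed (use CR in \<open>auto simp: indicator_def\<close>)
qed

lemma
  fixes g :: "'e::euclidean_space \<times> real \<Rightarrow> complex"
  assumes g: "compact_smooth g"
  shows fourier_laplace_bounded: "\<exists>C. \<forall>\<xi> p. 0 \<le> Re p \<longrightarrow> Re p \<le> 1 \<longrightarrow> norm (fourier_laplace g \<xi> p) \<le> C"
    and fourier_laplace_integrable: "integrable lborel (\<lambda>x. g x * (exp (- p * of_real (snd x)) * cis (- (fst x \<bullet> \<xi>))))"
    and continuous_on_fourier_laplace: "continuous_on (UNIV \<times> {p. 0 \<le> Re p \<and> Re p \<le> 1}) (\<lambda>z. fourier_laplace g (fst z) (snd z))"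
proof -
  obtain w where w: "integrable lborel w" "\<And>x. 0 \<le> w x"
    "\<And>p \<xi> x. 0 \<le> Re p \<Longrightarrow> Re p \<le> 1 \<Longrightarrow> norm (g x * (exp (- p * of_real (snd x)) * cis (- (fst x \<bullet> \<xi>)))) \<le> w x"
    using fourier_laplace_dominated[OF g] by blast
  have gc: "continuous_on UNIV g" by (intro smooth_continuous compact_smooth_smooth g)
  have c: "continuous_on UNIV (\<lambda>x. g x * (exp (- p * of_real (snd x)) * cis (- (fst x \<bullet> \<xi>))))" for p \<xi>
    by (intro continuous_intros continuous_on_cis gc)
  obtain R where R: "\<And>x. norm x > R \<Longrightarrow> g x = 0" using compact_smooth_supportE[OF g] by blast
  show i: "integrable lborel (\<lambda>x. g x * (exp (- p * of_real (snd x)) * cis (- (fst x \<bullet> \<xi>))))" for p \<xi>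
    by (rule integrable_continuous_bounded_support[OF c, of R]) (simp add: R)
  show "\<exists>C. \<forall>\<xi> p. 0 \<le> Re p \<longrightarrow> Re p \<le> 1 \<longrightarrow> norm (fourier_laplace g \<xi> p) \<le> C"
    unfolding fourier_laplace_def
    by (intro exI[of _ "integral\<^sup>L lborel w"] allI impI norm_lebesgue_integral_le i w)
  show "continuous_on (UNIV \<times> {p. 0 \<le> Re p \<and> Re p \<le> 1}) (\<lambda>z. fourier_laplace g (fst z) (snd z))"
    unfolding fourier_laplace_def
  proof (rule continuous_on_integral_dominated)
    show "\<exists>w d. 0 < d \<and> integrable lborel w \<and> (\<forall>z\<in>UNIV \<times> {p. 0 \<le> Re p \<and> Re p \<le> 1}. dist z z0 < d \<longrightarrow>
        (\<forall>x\<in>space lborel. norm (g x * (exp (- snd z * of_real (snd x)) * cis (- (fst x \<bullet> fst z)))) \<le> w x))" for z0 :: "'e \<times> complex"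
      by (intro exI[of _ w] exI[of _ 1]) (use w in auto)
    show "(\<lambda>x. g x * (exp (- snd z * of_real (snd x)) * cis (- (fst x \<bullet> fst z)))) \<in> borel_measurable lborel" for z :: "'e \<times> complex"
      using borel_measurable_continuous_onI[OF c] by simp
    show "continuous_on (UNIV \<times> {p. 0 \<le> Re p \<and> Re p \<le> 1})
        (\<lambda>z. g x * (exp (- snd z * of_real (snd x)) * cis (- (fst x \<bullet> fst z))))" for x
      by (intro continuous_intros continuous_on_cis)
  qed
qed

text \<open>The kernel is an exponential, so its directional derivative is a constant multiple of
  it; the derivative of the product \<open>g x * K x\<close> integrates to zero.\<close>

lemma fourier_laplace_derivative:
  fixes g :: "'e::euclidean_space \<times> real \<Rightarrow> complex"
  assumes g: "compact_smooth g" and v: "v \<in> Basis"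
  shows "fourier_laplace (pdir v g) \<xi> p = (p * of_real (snd v) + \<i> * of_real (fst v \<bullet> \<xi>)) * fourier_laplace g \<xi> p"
proof -
  define K where "K x = exp (- p * of_real (snd x)) * cis (- (fst x \<bullet> \<xi>))" for x :: "'e \<times> real"
  let ?c = "p * of_real (snd v) + \<i> * of_real (fst v \<bullet> \<xi>)"
  have Kc: "continuous_on UNIV K" unfolding K_def by (intro continuous_intros continuous_on_cis)
  have gc: "continuous_on UNIV g" by (intro smooth_continuous compact_smooth_smooth g)
  have gc': "continuous_on UNIV (pdir v g)" by (intro smooth_continuous compact_smooth_smooth compact_smooth_pdir g v)
  obtain R where R: "\<And>x. norm x > R \<Longrightarrow> g x = 0" using compact_smooth_supportE[OF g] by blast
  have K: "K x = exp (- (p * of_real (snd x) + \<i> * of_real (fst x \<bullet> \<xi>)))" for x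
    by (simp add: K_def cis_conv_exp exp_add[symmetric])
  have Kd: "((\<lambda>s. K (x + s *\<^sub>R v)) has_vector_derivative - ?c * K x) (at 0)" for x
  proof -
    have "((\<lambda>s. exp (- (p * of_real (snd x) + \<i> * of_real (fst x \<bullet> \<xi>)) + s * (- ?c))) has_field_derivative
        - ?c * exp (- (p * of_real (snd x) + \<i> * of_real (fst x \<bullet> \<xi>)))) (at (of_real 0))"
      by (auto intro!: derivative_eq_intros)
    from has_vector_derivative_real_field[OF this]
    show ?thesis unfolding K by (simp add: algebra_simps)
  qed
  have "(\<integral>x. g x * (- ?c * K x) + pdir v g x * K x \<partial>lborel) = 0"
  proof (rule integral_directional_derivative_eq_0[where f="\<lambda>x. g x * K x" and R=R and e=v])
    show "((\<lambda>s. g (x + s *\<^sub>R v) * K (x + s *\<^sub>R v)) has_vector_derivative g x * (- ?c * K x) + pdir v g x * K x) (at 0)" for x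
      using has_vector_derivative_mult[OF has_pdir_at_0[OF compact_smooth_smooth[OF g] v] Kd, of x x] by simp
    show "g x * (- ?c * K x) + pdir v g x * K x = 0" if "norm x > R" for x
      using R pdir_eq_0_outside[of R g x v] that by simp
  qed (auto intro!: continuous_intros gc gc' Kc simp: R)
  moreover have "(\<integral>x. g x * (- ?c * K x) + pdir v g x * K x \<partial>lborel) = - ?c * fourier_laplace g \<xi> p + fourier_laplace (pdir v g) \<xi> p"
  proof -
    have i: "integrable lborel (\<lambda>x. g x * K x)" "integrable lborel (\<lambda>x. pdir v g x * K x)"
      unfolding K_def by (intro fourier_laplace_integrable compact_smooth_pdir g v)+
    have "(\<integral>x. g x * (c * K x) + pdir v g x * K x \<partial>lborel)
        = c * (\<integral>x. g x * K x \<partial>lborel) + (\<integral>x. pdir v g x * K x \<partial>lborel)" for c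
      unfolding mult.left_commute[of _ c]
      by (subst Bochner_Integration.integral_add) (use i in \<open>simp_all only: integral_mult_right_zero integrable_mult_right\<close>)
    from this[of "- ?c"] show ?thesis by (simp only: fourier_laplace_def K_def)
  qed
  ultimately show ?thesis by (simp add: algebra_simps add_eq_0_iff)
qed

text \<open>Two derivatives in each coordinate direction produce the factors (\<xi> . b)^2 and
  |p|^2. Together with 1 they add up to the weight, so each induction step gains one power,
  uniformly in the strip.\<close>

lemma fourier_laplace_decay:
  fixes g :: "'e::euclidean_space \<times> real \<Rightarrow> complex"
  assumes g: "compact_smooth g"
  shows "\<exists>C. \<forall>\<xi> p. 0 \<le> Re p \<longrightarrow> Re p \<le> 1 \<longrightarrow>
    (1 + (norm \<xi>)\<^sup>2 + (norm p)\<^sup>2) ^ N * norm (fourier_laplace g \<xi> p) \<le> C"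
  using g
proof (induction N arbitrary: g)
  case 0
  then show ?case using fourier_laplace_bounded by auto
next
  case (Suc N)
  have bt: "(0::'e, 1::real) \<in> Basis" and be: "\<And>b. b \<in> Basis \<Longrightarrow> (b::'e, 0::real) \<in> Basis"
    by (auto simp: Basis_prod_def)
  let ?W = "\<lambda>\<xi> p. 1 + (norm (\<xi>::'e))\<^sup>2 + (norm (p::complex))\<^sup>2"
  have "\<exists>C. \<forall>\<xi> p. 0 \<le> Re p \<longrightarrow> Re p \<le> 1 \<longrightarrow>
      ?W \<xi> p ^ N * norm (fourier_laplace (pdir (b,0) (pdir (b,0) g)) \<xi> p) \<le> C" if "b \<in> Basis" for b :: 'e
    using Suc.IH[OF compact_smooth_pdir[OF compact_smooth_pdir[OF Suc.prems be[OF that]] be[OF that]]] .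
  then obtain Cb where Cb: "\<And>b \<xi> p. b \<in> Basis \<Longrightarrow> 0 \<le> Re p \<Longrightarrow> Re p \<le> 1 \<Longrightarrow>
      ?W \<xi> p ^ N * norm (fourier_laplace (pdir (b,0) (pdir (b,0) g)) \<xi> p) \<le> Cb b" by metis
  obtain Ct where Ct: "\<And>\<xi> p. 0 \<le> Re p \<Longrightarrow> Re p \<le> 1 \<Longrightarrow>
      ?W \<xi> p ^ N * norm (fourier_laplace (pdir (0,1) (pdir (0,1) g)) \<xi> p) \<le> Ct"
    using Suc.IH[OF compact_smooth_pdir[OF compact_smooth_pdir[OF Suc.prems bt] bt]] by blast
  obtain C0 where C0: "\<And>\<xi> p. 0 \<le> Re p \<Longrightarrow> Re p \<le> 1 \<Longrightarrow> ?W \<xi> p ^ N * norm (fourier_laplace g \<xi> p) \<le> C0"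
    using Suc.IH[OF Suc.prems] by blast
  show ?case
  proof (intro exI[of _ "C0 + (\<Sum>b\<in>(Basis::'e set). Cb b) + Ct"] allI impI)
    fix \<xi> :: 'e and p assume p: "0 \<le> Re p" "Re p \<le> 1"
    let ?L = "norm (fourier_laplace g \<xi> p)"
    have e: "norm (fourier_laplace (pdir (b,0) (pdir (b,0) g)) \<xi> p) = (\<xi> \<bullet> b)\<^sup>2 * ?L" if "b \<in> Basis" for b
      by (simp add: fourier_laplace_derivative be that compact_smooth_pdir Suc.prems norm_mult power2_eq_square
          inner_commute abs_mult_self_eq mult.assoc[symmetric])
    have t: "norm (fourier_laplace (pdir (0,1) (pdir (0,1) g)) \<xi> p) = (norm p)\<^sup>2 * ?L"
      by (simp add: fourier_laplace_derivative bt compact_smooth_pdir Suc.prems norm_mult power2_eq_square mult.assoc)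
    have n: "(norm \<xi>)\<^sup>2 = (\<Sum>b\<in>Basis. (\<xi> \<bullet> b)\<^sup>2)"
      by (subst power2_norm_eq_inner, subst euclidean_inner) (simp add: power2_eq_square)
    have "?W \<xi> p ^ Suc N * ?L = ?W \<xi> p ^ N * ?L + (\<Sum>b\<in>Basis. ?W \<xi> p ^ N * ((\<xi> \<bullet> b)\<^sup>2 * ?L)) + ?W \<xi> p ^ N * ((norm p)\<^sup>2 * ?L)"
      by (simp add: sum_distrib_left[symmetric] sum_distrib_right[symmetric] n[symmetric]) (simp add: algebra_simps)
    also have "\<dots> \<le> C0 + (\<Sum>b\<in>Basis. Cb b) + Ct"
      using C0[OF p] Cb[OF _ p] Ct[OF p] by (intro add_mono sum_mono) (auto simp: e[symmetric] t[symmetric])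
    finally show "?W \<xi> p ^ Suc N * ?L \<le> C0 + (\<Sum>b\<in>Basis. Cb b) + Ct" .
  qed
qed

text \<open>Size and measurability without smoothness: the class has to survive multiplication by
  unimodular factors that are neither smooth nor continuous.\<close>

definition rapidly_decreasing :: "('a::euclidean_space \<Rightarrow> complex) \<Rightarrow> bool" where
  "rapidly_decreasing a \<longleftrightarrow> a \<in> borel_measurable borel \<and> (\<forall>N. \<exists>C. \<forall>\<xi>. (1 + (norm \<xi>)\<^sup>2) ^ N * norm (a \<xi>) \<le> C)"

lemma rapidly_decreasing_integrable_weight:
  fixes a :: "'a::euclidean_space \<Rightarrow> complex"
  assumes a: "rapidly_decreasing a"
  shows "integrable lborel (\<lambda>\<xi>. (1 + (norm \<xi>)\<^sup>2) ^ N * norm (a \<xi>))"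
proof -
  have [measurable]: "a \<in> borel_measurable borel" using a by (simp add: rapidly_decreasing_def)
  obtain C where C: "\<And>\<xi>. (1 + (norm \<xi>)\<^sup>2) ^ (N + DIM('a)) * norm (a \<xi>) \<le> C"
    using a unfolding rapidly_decreasing_def by blast
  show ?thesis
  proof (rule Bochner_Integration.integrable_bound)
    show "integrable lborel (\<lambda>\<xi>::'a. C * (1 / (1 + (norm \<xi>)\<^sup>2) ^ DIM('a)))"
      by (intro integrable_mult_right integrable_polynomial_weight order_refl)
    show "AE \<xi> in lborel. norm ((1 + (norm \<xi>)\<^sup>2) ^ N * norm (a \<xi>)) \<le> norm (C * (1 / (1 + (norm \<xi>)\<^sup>2) ^ DIM('a)))"
    proof (rule AE_I2)
      fix \<xi> :: 'a
      have pos: "0 < (1 + (norm \<xi>)\<^sup>2) ^ DIM('a)" by (simp add: add_pos_nonneg)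
      have "(1 + (norm \<xi>)\<^sup>2) ^ N * norm (a \<xi>) \<le> C * (1 / (1 + (norm \<xi>)\<^sup>2) ^ DIM('a))"
        using C[of \<xi>] pos by (simp add: power_add field_simps)
      moreover have nn: "0 \<le> (1 + (norm \<xi>)\<^sup>2) ^ N * norm (a \<xi>)" by simp
      ultimately show "norm ((1 + (norm \<xi>)\<^sup>2) ^ N * norm (a \<xi>)) \<le> norm (C * (1 / (1 + (norm \<xi>)\<^sup>2) ^ DIM('a)))"
        unfolding real_norm_def abs_of_nonneg[OF nn] by (meson abs_ge_self order_trans)
    qed
  qed measurable
qed

lemma rapidly_decreasing_integrable: "rapidly_decreasing a \<Longrightarrow> integrable lborel a"
  using rapidly_decreasing_integrable_weight[of a 0]
  by (auto simp: rapidly_decreasing_def integrable_norm_iff)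

lemma rapidly_decreasing_mult:
  fixes a :: "'a::euclidean_space \<Rightarrow> complex"
  assumes a: "rapidly_decreasing a" and h: "h \<in> borel_measurable borel" and K: "\<And>\<xi>. norm (h \<xi>) \<le> K * (1 + (norm \<xi>)\<^sup>2)"
  shows "rapidly_decreasing (\<lambda>\<xi>. h \<xi> * a \<xi>)"
  unfolding rapidly_decreasing_def
proof (intro conjI allI)
  show "(\<lambda>\<xi>. h \<xi> * a \<xi>) \<in> borel_measurable borel"
    using a h by (auto simp: rapidly_decreasing_def)
  fix N
  obtain C where C: "\<And>\<xi>. (1 + (norm \<xi>)\<^sup>2) ^ Suc N * norm (a \<xi>) \<le> C"
    using a unfolding rapidly_decreasing_def by blast
  have "norm (h 0) \<le> K" using K[of 0] by simp
  then have K0: "0 \<le> K" using norm_ge_zero order_trans by blast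
  show "\<exists>C. \<forall>\<xi>. (1 + (norm \<xi>)\<^sup>2) ^ N * norm (h \<xi> * a \<xi>) \<le> C"
  proof (intro exI[of _ "K * C"] allI)
    fix \<xi> :: 'a
    have "(1 + (norm \<xi>)\<^sup>2) ^ N * norm (h \<xi> * a \<xi>) \<le> (1 + (norm \<xi>)\<^sup>2) ^ N * ((K * (1 + (norm \<xi>)\<^sup>2)) * norm (a \<xi>))"
      unfolding norm_mult by (intro mult_left_mono mult_right_mono K) auto
    also have "\<dots> = K * ((1 + (norm \<xi>)\<^sup>2) ^ Suc N * norm (a \<xi>))" by (simp add: mult_ac)
    also have "\<dots> \<le> K * C" by (intro mult_left_mono C K0)
    finally show "(1 + (norm \<xi>)\<^sup>2) ^ N * norm (h \<xi> * a \<xi>) \<le> K * C" .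
  qed
qed

lemma continuous_on_fourier_integral:
  fixes b :: "'a::euclidean_space \<Rightarrow> complex" and \<theta> :: "'a \<Rightarrow> 'p::euclidean_space"
  assumes b: "integrable lborel b" and \<theta>: "continuous_on UNIV \<theta>"
  shows "continuous_on UNIV (\<lambda>x. \<integral>\<xi>. b \<xi> * cis (x \<bullet> \<theta> \<xi>) \<partial>lborel)"
proof (rule continuous_on_integral_dominated)
  show "\<exists>w d. 0 < d \<and> integrable lborel w \<and> (\<forall>p\<in>UNIV. dist p p0 < d \<longrightarrow> (\<forall>x\<in>space lborel. norm (b x * cis (p \<bullet> \<theta> x)) \<le> w x))" for p0
    by (intro exI[of _ "\<lambda>x. norm (b x)"] exI[of _ 1]) (use b in \<open>auto simp: norm_mult\<close>)
qed (use b \<theta> in \<open>auto intro!: continuous_intros continuous_on_cis borel_measurable_times measurable_cis_continuous\<close>)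

lemma fourier_eq_uminus: "fourier \<phi> x = (\<integral>\<xi>. \<phi> \<xi> * cis ((- x) \<bullet> \<xi>) \<partial>lborel)"
  by (simp add: fourier_def)

lemma continuous_on_fourier:
  assumes "integrable lborel \<phi>"
  shows "continuous_on UNIV (fourier \<phi>)"
  unfolding fourier_eq_uminus[abs_def]
  by (rule continuous_on_compose2[OF continuous_on_fourier_integral[OF assms continuous_on_id]])
     (auto intro!: continuous_intros)

lemma rapidly_decreasing_fourier:
  fixes \<phi> :: "'e::euclidean_space \<times> real \<Rightarrow> complex"
  assumes \<phi>: "compact_smooth \<phi>"
  shows "rapidly_decreasing (fourier \<phi>)"
  unfolding rapidly_decreasing_def
proof (intro conjI allI)
  show "fourier \<phi> \<in> borel_measurable borel"
    by (intro borel_measurable_continuous_onI continuous_on_fourier compact_smooth_integrable \<phi>)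
  fix N
  obtain C where C: "\<And>\<xi> p. 0 \<le> Re p \<Longrightarrow> Re p \<le> 1 \<Longrightarrow>
      (1 + (norm \<xi>)\<^sup>2 + (norm p)\<^sup>2) ^ N * norm (fourier_laplace \<phi> \<xi> p) \<le> C"
    using fourier_laplace_decay[OF \<phi>] by blast
  show "\<exists>C. \<forall>\<xi>. (1 + (norm \<xi>)\<^sup>2) ^ N * norm (fourier \<phi> \<xi>) \<le> C"
  proof (intro exI[of _ C] allI)
    fix \<zeta> :: "'e \<times> real"
    obtain \<xi> \<sigma> where \<zeta>: "\<zeta> = (\<xi>, \<sigma>)" by (cases \<zeta>)
    show "(1 + (norm \<zeta>)\<^sup>2) ^ N * norm (fourier \<phi> \<zeta>) \<le> C"
      using C[of "\<i> * of_real \<sigma>" \<xi>]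
      by (simp add: \<zeta> fourier_eq_fourier_laplace norm_prod_def norm_mult add.assoc sum_nonneg)
  qed
qed

lemma fourier_derivative:
  fixes \<phi> :: "'e::euclidean_space \<times> real \<Rightarrow> complex"
  assumes \<phi>: "compact_smooth \<phi>" and v: "v \<in> Basis"
  shows "fourier (pdir v \<phi>) \<zeta> = \<i> * of_real (v \<bullet> \<zeta>) * fourier \<phi> \<zeta>"
  by (cases \<zeta>, cases v) (use fourier_laplace_derivative[OF assms] in
    \<open>simp add: fourier_eq_fourier_laplace algebra_simps\<close>)

lemma fourier_inversion_compact_smooth:
  fixes \<phi> :: "'e::euclidean_space \<times> real \<Rightarrow> complex"
  assumes \<phi>: "compact_smooth \<phi>"
  shows "(\<integral>\<xi>. fourier \<phi> \<xi> * cis (x \<bullet> \<xi>) \<partial>lborel) = of_real ((2 * pi) ^ DIM('e \<times> real)) * \<phi> x"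
proof -
  obtain C where "\<And>x. norm (\<phi> x) \<le> C" using compact_smooth_boundE[OF \<phi>] by metis
  then show ?thesis
    by (intro fourier_inversion compact_smooth_integrable smooth_continuous compact_smooth_smooth \<phi>
        rapidly_decreasing_integrable rapidly_decreasing_fourier)
qed

section \<open>Oscillatory integrals\<close>

text \<open>The phase \<theta> \<xi> = (\<xi>, |\<xi>|) gives the solution of the wave equation and
  \<theta> \<xi> = (fst \<xi>, |\<xi>|) its trace; both share one amplitude.\<close>

definition oscillatory :: "('c::euclidean_space \<Rightarrow> complex) \<Rightarrow> ('c \<Rightarrow> 'p::euclidean_space) \<Rightarrow> 'p \<Rightarrow> complex" where
  "oscillatory a \<theta> x = (\<integral>\<xi>. a \<xi> * cis (x \<bullet> \<theta> \<xi>) \<partial>lborel)"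

lemma oscillatory_integrable:
  assumes "rapidly_decreasing a" "continuous_on UNIV \<theta>"
  shows "integrable lborel (\<lambda>\<xi>. a \<xi> * cis (x \<bullet> \<theta> \<xi>))"
  by (rule integrable_bounded_mult[OF rapidly_decreasing_integrable[OF assms(1)], where C=1])
     (use assms in \<open>auto intro!: measurable_cis_continuous continuous_intros\<close>)

lemma rapidly_decreasing_phase_mult:
  assumes a: "rapidly_decreasing a" and \<theta>: "continuous_on UNIV \<theta>" and K: "\<And>\<xi>. norm (\<theta> \<xi>) \<le> K * (1 + (norm \<xi>)\<^sup>2)"
  shows "rapidly_decreasing (\<lambda>\<xi>. \<i> * of_real (v \<bullet> \<theta> \<xi>) * a \<xi>)"
proof (rule rapidly_decreasing_mult[OF a, where K="norm v * K"])
  show "(\<lambda>\<xi>. \<i> * complex_of_real (v \<bullet> \<theta> \<xi>)) \<in> borel_measurable borel"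
    by (intro borel_measurable_continuous_onI continuous_intros \<theta>)
  show "norm (\<i> * complex_of_real (v \<bullet> \<theta> \<xi>)) \<le> norm v * K * (1 + (norm \<xi>)\<^sup>2)" for \<xi>
  proof -
    have "\<bar>v \<bullet> \<theta> \<xi>\<bar> \<le> norm v * norm (\<theta> \<xi>)" by (rule Cauchy_Schwarz_ineq2)
    also have "\<dots> \<le> norm v * (K * (1 + (norm \<xi>)\<^sup>2))" by (intro mult_left_mono K norm_ge_zero)
    finally show ?thesis by (simp add: norm_mult mult.assoc)
  qed
qed

lemma oscillatory_has_derivative:
  assumes a: "rapidly_decreasing a" and \<theta>: "continuous_on UNIV \<theta>" and K: "\<And>\<xi>. norm (\<theta> \<xi>) \<le> K * (1 + (norm \<xi>)\<^sup>2)"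
  shows "((\<lambda>s. oscillatory a \<theta> (x + s *\<^sub>R v)) has_vector_derivative
    oscillatory (\<lambda>\<xi>. \<i> * of_real (v \<bullet> \<theta> \<xi>) * a \<xi>) \<theta> x) (at 0)"
proof -
  note rap = rapidly_decreasing_phase_mult[OF a \<theta> K, of v]
  have "((\<lambda>s. \<integral>\<xi>. a \<xi> * cis ((x + s *\<^sub>R v) \<bullet> \<theta> \<xi>) \<partial>lborel) has_vector_derivative
    (\<integral>\<xi>. (\<i> * of_real (v \<bullet> \<theta> \<xi>) * a \<xi>) * cis ((x + 0 *\<^sub>R v) \<bullet> \<theta> \<xi>) \<partial>lborel)) (at 0)"
  proof (rule has_vector_derivative_integral[where d=1 and w="\<lambda>\<xi>. norm (\<i> * of_real (v \<bullet> \<theta> \<xi>) * a \<xi>)"])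
    fix s \<xi>
    have "((\<lambda>s. a \<xi> * cis (x \<bullet> \<theta> \<xi>) * cis ((v \<bullet> \<theta> \<xi>) * s)) has_vector_derivative
        a \<xi> * cis (x \<bullet> \<theta> \<xi>) * (\<i> * of_real (v \<bullet> \<theta> \<xi>) * cis ((v \<bullet> \<theta> \<xi>) * s))) (at s)"
      by (intro has_vector_derivative_mult_right has_vector_derivative_cis)
    then show "((\<lambda>s. a \<xi> * cis ((x + s *\<^sub>R v) \<bullet> \<theta> \<xi>)) has_vector_derivative
        (\<i> * of_real (v \<bullet> \<theta> \<xi>) * a \<xi>) * cis ((x + s *\<^sub>R v) \<bullet> \<theta> \<xi>)) (at s)"
      by (simp add: inner_add_left mult_ac cis_mult[symmetric])
    show "integrable lborel (\<lambda>\<xi>. a \<xi> * cis ((x + s *\<^sub>R v) \<bullet> \<theta> \<xi>))"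
      by (rule oscillatory_integrable[OF a \<theta>])
    show "(\<lambda>\<xi>. (\<i> * of_real (v \<bullet> \<theta> \<xi>) * a \<xi>) * cis ((x + 0 *\<^sub>R v) \<bullet> \<theta> \<xi>)) \<in> borel_measurable lborel"
      by (rule borel_measurable_integrable[OF oscillatory_integrable[OF rap \<theta>]])
    show "integrable lborel (\<lambda>\<xi>. norm (\<i> * of_real (v \<bullet> \<theta> \<xi>) * a \<xi>))"
      by (intro integrable_norm rapidly_decreasing_integrable rap)
  qed (auto simp: norm_mult)
  then show ?thesis by (simp add: oscillatory_def)
qed

text \<open>A derivative multiplies the amplitude by a linear function of the phase, which grows at
  most quadratically, so the amplitude stays rapidly decreasing. Continuity of \<theta> suffices,
  which matters because |\<xi>| has a corner at 0.\<close>

lemma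
  assumes a: "rapidly_decreasing a" and \<theta>: "continuous_on UNIV \<theta>" and K: "\<And>\<xi>. norm (\<theta> \<xi>) \<le> K * (1 + (norm \<xi>)\<^sup>2)"
  shows smooth_oscillatory: "smooth (oscillatory a \<theta>)"
    and pdir_oscillatory: "pdir v (oscillatory a \<theta>) = oscillatory (\<lambda>\<xi>. \<i> * of_real (v \<bullet> \<theta> \<xi>) * a \<xi>) \<theta>"
proof -
  show "pdir v (oscillatory a \<theta>) = oscillatory (\<lambda>\<xi>. \<i> * of_real (v \<bullet> \<theta> \<xi>) * a \<xi>) \<theta>"
    using oscillatory_has_derivative[OF a \<theta> K] by (auto intro!: pdir_eqI)
  show "smooth (oscillatory a \<theta>)"
  proof (rule smooth_coinduct[where P="\<lambda>h. \<exists>a. rapidly_decreasing a \<and> h = oscillatory a \<theta>"])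
    fix h assume "\<exists>a. rapidly_decreasing a \<and> h = oscillatory a \<theta>"
    then obtain a where a: "rapidly_decreasing a" and h: "h = oscillatory a \<theta>" by blast
    have "continuous_on UNIV h" unfolding h oscillatory_def
      by (rule continuous_on_fourier_integral[OF rapidly_decreasing_integrable[OF a] \<theta>])
    moreover have "\<exists>f'. (\<exists>a. rapidly_decreasing a \<and> f' = oscillatory a \<theta>) \<and>
        (\<forall>x. ((\<lambda>s. h (x + s *\<^sub>R v)) has_vector_derivative f' x) (at 0))" for v
      unfolding h using oscillatory_has_derivative[OF a \<theta> K] rapidly_decreasing_phase_mult[OF a \<theta> K] by blast
    ultimately show "continuous_on UNIV h \<and> (\<forall>v\<in>Basis. \<exists>f'. (\<exists>a. rapidly_decreasing a \<and> f' = oscillatory a \<theta>) \<and>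
        (\<forall>x. ((\<lambda>s. h (x + s *\<^sub>R v)) has_vector_derivative f' x) (at 0)))" by blast
  qed (use a in blast)
qed

section \<open>The Cauchy problem for the wave equation\<close>

lemma Basis_time: "(0::'e::euclidean_space, 1::real) \<in> Basis"
  and Basis_space: "b \<in> Basis \<Longrightarrow> (b::'e::euclidean_space, 0::real) \<in> Basis"
  by (auto simp: Basis_prod_def)

text \<open>The factor \<kappa> is used with the values 1 and -1: it handles both time directions
  and the reflection t \<mapsto> - t.\<close>

lemma time_derivative:
  fixes g :: "'e::euclidean_space \<times> real \<Rightarrow> real"
  assumes "smooth g"
  shows "((\<lambda>t. g (x, \<kappa> * t)) has_real_derivative \<kappa> * pdir (0, 1) g (x, \<kappa> * t)) (at t)"
proof -
  have "((\<lambda>s. g ((x, 0) + s *\<^sub>R (0, 1))) has_real_derivative pdir (0, 1) g ((x, 0) + (\<kappa> * t) *\<^sub>R (0, 1))) (at (\<kappa> * t))"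
    using has_pdir[OF assms Basis_time, of "(x, 0)" "\<kappa> * t"] by (simp add: has_real_derivative_iff_has_vector_derivative)
  moreover have "((\<lambda>t. \<kappa> * t) has_real_derivative \<kappa>) (at t)" by (auto intro!: derivative_eq_intros)
  ultimately have "((\<lambda>t. g ((x, 0) + (\<kappa> * t) *\<^sub>R (0, 1))) has_real_derivative pdir (0, 1) g ((x, 0) + (\<kappa> * t) *\<^sub>R (0, 1)) * \<kappa>) (at t)"
    by (rule DERIV_chain2)
  then show ?thesis by (simp add: mult.commute)
qed

lemma space_derivative:
  fixes g :: "'e::euclidean_space \<times> real \<Rightarrow> real"
  assumes "smooth g" "e \<in> Basis"
  shows "((\<lambda>s. g (x + s *\<^sub>R e, t)) has_real_derivative pdir (e, 0) g (x, t)) (at 0)"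
  using has_pdir_at_0[OF assms(1) Basis_space[OF assms(2)], of "(x, t)"]
  by (simp add: has_real_derivative_iff_has_vector_derivative)

text \<open>Squaring makes the cut-off differentiable at the edge of the cone, so that the weight
  can be differentiated in time and in space.\<close>

lemma DERIV_max_0_square: "((\<lambda>s::real. (max 0 s)\<^sup>2) has_real_derivative 2 * max 0 s) (at s)"
proof (cases "s = 0")
  case True
  have "((\<lambda>h::real. (max 0 h)\<^sup>2 / h) \<longlongrightarrow> 0) (at 0)"
  proof (rule tendsto_0_le[where K=1])
    show "((\<lambda>h::real. h) \<longlongrightarrow> 0) (at 0)" by (rule tendsto_ident_at)
    show "\<forall>\<^sub>F h::real in at 0. norm ((max 0 h)\<^sup>2 / h) \<le> norm h * 1"
      by (intro always_eventually allI) (auto simp: max_def power2_eq_square)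
  qed
  then show ?thesis using True by (simp add: DERIV_def)
next
  case False
  show ?thesis
  proof (cases "s > 0")
    case True
    show ?thesis
      by (rule has_field_derivative_transform_within_open[of "\<lambda>s. s\<^sup>2" _ _ "{0<..}"])
        (use True in \<open>auto intro!: derivative_eq_intros simp: max_def\<close>)
  next
    case F: False
    show ?thesis
      by (rule has_field_derivative_transform_within_open[of "\<lambda>s. 0" _ _ "{..<0}"])
        (use F False in \<open>auto simp: max_def\<close>)
  qed
qed

lemma DERIV_square:
  "(f has_real_derivative D) (at x) \<Longrightarrow> ((\<lambda>x. (f x)\<^sup>2) has_real_derivative 2 * f x * D) (at x)"
  by (auto intro!: derivative_eq_intros)

lemma continuous_nonneg_integral_0_imp_0:
  fixes f :: "'a::euclidean_space \<Rightarrow> real"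
  assumes f: "continuous_on UNIV f" "integrable lborel f" "\<And>x. 0 \<le> f x" and 0: "(\<integral>x. f x \<partial>lborel) = 0"
  shows "f x = 0"
proof (rule ccontr)
  assume "f x \<noteq> 0"
  have "AE y in lborel. f y = 0" using integral_nonneg_eq_0_iff_AE[OF f(2)] f(3) 0 by simp
  have "open {y. f y \<noteq> 0}" by (intro open_Collect_neq f continuous_on_const)
  then obtain e where e: "e > 0" "ball x e \<subseteq> {y. f y \<noteq> 0}"
    using \<open>f x \<noteq> 0\<close> by (auto simp: open_contains_ball)
  have "AE y in lborel. y \<notin> ball x e"
    using \<open>AE y in lborel. f y = 0\<close> by eventually_elim (use e in auto)
  then have "emeasure lborel (ball x e) = 0" by (subst (asm) AE_iff_measurable[where N="ball x e"]) auto
  then have "measure lborel (ball x e) = 0" by (simp add: measure_def)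
  then show False using content_ball_pos[OF e(1), of x] by simp
qed

text \<open>Uniqueness through a weighted energy. The weight \<open>a\<close> is supported in a
  shrinking region r x \<le> \<rho> - t, so the integrals are over bounded sets whatever the growth
  of \<open>w\<close>. As |grad r| \<le> 1, the flux through the edge is absorbed by the loss due to
  the shrinking weight, and the energy cannot grow from its value 0.\<close>

lemma wave_zero_data_imp_zero:
  fixes w :: "'a::euclidean_space \<times> real \<Rightarrow> real"
  assumes w: "smooth w"
    and pde: "\<And>p. pdir (0,1) (pdir (0,1) w) p = (\<Sum>e\<in>Basis. pdir (e,0) (pdir (e,0) w) p)"
    and w0: "\<And>x. w (x, 0) = 0" and w1: "\<And>x. pdir (0,1) w (x, 0) = 0"
    and T: "0 \<le> T" and \<kappa>: "\<kappa> = 1 \<or> \<kappa> = -1"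
  shows "w (x0, \<kappa> * T) = 0"
proof -
  define wt where "wt = pdir (0,1) w"
  define we where "we e = pdir (e,0) w" for e :: 'a
  have swt: "smooth wt" unfolding wt_def by (intro smooth_pdir w Basis_time)
  have swe: "smooth (we e)" if "e \<in> Basis" for e unfolding we_def by (intro smooth_pdir w Basis_space that)
  \<comment> \<open>A smooth substitute for the distance to \<open>x0\<close>; its gradient, with
    components \<open>\<nu> e\<close>, has length at most 1.\<close>
  define r where "r x = sqrt (1 + (norm (x - x0))\<^sup>2)" for x
  \<comment> \<open>Since r x0 = 1, the offset 2 keeps the weight at \<open>x0\<close> positive up
    to time \<open>T\<close>.\<close>
  define \<rho> where "\<rho> = T + 2"
  define a where "a t x = (max 0 (\<rho> - t - r x))\<^sup>2" for t x
  define b where "b t x = 2 * max 0 (\<rho> - t - r x)" for t x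
  define \<nu> where "\<nu> e x = ((x - x0) \<bullet> e) / r x" for e x
  define en where "en t x = (wt (x, \<kappa> * t))\<^sup>2 + (\<Sum>e\<in>Basis. (we e (x, \<kappa> * t))\<^sup>2)" for t x
  define Pe where "Pe e t x = wt (x, \<kappa> * t) * we e (x, \<kappa> * t)" for e t x
  define Pe' where "Pe' e t x = wt (x, \<kappa> * t) * pdir (e,0) (we e) (x, \<kappa> * t) + pdir (e,0) wt (x, \<kappa> * t) * we e (x, \<kappa> * t)" for e t x
  define E where "E t = (\<integral>x. a t x * en t x \<partial>lborel)" for t
  have r1: "1 \<le> r x" "norm (x - x0) \<le> r x" for x
    unfolding r_def by (auto intro: real_le_rsqrt)
  have rpos: "0 < r x" for x using r1(1)[of x] by linarith
  have supp: "a t x = 0 \<and> b t x = 0" if "t \<ge> -1" "norm x > \<rho> + 1 + norm x0" for t x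
  proof -
    have "norm x \<le> norm (x - x0) + norm x0" by (metis diff_add_cancel norm_triangle_ineq)
    then have "\<rho> - t - r x \<le> 0" using r1(2)[of x] that by linarith
    then show ?thesis by (simp add: a_def b_def)
  qed
  have rc: "continuous_on UNIV r" unfolding r_def by (intro continuous_intros)
  have rc2: "continuous_on UNIV (\<lambda>z::real \<times> 'a. r (snd z))"
    by (rule continuous_on_compose2[OF rc]) (auto intro: continuous_intros)
  have cont2: "continuous_on UNIV (\<lambda>z::real \<times> 'a. g (snd z, \<kappa> * fst z))" if "smooth g" for g :: "'a \<times> real \<Rightarrow> real"
    by (rule continuous_on_compose2[OF smooth_continuous[OF that]]) (auto intro!: continuous_intros)
  have cont1: "continuous_on UNIV (\<lambda>x. g (x, \<kappa> * t))" if "smooth g" for g :: "'a \<times> real \<Rightarrow> real" and t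
    by (rule continuous_on_compose2[OF smooth_continuous[OF that]]) (auto intro!: continuous_intros)
  have ac: "continuous_on UNIV (a t)" and bc: "continuous_on UNIV (b t)" for t
    unfolding a_def b_def by (intro continuous_intros rc)+
  have ac2: "continuous_on UNIV (\<lambda>z. a (fst z) (snd z))" and bc2: "continuous_on UNIV (\<lambda>z. b (fst z) (snd z))"
    unfolding a_def b_def by (intro continuous_intros rc2)+
  have \<nu>c: "continuous_on UNIV (\<nu> e)" for e
    unfolding \<nu>_def by (intro continuous_intros rc) (use rpos in \<open>auto simp: less_imp_neq[symmetric]\<close>)
  have Pc: "continuous_on UNIV (Pe e t)" "continuous_on UNIV (Pe' e t)" if "e \<in> Basis" for e t
    unfolding Pe_def Pe'_def by (intro continuous_intros cont1 swt swe smooth_pdir Basis_space that)+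
  have enc: "continuous_on UNIV (en t)" for t
    unfolding en_def by (intro continuous_intros cont1 swt swe) auto
  define D where "D t x = 2 * wt (x, \<kappa> * t) * (\<kappa> * pdir (0,1) wt (x, \<kappa> * t))
      + (\<Sum>e\<in>Basis. 2 * we e (x, \<kappa> * t) * (\<kappa> * pdir (0,1) (we e) (x, \<kappa> * t)))" for t x
  have Dc2: "continuous_on UNIV (\<lambda>z. D (fst z) (snd z))"
    unfolding D_def by (intro continuous_intros cont2 swt swe smooth_pdir Basis_time) auto
  have enc2: "continuous_on UNIV (\<lambda>z. en (fst z) (snd z))"
    unfolding en_def by (intro continuous_intros cont2 swt swe) auto
  \<comment> \<open>The energy density changes by a divergence: the equation replaces the second
    time derivative by second space derivatives, and mixed derivatives commute. Running time in
    direction \<kappa> contributes the sign.\<close>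
  have D_eq: "D t x = 2 * \<kappa> * (\<Sum>e\<in>Basis. Pe' e t x)" for t x
  proof -
    have "pdir (0,1) wt (x, \<kappa> * t) = (\<Sum>e\<in>Basis. pdir (e,0) (we e) (x, \<kappa> * t))"
      using pde by (simp add: wt_def we_def)
    moreover have "pdir (0,1) (we e) (x, \<kappa> * t) = pdir (e,0) wt (x, \<kappa> * t)" if "e \<in> Basis" for e
      unfolding we_def wt_def by (rule pdir_commute[OF w Basis_time Basis_space[OF that]])
    ultimately show ?thesis
      by (simp add: D_def Pe'_def sum.distrib sum_distrib_left algebra_simps)
  qed
  define E' where "E' t x = - b t x * en t x + a t x * D t x" for t x
  have E'c2: "continuous_on UNIV (\<lambda>z. E' (fst z) (snd z))"
    unfolding E'_def by (intro continuous_intros bc2 ac2 enc2 Dc2)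
  have Ec: "continuous_on UNIV (\<lambda>x. a t x * en t x)" for t
    by (intro continuous_intros ac enc)
  have Eint: "integrable lborel (\<lambda>x. a t x * en t x)" if "t \<ge> -1" for t
    by (rule integrable_continuous_bounded_support[OF Ec, of "\<rho> + 1 + norm x0"]) (simp add: supp that)
  have dE: "(E has_real_derivative (\<integral>x. E' t x \<partial>lborel)) (at t)" if t: "t \<ge> 0" for t
  proof -
    let ?K = "cball (0::'a) (\<rho> + 1 + norm x0)"
    have "compact ({t - 1..t + 1} \<times> ?K)" by (intro compact_Times compact_cball compact_Icc)
    from continuous_on_compact_bound[OF this continuous_on_subset[OF E'c2 subset_UNIV]]
    obtain C where C: "\<And>z. z \<in> {t - 1..t + 1} \<times> ?K \<Longrightarrow> norm (E' (fst z) (snd z)) \<le> C" by metis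
    have "(E has_vector_derivative (\<integral>x. E' t x \<partial>lborel)) (at t)"
      unfolding E_def
    proof (rule has_vector_derivative_integral[where d=1 and w="\<lambda>x. C * indicator ?K x"])
      fix s x assume s: "\<bar>s - t\<bar> < 1"
      show "integrable lborel (\<lambda>x. a s x * en s x)" using s t by (intro Eint) auto
      have da: "((\<lambda>s. a s x) has_real_derivative - b s x) (at s)"
      proof -
        have "((\<lambda>s. \<rho> - s - r x) has_real_derivative - 1) (at s)" by (auto intro!: derivative_eq_intros)
        from DERIV_chain2[OF DERIV_max_0_square this] show ?thesis by (simp add: a_def b_def)
      qed
      have de: "((\<lambda>s. en s x) has_real_derivative D s x) (at s)"
        unfolding en_def D_def
        by (intro DERIV_add DERIV_sum DERIV_square time_derivative swt swe)
      show "((\<lambda>s. a s x * en s x) has_vector_derivative E' s x) (at s)"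
        using DERIV_mult[OF da de]
        by (simp add: E'_def has_real_derivative_iff_has_vector_derivative algebra_simps)
      show "norm (E' s x) \<le> C * indicator ?K x"
      proof (cases "x \<in> ?K")
        case True
        moreover have "t - 1 \<le> s \<and> s \<le> t + 1" using s by linarith
          ultimately show ?thesis using C[of "(s, x)"] by auto
      next
        case False
        then show ?thesis using supp[of s x] s t by (auto simp: E'_def)
      qed
    next
      show "E' t \<in> borel_measurable lborel"
      proof -
        have "continuous_on UNIV (\<lambda>x. (t, x))" by (intro continuous_intros)
        from continuous_on_compose2[OF E'c2 this] show ?thesis
          using borel_measurable_continuous_onI[of "E' t"] by simp
      qed
      have "emeasure lborel ?K < \<infinity>" by (rule emeasure_lborel_cball_finite)
      then show "integrable lborel (\<lambda>x. C * indicator ?K x)"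
        by (intro integrable_mult_right integrable_real_indicator) auto
    qed simp
    then show ?thesis by (simp add: has_real_derivative_iff_has_vector_derivative)
  qed
  have nonpos: "(\<integral>x. E' t x \<partial>lborel) \<le> 0" if t: "t \<ge> 0" for t
  proof -
    \<comment> \<open>\<open>Q e\<close> is the derivative of \<open>a t x * Pe e t x\<close> in
      direction \<open>e\<close>, so it integrates to zero; this moves the divergence from the
      energy flux onto the weight.\<close>
    define Q where "Q e x = a t x * Pe' e t x - b t x * \<nu> e x * Pe e t x" for e x
    have Qc: "continuous_on UNIV (Q e)" if "e \<in> Basis" for e
      unfolding Q_def by (intro continuous_intros ac bc \<nu>c Pc that)
    have Q0: "Q e x = 0" if "norm x > \<rho> + 1 + norm x0" for e x
      using supp[of t x] that t by (simp add: Q_def)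
    have Qint: "integrable lborel (Q e)" if "e \<in> Basis" for e
      by (rule integrable_continuous_bounded_support[OF Qc[OF that] Q0])
    have intQ: "(\<integral>x. Q e x \<partial>lborel) = 0" if e: "e \<in> Basis" for e
    proof (rule integral_directional_derivative_eq_0[where e=e, OF _ _ Qc[OF e] Q0])
      show "continuous_on UNIV (\<lambda>x. a t x * Pe e t x)" by (intro continuous_intros ac Pc e)
      show "a t x * Pe e t x = 0" if "norm x > \<rho> + 1 + norm x0" for x using supp[of t x] that t by simp
      show "((\<lambda>s. a t (x + s *\<^sub>R e) * Pe e t (x + s *\<^sub>R e)) has_vector_derivative Q e x) (at 0)" for x
      proof -
        have "((\<lambda>s. (norm (x + s *\<^sub>R e - x0))\<^sup>2) has_real_derivative 2 * ((x - x0) \<bullet> e)) (at 0)"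
        proof -
          have "(norm (y + s *\<^sub>R e))\<^sup>2 = (norm y)\<^sup>2 + 2 * s * (y \<bullet> e) + s\<^sup>2" for s y
            unfolding power2_norm_eq_inner using e
            by (simp add: inner_add_left inner_add_right inner_commute algebra_simps power2_eq_square)
          from this[of "x - x0"] have "(norm (x + s *\<^sub>R e - x0))\<^sup>2 = (norm (x - x0))\<^sup>2 + 2 * s * ((x - x0) \<bullet> e) + s\<^sup>2" for s
            by (simp add: algebra_simps)
          then show ?thesis by (auto intro!: derivative_eq_intros)
        qed
        from DERIV_add[OF DERIV_const[of 1] this]
        have d: "((\<lambda>s. 1 + (norm (x + s *\<^sub>R e - x0))\<^sup>2) has_real_derivative 2 * ((x - x0) \<bullet> e)) (at 0)" by simp
        have "0 < 1 + (norm (x + 0 *\<^sub>R e - x0))\<^sup>2" by (simp add: add_pos_nonneg)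
        from DERIV_chain2[OF DERIV_real_sqrt[OF this] d, folded r_def]
        have "((\<lambda>s. r (x + s *\<^sub>R e)) has_real_derivative inverse (r x) / 2 * (2 * ((x - x0) \<bullet> e))) (at 0)"
          by (simp only: scaleR_zero_left add_0_right)
        moreover have "inverse (r x) / 2 * (2 * ((x - x0) \<bullet> e)) = \<nu> e x" by (simp add: \<nu>_def inverse_eq_divide)
        ultimately have "((\<lambda>s. r (x + s *\<^sub>R e)) has_real_derivative \<nu> e x) (at 0)" by (simp only:)
        then have "((\<lambda>s. \<rho> - t - r (x + s *\<^sub>R e)) has_real_derivative - \<nu> e x) (at 0)"
          by (auto intro!: derivative_eq_intros)
        from DERIV_chain2[OF DERIV_max_0_square this]
        have da: "((\<lambda>s. a t (x + s *\<^sub>R e)) has_real_derivative - (b t x * \<nu> e x)) (at 0)"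
          by (simp add: a_def b_def)
        have dP: "((\<lambda>s. Pe e t (x + s *\<^sub>R e)) has_real_derivative Pe' e t x) (at 0)"
          unfolding Pe_def Pe'_def
          using DERIV_mult[OF space_derivative[OF swt e, of x "\<kappa> * t"] space_derivative[OF swe[OF e] e, of x "\<kappa> * t"]]
          by (simp add: algebra_simps)
        show ?thesis using DERIV_mult[OF da dP]
          by (simp add: Q_def has_real_derivative_iff_has_vector_derivative algebra_simps)
      qed
    qed
    \<comment> \<open>What remains of \<open>E'\<close> after the divergence terms: loss minus flux.
      Its sign follows from 2 A B \<le> A^2 + B^2 in each direction and from the sum of the squares
      of \<open>\<nu> e x\<close> being at most 1.\<close>
    define S where "S x = - b t x * en t x + 2 * \<kappa> * (\<Sum>e\<in>Basis. b t x * \<nu> e x * Pe e t x)" for x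
    have Sc: "continuous_on UNIV S"
      unfolding S_def by (intro continuous_intros bc enc \<nu>c Pc) auto
    have Sint: "integrable lborel S"
      by (rule integrable_continuous_bounded_support[OF Sc, of "\<rho> + 1 + norm x0"]) (use supp[of t] t in \<open>simp add: S_def\<close>)
    have "E' t x = S x + 2 * \<kappa> * (\<Sum>e\<in>Basis. Q e x)" for x
      unfolding E'_def D_eq S_def Q_def by (simp add: sum_subtractf sum_distrib_left algebra_simps)
    then have "(\<integral>x. E' t x \<partial>lborel) = (\<integral>x. S x \<partial>lborel) + 2 * \<kappa> * (\<Sum>e\<in>Basis. \<integral>x. Q e x \<partial>lborel)"
      using Sint Qint by (simp add: integral_sum)
    also have "\<dots> = (\<integral>x. S x \<partial>lborel)" by (simp add: intQ)
    also have "\<dots> \<le> 0"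
    proof -
      have "S x \<le> 0" for x
      proof -
        have "(\<Sum>e\<in>Basis. (\<nu> e x)\<^sup>2) = (norm (x - x0))\<^sup>2 / (r x)\<^sup>2"
          unfolding \<nu>_def power_divide sum_divide_distrib[symmetric]
          by (subst power2_norm_eq_inner, subst euclidean_inner) (simp add: power2_eq_square)
        also have "\<dots> \<le> 1" using r1(2)[of x] rpos[of x] by (simp add: power_mono)
        finally have \<nu>1: "(\<Sum>e\<in>Basis. (\<nu> e x)\<^sup>2) \<le> 1" .
        have "2 * \<kappa> * (\<Sum>e\<in>Basis. \<nu> e x * Pe e t x) = (\<Sum>e\<in>Basis. 2 * ((\<kappa> * \<nu> e x * wt (x, \<kappa> * t)) * we e (x, \<kappa> * t)))"
          by (simp add: sum_distrib_left Pe_def mult_ac)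
        also have "\<dots> \<le> (\<Sum>e\<in>Basis. (\<nu> e x)\<^sup>2 * (wt (x, \<kappa> * t))\<^sup>2 + (we e (x, \<kappa> * t))\<^sup>2)"
        proof (rule sum_mono)
          fix e :: 'a
          have "(\<kappa> * \<nu> e x * wt (x, \<kappa> * t))\<^sup>2 = (\<nu> e x)\<^sup>2 * (wt (x, \<kappa> * t))\<^sup>2"
            using \<kappa> by (auto simp: power_mult_distrib)
          then show "2 * ((\<kappa> * \<nu> e x * wt (x, \<kappa> * t)) * we e (x, \<kappa> * t)) \<le> (\<nu> e x)\<^sup>2 * (wt (x, \<kappa> * t))\<^sup>2 + (we e (x, \<kappa> * t))\<^sup>2"
            using sum_squares_bound[of "\<kappa> * \<nu> e x * wt (x, \<kappa> * t)" "we e (x, \<kappa> * t)"] by simp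
        qed
        also have "\<dots> = (\<Sum>e\<in>Basis. (\<nu> e x)\<^sup>2) * (wt (x, \<kappa> * t))\<^sup>2 + (\<Sum>e\<in>Basis. (we e (x, \<kappa> * t))\<^sup>2)"
          by (simp add: sum.distrib sum_distrib_right)
        also have "\<dots> \<le> en t x"
          unfolding en_def using mult_right_mono[OF \<nu>1, of "(wt (x, \<kappa> * t))\<^sup>2"] by simp
        finally have "b t x * (2 * \<kappa> * (\<Sum>e\<in>Basis. \<nu> e x * Pe e t x)) \<le> b t x * en t x"
          by (rule mult_left_mono) (simp add: b_def)
        moreover have "b t x * (2 * \<kappa> * (\<Sum>e\<in>Basis. \<nu> e x * Pe e t x)) = 2 * \<kappa> * (\<Sum>e\<in>Basis. b t x * \<nu> e x * Pe e t x)"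
          by (simp add: sum_distrib_left mult_ac)
        ultimately show ?thesis by (simp add: S_def)
      qed
      then have "0 \<le> (\<integral>x. - S x \<partial>lborel)" by (intro Bochner_Integration.integral_nonneg) simp
      then show ?thesis using Sint by simp
    qed
    finally show ?thesis .
  qed
  have E0: "E 0 = 0"
  proof -
    have "we e (x, 0) = 0" if "e \<in> Basis" for e x
    proof -
      have "((\<lambda>s. w (x + s *\<^sub>R e, 0)) has_real_derivative we e (x, 0)) (at 0)"
        unfolding we_def by (rule space_derivative[OF w that])
      then have "((\<lambda>s::real. 0::real) has_real_derivative we e (x, 0)) (at 0)" by (simp add: w0)
      then show ?thesis using DERIV_const DERIV_unique by blast
    qed
    then show ?thesis by (simp add: E_def en_def wt_def w1)
  qed
  have Et: "E t = 0" if t: "0 \<le> t" for t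
  proof (rule antisym)
    show "E t \<le> 0"
      using DERIV_nonpos_imp_nonincreasing[OF t, of E] dE nonpos E0 by force
    show "0 \<le> E t" unfolding E_def
      by (rule Bochner_Integration.integral_nonneg) (auto simp: a_def en_def intro!: mult_nonneg_nonneg add_nonneg_nonneg sum_nonneg)
  qed
  have wt0: "wt (x0, \<kappa> * t) = 0" if t: "0 \<le> t" "t \<le> T" for t
  proof -
    have "a t x0 * en t x0 = 0"
      by (rule continuous_nonneg_integral_0_imp_0[OF Ec Eint])
        (use t Et[of t] in \<open>auto simp: E_def a_def en_def intro!: mult_nonneg_nonneg add_nonneg_nonneg sum_nonneg\<close>)
    moreover have "a t x0 > 0" using t by (simp add: a_def \<rho>_def r_def)
    ultimately have "en t x0 = 0" by simp
    moreover have "0 \<le> (\<Sum>e\<in>Basis. (we e (x0, \<kappa> * t))\<^sup>2)" by (simp add: sum_nonneg)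
    moreover have "0 \<le> (wt (x0, \<kappa> * t))\<^sup>2" by simp
    ultimately have "(wt (x0, \<kappa> * t))\<^sup>2 = 0" unfolding en_def by linarith
    then show ?thesis by simp
  qed
  \<comment> \<open>Vanishing energy gives a zero time derivative along the axis above
    \<open>x0\<close>, so the value is that of the initial data.\<close>
  have "w (x0, \<kappa> * T) = w (x0, \<kappa> * 0)"
  proof (rule has_field_derivative_zero_constant[of "{0..T}" "\<lambda>t. w (x0, \<kappa> * t)", THEN exE])
    show "((\<lambda>t. w (x0, \<kappa> * t)) has_real_derivative 0) (at t within {0..T})" if "t \<in> {0..T}" for t
      using time_derivative[OF w, of x0 \<kappa> t] wt0[of t] that
      by (auto simp: wt_def intro: has_field_derivative_at_within)
    show "w (x0, \<kappa> * T) = w (x0, \<kappa> * 0)" if "\<forall>t\<in>{0..T}. w (x0, \<kappa> * t) = c" for c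
      using that T by (metis atLeastAtMost_iff order_refl)
  qed auto
  then show ?thesis by (simp add: w0)
qed

section \<open>The solution operator in Fourier variables\<close>

lemma iter_pd_add:
  "smooth f \<Longrightarrow> smooth g \<Longrightarrow> vs \<in> lists Basis \<Longrightarrow>
    iter_pd vs (\<lambda>x. f x + g x) = (\<lambda>x. iter_pd vs f x + iter_pd vs g x)"
  by (induction vs) (auto simp: pdir_add smooth_iter_pd)

lemma
  assumes "finite I" "\<And>i. i \<in> I \<Longrightarrow> smooth (f i)"
  shows iter_pd_sum: "vs \<in> lists Basis \<Longrightarrow> iter_pd vs (\<lambda>x. \<Sum>i\<in>I. f i x) = (\<lambda>x. \<Sum>i\<in>I. iter_pd vs (f i) x)"
proof -
  have 0: "iter_pd vs (\<lambda>_. 0) = (\<lambda>_. 0)" if "vs \<in> lists Basis" for vs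
    using iter_pd_bounded_linear[OF bounded_linear_zero smooth_const[of "0::'b"] that] by simp
  show "vs \<in> lists Basis \<Longrightarrow> iter_pd vs (\<lambda>x. \<Sum>i\<in>I. f i x) = (\<lambda>x. \<Sum>i\<in>I. iter_pd vs (f i) x)"
    using assms by (induction I rule: finite_induct) (auto simp: iter_pd_add smooth_sum 0)
qed

definition laplacian :: "('a::euclidean_space \<Rightarrow> real) \<Rightarrow> 'a \<Rightarrow> real" where
  "laplacian f x = (\<Sum>e\<in>Basis. pdir e (pdir e f) x)"

lemma C0e_tilde_iff:
  "f \<in> C0e_tilde \<longleftrightarrow> compact_smooth f \<and> even_last f \<and> (\<forall>vs\<in>lists Basis. \<forall>x'. iter_pd vs f (x', 0) = 0)"
  by (auto simp: C0e_tilde_def Ce_tilde_def compact_smooth_def)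

lemma even_last_space_derivative:
  assumes "even_last f"
  shows "even_last (pdir (b, 0) f)"
  using assms by (simp add: even_last_def pdir_def)

text \<open>Used with c = 1 and c = -1: each derivative in the last variable flips parity, so two of
  them restore evenness.\<close>

lemma time_derivative_reflection:
  fixes f :: "(real^'n) \<times> real \<Rightarrow> real"
  assumes f: "smooth f" and c: "\<And>x y. f (x, - y) = c * f (x, y)"
  shows "pdir (0, 1) f (x, - y) = - c * pdir (0, 1) f (x, y)"
proof (rule pdir_eqI)
  have "((\<lambda>t. c * f (x, - 1 * t)) has_real_derivative c * (- 1 * pdir (0, 1) f (x, - 1 * (- y)))) (at (- y))"
    by (intro DERIV_cmult time_derivative f)
  moreover have "c * f (x, - 1 * t) = f (x, t)" for t using c[of x "- t"] by simp
  ultimately have "((\<lambda>t. f (x, t)) has_real_derivative - c * pdir (0, 1) f (x, y)) (at (- y + 0))" by simp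
  then have "((\<lambda>t. f (x, - y + t)) has_real_derivative - c * pdir (0, 1) f (x, y)) (at 0)"
    using DERIV_shift[of "\<lambda>t. f (x, t)" "- c * pdir (0, 1) f (x, y)" 0 "- y"] by (simp add: add.commute)
  then show "((\<lambda>s. f ((x, - y) + s *\<^sub>R (0, 1))) has_vector_derivative - c * pdir (0, 1) f (x, y)) (at 0)"
    by (simp add: has_real_derivative_iff_has_vector_derivative)
qed

lemma C0e_tilde_add: "f \<in> C0e_tilde \<Longrightarrow> g \<in> C0e_tilde \<Longrightarrow> (\<lambda>x. f x + g x) \<in> C0e_tilde"
  by (auto simp: C0e_tilde_iff iter_pd_add compact_smooth_smooth compact_smooth_add even_last_def)

lemma C0e_tilde_sum: "finite I \<Longrightarrow> (\<And>i. i \<in> I \<Longrightarrow> f i \<in> C0e_tilde) \<Longrightarrow> (\<lambda>x. \<Sum>i\<in>I. f i x) \<in> C0e_tilde"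
  by (auto simp: C0e_tilde_iff iter_pd_sum compact_smooth_smooth compact_smooth_sum even_last_def)

lemma C0e_tilde_cmult:
  fixes f :: "(real^'n) \<times> real \<Rightarrow> real"
  assumes "f \<in> C0e_tilde"
  shows "(\<lambda>x. c * f x) \<in> C0e_tilde"
  using assms compact_smooth_bounded_linear[OF bounded_linear_mult_right, of f c]
    iter_pd_bounded_linear[OF bounded_linear_mult_right compact_smooth_smooth, of f _ c]
  by (auto simp: C0e_tilde_iff even_last_def)

lemma C0e_tilde_0: "(\<lambda>_. 0) \<in> C0e_tilde"
  using C0e_tilde_sum[of "{}"] by simp

lemma C0e_tilde_diff: "f \<in> C0e_tilde \<Longrightarrow> g \<in> C0e_tilde \<Longrightarrow> (\<lambda>x. f x - g x) \<in> C0e_tilde"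
  using C0e_tilde_add[of f "\<lambda>x. - 1 * g x"] C0e_tilde_cmult[of g "- 1"] by simp

lemma flat_pdir:
  fixes f :: "'e::euclidean_space \<times> real \<Rightarrow> 'b::real_normed_vector"
  assumes "\<forall>vs\<in>lists Basis. \<forall>x'. iter_pd vs f (x', 0) = 0" "v \<in> Basis"
  shows "\<forall>vs\<in>lists Basis. \<forall>x'. iter_pd vs (pdir v f) (x', 0) = 0"
proof (intro ballI allI)
  fix vs :: "('e \<times> real) list" and x' assume "vs \<in> lists Basis"
  then have "vs @ [v] \<in> lists Basis" using assms(2) by simp
  from bspec[OF assms(1) this] show "iter_pd vs (pdir v f) (x', 0) = 0" by (simp add: iter_pd_append)
qed

lemma C0e_tilde_space_derivative:
  fixes f :: "(real^'n) \<times> real \<Rightarrow> real"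
  assumes f: "f \<in> C0e_tilde" and b: "b \<in> Basis"
  shows "pdir (b, 0) f \<in> C0e_tilde"
  using f compact_smooth_pdir[OF _ Basis_space[OF b], of f] flat_pdir[OF _ Basis_space[OF b], of f]
  by (simp add: C0e_tilde_iff even_last_space_derivative)

text \<open>One derivative in the last variable makes an even function odd and leaves the class, a
  second one leads back. Two time derivatives of the trace amount to this operator on the
  data.\<close>

lemma C0e_tilde_laplacian:
  fixes f :: "(real^'n) \<times> real \<Rightarrow> real"
  assumes f: "f \<in> C0e_tilde"
  shows "laplacian f \<in> C0e_tilde"
proof -
  have "pdir e (pdir e f) \<in> C0e_tilde" if e: "e \<in> Basis" for e
  proof (cases "e = (0, 1)")
    case True
    have s: "smooth f" and ev: "even_last f" using f by (auto simp: C0e_tilde_iff compact_smooth_smooth)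
    have "even_last (pdir (0, 1) (pdir (0, 1) f))"
    proof -
      have 1: "pdir (0, 1) f (x, - y) = - 1 * pdir (0, 1) f (x, y)" for x y
        using time_derivative_reflection[OF s, of 1] ev by (simp add: even_last_def)
      show ?thesis
        using time_derivative_reflection[OF smooth_pdir[OF s Basis_time] 1] by (simp add: even_last_def)
    qed
    then show ?thesis using f e True
      by (auto simp: C0e_tilde_iff compact_smooth_pdir intro!: flat_pdir[rule_format])
  next
    case False
    then obtain b where "e = (b, 0)" "b \<in> Basis" using e by (auto simp: Basis_prod_def)
    then show ?thesis using f by (simp add: C0e_tilde_space_derivative)
  qed
  then show ?thesis unfolding laplacian_def[abs_def] by (intro C0e_tilde_sum) auto
qed

section \<open>Solution and trace as oscillatory integrals\<close>

text \<open>The inversion constant is absorbed here, so that \<open>f\<close> is the plain integral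
  of its amplitude against \<open>cis\<close>.\<close>

definition wave_amplitude :: "('e::euclidean_space \<times> real \<Rightarrow> real) \<Rightarrow> 'e \<times> real \<Rightarrow> complex" where
  "wave_amplitude f \<xi> = fourier (\<lambda>x. complex_of_real (f x)) \<xi> / of_real ((2 * pi) ^ DIM('e \<times> real))"

text \<open>The candidate for the solution. For real \<open>f\<close> the real part replaces exp (i
  t |\<xi>|) by cos (t |\<xi>|), which encodes the zero initial velocity.\<close>

definition wave_kernel :: "('e::euclidean_space \<times> real \<Rightarrow> real) \<Rightarrow> ('e \<times> real) \<times> real \<Rightarrow> real" where
  "wave_kernel f p = Re (oscillatory (wave_amplitude f) (\<lambda>\<xi>. (\<xi>, norm \<xi>)) p)"

definition wave_trace :: "('e::euclidean_space \<times> real \<Rightarrow> real) \<Rightarrow> 'e \<times> real \<Rightarrow> real" where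
  "wave_trace f p = Re (oscillatory (wave_amplitude f) (\<lambda>\<xi>. (fst \<xi>, norm \<xi>)) p)"

lemma compact_smooth_of_real:
  "compact_smooth f \<Longrightarrow> compact_smooth (\<lambda>x. complex_of_real (f x))"
  by (rule compact_smooth_bounded_linear[OF bounded_linear_of_real])

lemma rapidly_decreasing_wave_amplitude:
  fixes f :: "'e::euclidean_space \<times> real \<Rightarrow> real"
  assumes "compact_smooth f"
  shows "rapidly_decreasing (wave_amplitude f)"
proof -
  have "rapidly_decreasing (\<lambda>\<xi>. (1 / of_real ((2 * pi) ^ DIM('e \<times> real))) * fourier (\<lambda>x. complex_of_real (f x)) \<xi>)"
    by (rule rapidly_decreasing_mult[OF rapidly_decreasing_fourier[OF compact_smooth_of_real[OF assms]],
          where K="norm (1 / complex_of_real ((2 * pi) ^ DIM('e \<times> real)))"])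
       (auto simp: mult_le_cancel_left1 simp del: norm_divide)
  then show ?thesis by (simp add: wave_amplitude_def[abs_def])
qed

lemma wave_amplitude_uminus: "wave_amplitude f (- \<xi>) = cnj (wave_amplitude f \<xi>)"
proof -
  have "fourier (\<lambda>x. complex_of_real (f x)) (- \<xi>) = cnj (fourier (\<lambda>x. complex_of_real (f x)) \<xi>)"
  proof (cases "integrable lborel (\<lambda>x. complex_of_real (f x) * cis (- (\<xi> \<bullet> x)))")
    case True
    from integral_bounded_linear[OF bounded_linear_cnj this] show ?thesis
      by (simp add: fourier_def cis_cnj)
  next
    \<comment> \<open>Without integrability both integrals take the default value 0; conjugation
      preserves integrability, so the two cases agree on both sides.\<close>
    case False
    have "\<not> integrable lborel (\<lambda>x. complex_of_real (f x) * cis (- ((- \<xi>) \<bullet> x)))"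
    proof
      assume "integrable lborel (\<lambda>x. complex_of_real (f x) * cis (- ((- \<xi>) \<bullet> x)))"
      from integrable_bounded_linear[OF bounded_linear_cnj this] False show False by (simp add: cis_cnj)
    qed
    then show ?thesis using False unfolding fourier_def by (simp add: not_integrable_integral_eq)
  qed
  then show ?thesis by (simp add: wave_amplitude_def)
qed

lemma wave_amplitude_pdir:
  assumes f: "compact_smooth f" and v: "v \<in> Basis"
  shows "wave_amplitude (pdir v f) \<xi> = \<i> * of_real (v \<bullet> \<xi>) * wave_amplitude f \<xi>"
proof -
  have "(\<lambda>x. complex_of_real (pdir v f x)) = pdir v (\<lambda>x. complex_of_real (f x))"
    by (rule pdir_bounded_linear[OF bounded_linear_of_real compact_smooth_smooth[OF f] v, symmetric])
  then show ?thesis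
    by (simp add: wave_amplitude_def fourier_derivative[OF compact_smooth_of_real[OF f] v])
qed

lemma fourier_integrand_integrable:
  assumes "compact_smooth (\<phi> :: 'a::euclidean_space \<Rightarrow> complex)"
  shows "integrable lborel (\<lambda>x. \<phi> x * cis (- (\<xi> \<bullet> x)))"
  by (rule integrable_bounded_mult[OF compact_smooth_integrable[OF assms], where C=1])
     (auto intro!: measurable_cis_continuous continuous_intros)

lemma wave_amplitude_add:
  assumes "compact_smooth f" "compact_smooth g"
  shows "wave_amplitude (\<lambda>x. f x + g x) \<xi> = wave_amplitude f \<xi> + wave_amplitude g \<xi>"
  unfolding wave_amplitude_def fourier_def
  by (simp add: distrib_right add_divide_distrib fourier_integrand_integrable compact_smooth_of_real assms)

lemma wave_amplitude_cmult: "wave_amplitude (\<lambda>x. c * f x) \<xi> = of_real c * wave_amplitude f \<xi>"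
  unfolding wave_amplitude_def fourier_def by (simp add: mult.assoc)

lemma wave_amplitude_sum:
  "finite I \<Longrightarrow> (\<And>i. i \<in> I \<Longrightarrow> compact_smooth (f i)) \<Longrightarrow>
    wave_amplitude (\<lambda>x. \<Sum>i\<in>I. f i x) \<xi> = (\<Sum>i\<in>I. wave_amplitude (f i) \<xi>)"
proof (induction I rule: finite_induct)
  case empty
  then show ?case by (simp add: wave_amplitude_def fourier_def)
next
  case (insert i I)
  then show ?case by (simp add: wave_amplitude_add compact_smooth_sum)
qed

lemma i_mult_square: "\<i> * c * (\<i> * c * a) = - (c\<^sup>2) * a"
proof -
  have "\<i> * c * (\<i> * c * a) = (\<i> * \<i>) * (c * c * a)" by (simp only: mult_ac)
  then show ?thesis by (simp add: power2_eq_square)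
qed

lemma wave_amplitude_laplacian:
  assumes f: "compact_smooth f"
  shows "wave_amplitude (laplacian f) \<xi> = - of_real ((norm \<xi>)\<^sup>2) * wave_amplitude f \<xi>"
proof -
  have "wave_amplitude (laplacian f) \<xi> = (\<Sum>e\<in>Basis. wave_amplitude (pdir e (pdir e f)) \<xi>)"
    unfolding laplacian_def[abs_def] by (rule wave_amplitude_sum) (auto intro: compact_smooth_pdir f)
  also have "\<dots> = (\<Sum>e\<in>Basis. - of_real ((e \<bullet> \<xi>)\<^sup>2) * wave_amplitude f \<xi>)"
    by (intro sum.cong refl) (simp add: wave_amplitude_pdir compact_smooth_pdir f i_mult_square)
  also have "\<dots> = - of_real (\<Sum>e\<in>Basis. (e \<bullet> \<xi>)\<^sup>2) * wave_amplitude f \<xi>"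
    by (simp add: sum_distrib_right sum_negf)
  also have "(\<Sum>e\<in>Basis. (e \<bullet> \<xi>)\<^sup>2) = (norm \<xi>)\<^sup>2"
    by (subst power2_norm_eq_inner, subst euclidean_inner) (simp add: power2_eq_square inner_commute)
  finally show ?thesis .
qed

lemma wave_amplitude_inversion:
  fixes f :: "'e::euclidean_space \<times> real \<Rightarrow> real"
  assumes f: "compact_smooth f"
  shows "(\<integral>\<xi>. wave_amplitude f \<xi> * cis (x \<bullet> \<xi>) \<partial>lborel) = of_real (f x)"
  using fourier_inversion_compact_smooth[OF compact_smooth_of_real[OF f], of x]
  by (simp add: wave_amplitude_def field_simps)

lemma phase_bounds:
  "continuous_on UNIV (\<lambda>\<xi>::'a::euclidean_space. (\<xi>, norm \<xi>))"
  "norm (\<xi>, norm \<xi>) \<le> 2 * (1 + (norm (\<xi>::'a))\<^sup>2)"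
  "continuous_on UNIV (\<lambda>\<zeta>::'e::euclidean_space \<times> real. (fst \<zeta>, norm \<zeta>))"
  "norm (fst \<zeta>, norm \<zeta>) \<le> 2 * (1 + (norm (\<zeta>::'e \<times> real))\<^sup>2)"
proof -
  have sq: "2 * r \<le> 2 * (1 + r\<^sup>2)" for r :: real
    using zero_le_power2[of "r - 1 / 2"] by (simp add: power2_eq_square algebra_simps)
  show "norm (\<xi>, norm \<xi>) \<le> 2 * (1 + (norm \<xi>)\<^sup>2)"
    using norm_Pair_le[of \<xi> "norm \<xi>"] sq[of "norm \<xi>"] by simp
  show "norm (fst \<zeta>, norm \<zeta>) \<le> 2 * (1 + (norm \<zeta>)\<^sup>2)"
    using norm_Pair_le[of "fst \<zeta>" "norm \<zeta>"] norm_fst_le[of "fst \<zeta>" "snd \<zeta>"] sq[of "norm \<zeta>"] by simp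
qed (intro continuous_intros)+

text \<open>Conjugation reverses x and t. Replacing \<xi> by - \<xi> conjugates the amplitude of a
  real function and undoes the change of x since \<open>P\<close> is odd, but leaves |\<xi>| alone,
  so only t stays reversed. Used for \<open>P\<close> the identity and
  \<open>P = fst\<close>.\<close>

lemma oscillatory_time_reflection:
  fixes f :: "'e::euclidean_space \<times> real \<Rightarrow> real" and P :: "'e \<times> real \<Rightarrow> 'q::euclidean_space"
  assumes f: "compact_smooth f" and P: "continuous_on UNIV P" "\<And>\<xi>. P (- \<xi>) = - P \<xi>"
  shows "oscillatory (wave_amplitude f) (\<lambda>\<xi>. (P \<xi>, norm \<xi>)) (x, - t)
      = cnj (oscillatory (wave_amplitude f) (\<lambda>\<xi>. (P \<xi>, norm \<xi>)) (x, t))"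
proof -
  have c: "continuous_on UNIV (\<lambda>\<xi>. (P \<xi>, norm \<xi>))" by (intro continuous_intros P)
  have i: "integrable lborel (\<lambda>\<xi>. wave_amplitude f \<xi> * cis ((x, t) \<bullet> (P \<xi>, norm \<xi>)))" for t
    by (rule oscillatory_integrable[OF rapidly_decreasing_wave_amplitude[OF f] c])
  have "cnj (oscillatory (wave_amplitude f) (\<lambda>\<xi>. (P \<xi>, norm \<xi>)) (x, t))
      = (\<integral>\<xi>. cnj (wave_amplitude f \<xi>) * cis (- ((x, t) \<bullet> (P \<xi>, norm \<xi>))) \<partial>lborel)"
    using integral_bounded_linear[OF bounded_linear_cnj i[of t]] by (simp add: oscillatory_def cis_cnj)
  also have "\<dots> = (\<integral>\<xi>. wave_amplitude f (- \<xi>) * cis ((x, - t) \<bullet> (P (- \<xi>), norm (- \<xi>))) \<partial>lborel)"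
    by (simp add: wave_amplitude_uminus P)
  also have "\<dots> = (\<integral>\<xi>. wave_amplitude f \<xi> * cis ((x, - t) \<bullet> (P \<xi>, norm \<xi>)) \<partial>lborel)"
    by (rule lborel_integral_uminus[of "\<lambda>\<xi>. wave_amplitude f \<xi> * cis ((x, - t) \<bullet> (P \<xi>, norm \<xi>))"])
       (use borel_measurable_integrable[OF i[of "- t"]] in simp)
  finally show ?thesis by (simp add: oscillatory_def)
qed

context
  fixes f :: "'e::euclidean_space \<times> real \<Rightarrow> real"
  assumes f: "compact_smooth f"
begin

lemma smooth_wave_trace: "smooth (wave_trace f)"
  unfolding wave_trace_def[abs_def]
  by (intro smooth_bounded_linear[OF bounded_linear_Re] smooth_oscillatory[OF _ phase_bounds(3,4)]
      rapidly_decreasing_wave_amplitude f)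

lemma smooth_wave_kernel: "smooth (wave_kernel f)"
  unfolding wave_kernel_def[abs_def]
  by (intro smooth_bounded_linear[OF bounded_linear_Re] smooth_oscillatory[OF _ phase_bounds(1,2)]
      rapidly_decreasing_wave_amplitude f)

lemma wave_trace_eq_kernel: "wave_trace f (x, t) = wave_kernel f ((x, 0), t)"
  by (simp add: wave_trace_def wave_kernel_def oscillatory_def inner_prod_def)

lemma wave_trace_even: "wave_trace f (x, - t) = wave_trace f (x, t)"
  unfolding wave_trace_def using oscillatory_time_reflection[OF f, of fst x t] by (simp add: continuous_on_fst continuous_on_id)

lemma wave_kernel_even: "wave_kernel f (x, - t) = wave_kernel f (x, t)"
  unfolding wave_kernel_def using oscillatory_time_reflection[OF f, of "\<lambda>\<xi>. \<xi>" x t] by (simp add: continuous_on_id)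

lemma wave_kernel_initial: "wave_kernel f (x, 0) = f x"
  by (simp add: wave_kernel_def oscillatory_def wave_amplitude_inversion[OF f])

lemma wave_trace_initial: "wave_trace f (x, 0) = f (x, 0)"
  by (simp add: wave_trace_eq_kernel wave_kernel_initial)

lemma of_real_wave_trace:
  "of_real (wave_trace f (x, t)) = (oscillatory (wave_amplitude f) (\<lambda>\<xi>. (fst \<xi>, norm \<xi>)) (x, t)
    + oscillatory (wave_amplitude f) (\<lambda>\<xi>. (fst \<xi>, norm \<xi>)) (x, - t)) / 2"
  using oscillatory_time_reflection[OF f, of fst x t]
  by (simp add: wave_trace_def continuous_on_fst continuous_on_id complex_add_cnj)

lemma wave_trace_bounded: "\<bar>wave_trace f p\<bar> \<le> (\<integral>\<xi>. norm (wave_amplitude f \<xi>) \<partial>lborel)"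
proof -
  have "norm (oscillatory (wave_amplitude f) (\<lambda>\<xi>. (fst \<xi>, norm \<xi>)) p) \<le> (\<integral>\<xi>. norm (wave_amplitude f \<xi>) \<partial>lborel)"
    unfolding oscillatory_def
    by (rule norm_lebesgue_integral_le[OF oscillatory_integrable[OF _ phase_bounds(3)] integrable_norm[OF rapidly_decreasing_integrable]])
      (simp_all add: norm_mult rapidly_decreasing_wave_amplitude f)
  then show ?thesis unfolding wave_trace_def by (rule order_trans[OF abs_Re_le_cmod])
qed

lemma pdir_wave_trace_space:
  assumes b: "b \<in> Basis"
  shows "pdir (b, 0) (wave_trace f) = wave_trace (pdir (b, 0) f)"
proof -
  note rap = rapidly_decreasing_wave_amplitude[OF f]
  have "pdir (b, 0) (wave_trace f) = (\<lambda>p. Re (oscillatory (\<lambda>\<xi>. \<i> * of_real ((b, 0) \<bullet> (fst \<xi>, norm \<xi>)) * wave_amplitude f \<xi>) (\<lambda>\<xi>. (fst \<xi>, norm \<xi>)) p))"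
    unfolding wave_trace_def[abs_def]
    by (subst pdir_bounded_linear[OF bounded_linear_Re smooth_oscillatory[OF rap phase_bounds(3,4)] Basis_space[OF b]],
        subst pdir_oscillatory[OF rap phase_bounds(3,4)]) simp
  moreover have "wave_amplitude (pdir (b, 0) f) = (\<lambda>\<xi>. \<i> * of_real ((b, 0) \<bullet> (fst \<xi>, norm \<xi>)) * wave_amplitude f \<xi>)"
    by (simp add: fun_eq_iff wave_amplitude_pdir[OF f Basis_space[OF b]] inner_prod_def)
  ultimately show ?thesis by (simp add: wave_trace_def[abs_def])
qed

text \<open>On the hyperplane the last frequency is no longer visible in the space phase, but
  |\<xi>| still contains it: two time derivatives multiply the amplitude by - |\<xi>|^2, the symbol
  of the full Laplacian.\<close>

lemma pdir_wave_trace_time: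
  "pdir (0, 1) (pdir (0, 1) (wave_trace f)) = wave_trace (laplacian f)"
proof -
  let ?\<theta> = "\<lambda>\<xi>::'e \<times> real. (fst \<xi>, norm \<xi>)"
  note rap = rapidly_decreasing_wave_amplitude[OF f]
  note rap' = rapidly_decreasing_phase_mult[OF rap phase_bounds(3,4), of "(0,1)"]
  have 1: "pdir (0, 1) (wave_trace f) = (\<lambda>p. Re (oscillatory (\<lambda>\<xi>. \<i> * of_real ((0, 1) \<bullet> ?\<theta> \<xi>) * wave_amplitude f \<xi>) ?\<theta> p))"
    unfolding wave_trace_def[abs_def]
    by (subst pdir_bounded_linear[OF bounded_linear_Re smooth_oscillatory[OF rap phase_bounds(3,4)] Basis_time],
        subst pdir_oscillatory[OF rap phase_bounds(3,4)]) simp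
  have 2: "pdir (0, 1) (pdir (0, 1) (wave_trace f))
      = (\<lambda>p. Re (oscillatory (\<lambda>\<xi>. \<i> * of_real ((0, 1) \<bullet> ?\<theta> \<xi>) * (\<i> * of_real ((0, 1) \<bullet> ?\<theta> \<xi>) * wave_amplitude f \<xi>)) ?\<theta> p))"
    unfolding 1
    by (subst pdir_bounded_linear[OF bounded_linear_Re smooth_oscillatory[OF rap' phase_bounds(3,4)] Basis_time],
        subst pdir_oscillatory[OF rap' phase_bounds(3,4)]) simp
  have "wave_amplitude (laplacian f) = (\<lambda>\<xi>. \<i> * of_real ((0, 1) \<bullet> ?\<theta> \<xi>) * (\<i> * of_real ((0, 1) \<bullet> ?\<theta> \<xi>) * wave_amplitude f \<xi>))"
    unfolding i_mult_square by (simp add: fun_eq_iff wave_amplitude_laplacian[OF f])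
  then show ?thesis unfolding 2 by (simp add: wave_trace_def[abs_def])
qed

lemma wave_kernel_equation:
  "pdir (0, 1) (pdir (0, 1) (wave_kernel f)) p = (\<Sum>e\<in>Basis. pdir (e, 0) (pdir (e, 0) (wave_kernel f)) p)"
proof -
  let ?\<theta> = "\<lambda>\<xi>::'e \<times> real. (\<xi>, norm \<xi>)"
  let ?a = "wave_amplitude f"
  note rap = rapidly_decreasing_wave_amplitude[OF f]
  have 2: "pdir v (pdir v (wave_kernel f)) p = Re (\<integral>\<xi>. - of_real ((v \<bullet> ?\<theta> \<xi>)\<^sup>2) * (?a \<xi> * cis (p \<bullet> ?\<theta> \<xi>)) \<partial>lborel)"
    and i: "integrable lborel (\<lambda>\<xi>. - of_real ((v \<bullet> ?\<theta> \<xi>)\<^sup>2) * (?a \<xi> * cis (p \<bullet> ?\<theta> \<xi>)))" if v: "v \<in> Basis" for v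
  proof -
    note rap' = rapidly_decreasing_phase_mult[OF rap phase_bounds(1,2), of v]
    note rap'' = rapidly_decreasing_phase_mult[OF rap' phase_bounds(1,2), of v]
    have 1: "pdir v (wave_kernel f) = (\<lambda>p. Re (oscillatory (\<lambda>\<xi>. \<i> * of_real (v \<bullet> ?\<theta> \<xi>) * ?a \<xi>) ?\<theta> p))"
      unfolding wave_kernel_def[abs_def]
      by (subst pdir_bounded_linear[OF bounded_linear_Re smooth_oscillatory[OF rap phase_bounds(1,2)] v],
          subst pdir_oscillatory[OF rap phase_bounds(1,2)]) simp
    have e: "\<i> * of_real (v \<bullet> ?\<theta> \<xi>) * (\<i> * of_real (v \<bullet> ?\<theta> \<xi>) * ?a \<xi>) * cis (p \<bullet> ?\<theta> \<xi>)
        = - of_real ((v \<bullet> ?\<theta> \<xi>)\<^sup>2) * (?a \<xi> * cis (p \<bullet> ?\<theta> \<xi>))" for \<xi>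
      unfolding i_mult_square by simp
    have "pdir v (pdir v (wave_kernel f)) p = Re (oscillatory (\<lambda>\<xi>. \<i> * of_real (v \<bullet> ?\<theta> \<xi>) * (\<i> * of_real (v \<bullet> ?\<theta> \<xi>) * ?a \<xi>)) ?\<theta> p)"
      unfolding 1
      by (subst pdir_bounded_linear[OF bounded_linear_Re smooth_oscillatory[OF rap' phase_bounds(1,2)] v],
          subst pdir_oscillatory[OF rap' phase_bounds(1,2)]) simp
    then show "pdir v (pdir v (wave_kernel f)) p = Re (\<integral>\<xi>. - of_real ((v \<bullet> ?\<theta> \<xi>)\<^sup>2) * (?a \<xi> * cis (p \<bullet> ?\<theta> \<xi>)) \<partial>lborel)"
      unfolding oscillatory_def e .
    show "integrable lborel (\<lambda>\<xi>. - of_real ((v \<bullet> ?\<theta> \<xi>)\<^sup>2) * (?a \<xi> * cis (p \<bullet> ?\<theta> \<xi>)))"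
      using oscillatory_integrable[OF rap'' phase_bounds(1), of p] unfolding e .
  qed
  have "(\<Sum>e\<in>Basis. pdir (e, 0) (pdir (e, 0) (wave_kernel f)) p)
      = Re (\<Sum>e\<in>Basis. \<integral>\<xi>. - of_real (((e, 0) \<bullet> ?\<theta> \<xi>)\<^sup>2) * (?a \<xi> * cis (p \<bullet> ?\<theta> \<xi>)) \<partial>lborel)"
    by (simp only: Re_sum 2[OF Basis_space] cong: sum.cong)
  also have "(\<Sum>e\<in>Basis. \<integral>\<xi>. - of_real (((e, 0) \<bullet> ?\<theta> \<xi>)\<^sup>2) * (?a \<xi> * cis (p \<bullet> ?\<theta> \<xi>)) \<partial>lborel)
      = (\<integral>\<xi>. (\<Sum>e\<in>Basis. - of_real (((e, 0) \<bullet> ?\<theta> \<xi>)\<^sup>2) * (?a \<xi> * cis (p \<bullet> ?\<theta> \<xi>))) \<partial>lborel)"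
    by (rule Bochner_Integration.integral_sum[symmetric]) (rule i[OF Basis_space])
  also have "\<dots> = (\<integral>\<xi>. - of_real (((0, 1) \<bullet> ?\<theta> \<xi>)\<^sup>2) * (?a \<xi> * cis (p \<bullet> ?\<theta> \<xi>)) \<partial>lborel)"
  proof (intro Bochner_Integration.integral_cong refl)
    fix \<xi> :: "'e \<times> real"
    have "(\<Sum>e\<in>Basis. (e \<bullet> \<xi>)\<^sup>2) = (norm \<xi>)\<^sup>2"
      by (subst power2_norm_eq_inner, subst euclidean_inner) (simp add: power2_eq_square inner_commute)
    then have "(\<Sum>e\<in>Basis. ((e, 0) \<bullet> ?\<theta> \<xi>)\<^sup>2) = ((0, 1) \<bullet> ?\<theta> \<xi>)\<^sup>2" by (simp only: inner_Pair) simp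
    then show "(\<Sum>e\<in>Basis. - of_real (((e, 0) \<bullet> ?\<theta> \<xi>)\<^sup>2) * (?a \<xi> * cis (p \<bullet> ?\<theta> \<xi>)))
        = - of_real (((0, 1) \<bullet> ?\<theta> \<xi>)\<^sup>2) * (?a \<xi> * cis (p \<bullet> ?\<theta> \<xi>))"
      by (simp only: sum_distrib_right[symmetric] sum_negf of_real_sum[symmetric])
  qed
  finally show ?thesis unfolding 2[OF Basis_time] by simp
qed

end

lemma wave_trace_add:
  assumes f: "compact_smooth f" and g: "compact_smooth g"
  shows "wave_trace (\<lambda>x. f x + g x) p = wave_trace f p + wave_trace g p"
  unfolding wave_trace_def oscillatory_def wave_amplitude_add[OF f g]
  by (simp add: distrib_right oscillatory_integrable rapidly_decreasing_wave_amplitude f g phase_bounds)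

lemma wave_trace_cmult: "wave_trace (\<lambda>x. c * f x) p = c * wave_trace f p"
  unfolding wave_trace_def oscillatory_def wave_amplitude_cmult by (simp add: mult.assoc)

section \<open>Identification of \<open>wave_U\<close> with the Fourier formula\<close>

lemma even_time_derivative_0:
  fixes g :: "'e::euclidean_space \<times> real \<Rightarrow> real"
  assumes g: "smooth g" and even: "\<And>t. g (x, - t) = g (x, t)"
  shows "pdir (0, 1) g (x, 0) = 0"
proof -
  have 1: "((\<lambda>t. g (x, t)) has_real_derivative pdir (0, 1) g (x, 0)) (at 0)"
    using time_derivative[OF g, of x 1 0] by simp
  have 2: "((\<lambda>t. g (x, t)) has_real_derivative - pdir (0, 1) g (x, 0)) (at 0)"
    using time_derivative[OF g, of x "- 1" 0] by (simp add: even)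
  have "pdir (0, 1) g (x, 0) = - pdir (0, 1) g (x, 0)" by (rule DERIV_unique[OF 1 2])
  then show ?thesis by simp
qed

text \<open>The Fourier formula gives existence, and the difference of two solutions has zero data.
  Hence \<open>THE\<close> evaluates to \<open>wave_kernel f\<close>, whose restriction to the
  hyperplane is the trace.\<close>

lemma wave_U_eq_wave_trace:
  fixes f :: "(real^'n) \<times> real \<Rightarrow> real"
  assumes f: "compact_smooth f"
  shows "wave_U f = wave_trace f"
proof -
  have sol: "wave_solution f (wave_kernel f)"
    unfolding wave_solution_def
    using smooth_wave_kernel[OF f] wave_kernel_equation[OF f] wave_kernel_initial[OF f]
      even_time_derivative_0[OF smooth_wave_kernel[OF f] wave_kernel_even[OF f]] by simp
  have uniq: "u = wave_kernel f" if u: "wave_solution f u" for u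
  proof
    fix p :: "((real^'n) \<times> real) \<times> real"
    obtain x t where p: "p = (x, t)" using prod.exhaust by blast
    let ?v = "\<lambda>q. - wave_kernel f q"
    define w where "w q = u q + ?v q" for q
    have su: "smooth u"
      and u_pde: "\<And>q. iter_pd [(0,1),(0,1)] u q - (\<Sum>e\<in>Basis. iter_pd [(e,0),(e,0)] u q) = 0"
      and u0: "\<And>y. u (y, 0) = f y" and u1: "\<And>y. iter_pd [(0,1)] u (y, 0) = 0"
      using u unfolding wave_solution_def by blast+
    have sv: "smooth ?v" by (rule smooth_bounded_linear[OF bounded_linear_minus[OF bounded_linear_ident] smooth_wave_kernel[OF f]])
    have sw: "smooth w" unfolding w_def[abs_def] by (rule smooth_add[OF su sv])
    have p1: "pdir v w = (\<lambda>q. pdir v u q + - pdir v (wave_kernel f) q)" if "v \<in> Basis" for v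
      unfolding w_def[abs_def]
      by (subst pdir_add[OF su sv that], subst pdir_bounded_linear[OF bounded_linear_minus[OF bounded_linear_ident] smooth_wave_kernel[OF f] that]) simp
    have p2: "pdir v (pdir v w) q = pdir v (pdir v u) q - pdir v (pdir v (wave_kernel f)) q" if "v \<in> Basis" for v q
    proof -
      have s: "smooth (pdir v u)" "smooth (pdir v (wave_kernel f))" by (intro smooth_pdir su smooth_wave_kernel f that)+
      have "pdir v (\<lambda>q. - pdir v (wave_kernel f) q) = (\<lambda>q. - pdir v (pdir v (wave_kernel f)) q)"
        by (rule pdir_bounded_linear[OF bounded_linear_minus[OF bounded_linear_ident] s(2) that])
      moreover have "smooth (\<lambda>q. - pdir v (wave_kernel f) q)"
        by (rule smooth_bounded_linear[OF bounded_linear_minus[OF bounded_linear_ident] s(2)])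
      ultimately show ?thesis unfolding p1[OF that] by (subst pdir_add[OF s(1) _ that]) auto
    qed
    have pde: "pdir (0,1) (pdir (0,1) w) q = (\<Sum>e\<in>Basis. pdir (e,0) (pdir (e,0) w) q)" for q
    proof -
      have "pdir (0,1) (pdir (0,1) u) q = (\<Sum>e\<in>Basis. pdir (e,0) (pdir (e,0) u) q)"
        using u_pde[of q] by simp
      then show ?thesis
        by (simp add: p2 Basis_time Basis_space wave_kernel_equation[OF f] sum_subtractf)
    qed
    have w0: "w (y, 0) = 0" for y by (simp add: w_def u0 wave_kernel_initial[OF f])
    have w1: "pdir (0,1) w (y, 0) = 0" for y
      using u1[of y] even_time_derivative_0[OF smooth_wave_kernel[OF f] wave_kernel_even[OF f], of y]
      by (simp add: p1 Basis_time)
    \<comment> \<open>The uniqueness lemma runs over nonnegative times; the sign of \<open>t\<close>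
      is the direction \<kappa>.\<close>
    have "w (x, sgn t * \<bar>t\<bar>) = 0"
    proof (cases "t = 0")
      case False
      then show ?thesis
        by (intro wave_zero_data_imp_zero[OF sw pde w0 w1]) (auto simp: sgn_if)
    qed (simp add: w0)
    then show "u p = wave_kernel f p" by (simp add: w_def p sgn_mult_abs)
  qed
  have "(THE u. wave_solution f u) = wave_kernel f" by (rule the_equality) (fact sol, rule uniq)
  then show ?thesis by (auto simp: wave_U_def wave_trace_eq_kernel[OF f])
qed

section \<open>Derivatives of the trace\<close>

text \<open>Space derivatives and pairs of time derivatives pass to the data, so at most one time
  derivative survives in front of a trace. It cannot be absorbed too, because it is odd in
  t.\<close>

lemma iter_pd_wave_trace:
  fixes f :: "(real^'n) \<times> real \<Rightarrow> real"
  assumes f: "f \<in> C0e_tilde" and vs: "vs \<in> lists Basis"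
  shows "\<exists>h\<in>C0e_tilde. iter_pd vs (wave_trace f) = wave_trace h \<or> iter_pd vs (wave_trace f) = pdir (0, 1) (wave_trace h)"
  using vs
proof (induction vs)
  case Nil
  then show ?case using f by auto
next
  case (Cons v vs)
  then obtain h where h: "h \<in> C0e_tilde" and
    alt: "iter_pd vs (wave_trace f) = wave_trace h \<or> iter_pd vs (wave_trace f) = pdir (0, 1) (wave_trace h)" by auto
  have hc: "compact_smooth h" using h by (simp add: C0e_tilde_iff)
  show ?case
  proof (cases "v = (0, 1)")
    case True
    show ?thesis
      using alt h C0e_tilde_laplacian[OF h] by (auto simp: True pdir_wave_trace_time[OF hc])
  next
    case False
    moreover have "v \<in> Basis" using Cons.hyps(1) by simp
    ultimately obtain b where v: "v = (b, 0)" and b: "b \<in> Basis" by (auto simp: Basis_prod_def)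
    have "pdir v (pdir (0, 1) (wave_trace h)) = pdir (0, 1) (wave_trace (pdir v h))"
      unfolding v pdir_wave_trace_space[OF hc b, symmetric]
      by (rule ext) (rule pdir_commute[OF smooth_wave_trace[OF hc] Basis_space[OF b] Basis_time])
    then show ?thesis
      using alt C0e_tilde_space_derivative[OF h b] by (auto simp: v pdir_wave_trace_space[OF hc b])
  qed
qed

text \<open>In the normal form of a derivative, a trace vanishes at t = 0 because its data vanish on
  the hyperplane, and a time derivative of a trace vanishes because the trace is even.\<close>

lemma wave_trace_in_Ce_tilde:
  fixes f :: "(real^'n) \<times> real \<Rightarrow> real"
  assumes f: "f \<in> C0e_tilde"
  shows "wave_trace f \<in> Ce_tilde"
proof -
  have fc: "compact_smooth f" using f by (simp add: C0e_tilde_iff)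
  have "iter_pd vs (wave_trace f) (x, 0) = 0" if vs: "vs \<in> lists Basis" for vs x
  proof -
    obtain h where h: "h \<in> C0e_tilde" and
      alt: "iter_pd vs (wave_trace f) = wave_trace h \<or> iter_pd vs (wave_trace f) = pdir (0, 1) (wave_trace h)"
      using iter_pd_wave_trace[OF f vs] by blast
    have hc: "compact_smooth h" using h by (simp add: C0e_tilde_iff)
    have "\<forall>x. iter_pd [] h (x, 0) = 0" using h unfolding C0e_tilde_iff by blast
    then have "wave_trace h (x, 0) = 0" by (simp add: wave_trace_initial[OF hc])
    moreover have "pdir (0, 1) (wave_trace h) (x, 0) = 0"
      by (rule even_time_derivative_0[OF smooth_wave_trace[OF hc] wave_trace_even[OF hc]])
    ultimately show ?thesis using alt by auto
  qed
  then show ?thesis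
    by (auto simp: Ce_tilde_def smooth_wave_trace[OF fc] even_last_def wave_trace_even[OF fc])
qed

text \<open>An interpolation in the style of Landau: on an interval of length 1 the first derivative
  is bounded by the function and its second derivative, and the latter is the trace of the Laplacian
  of the data.\<close>

lemma wave_trace_derivatives_decay:
  fixes f :: "(real^'n) \<times> real \<Rightarrow> real"
  assumes decay: "\<And>h :: (real^'n) \<times> real \<Rightarrow> real. h \<in> C0e_tilde \<Longrightarrow> \<exists>C. \<forall>x t. \<bar>wave_trace h (x, t)\<bar> \<le> C * (1 + \<bar>t\<bar>) powr (- q)"
    and q: "0 \<le> q" and f: "f \<in> C0e_tilde" and vs: "vs \<in> lists Basis"
  shows "\<exists>C. \<forall>x t. \<bar>iter_pd vs (wave_trace f) (x, t)\<bar> \<le> C * (1 + \<bar>t\<bar>) powr (- q)"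
proof -
  obtain h where h: "h \<in> C0e_tilde" and
    alt: "iter_pd vs (wave_trace f) = wave_trace h \<or> iter_pd vs (wave_trace f) = pdir (0, 1) (wave_trace h)"
    using iter_pd_wave_trace[OF f vs] by blast
  have hc: "compact_smooth h" using h by (simp add: C0e_tilde_iff)
  let ?F = "wave_trace h"
  obtain C where C: "\<And>x t. \<bar>?F (x, t)\<bar> \<le> C * (1 + \<bar>t\<bar>) powr (- q)" using decay[OF h] by blast
  obtain C2 where C2: "\<And>x t. \<bar>pdir (0,1) (pdir (0,1) ?F) (x, t)\<bar> \<le> C2 * (1 + \<bar>t\<bar>) powr (- q)"
    unfolding pdir_wave_trace_time[OF hc] using decay[OF C0e_tilde_laplacian[OF h]] by blast
  have CC: "0 \<le> C" "0 \<le> C2" using C[of 0 0] C2[of 0 0] by (auto intro: order_trans[OF abs_ge_zero])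
  have s: "smooth ?F" by (rule smooth_wave_trace[OF hc])
  \<comment> \<open>For t \<ge> 0 the interval [t, t + 1] lies where the decreasing weight is at
    most its value at t; negative times follow because the derivative is odd.\<close>
  have pos: "\<bar>pdir (0,1) ?F (x, t)\<bar> \<le> (2 * C + C2) * (1 + t) powr (- q)" if t: "0 \<le> t" for x t
  proof -
    have d1: "((\<lambda>t. ?F (x, t)) has_real_derivative pdir (0,1) ?F (x, r)) (at r)" for r
      using time_derivative[OF s, of x 1 r] by simp
    have d2: "((\<lambda>t. pdir (0,1) ?F (x, t)) has_real_derivative pdir (0,1) (pdir (0,1) ?F) (x, r)) (at r)" for r
      using time_derivative[OF smooth_pdir[OF s Basis_time], of x 1 r] by simp
    obtain c where c: "t < c" "c < t + 1" "?F (x, t + 1) - ?F (x, t) = pdir (0,1) ?F (x, c)"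
      using MVT2[of t "t + 1" "\<lambda>t. ?F (x, t)" "\<lambda>t. pdir (0,1) ?F (x, t)"] d1 by auto
    obtain c' where c': "t < c'" "c' < c" "pdir (0,1) ?F (x, c) - pdir (0,1) ?F (x, t) = (c - t) * pdir (0,1) (pdir (0,1) ?F) (x, c')"
      using MVT2[of t c "\<lambda>t. pdir (0,1) ?F (x, t)" "\<lambda>t. pdir (0,1) (pdir (0,1) ?F) (x, t)"] d2 c(1) by auto
    have mono: "(1 + \<bar>r\<bar>) powr (- q) \<le> (1 + t) powr (- q)" if "t \<le> r" for r
      using that t q by (intro powr_mono2') auto
    have 1: "\<bar>?F (x, t + 1)\<bar> \<le> C * (1 + t) powr (- q)" "\<bar>?F (x, t)\<bar> \<le> C * (1 + t) powr (- q)"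
      using order_trans[OF C mult_left_mono[OF mono CC(1)]] by simp_all
    have 2: "\<bar>pdir (0,1) (pdir (0,1) ?F) (x, c')\<bar> \<le> C2 * (1 + t) powr (- q)"
      using order_trans[OF C2 mult_left_mono[OF mono CC(2)]] c' by simp
    have "\<bar>(c - t) * pdir (0,1) (pdir (0,1) ?F) (x, c')\<bar> \<le> \<bar>pdir (0,1) (pdir (0,1) ?F) (x, c')\<bar>"
      using c c' by (simp add: abs_mult mult_left_le_one_le)
    then have "\<bar>pdir (0,1) ?F (x, t)\<bar> \<le> \<bar>?F (x, t + 1)\<bar> + \<bar>?F (x, t)\<bar> + \<bar>pdir (0,1) (pdir (0,1) ?F) (x, c')\<bar>"
      using c(3) c'(3) by linarith
    then show ?thesis using 1 2 by (simp add: algebra_simps)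
  qed
  have "\<bar>pdir (0,1) ?F (x, t)\<bar> \<le> (2 * C + C2) * (1 + \<bar>t\<bar>) powr (- q)" for x t
  proof (cases "0 \<le> t")
    case True
    then show ?thesis using pos[of t x] by simp
  next
    case False
    have "pdir (0,1) ?F (x, - t) = - pdir (0,1) ?F (x, t)"
      using time_derivative_reflection[OF s, of 1 x t] wave_trace_even[OF hc] by simp
    then show ?thesis using pos[of "- t" x] False by simp
  qed
  then show ?thesis using alt C by metis
qed

section \<open>The square root substitution\<close>

text \<open>The case k = 1 is the transform of the theorem. Higher k are needed for smoothness,
  since every derivative in the last variable raises the divisor by \<open>sqrt (snd x)\<close>
  squared.\<close>

definition sqrt_pullback :: "nat \<Rightarrow> ('e \<times> real \<Rightarrow> real) \<Rightarrow> 'e \<times> real \<Rightarrow> real" where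
  "sqrt_pullback k f x = (if snd x > 0 then f (fst x, sqrt (snd x)) / sqrt (snd x) ^ k else 0)"

lemma sqrt_pullback_1: "sqrt_pullback 1 f (x, z) = (if z > 0 then f (x, sqrt z) / sqrt z else 0)"
  by (simp add: sqrt_pullback_def)

lemma sqrt_pullback_nonpos: "z \<le> 0 \<Longrightarrow> sqrt_pullback k f (x, z) = 0"
  by (simp add: sqrt_pullback_def)

text \<open>One power of y beyond the divisor makes the quotient O(sqrt z), hence continuous across
  z = 0.\<close>

lemma continuous_on_sqrt_pullback:
  fixes f :: "'e::euclidean_space \<times> real \<Rightarrow> real"
  assumes f: "continuous_on UNIV f" and K: "\<And>x y. \<bar>f (x, y)\<bar> \<le> K * \<bar>y\<bar> ^ Suc k"
  shows "continuous_on UNIV (sqrt_pullback k f)"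
proof -
  have "isCont (sqrt_pullback k f) (x, z)" for x z
  proof -
    consider "z > 0" | "z < 0" | "z = 0" by linarith
    then show ?thesis
    proof cases
      case 1
      have op: "open {p::'e \<times> real. 0 < snd p}" by (intro open_Collect_less continuous_intros)
      have "continuous_on {p::'e \<times> real. 0 < snd p} (\<lambda>p. f (fst p, sqrt (snd p)) / sqrt (snd p) ^ k)"
        by (intro continuous_intros continuous_on_compose2[OF f]) auto
      then have "continuous_on {p. 0 < snd p} (sqrt_pullback k f)"
        by (rule continuous_on_eq) (simp add: sqrt_pullback_def)
      then show ?thesis using op 1 by (simp add: continuous_on_eq_continuous_at)
    next
      case 2
      have op: "open {p::'e \<times> real. snd p < 0}" by (intro open_Collect_less continuous_intros)
      have "continuous_on {p. snd p < 0} (sqrt_pullback k f)"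
        by (rule continuous_on_eq[OF continuous_on_const[of _ 0]]) (simp add: sqrt_pullback_def)
      then show ?thesis using op 2 by (simp add: continuous_on_eq_continuous_at)
    next
      case 3
      have K0: "0 \<le> K" using K[of 0 1] by (simp add: order_trans[OF abs_ge_zero])
      have le: "\<bar>sqrt_pullback k f p\<bar> \<le> K * sqrt \<bar>snd p\<bar>" for p
      proof (cases "snd p > 0")
        case True
        have "\<bar>sqrt_pullback k f p\<bar> = \<bar>f (fst p, sqrt (snd p))\<bar> / sqrt (snd p) ^ k"
          using True by (simp add: sqrt_pullback_def)
        also have "\<dots> \<le> (K * \<bar>sqrt (snd p)\<bar> ^ Suc k) / sqrt (snd p) ^ k"
          using True by (intro divide_right_mono K) auto
        finally show ?thesis using True by simp
      qed (use K0 in \<open>auto simp: sqrt_pullback_def\<close>)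
      have "((\<lambda>p. K * sqrt \<bar>snd p\<bar>) \<longlongrightarrow> K * sqrt \<bar>snd (x, 0::real)\<bar>) (at (x, 0))"
        by (intro tendsto_intros)
      then have "((\<lambda>p. K * sqrt \<bar>snd p\<bar>) \<longlongrightarrow> 0) (at (x, 0))" by simp
      then have "(sqrt_pullback k f \<longlongrightarrow> 0) (at (x, 0))"
        by (rule Lim_null_comparison[rotated]) (use le in auto)
      then show ?thesis using 3 by (simp add: isCont_def sqrt_pullback_def)
    qed
  qed
  then show ?thesis by (auto simp: continuous_on_eq_continuous_at)
qed

text \<open>\<open>C0e_tilde\<close> without evenness, so that it is closed under single derivatives
  in the last variable as well.\<close>

definition flat_compact_smooth :: "('e::euclidean_space \<times> real \<Rightarrow> real) \<Rightarrow> bool" where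
  "flat_compact_smooth f \<longleftrightarrow> compact_smooth f \<and> (\<forall>vs\<in>lists Basis. \<forall>x. iter_pd vs f (x, 0) = 0)"

lemma flat_compact_smooth_pdir: "flat_compact_smooth f \<Longrightarrow> v \<in> Basis \<Longrightarrow> flat_compact_smooth (pdir v f)"
  using flat_pdir[of f v] by (simp add: flat_compact_smooth_def compact_smooth_pdir)

lemma flat_compact_smooth_0: "flat_compact_smooth f \<Longrightarrow> f (x, 0) = 0"
  unfolding flat_compact_smooth_def by (metis iter_pd.simps(1) lists.Nil)

text \<open>Each use of the mean value theorem between the hyperplane and (x, y) gains one factor
  |y|, and the derivative is flat again.\<close>

lemma flat_compact_smooth_bound:
  assumes "flat_compact_smooth f"
  shows "\<exists>C\<ge>0. \<forall>x y. \<bar>f (x, y)\<bar> \<le> C * \<bar>y\<bar> ^ N"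
  using assms
proof (induction N arbitrary: f)
  case 0
  then show ?case
    using compact_smooth_boundE[of f] unfolding flat_compact_smooth_def real_norm_def
    by (metis less_eq_real_def mult.right_neutral power_0)
next
  case (Suc N)
  obtain C where C: "C \<ge> 0" "\<And>x y. \<bar>pdir (0,1) f (x, y)\<bar> \<le> C * \<bar>y\<bar> ^ N"
    using Suc.IH[OF flat_compact_smooth_pdir[OF Suc.prems Basis_time]] by blast
  have s: "smooth f" using Suc.prems by (simp add: flat_compact_smooth_def compact_smooth_smooth)
  have d: "((\<lambda>t. f (x, t)) has_real_derivative pdir (0,1) f (x, r)) (at r)" for x r
    using time_derivative[OF s, of x 1 r] by simp
  have "\<bar>f (x, y)\<bar> \<le> C * \<bar>y\<bar> ^ Suc N" for x y
  proof (cases "y = 0")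
    case True
    then show ?thesis by (simp add: flat_compact_smooth_0[OF Suc.prems])
  next
    case False
    obtain c where c: "\<bar>c\<bar> \<le> \<bar>y\<bar>" "f (x, y) = y * pdir (0,1) f (x, c)"
    proof (cases "y > 0")
      case True
      obtain c where "0 < c" "c < y" "f (x, y) - f (x, 0) = (y - 0) * pdir (0,1) f (x, c)"
        using MVT2[OF True, of "\<lambda>t. f (x, t)" "\<lambda>t. pdir (0,1) f (x, t)"] d by blast
      then show ?thesis using that[of c] by (simp add: flat_compact_smooth_0[OF Suc.prems])
    next
      case F: False
      then have "y < 0" using False by simp
      then obtain c where "y < c" "c < 0" "f (x, 0) - f (x, y) = (0 - y) * pdir (0,1) f (x, c)"
        using MVT2[of y 0 "\<lambda>t. f (x, t)" "\<lambda>t. pdir (0,1) f (x, t)"] d by blast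
      then show ?thesis using that[of c] by (simp add: flat_compact_smooth_0[OF Suc.prems])
    qed
    have "\<bar>f (x, y)\<bar> \<le> \<bar>y\<bar> * (C * \<bar>c\<bar> ^ N)" unfolding c(2) abs_mult by (intro mult_left_mono C) auto
    also have "\<dots> \<le> \<bar>y\<bar> * (C * \<bar>y\<bar> ^ N)" using c(1) C(1) by (intro mult_left_mono power_mono) auto
    finally show ?thesis by (simp add: mult_ac)
  qed
  then show ?case using C(1) by blast
qed

text \<open>The numerator left by the chain rule for f (x, sqrt z) / sqrt z ^ k once everything is
  put over sqrt z ^ (k + 2). Written with y = sqrt z, it is again smooth and flat in (x, y).\<close>

definition sqrt_derivative :: "nat \<Rightarrow> ('e::euclidean_space \<times> real \<Rightarrow> real) \<Rightarrow> 'e \<times> real \<Rightarrow> real" where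
  "sqrt_derivative k f x = - (real k / 2) * f x + (x \<bullet> (0, 1)) * (1 / 2 * pdir (0, 1) f x)"

lemma flat_coordinate_combination:
  fixes g h :: "'e::euclidean_space \<times> real \<Rightarrow> real"
  assumes "flat_compact_smooth g" "flat_compact_smooth h"
  shows "flat_compact_smooth (\<lambda>x. c * g x + (x \<bullet> (0, 1)) * (d * h x))"
proof -
  have lin: "flat_compact_smooth (\<lambda>x. c * g x)" if "flat_compact_smooth g" for c and g :: "'e \<times> real \<Rightarrow> real"
    using that compact_smooth_bounded_linear[OF bounded_linear_mult_right, of g c]
      iter_pd_bounded_linear[OF bounded_linear_mult_right compact_smooth_smooth, of g _ c]
    by (auto simp: flat_compact_smooth_def)
  have add: "flat_compact_smooth (\<lambda>x. g x + h x)" if "flat_compact_smooth g" "flat_compact_smooth h" for g h :: "'e \<times> real \<Rightarrow> real"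
    using that by (auto simp: flat_compact_smooth_def compact_smooth_add iter_pd_add compact_smooth_smooth)
  have "compact_smooth (\<lambda>x. g x + (x \<bullet> (0, 1)) * h x) \<and> iter_pd vs (\<lambda>x. g x + (x \<bullet> (0, 1)) * h x) (y, 0) = 0"
    if "vs \<in> lists Basis" "flat_compact_smooth g" "flat_compact_smooth h" for vs y and g h :: "'e \<times> real \<Rightarrow> real"
    using that
  \<comment> \<open>The innermost derivative is taken first: it turns the combination into another
    of the same shape, to which the shorter list applies.\<close>
  proof (induction vs arbitrary: g h rule: rev_induct)
    case Nil
    then show ?case
      using compact_smooth_add[OF _ compact_smooth_coordinate_mult[of h "(0, 1)"], of g]
      by (simp add: flat_compact_smooth_0 flat_compact_smooth_def)
  next
    case (snoc v vs)
    have v: "v \<in> Basis" and vs: "vs \<in> lists Basis" using snoc.prems by auto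
    have gs: "compact_smooth g" "compact_smooth h" using snoc.prems by (auto simp: flat_compact_smooth_def)
    have cs: "compact_smooth (\<lambda>x. (x \<bullet> (0, 1)) * h x)"
      using compact_smooth_coordinate_mult[OF gs(2), of "(0,1)"] by simp
    have "pdir v (\<lambda>x. g x + (x \<bullet> (0, 1)) * h x) = (\<lambda>x. (pdir v g x + (v \<bullet> (0,1)) * h x) + (x \<bullet> (0, 1)) * pdir v h x)"
      using pdir_add[OF compact_smooth_smooth[OF gs(1)] compact_smooth_smooth[OF cs] v]
        pdir_coordinate_mult[OF compact_smooth_smooth[OF gs(2)] v, of "(0,1)"] by (simp add: add.assoc)
    then show ?case
      using snoc.IH[OF vs add[OF flat_compact_smooth_pdir[OF snoc.prems(2) v] lin[OF snoc.prems(3), of "v \<bullet> (0,1)"]]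
        flat_compact_smooth_pdir[OF snoc.prems(3) v]] compact_smooth_add[OF gs(1) cs]
      by (simp add: iter_pd_append)
  qed
  note main = this[OF _ lin[OF assms(1), of c] lin[OF assms(2), of d]]
  show ?thesis
    unfolding flat_compact_smooth_def using main[of "[]"] main by simp
qed

lemma flat_sqrt_derivative: "flat_compact_smooth f \<Longrightarrow> flat_compact_smooth (sqrt_derivative k f)"
  unfolding sqrt_derivative_def[abs_def]
  by (rule flat_coordinate_combination) (auto intro: flat_compact_smooth_pdir Basis_time)

lemma sqrt_pullback_space_derivative:
  assumes f: "flat_compact_smooth f" and b: "b \<in> Basis"
  shows "((\<lambda>s. sqrt_pullback k f (p + s *\<^sub>R (b, 0))) has_vector_derivative sqrt_pullback k (pdir (b, 0) f) p) (at 0)"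
proof (cases "snd p > 0")
  case True
  have s: "smooth f" using f by (simp add: flat_compact_smooth_def compact_smooth_smooth)
  have "((\<lambda>s. f (fst p + s *\<^sub>R b, sqrt (snd p))) has_real_derivative pdir (b, 0) f (fst p, sqrt (snd p))) (at 0)"
    by (rule space_derivative[OF s b])
  from DERIV_cdivide[OF this, of "sqrt (snd p) ^ k"] show ?thesis
    using True by (simp add: sqrt_pullback_def has_real_derivative_iff_has_vector_derivative)
next
  case False
  then show ?thesis by (simp add: sqrt_pullback_def)
qed

lemma sqrt_pullback_time_derivative:
  assumes f: "flat_compact_smooth f"
  shows "((\<lambda>s. sqrt_pullback k f (p + s *\<^sub>R (0, 1))) has_vector_derivative sqrt_pullback (k + 2) (sqrt_derivative k f) p) (at 0)"
proof -
  obtain x z where p: "p = (x, z)" using prod.exhaust by blast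
  have s: "smooth f" using f by (simp add: flat_compact_smooth_def compact_smooth_smooth)
  have "((\<lambda>t. sqrt_pullback k f (x, t)) has_real_derivative sqrt_pullback (k + 2) (sqrt_derivative k f) (x, z)) (at z)"
  proof -
    consider "z > 0" | "z < 0" | "z = 0" by linarith
    then show ?thesis
    proof cases
      case 1
      have d1: "((\<lambda>t. f (x, sqrt t)) has_real_derivative pdir (0,1) f (x, sqrt z) * (inverse (sqrt z) / 2)) (at z)"
        using DERIV_chain2[OF _ DERIV_real_sqrt[OF 1], of "\<lambda>t. f (x, t)"] time_derivative[OF s, of x 1 "sqrt z"] by simp
      have d2: "((\<lambda>t. sqrt t ^ k) has_real_derivative real k * (inverse (sqrt z) / 2 * sqrt z ^ (k - Suc 0))) (at z)"
        using DERIV_power[OF DERIV_real_sqrt[OF 1], of k] by simp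
      have r: "sqrt z > 0" using 1 by simp
      have "((\<lambda>t. f (x, sqrt t) / sqrt t ^ k) has_real_derivative
          sqrt_derivative k f (x, sqrt z) / sqrt z ^ (k + 2)) (at z)"
      proof (rule DERIV_cong[OF DERIV_divide[OF d1 d2]])
        show "sqrt z ^ k \<noteq> 0" using r by simp
        show "(pdir (0,1) f (x, sqrt z) * (inverse (sqrt z) / 2) * sqrt z ^ k
            - f (x, sqrt z) * (real k * (inverse (sqrt z) / 2 * sqrt z ^ (k - Suc 0)))) / (sqrt z ^ k * sqrt z ^ k)
            = sqrt_derivative k f (x, sqrt z) / sqrt z ^ (k + 2)"
        proof -
          have gen: "(A * (inverse r / 2) * r ^ k - B * (real k * (inverse r / 2 * r ^ (k - Suc 0)))) / (r ^ k * r ^ k)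
              = (- (real k / 2) * B + r * (1 / 2 * A)) / r ^ (k + 2)" if "r > 0" for r A B :: real
            using that by (cases k) (auto simp: field_simps power2_eq_square)
          show ?thesis unfolding sqrt_derivative_def using gen[OF r] by simp
        qed
      qed
      then have "((\<lambda>t. sqrt_pullback k f (x, t)) has_real_derivative
          sqrt_derivative k f (x, sqrt z) / sqrt z ^ (k + 2)) (at z)"
        by (rule has_field_derivative_transform_within_open[of _ _ _ "{0<..}"]) (use 1 in \<open>auto simp: sqrt_pullback_def\<close>)
      then show ?thesis using 1 by (simp add: sqrt_pullback_def)
    next
      case 2
      have "((\<lambda>t. sqrt_pullback k f (x, t)) has_real_derivative 0) (at z)"
        by (rule has_field_derivative_transform_within_open[of "\<lambda>_. 0" _ _ "{..<0}"]) (use 2 in \<open>auto simp: sqrt_pullback_def\<close>)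
      then show ?thesis using 2 by (simp add: sqrt_pullback_def)
    next
      case 3
      \<comment> \<open>With \<open>k + 4\<close> powers a factor t^2 is left after division by
        \<open>sqrt t ^ k\<close>; the difference quotient at 0 is then O(|h|), and the derivative
        there is 0.\<close>
      obtain C where C: "C \<ge> 0" "\<And>x y. \<bar>f (x, y)\<bar> \<le> C * \<bar>y\<bar> ^ (k + 4)" using flat_compact_smooth_bound[OF f] by blast
      have le: "\<bar>sqrt_pullback k f (x, t)\<bar> \<le> C * t\<^sup>2" for t
      proof (cases "t > 0")
        case True
        have "\<bar>sqrt_pullback k f (x, t)\<bar> = \<bar>f (x, sqrt t)\<bar> / sqrt t ^ k"
          using True by (simp add: sqrt_pullback_def)
        also have "\<dots> \<le> (C * \<bar>sqrt t\<bar> ^ (k + 4)) / sqrt t ^ k"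
          using True by (intro divide_right_mono C) auto
        also have "\<bar>sqrt t\<bar> ^ (k + 4) = ((sqrt t)\<^sup>2)\<^sup>2 * sqrt t ^ k"
          using True power_mult[of "sqrt t" 2 2] by (simp add: power_add)
        also have "C * (((sqrt t)\<^sup>2)\<^sup>2 * sqrt t ^ k) / sqrt t ^ k = C * ((sqrt t)\<^sup>2)\<^sup>2" using True by simp
        finally show ?thesis using True by simp
      qed (use C in \<open>auto simp: sqrt_pullback_def\<close>)
      have "((\<lambda>h. sqrt_pullback k f (x, h) / h) \<longlongrightarrow> 0) (at 0)"
      proof (rule Lim_null_comparison)
        show "\<forall>\<^sub>F h in at 0. norm (sqrt_pullback k f (x, h) / h) \<le> C * \<bar>h\<bar>"
        proof (intro always_eventually allI)
          fix h :: real
          show "norm (sqrt_pullback k f (x, h) / h) \<le> C * \<bar>h\<bar>"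
          proof (cases "h = 0")
            case False
            have "norm (sqrt_pullback k f (x, h) / h) \<le> (C * h\<^sup>2) / \<bar>h\<bar>"
              using divide_right_mono[OF le[of h], of "\<bar>h\<bar>"] by simp
            also have "\<dots> = C * \<bar>h\<bar>" using False by (simp add: power2_eq_square abs_if)
            finally show ?thesis .
          qed simp
        qed
        have "((\<lambda>h::real. C * \<bar>h\<bar>) \<longlongrightarrow> C * \<bar>0\<bar>) (at 0)" by (intro tendsto_intros)
        then show "((\<lambda>h::real. C * \<bar>h\<bar>) \<longlongrightarrow> 0) (at 0)" by simp
      qed
      then show ?thesis unfolding DERIV_def 3 by (simp add: sqrt_pullback_nonpos)
    qed
  qed
  then have "((\<lambda>t. sqrt_pullback k f (x, z + t)) has_real_derivative sqrt_pullback (k + 2) (sqrt_derivative k f) (x, z)) (at 0)"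
    using DERIV_shift[of "\<lambda>t. sqrt_pullback k f (x, t)" _ 0 z] by (simp add: add.commute)
  then show ?thesis by (simp add: p has_real_derivative_iff_has_vector_derivative)
qed

lemma flat_continuous_sqrt_pullback:
  assumes f: "flat_compact_smooth f"
  shows "continuous_on UNIV (sqrt_pullback k f)"
proof -
  obtain C where "\<And>x y. \<bar>f (x, y)\<bar> \<le> C * \<bar>y\<bar> ^ Suc k" using flat_compact_smooth_bound[OF f] by blast
  then show ?thesis
    using f by (intro continuous_on_sqrt_pullback smooth_continuous compact_smooth_smooth) (auto simp: flat_compact_smooth_def)
qed

text \<open>No single exponent is stable under differentiation, but the family over all
  \<open>k\<close> and all flat functions is.\<close>

lemma smooth_sqrt_pullback:
  assumes f: "flat_compact_smooth f"
  shows "smooth (sqrt_pullback k f)"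
proof (rule smooth_coinduct[where P="\<lambda>h. \<exists>k f. flat_compact_smooth f \<and> h = sqrt_pullback k f"])
  fix h :: "'a \<times> real \<Rightarrow> real" assume "\<exists>k f. flat_compact_smooth f \<and> h = sqrt_pullback k f"
  then obtain k f where f: "flat_compact_smooth f" and h: "h = sqrt_pullback k f" by blast
  have "\<exists>f'. (\<exists>k f. flat_compact_smooth f \<and> f' = sqrt_pullback k f) \<and>
      (\<forall>x. ((\<lambda>s. h (x + s *\<^sub>R v)) has_vector_derivative f' x) (at 0))" if v: "v \<in> Basis" for v
  proof (cases "v = (0, 1)")
    case True
    then show ?thesis unfolding h using sqrt_pullback_time_derivative[OF f] flat_sqrt_derivative[OF f] by blast
  next
    case False
    then obtain b where "v = (b, 0)" "b \<in> Basis" using v by (auto simp: Basis_prod_def)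
    then show ?thesis unfolding h using sqrt_pullback_space_derivative[OF f] flat_compact_smooth_pdir[OF f v] by blast
  qed
  then show "continuous_on UNIV h \<and> (\<forall>v\<in>Basis. \<exists>f'. (\<exists>k f. flat_compact_smooth f \<and> f' = sqrt_pullback k f) \<and>
      (\<forall>x. ((\<lambda>s. h (x + s *\<^sub>R v)) has_vector_derivative f' x) (at 0)))"
    unfolding h using flat_continuous_sqrt_pullback[OF f] by blast
qed (use f in blast)

lemma compact_smooth_sqrt_pullback:
  assumes f: "flat_compact_smooth f"
  shows "compact_smooth (sqrt_pullback k f)"
proof -
  obtain R where R: "R > 0" "\<And>x. norm x > R \<Longrightarrow> f x = 0"
    using compact_smooth_supportE[of f] f unfolding flat_compact_smooth_def by metis
  show ?thesis
  \<comment> \<open>On the support |x| \<le> R and sqrt z \<le> R, so z \<le> R^2.\<close>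
  proof (rule compact_smoothI[OF smooth_sqrt_pullback[OF f], of "R + R\<^sup>2"])
    fix p :: "'a \<times> real" assume p: "norm p > R + R\<^sup>2"
    obtain x z where xz: "p = (x, z)" using prod.exhaust by blast
    show "sqrt_pullback k f p = 0"
    proof (rule ccontr)
      assume n: "sqrt_pullback k f p \<noteq> 0"
      then have z: "z > 0" "f (x, sqrt z) \<noteq> 0" by (auto simp: sqrt_pullback_def xz split: if_splits)
      then have le: "norm (x, sqrt z) \<le> R" using R(2) not_less by blast
      have "norm x \<le> R" "\<bar>sqrt z\<bar> \<le> R"
        using order_trans[OF norm_fst_le[of x "sqrt z"] le] order_trans[OF norm_snd_le[of "sqrt z" x] le] by auto
      moreover from this have "z \<le> R\<^sup>2" using z(1) by (metis abs_le_square_iff abs_of_pos R(1) real_sqrt_pow2 less_imp_le)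
      ultimately show False using p norm_Pair_le[of x z] z(1) by (simp add: xz)
    qed
  qed
qed

section \<open>The substitution z = t^2 in Laplace transforms and in the weighted norm\<close>

text \<open>On t > 0 the factor dz / sqrt z equals 2 dt, and evenness unfolds twice the half line
  into the whole line.\<close>

lemma
  fixes h :: "real \<Rightarrow> real"
  assumes h: "h \<in> borel_measurable borel" and even: "\<And>t. h (- t) = h t"
    and int: "integrable lborel (\<lambda>t. exp (- p * complex_of_real (t\<^sup>2)) * of_real (h t))"
  shows laplace_sqrt_substitution:
      "(\<integral>z. exp (- p * complex_of_real z) * of_real (if z > 0 then h (sqrt z) / sqrt z else 0) \<partial>lborel)
        = (\<integral>t. exp (- p * complex_of_real (t\<^sup>2)) * of_real (h t) \<partial>lborel)"
    and integrable_laplace_sqrt_substitution: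
      "integrable lborel (\<lambda>z. exp (- p * complex_of_real z) * of_real (if z > 0 then h (sqrt z) / sqrt z else 0))"
proof -
  define k where "k z = exp (- p * complex_of_real z) * of_real (h (sqrt z) / sqrt z)" for z
  have [measurable]: "k \<in> borel_measurable borel"
    unfolding k_def using h by measurable
  have e: "(exp (- p * complex_of_real z) * of_real (if z > 0 then h (sqrt z) / sqrt z else 0)) = indicator {0<..} z *\<^sub>R k z" for z
    by (simp add: k_def indicator_def)
  have e2: "(indicator {0<..} t * (2 * t)) *\<^sub>R k (t\<^sup>2) = 2 *\<^sub>R (indicator {0<..} t *\<^sub>R (exp (- p * complex_of_real (t\<^sup>2)) * of_real (h t)))" for t
    by (simp add: k_def indicator_def scaleR_conv_of_real)
  have i: "integrable lborel (\<lambda>t. indicator {0<..} t *\<^sub>R (exp (- p * complex_of_real (t\<^sup>2)) * of_real (h t)))"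
    using integrable_mult_indicator[OF _ int, of "{0<..}"] by simp
  show "(\<integral>z. exp (- p * complex_of_real z) * of_real (if z > 0 then h (sqrt z) / sqrt z else 0) \<partial>lborel)
        = (\<integral>t. exp (- p * complex_of_real (t\<^sup>2)) * of_real (h t) \<partial>lborel)"
    unfolding e set_integral_square_substitution[OF \<open>k \<in> borel_measurable borel\<close>] e2 integral_scaleR_right
    by (subst integral_even_function[OF int]) (simp_all only: even power2_minus)
  show "integrable lborel (\<lambda>z. exp (- p * complex_of_real z) * of_real (if z > 0 then h (sqrt z) / sqrt z else 0))"
    unfolding e set_integrable_square_substitution[OF \<open>k \<in> borel_measurable borel\<close>] e2
    by (rule integrable_scaleR_right) (rule i)
qed

lemma nn_integral_even_function:
  fixes h :: "real \<Rightarrow> ennreal"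
  assumes [measurable]: "h \<in> borel_measurable borel" and even: "\<And>t. h (- t) = h t"
  shows "(\<integral>\<^sup>+t. h t \<partial>lborel) = 2 * (\<integral>\<^sup>+t\<in>{0<..}. h t \<partial>lborel)"
proof -
  have "(\<integral>\<^sup>+t. h t \<partial>lborel) = (\<integral>\<^sup>+t. h t * indicator {0<..} t + h t * indicator {..<0} t \<partial>lborel)"
  proof (rule nn_integral_cong_AE)
    show "AE t in lborel. h t = h t * indicator {0<..} t + h t * indicator {..<0} t"
      using AE_lborel_singleton[of 0] by eventually_elim (auto split: split_indicator)
  qed
  also have "\<dots> = (\<integral>\<^sup>+t\<in>{0<..}. h t \<partial>lborel) + (\<integral>\<^sup>+t\<in>{..<0}. h t \<partial>lborel)"
    by (rule nn_integral_add) auto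
  also have "(\<integral>\<^sup>+t\<in>{..<0}. h t \<partial>lborel) = (\<integral>\<^sup>+t. h (0 + - 1 * t) * indicator {..<0} (0 + - 1 * t) \<partial>lborel)"
    by (subst nn_integral_real_affine[where c="- 1" and t=0]) auto
  also have "\<dots> = (\<integral>\<^sup>+t\<in>{0<..}. h t \<partial>lborel)"
    by (intro nn_integral_cong) (auto simp: even split: split_indicator)
  finally show ?thesis by (simp add: mult_2)
qed

text \<open>Since (f / y)^2 (2 y) = 2 f^2 / y on y > 0, the weighted space becomes an ordinary L^2
  space on the half space; the factor 2 is the evenness of \<open>f\<close>.\<close>

lemma nn_integral_sqrt_pullback:
  fixes f :: "'e::euclidean_space \<times> real \<Rightarrow> real"
  assumes f: "f \<in> borel_measurable borel" and even: "\<And>x t. f (x, - t) = f (x, t)"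
  shows "(\<integral>\<^sup>+x. ennreal ((f x)\<^sup>2 / \<bar>snd x\<bar>) \<partial>lborel) = (\<integral>\<^sup>+x. ennreal ((sqrt_pullback 1 f x)\<^sup>2) \<partial>lborel)"
proof -
  note [measurable] = f
  have m: "(\<lambda>x. ennreal ((f x)\<^sup>2 / \<bar>snd x\<bar>)) \<in> borel_measurable (lborel \<Otimes>\<^sub>M lborel)"
      "(\<lambda>x. ennreal ((sqrt_pullback 1 f x)\<^sup>2)) \<in> borel_measurable (lborel \<Otimes>\<^sub>M lborel)"
  proof -
    have [measurable]: "(snd :: 'e \<times> real \<Rightarrow> real) \<in> borel_measurable borel"
      by (intro borel_measurable_continuous_onI continuous_intros)
    have 1: "(\<lambda>x. ennreal ((f x)\<^sup>2 / \<bar>snd x\<bar>)) \<in> borel_measurable (borel \<Otimes>\<^sub>M borel)"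
      unfolding borel_prod by measurable
    have "(\<lambda>x::'e \<times> real. f (fst x, sqrt (snd x))) \<in> borel_measurable borel"
      by (rule measurable_compose[OF _ f], rule borel_measurable_continuous_onI) (intro continuous_intros)
    moreover have "(\<lambda>x::'e \<times> real. sqrt (snd x)) \<in> borel_measurable borel"
      by (intro borel_measurable_continuous_onI continuous_intros)
    ultimately have 2: "(\<lambda>x. ennreal ((sqrt_pullback 1 f x)\<^sup>2)) \<in> borel_measurable (borel \<Otimes>\<^sub>M borel)"
      unfolding borel_prod sqrt_pullback_def[abs_def] by measurable
    show "(\<lambda>x. ennreal ((f x)\<^sup>2 / \<bar>snd x\<bar>)) \<in> borel_measurable (lborel \<Otimes>\<^sub>M lborel)"
      "(\<lambda>x. ennreal ((sqrt_pullback 1 f x)\<^sup>2)) \<in> borel_measurable (lborel \<Otimes>\<^sub>M lborel)"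
      using 1 2 by (simp_all cong: measurable_cong_sets)
  qed
  have fx[measurable]: "(\<lambda>t. f (x, t)) \<in> borel_measurable borel" for x
    by (rule measurable_compose[OF _ f], rule borel_measurable_continuous_onI) (intro continuous_intros)
  have "(\<integral>\<^sup>+t. ennreal ((f (x, t))\<^sup>2 / \<bar>t\<bar>) \<partial>lborel) = (\<integral>\<^sup>+t. ennreal ((sqrt_pullback 1 f (x, t))\<^sup>2) \<partial>lborel)" for x
  proof -
    have "(\<integral>\<^sup>+t. ennreal ((sqrt_pullback 1 f (x, t))\<^sup>2) \<partial>lborel) = (\<integral>\<^sup>+t\<in>{0<..}. ennreal ((f (x, sqrt t) / sqrt t)\<^sup>2) \<partial>lborel)"
      by (intro nn_integral_cong) (auto simp: sqrt_pullback_def split: split_indicator)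
    also have "\<dots> = (\<integral>\<^sup>+y\<in>{0<..}. ennreal ((f (x, sqrt (y\<^sup>2)) / sqrt (y\<^sup>2))\<^sup>2) * ennreal (2 * y) \<partial>lborel)"
      by (rule nn_integral_square_substitution) measurable
    also have "\<dots> = (\<integral>\<^sup>+y. 2 * (ennreal ((f (x, y))\<^sup>2 / \<bar>y\<bar>) * indicator {0<..} y) \<partial>lborel)"
    proof (intro nn_integral_cong)
      fix y :: real
      have "ennreal ((f (x, y) / y)\<^sup>2) * ennreal (2 * y) = 2 * ennreal ((f (x, y))\<^sup>2 / y)" if "y > 0"
      proof -
        have "ennreal ((f (x, y) / y)\<^sup>2) * ennreal (2 * y) = ennreal ((f (x, y) / y)\<^sup>2 * (2 * y))"
          using that by (intro ennreal_mult[symmetric]) auto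
        also have "(f (x, y) / y)\<^sup>2 * (2 * y) = 2 * ((f (x, y))\<^sup>2 / y)" using that by (simp add: power2_eq_square field_simps)
        also have "ennreal (2 * ((f (x, y))\<^sup>2 / y)) = 2 * ennreal ((f (x, y))\<^sup>2 / y)"
          using that by (subst ennreal_mult) auto
        finally show ?thesis .
      qed
      then show "ennreal ((f (x, sqrt (y\<^sup>2)) / sqrt (y\<^sup>2))\<^sup>2) * ennreal (2 * y) * indicator {0<..} y
          = 2 * (ennreal ((f (x, y))\<^sup>2 / \<bar>y\<bar>) * indicator {0<..} y)"
        by (auto split: split_indicator)
    qed
    also have "\<dots> = 2 * (\<integral>\<^sup>+y\<in>{0<..}. ennreal ((f (x, y))\<^sup>2 / \<bar>y\<bar>) \<partial>lborel)"
      by (rule nn_integral_cmult) measurable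
    also have "\<dots> = (\<integral>\<^sup>+t. ennreal ((f (x, t))\<^sup>2 / \<bar>t\<bar>) \<partial>lborel)"
      by (rule nn_integral_even_function[symmetric]) (auto simp: even)
    finally show ?thesis by simp
  qed
  then show ?thesis
    using lborel.nn_integral_fst[OF m(1)] lborel.nn_integral_fst[OF m(2)] by (simp add: lborel_prod)
qed

section \<open>The solution operator as a Fourier multiplier\<close>

lemma AE_snd_neq_0: "AE x::'e::euclidean_space \<times> real in lborel. snd x \<noteq> 0"
proof -
  have "negligible {x::'e \<times> real. x \<bullet> (0, 1) = 0}"
    by (rule negligible_standard_hyperplane) (rule Basis_time)
  then have "{x::'e \<times> real. x \<bullet> (0, 1) = 0} \<in> null_sets lebesgue"
    by (simp add: negligible_iff_null_sets)
  moreover have "{x::'e \<times> real. x \<bullet> (0, 1) = 0} \<in> sets lborel"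
    by (simp add: borel_closed closed_Collect_eq continuous_on_inner continuous_on_id)
  ultimately have "{x::'e \<times> real. x \<bullet> (0, 1) = 0} \<in> null_sets lborel"
    by (simp add: null_sets_completion_iff)
  then show ?thesis by (rule AE_I') (auto simp: inner_prod_def)
qed

lemma continuous_on_UNIV_imp_isCont: "continuous_on UNIV f \<Longrightarrow> isCont f x"
  by (simp add: continuous_on_eq_continuous_at)

text \<open>Inversion p \<mapsto> 1 / p preserves the right half plane. The bound holds up to the
  imaginary axis and makes the passage to it a matter of domination.\<close>

lemma norm_exp_quotient_le_1: "0 \<le> Re p \<Longrightarrow> norm (exp (- complex_of_real (r\<^sup>2) / (4 * p))) \<le> 1"
  by (simp add: Re_divide complex_eq_iff divide_nonneg_nonneg mult_nonneg_nonneg)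

text \<open>The Gaussian average of cis (t |\<xi>|) over t and that of cis (v . \<xi>) over the
  whole space depend on \<xi> through the same factor exp (- |\<xi>|^2 / (4 p)). They differ by the
  number of Gaussian variables only, hence by \<open>gaussian_const p ^ DIM('e)\<close>.
  Superposition over \<xi> gives the claim.\<close>

lemma
  fixes f :: "'e::euclidean_space \<times> real \<Rightarrow> real"
  assumes f: "compact_smooth f" and p: "0 < Re p"
  shows laplace_wave_trace: "gaussian_const p ^ DIM('e) * (\<integral>t. exp (- p * complex_of_real (t\<^sup>2)) * of_real (wave_trace f (x, t)) \<partial>lborel)
      = (\<integral>v. exp (- p * complex_of_real ((norm v)\<^sup>2)) * of_real (f ((x, 0) + v)) \<partial>lborel)"
    and integrable_laplace_wave_trace:
      "integrable lborel (\<lambda>t. exp (- p * complex_of_real (t\<^sup>2)) * of_real (wave_trace f (x, t)))"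
proof -
  let ?a = "wave_amplitude f"
  let ?\<theta> = "\<lambda>\<xi>::'e \<times> real. (fst \<xi>, norm \<xi>)"
  define W where "W t = (\<integral>\<xi>. ?a \<xi> * cis ((x, t) \<bullet> ?\<theta> \<xi>) \<partial>lborel)" for t
  have ia: "integrable lborel ?a" by (intro rapidly_decreasing_integrable rapidly_decreasing_wave_amplitude f)
  have ig: "integrable lborel (\<lambda>t::real. exp (- p * complex_of_real (t\<^sup>2)))"
    using integrable_complex_gaussian_moment[OF p, of 0] by simp
  have iv: "integrable lborel (\<lambda>v::'e \<times> real. exp (- p * complex_of_real ((norm v)\<^sup>2)))"
    by (rule integrable_complex_gaussian[OF p])
  have m1: "(\<lambda>z. cis ((x, fst z) \<bullet> ?\<theta> (snd z))) \<in> borel_measurable borel"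
    by (intro measurable_cis_continuous continuous_intros)
  note sw1 = integral_bounded_kernel_swap[OF ig ia, where h="\<lambda>t \<xi>. cis ((x, t) \<bullet> ?\<theta> \<xi>)" and C=1, OF m1]
  have iW: "integrable lborel (\<lambda>t. exp (- p * complex_of_real (t\<^sup>2)) * W t)"
    unfolding W_def by (rule sw1(2)) simp
  have inner: "(\<integral>t. exp (- p * complex_of_real (t\<^sup>2)) * cis ((x, t) \<bullet> ?\<theta> \<xi>) \<partial>lborel)
      = cis (x \<bullet> fst \<xi>) * (gaussian_const p * exp (- complex_of_real ((norm \<xi>)\<^sup>2) / (4 * p)))" for \<xi>
  proof -
    have "cis ((x, t) \<bullet> ?\<theta> \<xi>) = cis (x \<bullet> fst \<xi>) * cis (- (t * (- norm \<xi>)))" for t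
      by (simp add: cis_mult)
    then have "(\<integral>t. exp (- p * complex_of_real (t\<^sup>2)) * cis ((x, t) \<bullet> ?\<theta> \<xi>) \<partial>lborel)
        = (\<integral>t. cis (x \<bullet> fst \<xi>) * (exp (- p * complex_of_real (t\<^sup>2)) * cis (- (t * (- norm \<xi>)))) \<partial>lborel)"
      by (simp only: mult_ac)
    also have "\<dots> = cis (x \<bullet> fst \<xi>) * (\<integral>t. exp (- p * complex_of_real (t\<^sup>2)) * cis (- (t * (- norm \<xi>))) \<partial>lborel)"
      by (rule integral_mult_right_zero)
    finally show ?thesis unfolding complex_gaussian_fourier_real[OF p] by simp
  qed
  have inner2: "(\<integral>v. exp (- p * complex_of_real ((norm v)\<^sup>2)) * cis (((x, 0) + v) \<bullet> \<xi>) \<partial>lborel)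
      = cis (x \<bullet> fst \<xi>) * (gaussian_const p ^ DIM('e \<times> real) * exp (- complex_of_real ((norm \<xi>)\<^sup>2) / (4 * p)))" for \<xi> :: "'e \<times> real"
  proof -
    have "cis (((x, 0) + v) \<bullet> \<xi>) = cis (x \<bullet> fst \<xi>) * cis (- (v \<bullet> (- \<xi>)))" for v :: "'e \<times> real"
      by (cases \<xi>, cases v) (simp add: cis_mult inner_add_left add_ac)
    then have "(\<integral>v. exp (- p * complex_of_real ((norm v)\<^sup>2)) * cis (((x, 0) + v) \<bullet> \<xi>) \<partial>lborel)
        = (\<integral>v. cis (x \<bullet> fst \<xi>) * (exp (- p * complex_of_real ((norm v)\<^sup>2)) * cis (- (v \<bullet> (- \<xi>)))) \<partial>lborel)"
      by (simp only: mult_ac)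
    also have "\<dots> = cis (x \<bullet> fst \<xi>) * (\<integral>v. exp (- p * complex_of_real ((norm v)\<^sup>2)) * cis (- (v \<bullet> (- \<xi>))) \<partial>lborel)"
      by (rule integral_mult_right_zero)
    finally show ?thesis unfolding complex_gaussian_fourier[OF p] by simp
  qed
  have m2: "(\<lambda>z::('e \<times> real) \<times> ('e \<times> real). cis (((x, 0) + fst z) \<bullet> snd z)) \<in> borel_measurable borel"
    by (intro measurable_cis_continuous continuous_intros)
  have "gaussian_const p ^ DIM('e) * (\<integral>t. exp (- p * complex_of_real (t\<^sup>2)) * W t \<partial>lborel)
      = gaussian_const p ^ DIM('e) * (\<integral>\<xi>. ?a \<xi> * (cis (x \<bullet> fst \<xi>) * (gaussian_const p * exp (- complex_of_real ((norm \<xi>)\<^sup>2) / (4 * p)))) \<partial>lborel)"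
    unfolding W_def by (subst sw1(1)) (simp_all only: inner norm_cis order_refl)
  also have "\<dots> = (\<integral>\<xi>. gaussian_const p ^ DIM('e) * (?a \<xi> * (cis (x \<bullet> fst \<xi>) * (gaussian_const p * exp (- complex_of_real ((norm \<xi>)\<^sup>2) / (4 * p))))) \<partial>lborel)"
    by (rule integral_mult_right_zero[symmetric])
  also have "\<dots> = (\<integral>\<xi>. ?a \<xi> * (\<integral>v. exp (- p * complex_of_real ((norm v)\<^sup>2)) * cis (((x, 0) + v) \<bullet> \<xi>) \<partial>lborel) \<partial>lborel)"
    unfolding inner2 by (intro Bochner_Integration.integral_cong refl) (simp add: mult_ac)
  also have "\<dots> = (\<integral>v. exp (- p * complex_of_real ((norm v)\<^sup>2)) * (\<integral>\<xi>. ?a \<xi> * cis (((x, 0) + v) \<bullet> \<xi>) \<partial>lborel) \<partial>lborel)"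
    by (rule integral_bounded_kernel_swap(1)[OF iv ia, where h="\<lambda>v \<xi>. cis (((x, 0) + v) \<bullet> \<xi>)" and C=1, OF m2, symmetric]) simp
  also have "\<dots> = (\<integral>v. exp (- p * complex_of_real ((norm v)\<^sup>2)) * of_real (f ((x, 0) + v)) \<partial>lborel)"
    unfolding wave_amplitude_inversion[OF f] ..
  finally have 1: "gaussian_const p ^ DIM('e) * (\<integral>t. exp (- p * complex_of_real (t\<^sup>2)) * W t \<partial>lborel)
      = (\<integral>v. exp (- p * complex_of_real ((norm v)\<^sup>2)) * of_real (f ((x, 0) + v)) \<partial>lborel)" .
  \<comment> \<open>\<open>W\<close> is the complex integral whose real part is the trace. The real
    part is half the sum over t and - t, and both halves contribute equally because the Gaussian is
    even.\<close>
  have e: "exp (- p * complex_of_real (t\<^sup>2)) * of_real (wave_trace f (x, t))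
      = (exp (- p * complex_of_real (t\<^sup>2)) * W t + exp (- p * complex_of_real ((- t)\<^sup>2)) * W (- t)) / 2" for t
    unfolding of_real_wave_trace[OF f] W_def oscillatory_def by (simp add: field_simps)
  have mW: "(\<lambda>t. exp (- p * complex_of_real (t\<^sup>2)) * W t) \<in> borel_measurable borel" using iW by auto
  have iW': "integrable lborel (\<lambda>t. exp (- p * complex_of_real ((- t)\<^sup>2)) * W (- t))"
    using lborel_integrable_scale[of "- 1", OF _ mW] iW by simp
  show "integrable lborel (\<lambda>t. exp (- p * complex_of_real (t\<^sup>2)) * of_real (wave_trace f (x, t)))"
    unfolding e using iW iW' by simp
  have "(\<integral>t. exp (- p * complex_of_real (t\<^sup>2)) * of_real (wave_trace f (x, t)) \<partial>lborel)
      = ((\<integral>t. exp (- p * complex_of_real (t\<^sup>2)) * W t \<partial>lborel) + (\<integral>t. exp (- p * complex_of_real ((- t)\<^sup>2)) * W (- t) \<partial>lborel)) / 2"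
    unfolding e using iW iW' by (subst integral_divide_zero, subst Bochner_Integration.integral_add) auto
  also have "(\<integral>t. exp (- p * complex_of_real ((- t)\<^sup>2)) * W (- t) \<partial>lborel) = (\<integral>t. exp (- p * complex_of_real (t\<^sup>2)) * W t \<partial>lborel)"
    by (rule lborel_integral_uminus[OF mW])
  finally show "gaussian_const p ^ DIM('e) * (\<integral>t. exp (- p * complex_of_real (t\<^sup>2)) * of_real (wave_trace f (x, t)) \<partial>lborel)
      = (\<integral>v. exp (- p * complex_of_real ((norm v)\<^sup>2)) * of_real (f ((x, 0) + v)) \<partial>lborel)"
    using 1 by simp
qed

definition time_laplace :: "('e::euclidean_space \<times> real \<Rightarrow> real) \<Rightarrow> complex \<Rightarrow> 'e \<Rightarrow> complex" where
  "time_laplace g p y = (\<integral>z. exp (- p * complex_of_real z) * of_real (g (y, z)) \<partial>lborel)"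

context
  fixes f :: "'e::euclidean_space \<times> real \<Rightarrow> real"
  assumes f: "flat_compact_smooth f" and ev: "\<And>x y. f (x, - y) = f (x, y)"
begin

lemma fc: "compact_smooth f" using f by (simp add: flat_compact_smooth_def)

lemma gc: "compact_smooth (sqrt_pullback 1 f)" by (rule compact_smooth_sqrt_pullback[OF f])

text \<open>The Gaussian factors over v = (w, y), and its y-part is the Laplace kernel exp (- p z)
  at z = y^2.\<close>

lemma gaussian_integral_time_laplace:
  assumes p: "0 < Re p"
  shows "(\<integral>v. exp (- p * complex_of_real ((norm v)\<^sup>2)) * of_real (f ((x, 0) + v)) \<partial>lborel)
    = (\<integral>w. exp (- p * complex_of_real ((norm w)\<^sup>2)) * time_laplace (sqrt_pullback 1 f) p (x + w) \<partial>lborel)"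
proof -
  obtain C where C: "\<And>x. norm (f x) \<le> C" using compact_smooth_boundE[OF fc] by metis
  have cf: "continuous_on UNIV f" by (intro smooth_continuous compact_smooth_smooth fc)
  have i: "integrable lborel (\<lambda>v. exp (- p * complex_of_real ((norm v)\<^sup>2)) * of_real (f ((x, 0) + v)))"
  proof (rule integrable_bounded_mult[OF integrable_complex_gaussian[OF p], where C=C])
    have "continuous_on UNIV (\<lambda>v. complex_of_real (f ((x, 0) + v)))"
      by (intro continuous_intros continuous_on_compose2[OF cf]) auto
    then show "(\<lambda>v. complex_of_real (f ((x, 0) + v))) \<in> borel_measurable lborel"
      unfolding measurable_lborel2 by (rule borel_measurable_continuous_onI)
  qed (use C in simp)
  have "(\<integral>y. exp (- p * complex_of_real ((norm (w, y))\<^sup>2)) * of_real (f ((x, 0) + (w, y))) \<partial>lborel)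
      = exp (- p * complex_of_real ((norm w)\<^sup>2)) * time_laplace (sqrt_pullback 1 f) p (x + w)" for w
  proof -
    have fw: "continuous_on UNIV (\<lambda>y. f (x + w, y))"
      by (intro continuous_on_compose2[OF cf] continuous_intros) auto
    have "integrable lborel (\<lambda>y::real. exp (- p * complex_of_real (y\<^sup>2)) * of_real (f (x + w, y)))"
      using integrable_complex_gaussian_moment[OF p, of 0] C
      by (intro integrable_bounded_mult[where C=C]) (auto intro!: borel_measurable_continuous_onI continuous_intros fw)
    from laplace_sqrt_substitution[OF borel_measurable_continuous_onI[OF fw] ev this]
    have L: "time_laplace (sqrt_pullback 1 f) p (x + w) = (\<integral>y. exp (- p * complex_of_real (y\<^sup>2)) * of_real (f (x + w, y)) \<partial>lborel)"
      unfolding time_laplace_def sqrt_pullback_1 .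
    have "exp (- p * complex_of_real ((norm (w, y))\<^sup>2)) = exp (- p * complex_of_real ((norm w)\<^sup>2)) * exp (- p * complex_of_real (y\<^sup>2))" for y
      by (simp add: norm_prod_def exp_add[symmetric] algebra_simps)
    then show ?thesis unfolding L by (simp add: mult.assoc)
  qed
  then show ?thesis unfolding integral_lborel_pair[OF i] by simp
qed

text \<open>Inversion in the space variable at fixed \<open>p\<close>: the Laplace transform is
  continuous with bounded support in \<open>y\<close>, and \<open>fourier_laplace_decay\<close>
  makes its Fourier transform integrable.\<close>

lemma
  assumes p: "0 \<le> Re p" "Re p \<le> 1"
  shows time_laplace_inversion: "(\<integral>\<xi>. fourier_laplace (\<lambda>x. complex_of_real (sqrt_pullback 1 f x)) \<xi> p * cis (y \<bullet> \<xi>) \<partial>lborel)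
      = of_real ((2 * pi) ^ DIM('e)) * time_laplace (sqrt_pullback 1 f) p y"
    and integrable_fourier_laplace_space:
      "integrable lborel (\<lambda>\<xi>. fourier_laplace (\<lambda>x. complex_of_real (sqrt_pullback 1 f x)) \<xi> p)"
proof -
  let ?g = "\<lambda>x. complex_of_real (sqrt_pullback 1 f x)"
  have cg: "compact_smooth ?g" by (rule compact_smooth_of_real[OF gc])
  have cont: "continuous_on UNIV ?g" by (intro smooth_continuous compact_smooth_smooth cg)
  obtain C R where CR: "C > 0" "R > 0" "\<And>x. norm x > R \<Longrightarrow> ?g x = 0" "\<And>x. norm (?g x) \<le> C"
    using compact_smooth_boundE[OF cg] by metis
  have bd: "norm (exp (- p * complex_of_real z) * ?g (y, z)) \<le> C * exp R * indicator {- R..R} z" for y z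
  proof (cases "\<bar>z\<bar> \<le> R")
    case True
    then have "- (Re p * z) \<le> R"
      using mult_mono[of "Re p" 1 "\<bar>z\<bar>" R] p CR(2) abs_mult[of "Re p" z] by auto
    then have "exp (- (Re p * z)) * norm (?g (y, z)) \<le> exp R * C" by (intro mult_mono CR) auto
    then show ?thesis using True by (simp add: norm_mult mult.commute indicator_def abs_le_iff)
  next
    case False
    then have "?g (y, z) = 0" using CR(3)[of "(y, z)"] norm_snd_le[of z y] by simp
    then show ?thesis using CR by simp
  qed
  have iw: "integrable lborel (\<lambda>z::real. C * exp R * indicator {- R..R} z)"
    by (intro integrable_mult_right integrable_real_indicator) (auto simp: emeasure_lborel_Icc_eq)
  have tc: "continuous_on UNIV (time_laplace (sqrt_pullback 1 f) p)"
    unfolding time_laplace_def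
  proof (rule continuous_on_integral_dominated)
    show "continuous_on UNIV (\<lambda>y. exp (- p * complex_of_real z) * ?g (y, z))" for z
      by (intro continuous_intros continuous_on_compose2[OF cont]) auto
    have "continuous_on UNIV (\<lambda>z. exp (- p * complex_of_real z) * ?g (y, z))" for y
      by (intro continuous_intros continuous_on_compose2[OF cont]) auto
    then show "(\<lambda>z. exp (- p * complex_of_real z) * ?g (y, z)) \<in> borel_measurable lborel" for y
      unfolding measurable_lborel2 by (rule borel_measurable_continuous_onI)
    show "\<exists>w d. 0 < d \<and> integrable lborel w \<and> (\<forall>y\<in>UNIV. dist y y0 < d \<longrightarrow>
        (\<forall>z\<in>space lborel. norm (exp (- p * complex_of_real z) * ?g (y, z)) \<le> w z))" for y0
      using bd iw by (intro exI[of _ "\<lambda>z. C * exp R * indicator {- R..R} z"] exI[of _ 1]) auto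
  qed
  have t0: "time_laplace (sqrt_pullback 1 f) p y = 0" if "norm y > R" for y
  proof -
    have "sqrt_pullback 1 f (y, z) = 0" for z using CR(3)[of "(y, z)"] norm_fst_le[of y z] that by simp
    then show ?thesis by (simp add: time_laplace_def)
  qed
  have F: "fourier (time_laplace (sqrt_pullback 1 f) p) \<xi> = fourier_laplace ?g \<xi> p" for \<xi>
  proof -
    have "fourier_laplace ?g \<xi> p = (\<integral>y. (\<integral>z. ?g (y, z) * (exp (- p * of_real z) * cis (- (y \<bullet> \<xi>))) \<partial>lborel) \<partial>lborel)"
      unfolding fourier_laplace_def by (subst integral_lborel_pair[OF fourier_laplace_integrable[OF cg]]) simp
    also have "\<dots> = (\<integral>y. (\<integral>z. (exp (- p * complex_of_real z) * ?g (y, z)) * cis (- (y \<bullet> \<xi>)) \<partial>lborel) \<partial>lborel)"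
      by (simp only: mult_ac)
    finally show ?thesis by (simp add: fourier_def time_laplace_def inner_commute)
  qed
  have it: "integrable lborel (time_laplace (sqrt_pullback 1 f) p)"
    by (rule integrable_continuous_bounded_support[OF tc t0])
  obtain B where B: "\<And>y. norm (time_laplace (sqrt_pullback 1 f) p y) \<le> B * indicator (cball 0 R) y" "B > 0"
    using bounded_continuous_bounded_support[OF tc t0] by blast
  have Bn: "norm (time_laplace (sqrt_pullback 1 f) p y) \<le> B" for y
    using B(1)[of y] B(2) by (cases "norm y \<le> R") auto
  obtain D where D: "\<And>\<xi> p. 0 \<le> Re p \<Longrightarrow> Re p \<le> 1 \<Longrightarrow>
      (1 + (norm \<xi>)\<^sup>2 + (norm p)\<^sup>2) ^ DIM('e) * norm (fourier_laplace ?g \<xi> p) \<le> D"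
    using fourier_laplace_decay[OF cg] by blast
  show i: "integrable lborel (\<lambda>\<xi>. fourier_laplace ?g \<xi> p)"
  proof (rule Bochner_Integration.integrable_bound)
    show "integrable lborel (\<lambda>\<xi>::'e. D * (1 / (1 + (norm \<xi>)\<^sup>2) ^ DIM('e)))"
      by (intro integrable_mult_right integrable_polynomial_weight order_refl)
    show "(\<lambda>\<xi>. fourier_laplace ?g \<xi> p) \<in> borel_measurable lborel"
      unfolding F[symmetric] using borel_measurable_continuous_onI[OF continuous_on_fourier[OF it]] by simp
    show "AE \<xi> in lborel. norm (fourier_laplace ?g \<xi> p) \<le> norm (D * (1 / (1 + (norm \<xi>)\<^sup>2) ^ DIM('e)))"
    proof (rule AE_I2)
      fix \<xi> :: 'e
      have pos: "0 < (1 + (norm \<xi>)\<^sup>2) ^ DIM('e)" by (simp add: add_pos_nonneg)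
      have "(1 + (norm \<xi>)\<^sup>2) ^ DIM('e) * norm (fourier_laplace ?g \<xi> p) \<le> (1 + (norm \<xi>)\<^sup>2 + (norm p)\<^sup>2) ^ DIM('e) * norm (fourier_laplace ?g \<xi> p)"
        by (intro mult_right_mono power_mono) auto
      also have "\<dots> \<le> D" by (rule D[OF p])
      finally have "norm (fourier_laplace ?g \<xi> p) \<le> D * (1 / (1 + (norm \<xi>)\<^sup>2) ^ DIM('e))"
        using pos by (simp add: field_simps)
      then show "norm (fourier_laplace ?g \<xi> p) \<le> norm (D * (1 / (1 + (norm \<xi>)\<^sup>2) ^ DIM('e)))"
        unfolding real_norm_def by (meson abs_ge_self order_trans)
    qed
  qed
  show "(\<integral>\<xi>. fourier_laplace ?g \<xi> p * cis (y \<bullet> \<xi>) \<partial>lborel)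
      = of_real ((2 * pi) ^ DIM('e)) * time_laplace (sqrt_pullback 1 f) p y"
    unfolding F[symmetric] by (rule fourier_inversion[OF it tc Bn i[folded F]])
qed

text \<open>Averaging cis over DIM('e) Gaussian variables yields
  \<open>gaussian_const p ^ DIM('e)\<close>, exactly the power in \<open>laplace_wave_trace\<close>.
  The cancellation, possible since the constant is nonzero, leaves a pure exponential as symbol in
  every dimension.\<close>

lemma laplace_wave_trace_multiplier:
  assumes p: "0 < Re p" "Re p \<le> 1"
  shows "of_real ((2 * pi) ^ DIM('e)) * (\<integral>t. exp (- p * complex_of_real (t\<^sup>2)) * of_real (wave_trace f (x, t)) \<partial>lborel)
    = (\<integral>\<xi>. fourier_laplace (\<lambda>x. complex_of_real (sqrt_pullback 1 f x)) \<xi> p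
        * exp (- complex_of_real ((norm \<xi>)\<^sup>2) / (4 * p)) * cis (x \<bullet> \<xi>) \<partial>lborel)"
proof -
  let ?\<Lambda> = "\<lambda>\<xi>. fourier_laplace (\<lambda>x. complex_of_real (sqrt_pullback 1 f x)) \<xi> p"
  have p': "0 \<le> Re p" using p by simp
  have g0: "gaussian_const p \<noteq> 0" using gaussian_const_square[OF p(1)] p(1) by auto
  have ig: "integrable lborel (\<lambda>w::'e. exp (- p * complex_of_real ((norm w)\<^sup>2)))"
    by (rule integrable_complex_gaussian[OF p(1)])
  have m: "(\<lambda>z::'e \<times> 'e. cis ((x + fst z) \<bullet> snd z)) \<in> borel_measurable borel"
    by (intro measurable_cis_continuous continuous_intros)
  have inner: "(\<integral>w. exp (- p * complex_of_real ((norm w)\<^sup>2)) * cis ((x + w) \<bullet> \<xi>) \<partial>lborel)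
      = cis (x \<bullet> \<xi>) * (gaussian_const p ^ DIM('e) * exp (- complex_of_real ((norm \<xi>)\<^sup>2) / (4 * p)))" for \<xi> :: 'e
  proof -
    have "cis ((x + w) \<bullet> \<xi>) = cis (x \<bullet> \<xi>) * cis (- (w \<bullet> (- \<xi>)))" for w
      by (simp add: cis_mult inner_add_left)
    then have "(\<integral>w. exp (- p * complex_of_real ((norm w)\<^sup>2)) * cis ((x + w) \<bullet> \<xi>) \<partial>lborel)
        = (\<integral>w. cis (x \<bullet> \<xi>) * (exp (- p * complex_of_real ((norm w)\<^sup>2)) * cis (- (w \<bullet> (- \<xi>)))) \<partial>lborel)"
      by (simp only: mult_ac)
    also have "\<dots> = cis (x \<bullet> \<xi>) * (\<integral>w. exp (- p * complex_of_real ((norm w)\<^sup>2)) * cis (- (w \<bullet> (- \<xi>))) \<partial>lborel)"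
      by (rule integral_mult_right_zero)
    finally show ?thesis unfolding complex_gaussian_fourier[OF p(1)] by simp
  qed
  have "gaussian_const p ^ DIM('e) * (of_real ((2 * pi) ^ DIM('e)) * (\<integral>t. exp (- p * complex_of_real (t\<^sup>2)) * of_real (wave_trace f (x, t)) \<partial>lborel))
      = of_real ((2 * pi) ^ DIM('e)) * (\<integral>w. exp (- p * complex_of_real ((norm w)\<^sup>2)) * time_laplace (sqrt_pullback 1 f) p (x + w) \<partial>lborel)"
    unfolding gaussian_integral_time_laplace[OF p(1), symmetric] laplace_wave_trace[OF fc p(1), symmetric] by (simp only: mult_ac)
  also have "\<dots> = (\<integral>w. exp (- p * complex_of_real ((norm w)\<^sup>2)) * (\<integral>\<xi>. ?\<Lambda> \<xi> * cis ((x + w) \<bullet> \<xi>) \<partial>lborel) \<partial>lborel)"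
    unfolding time_laplace_inversion[OF p' p(2)] integral_mult_right_zero[symmetric] by (simp only: mult_ac)
  also have "\<dots> = (\<integral>\<xi>. ?\<Lambda> \<xi> * (\<integral>w. exp (- p * complex_of_real ((norm w)\<^sup>2)) * cis ((x + w) \<bullet> \<xi>) \<partial>lborel) \<partial>lborel)"
    by (rule integral_bounded_kernel_swap(1)[OF ig integrable_fourier_laplace_space[OF p' p(2)], where C=1, OF m]) simp
  also have "\<dots> = (\<integral>\<xi>. gaussian_const p ^ DIM('e) * (?\<Lambda> \<xi> * exp (- complex_of_real ((norm \<xi>)\<^sup>2) / (4 * p)) * cis (x \<bullet> \<xi>)) \<partial>lborel)"
    unfolding inner by (intro Bochner_Integration.integral_cong refl) (simp add: mult_ac)
  also have "\<dots> = gaussian_const p ^ DIM('e) * (\<integral>\<xi>. ?\<Lambda> \<xi> * exp (- complex_of_real ((norm \<xi>)\<^sup>2) / (4 * p)) * cis (x \<bullet> \<xi>) \<partial>lborel)"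
    by (rule integral_mult_right_zero)
  finally show ?thesis using g0 by simp
qed

text \<open>The trace is not compactly supported, so flatness must be made uniform in x differently:
  value and first time derivative vanish at t = 0, and the second is bounded by the mass of an
  amplitude. Two powers suffice for a continuous and bounded pullback.\<close>

lemma wave_trace_quadratic_bound: "\<exists>K\<ge>0. \<forall>x t. \<bar>wave_trace f (x, t)\<bar> \<le> K * \<bar>t\<bar> ^ Suc 1"
proof -
  let ?F = "wave_trace f"
  define K where "K = (\<integral>\<xi>. norm (wave_amplitude (laplacian f) \<xi>) \<partial>lborel)"
  have lc: "compact_smooth (laplacian f)"
    unfolding laplacian_def[abs_def] by (intro compact_smooth_sum compact_smooth_pdir fc) auto
  have K: "\<bar>pdir (0,1) (pdir (0,1) ?F) p\<bar> \<le> K" for p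
    unfolding pdir_wave_trace_time[OF fc] K_def by (rule wave_trace_bounded[OF lc])
  have K0: "K \<ge> 0" by (simp add: K_def)
  have s: "smooth ?F" by (rule smooth_wave_trace[OF fc])
  have pos: "\<bar>?F (x, t)\<bar> \<le> K * t\<^sup>2" if t: "t > 0" for x t
  proof -
    have d1: "((\<lambda>t. ?F (x, t)) has_real_derivative pdir (0,1) ?F (x, r)) (at r)" for r
      using time_derivative[OF s, of x 1 r] by simp
    have d2: "((\<lambda>t. pdir (0,1) ?F (x, t)) has_real_derivative pdir (0,1) (pdir (0,1) ?F) (x, r)) (at r)" for r
      using time_derivative[OF smooth_pdir[OF s Basis_time], of x 1 r] by simp
    have F0: "?F (x, 0) = 0" by (simp add: wave_trace_initial[OF fc] flat_compact_smooth_0[OF f])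
    have F1: "pdir (0,1) ?F (x, 0) = 0" by (rule even_time_derivative_0[OF s wave_trace_even[OF fc]])
    obtain c where c: "0 < c" "c < t" "?F (x, t) = t * pdir (0,1) ?F (x, c)"
      using MVT2[OF t, of "\<lambda>t. ?F (x, t)" "\<lambda>t. pdir (0,1) ?F (x, t)"] d1 F0 by auto
    obtain c' where c': "0 < c'" "c' < c" "pdir (0,1) ?F (x, c) = c * pdir (0,1) (pdir (0,1) ?F) (x, c')"
      using MVT2[OF c(1), of "\<lambda>t. pdir (0,1) ?F (x, t)" "\<lambda>t. pdir (0,1) (pdir (0,1) ?F) (x, t)"] d2 F1 by auto
    have "\<bar>?F (x, t)\<bar> = t * (c * \<bar>pdir (0,1) (pdir (0,1) ?F) (x, c')\<bar>)"
      using t c c' by (simp add: abs_mult)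
    also have "\<dots> \<le> t * (t * K)" using t c K K0 by (intro mult_left_mono mult_mono) auto
    finally show ?thesis by (simp add: power2_eq_square mult_ac)
  qed
  have "\<bar>?F (x, t)\<bar> \<le> K * \<bar>t\<bar> ^ Suc 1" for x t
  proof -
    consider "t > 0" | "t < 0" | "t = 0" by linarith
    then show ?thesis
    proof cases
      case 1
      then show ?thesis using pos[of t x] by (simp add: power2_eq_square)
    next
      case 2
      then show ?thesis using pos[of "- t" x] wave_trace_even[OF fc, of x t] by (simp add: power2_eq_square)
    next
      case 3
      then show ?thesis by (simp add: wave_trace_initial[OF fc] flat_compact_smooth_0[OF f])
    qed
  qed
  then show ?thesis using K0 by blast
qed

lemma continuous_on_pulled_back_trace: "continuous_on UNIV (sqrt_pullback 1 (wave_trace f))"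
proof -
  obtain K where "\<And>x t. \<bar>wave_trace f (x, t)\<bar> \<le> K * \<bar>t\<bar> ^ Suc 1" using wave_trace_quadratic_bound by blast
  then show ?thesis by (rule continuous_on_sqrt_pullback[OF smooth_continuous[OF smooth_wave_trace[OF fc]]])
qed

lemma pulled_back_trace_bounded: "\<exists>B\<ge>0. \<forall>p. \<bar>sqrt_pullback 1 (wave_trace f) p\<bar> \<le> B"
proof -
  obtain K where K: "K \<ge> 0" "\<And>x t. \<bar>wave_trace f (x, t)\<bar> \<le> K * \<bar>t\<bar> ^ Suc 1" using wave_trace_quadratic_bound by blast
  define A where "A = (\<integral>\<xi>. norm (wave_amplitude f \<xi>) \<partial>lborel)"
  have A: "\<bar>wave_trace f p\<bar> \<le> A" for p unfolding A_def by (rule wave_trace_bounded[OF fc])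
  have A0: "A \<ge> 0" by (simp add: A_def)
  have "\<bar>sqrt_pullback 1 (wave_trace f) (x, t)\<bar> \<le> K + A" for x t
  proof (cases "t > 0")
    case True
    then have e: "\<bar>sqrt_pullback 1 (wave_trace f) (x, t)\<bar> = \<bar>wave_trace f (x, sqrt t)\<bar> / sqrt t" by (simp add: sqrt_pullback_def)
    show ?thesis
    proof (cases "t \<ge> 1")
      case t1: True
      then have "\<bar>wave_trace f (x, sqrt t)\<bar> / sqrt t \<le> A / 1" by (intro frac_le A A0) auto
      then show ?thesis using e K by simp
    next
      case False
      have "\<bar>wave_trace f (x, sqrt t)\<bar> / sqrt t \<le> K * \<bar>sqrt t\<bar> ^ Suc 1 / sqrt t" using True by (intro divide_right_mono K) auto
      also have "\<dots> = K * sqrt t"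
      proof -
        have "K * \<bar>s\<bar> ^ Suc 1 / s = K * s" if "s > 0" for s :: real using that by simp
        from this[of "sqrt t"] show ?thesis using True by (simp only: real_sqrt_gt_zero)
      qed
      also have "\<dots> \<le> K * 1" using False K by (intro mult_left_mono) auto
      finally show ?thesis using e A0 by simp
    qed
  qed (use K A0 in \<open>simp add: sqrt_pullback_nonpos\<close>)
  then show ?thesis using K A0 by (intro exI[of _ "K + A"]) auto
qed

section \<open>Spectrum of the pulled-back trace\<close>

text \<open>The symbol exp (- |\<xi>|^2 / (4 p)) at p = i \<sigma>. On the null set \<sigma> = 0
  division by zero sets the phase to 0.\<close>

definition trace_spectrum :: "'e \<times> real \<Rightarrow> complex" where
  "trace_spectrum \<zeta> = fourier (\<lambda>x. complex_of_real (sqrt_pullback 1 f x)) \<zeta> * cis ((norm (fst \<zeta>))\<^sup>2 / (4 * snd \<zeta>))"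

lemma norm_trace_spectrum: "norm (trace_spectrum \<zeta>) = norm (fourier (\<lambda>x. complex_of_real (sqrt_pullback 1 f x)) \<zeta>)"
  by (simp add: trace_spectrum_def norm_mult)

lemma measurable_trace_spectrum: "trace_spectrum \<in> borel_measurable borel"
proof -
  have 1: "fourier (\<lambda>x. complex_of_real (sqrt_pullback 1 f x)) \<in> borel_measurable borel"
    by (intro borel_measurable_continuous_onI continuous_on_fourier compact_smooth_integrable compact_smooth_of_real gc)
  have 2: "(\<lambda>\<zeta>::'e \<times> real. (norm (fst \<zeta>))\<^sup>2) \<in> borel_measurable borel" "(\<lambda>\<zeta>::'e \<times> real. 4 * snd \<zeta>) \<in> borel_measurable borel"
    by (intro borel_measurable_continuous_onI continuous_intros)+
  have 3: "cis \<in> borel_measurable borel" by (intro borel_measurable_continuous_onI continuous_on_cis continuous_on_id)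
  have "(\<lambda>\<zeta>::'e \<times> real. cis ((norm (fst \<zeta>))\<^sup>2 / (4 * snd \<zeta>))) \<in> borel_measurable borel"
    by (rule measurable_compose[OF borel_measurable_divide[OF 2] 3])
  with 1 show ?thesis unfolding trace_spectrum_def[abs_def] by (rule borel_measurable_times)
qed

lemma rapidly_decreasing_trace_spectrum: "rapidly_decreasing trace_spectrum"
  using rapidly_decreasing_fourier[OF compact_smooth_of_real[OF gc]] measurable_trace_spectrum
  unfolding rapidly_decreasing_def norm_trace_spectrum by blast

lemma AE_isCont_trace_spectrum: "AE \<zeta> in lborel. isCont trace_spectrum \<zeta>"
  using AE_snd_neq_0
proof eventually_elim
  case (elim \<zeta>)
  have "isCont (fourier (\<lambda>x. complex_of_real (sqrt_pullback 1 f x))) \<zeta>"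
    by (intro continuous_on_UNIV_imp_isCont continuous_on_fourier compact_smooth_integrable compact_smooth_of_real gc)
  moreover have "isCont (\<lambda>\<zeta>::'e \<times> real. cis ((norm (fst \<zeta>))\<^sup>2 / (4 * snd \<zeta>))) \<zeta>"
  proof -
    have "isCont (\<lambda>\<zeta>::'e \<times> real. (norm (fst \<zeta>))\<^sup>2 / (4 * snd \<zeta>)) \<zeta>" using elim by (intro continuous_intros) auto
    moreover have "isCont cis r" for r
      using continuous_on_cis[OF continuous_on_id, of UNIV] by (simp add: continuous_on_eq_continuous_at)
    ultimately show ?thesis by (rule isCont_o2)
  qed
  ultimately show ?case unfolding trace_spectrum_def[abs_def] by (rule continuous_mult)
qed

text \<open>Integrability of the pullback in \<tau> is not known, so it is damped by exp (- e
  \<tau>). The Fourier transform in \<tau> is then the Laplace transform on the line Re p = e, where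
  the multiplier formula holds. After inversion, e tends to 0 on both sides.\<close>

theorem pulled_back_trace_representation:
  "of_real ((2 * pi) ^ DIM('e \<times> real)) * of_real (sqrt_pullback 1 (wave_trace f) (x, \<tau>))
    = (\<integral>\<zeta>. trace_spectrum \<zeta> * cis ((x, \<tau>) \<bullet> \<zeta>) \<partial>lborel)"
proof -
  let ?g = "\<lambda>x. complex_of_real (sqrt_pullback 1 f x)"
  let ?G = "sqrt_pullback 1 (wave_trace f)"
  let ?n = "DIM('e \<times> real)"
  have cg: "compact_smooth ?g" by (rule compact_smooth_of_real[OF gc])
  \<comment> \<open>The point e + i s on the line Re p = e.\<close>
  define P where "P e s = Complex e s" for e s
  define H where "H e \<zeta> = fourier_laplace ?g (fst \<zeta>) (P e (snd \<zeta>)) * exp (- complex_of_real ((norm (fst \<zeta>))\<^sup>2) / (4 * P e (snd \<zeta>)))" for e and \<zeta> :: "'e \<times> real"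
  obtain D where D: "\<And>\<xi> p. 0 \<le> Re p \<Longrightarrow> Re p \<le> 1 \<Longrightarrow>
      (1 + (norm \<xi>)\<^sup>2 + (norm p)\<^sup>2) ^ ?n * norm (fourier_laplace ?g \<xi> p) \<le> D"
    using fourier_laplace_decay[OF cg] by blast
  define w where "w \<zeta> = D * (1 / (1 + (norm \<zeta>)\<^sup>2) ^ ?n)" for \<zeta> :: "'e \<times> real"
  have iw: "integrable lborel w" unfolding w_def by (intro integrable_mult_right integrable_polynomial_weight order_refl)
  \<comment> \<open>A majorant independent of \<open>e\<close>: the decay is uniform in the strip
    and the symbol has modulus at most 1.\<close>
  have Hw: "norm (H e \<zeta>) \<le> w \<zeta>" if e: "0 \<le> e" "e \<le> 1" for e \<zeta>
  proof -
    have pos: "0 < (1 + (norm \<zeta>)\<^sup>2) ^ ?n" by (simp add: add_pos_nonneg)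
    let ?L = "norm (fourier_laplace ?g (fst \<zeta>) (P e (snd \<zeta>)))"
    have n: "(norm \<zeta>)\<^sup>2 \<le> (norm (fst \<zeta>))\<^sup>2 + (norm (P e (snd \<zeta>)))\<^sup>2"
      by (simp add: P_def norm_prod_def cmod_power2)
    have "(1 + (norm \<zeta>)\<^sup>2) ^ ?n * ?L \<le> (1 + (norm (fst \<zeta>))\<^sup>2 + (norm (P e (snd \<zeta>)))\<^sup>2) ^ ?n * ?L"
      using n by (intro mult_right_mono power_mono) auto
    also have "\<dots> \<le> D" by (rule D) (use e in \<open>auto simp: P_def\<close>)
    finally have "?L \<le> w \<zeta>" using pos by (simp add: w_def field_simps)
    moreover have "norm (H e \<zeta>) \<le> ?L * 1"
      unfolding H_def norm_mult using e by (intro mult_left_mono norm_exp_quotient_le_1) (auto simp: P_def)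
    ultimately show ?thesis by simp
  qed
  have Hc: "continuous_on UNIV (H e)" if e: "0 < e" "e \<le> 1" for e
  proof -
    have Pc: "continuous_on UNIV (\<lambda>\<zeta>::'e \<times> real. P e (snd \<zeta>))"
      unfolding P_def Complex_eq by (intro continuous_intros)
    have "continuous_on UNIV (\<lambda>\<zeta>::'e \<times> real. (\<lambda>z. fourier_laplace ?g (fst z) (snd z)) (fst \<zeta>, P e (snd \<zeta>)))"
      by (rule continuous_on_compose2[OF continuous_on_fourier_laplace[OF cg]])
        (use e in \<open>auto intro!: continuous_intros Pc simp: P_def\<close>)
    moreover have "4 * P e s \<noteq> 0" for s using e by (auto simp: P_def complex_eq_iff)
    ultimately show ?thesis unfolding H_def by (intro continuous_intros Pc) auto
  qed
  have Hm: "H e \<in> borel_measurable borel" if e: "0 < e" "e \<le> 1" for e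
    by (rule borel_measurable_continuous_onI[OF Hc[OF that]])
  have eq: "of_real ((2 * pi) ^ ?n) * (exp (- of_real (e * \<tau>)) * of_real (?G (x, \<tau>))) = (\<integral>\<zeta>. H e \<zeta> * cis ((x, \<tau>) \<bullet> \<zeta>) \<partial>lborel)"
    if e: "0 < e" "e \<le> 1" for e \<tau>
  proof -
    \<comment> \<open>The pullback vanishes for \<tau> \<le> 0 and is bounded, so the damped
      function is bounded; integrability comes from the Gaussian-weighted trace.\<close>
    define q where "q \<tau> = exp (- of_real (e * \<tau>)) * complex_of_real (?G (x, \<tau>))" for \<tau>
    have qc: "continuous_on UNIV q"
      unfolding q_def by (intro continuous_intros continuous_on_compose2[OF continuous_on_pulled_back_trace]) auto
    have Gx: "?G (x, z) = (if z > 0 then wave_trace f (x, sqrt z) / sqrt z else 0)" for z by (simp add: sqrt_pullback_def)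
    have wm: "(\<lambda>t. wave_trace f (x, t)) \<in> borel_measurable borel"
      by (intro borel_measurable_continuous_onI continuous_on_compose2[OF smooth_continuous[OF smooth_wave_trace[OF fc]]] continuous_intros) auto
    have RP: "0 < Re (P e s)" "Re (P e s) \<le> 1" for s using e by (auto simp: P_def)
    note Lsub = laplace_sqrt_substitution[OF wm wave_trace_even[OF fc] integrable_laplace_wave_trace[OF fc RP(1)]]
      integrable_laplace_sqrt_substitution[OF wm wave_trace_even[OF fc] integrable_laplace_wave_trace[OF fc RP(1)]]
    have qi: "integrable lborel q"
      using Lsub(2)[of 0] unfolding q_def Gx by (simp add: P_def complex_of_real_def[symmetric])
    obtain B where B: "B \<ge> 0" "\<And>p. \<bar>?G p\<bar> \<le> B" using pulled_back_trace_bounded by blast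
    have qb: "norm (q \<tau>) \<le> B" for \<tau>
    proof (cases "\<tau> > 0")
      case True
      have "norm (q \<tau>) = exp (- (e * \<tau>)) * \<bar>?G (x, \<tau>)\<bar>" by (simp add: q_def norm_mult)
      also have "\<dots> \<le> 1 * B" using True e by (intro mult_mono B) auto
      finally show ?thesis by simp
    qed (use B in \<open>simp add: q_def sqrt_pullback_nonpos\<close>)
    have qF: "of_real ((2 * pi) ^ DIM('e)) * fourier q s = (\<integral>\<xi>. H e (\<xi>, s) * cis (x \<bullet> \<xi>) \<partial>lborel)" for s
    proof -
      have "exp (- P e s * complex_of_real z) = exp (- of_real (e * z)) * cis (- (s * z))" for z
        by (simp add: P_def Complex_eq cis_conv_exp exp_add[symmetric] algebra_simps)
      then have "fourier q s = (\<integral>z. exp (- P e s * complex_of_real z) * of_real (?G (x, z)) \<partial>lborel)"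
        unfolding fourier_def q_def by (simp add: mult_ac)
      also have "\<dots> = (\<integral>t. exp (- P e s * complex_of_real (t\<^sup>2)) * of_real (wave_trace f (x, t)) \<partial>lborel)"
        unfolding Gx by (rule Lsub(1))
      finally show ?thesis
        unfolding H_def by (simp only: laplace_wave_trace_multiplier[OF RP] fst_conv snd_conv)
    qed
    have i2: "integrable lborel (\<lambda>\<zeta>. H e \<zeta> * cis (x \<bullet> fst \<zeta>))"
      and i3: "integrable lborel (\<lambda>\<zeta>. H e \<zeta> * cis ((x, \<tau>) \<bullet> \<zeta>))" for \<tau>
    proof -
      have iH: "integrable lborel (H e)"
      proof (rule Bochner_Integration.integrable_bound[OF iw])
        show "AE \<zeta> in lborel. norm (H e \<zeta>) \<le> norm (w \<zeta>)"
          using order_trans[OF Hw abs_ge_self] e by (intro AE_I2) simp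
      qed (use Hm[OF e] in simp)
      show "integrable lborel (\<lambda>\<zeta>. H e \<zeta> * cis (x \<bullet> fst \<zeta>))" "integrable lborel (\<lambda>\<zeta>. H e \<zeta> * cis ((x, \<tau>) \<bullet> \<zeta>))"
        by (rule integrable_bounded_mult[OF iH, where C=1]; auto intro!: measurable_cis_continuous continuous_intros)+
    qed
    have FL: "fourier q = (\<lambda>s. (\<integral>\<xi>. H e (\<xi>, s) * cis (x \<bullet> \<xi>) \<partial>lborel) / of_real ((2 * pi) ^ DIM('e)))"
      unfolding qF[symmetric] by (simp add: fun_eq_iff)
    have "integrable lborel (fourier q)"
      unfolding FL using integrable_lborel_snd[OF i2] by simp
    from fourier_inversion[OF qi qc qb this, of \<tau>]
    have "of_real ((2 * pi) ^ DIM('e)) * (of_real (2 * pi) * q \<tau>) = of_real ((2 * pi) ^ DIM('e)) * (\<integral>s. fourier q s * cis (\<tau> * s) \<partial>lborel)"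
      by simp
    also have "\<dots> = (\<integral>s. of_real ((2 * pi) ^ DIM('e)) * (fourier q s * cis (\<tau> * s)) \<partial>lborel)"
      by (rule integral_mult_right_zero[symmetric])
    also have "\<dots> = (\<integral>s. (\<integral>\<xi>. H e (\<xi>, s) * cis (x \<bullet> \<xi>) \<partial>lborel) * cis (\<tau> * s) \<partial>lborel)"
      unfolding mult.assoc[symmetric] qF ..
    also have "\<dots> = (\<integral>s. (\<integral>\<xi>. H e (\<xi>, s) * cis ((x, \<tau>) \<bullet> (\<xi>, s)) \<partial>lborel) \<partial>lborel)"
      by (subst integral_mult_left_zero[symmetric]) (simp add: cis_mult[symmetric] mult.assoc)
    also have "\<dots> = (\<integral>\<zeta>. H e \<zeta> * cis ((x, \<tau>) \<bullet> \<zeta>) \<partial>lborel)"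
      by (rule integral_lborel_pair_swap[OF i3, symmetric])
    finally show ?thesis by (simp add: q_def mult_ac)
  qed
  define e where "e k = inverse (real (Suc k))" for k
  have e: "e \<longlonglongrightarrow> 0" "\<And>k. 0 < e k" "\<And>k. e k \<le> 1"
    unfolding e_def using LIMSEQ_inverse_real_of_nat by (auto simp: inverse_le_1_iff)
  have "(\<lambda>k. \<integral>\<zeta>. H (e k) \<zeta> * cis ((x, \<tau>) \<bullet> \<zeta>) \<partial>lborel) \<longlonglongrightarrow> (\<integral>\<zeta>. trace_spectrum \<zeta> * cis ((x, \<tau>) \<bullet> \<zeta>) \<partial>lborel)"
  proof (rule integral_dominated_convergence[where w=w])
    show "AE \<zeta> in lborel. (\<lambda>k. H (e k) \<zeta> * cis ((x, \<tau>) \<bullet> \<zeta>)) \<longlonglongrightarrow> trace_spectrum \<zeta> * cis ((x, \<tau>) \<bullet> \<zeta>)"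
      using AE_snd_neq_0
    proof eventually_elim
      case (elim \<zeta>)
      have Pl: "(\<lambda>k. P (e k) (snd \<zeta>)) \<longlonglongrightarrow> P 0 (snd \<zeta>)"
      proof -
        have "P r s = of_real r + \<i> * of_real s" for r s by (simp add: P_def Complex_eq)
        then show ?thesis using e(1) by (simp only:) (intro tendsto_intros)
      qed
      have P0: "P 0 (snd \<zeta>) = \<i> * of_real (snd \<zeta>)" by (simp add: P_def Complex_eq)
      have "(\<lambda>k. (\<lambda>z. fourier_laplace ?g (fst z) (snd z)) (fst \<zeta>, P (e k) (snd \<zeta>)))
          \<longlonglongrightarrow> (\<lambda>z. fourier_laplace ?g (fst z) (snd z)) (fst \<zeta>, P 0 (snd \<zeta>))"
        by (rule continuous_on_tendsto_compose[OF continuous_on_fourier_laplace[OF cg]])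
          (intro tendsto_Pair tendsto_const Pl, use e in \<open>auto simp: P_def less_imp_le\<close>)
      then have "(\<lambda>k. H (e k) \<zeta>) \<longlonglongrightarrow> H 0 \<zeta>"
        unfolding H_def by (intro tendsto_intros Pl) (use elim in \<open>auto simp: P0\<close>)
      moreover have "H 0 \<zeta> = trace_spectrum \<zeta>"
      proof -
        have "- complex_of_real ((norm (fst \<zeta>))\<^sup>2) / (4 * (\<i> * of_real (snd \<zeta>))) = \<i> * of_real ((norm (fst \<zeta>))\<^sup>2 / (4 * snd \<zeta>))"
          using elim by (simp add: field_simps)
        then show ?thesis
          using fourier_eq_fourier_laplace[of ?g "fst \<zeta>" "snd \<zeta>"]
          by (simp add: H_def trace_spectrum_def P0 cis_conv_exp)
      qed
      ultimately show ?case by (intro tendsto_mult_right) simp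
    qed
    have "(\<lambda>\<zeta>. cis ((x, \<tau>) \<bullet> \<zeta>)) \<in> borel_measurable borel" by (intro measurable_cis_continuous continuous_intros)
    then show "(\<lambda>\<zeta>. H (e k) \<zeta> * cis ((x, \<tau>) \<bullet> \<zeta>)) \<in> borel_measurable lborel" for k
      using Hm[OF e(2,3)] by simp
    show "(\<lambda>\<zeta>. trace_spectrum \<zeta> * cis ((x, \<tau>) \<bullet> \<zeta>)) \<in> borel_measurable lborel"
      using measurable_trace_spectrum \<open>(\<lambda>\<zeta>. cis ((x, \<tau>) \<bullet> \<zeta>)) \<in> borel_measurable borel\<close> by simp
    show "AE \<zeta> in lborel. norm (H (e k) \<zeta> * cis ((x, \<tau>) \<bullet> \<zeta>)) \<le> w \<zeta>" for k
      using Hw[of "e k"] e(2,3)[of k] by (simp add: norm_mult less_imp_le)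
  qed (rule iw)
  moreover have "(\<lambda>k. \<integral>\<zeta>. H (e k) \<zeta> * cis ((x, \<tau>) \<bullet> \<zeta>) \<partial>lborel)
      \<longlonglongrightarrow> of_real ((2 * pi) ^ ?n) * (exp (- of_real (0 * \<tau>)) * of_real (?G (x, \<tau>)))"
    unfolding eq[OF e(2,3), symmetric] by (intro tendsto_intros e)
  ultimately show ?thesis by (simp add: LIMSEQ_unique)
qed

text \<open>The factor (2 pi)^n of the representation cancels against the one from inverting \<phi>,
  so the density demanded by \<open>sobolev\<close> is \<open>trace_spectrum\<close> itself. Its
  modulus is that of the transform of a test function, which beats every power of the
  weight.\<close>

theorem sobolev_pulled_back_trace: "sobolev s (sqrt_pullback 1 (wave_trace f))"
  unfolding sobolev_def
proof (intro conjI exI[of _ trace_spectrum] allI impI)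
  let ?G = "sqrt_pullback 1 (wave_trace f)"
  let ?n = "DIM('e \<times> real)"
  let ?g = "fourier (\<lambda>x. complex_of_real (sqrt_pullback 1 f x))"
  have rg: "rapidly_decreasing ?g" by (rule rapidly_decreasing_fourier[OF compact_smooth_of_real[OF gc]])
  show "trace_spectrum \<in> borel_measurable lborel" using measurable_trace_spectrum by simp
  obtain N :: nat where N: "s \<le> real N" using real_arch_simple by blast
  obtain C where C: "\<And>\<xi>. (1 + (norm \<xi>)\<^sup>2) ^ 0 * norm (?g \<xi>) \<le> C"
    using rg unfolding rapidly_decreasing_def by blast
  have C0: "0 \<le> C" using order_trans[OF norm_ge_zero, of "?g 0" C] C[of 0] by simp
  show "(\<integral>\<^sup>+\<zeta>. ennreal ((1 + (norm \<zeta>)\<^sup>2) powr s * (cmod (trace_spectrum \<zeta>))\<^sup>2) \<partial>lborel) < \<infinity>"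
  proof -
    have "(\<integral>\<^sup>+\<zeta>. ennreal ((1 + (norm \<zeta>)\<^sup>2) powr s * (cmod (trace_spectrum \<zeta>))\<^sup>2) \<partial>lborel)
        \<le> (\<integral>\<^sup>+\<zeta>. ennreal (C * ((1 + (norm \<zeta>)\<^sup>2) ^ N * norm (?g \<zeta>))) \<partial>lborel)"
    proof (intro nn_integral_mono ennreal_leI)
      fix \<zeta> :: "'e \<times> real"
      have "(1 + (norm \<zeta>)\<^sup>2) powr s \<le> (1 + (norm \<zeta>)\<^sup>2) powr real N" using N by (intro powr_mono) auto
      also have "\<dots> = (1 + (norm \<zeta>)\<^sup>2) ^ N" by (simp add: powr_realpow add_pos_nonneg)
      finally have "(1 + (norm \<zeta>)\<^sup>2) powr s * (norm (?g \<zeta>) * norm (?g \<zeta>)) \<le> (1 + (norm \<zeta>)\<^sup>2) ^ N * (C * norm (?g \<zeta>))"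
        using C[of \<zeta>] C0 by (intro mult_mono) auto
      then show "(1 + (norm \<zeta>)\<^sup>2) powr s * (cmod (trace_spectrum \<zeta>))\<^sup>2 \<le> C * ((1 + (norm \<zeta>)\<^sup>2) ^ N * norm (?g \<zeta>))"
        by (simp add: norm_trace_spectrum power2_eq_square mult_ac)
    qed
    also have "\<dots> < \<infinity>"
    proof -
      have "integrable lborel (\<lambda>\<zeta>. C * ((1 + (norm \<zeta>)\<^sup>2) ^ N * norm (?g \<zeta>)))"
        by (intro integrable_mult_right rapidly_decreasing_integrable_weight rg)
      then show ?thesis using C0 by (subst nn_integral_eq_integral) auto
    qed
    finally show ?thesis .
  qed
  obtain B where B: "B \<ge> 0" "\<And>p. \<bar>?G p\<bar> \<le> B" using pulled_back_trace_bounded by blast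
  have Gm: "(\<lambda>x. complex_of_real (?G x)) \<in> borel_measurable borel"
    by (intro borel_measurable_continuous_onI continuous_intros continuous_on_pulled_back_trace)
  fix \<phi> :: "'e \<times> real \<Rightarrow> complex" assume "test_fun \<phi>"
  then have \<phi>: "compact_smooth \<phi>" by (simp add: test_fun_iff_compact_smooth)
  have i\<phi>: "integrable lborel (fourier \<phi>)" by (intro rapidly_decreasing_integrable rapidly_decreasing_fourier \<phi>)
  show "integrable lborel (\<lambda>x. complex_of_real (?G x) * fourier \<phi> x)"
    using integrable_bounded_mult[OF i\<phi>, of "\<lambda>x. complex_of_real (?G x)" B] Gm B by (simp add: mult.commute)
  let ?c = "complex_of_real ((2 * pi) ^ ?n)"
  have "?c * (\<integral>x. complex_of_real (?G x) * fourier \<phi> x \<partial>lborel) = (\<integral>x. ?c * (complex_of_real (?G x) * fourier \<phi> x) \<partial>lborel)"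
    by (rule integral_mult_right_zero[symmetric])
  also have "\<dots> = (\<integral>x. fourier \<phi> x * (\<integral>\<zeta>. trace_spectrum \<zeta> * cis (x \<bullet> \<zeta>) \<partial>lborel) \<partial>lborel)"
  proof (intro Bochner_Integration.integral_cong refl)
    fix x :: "'e \<times> real"
    show "?c * (complex_of_real (?G x) * fourier \<phi> x) = fourier \<phi> x * (\<integral>\<zeta>. trace_spectrum \<zeta> * cis (x \<bullet> \<zeta>) \<partial>lborel)"
    proof -
      have "?c * complex_of_real (?G x) = (\<integral>\<zeta>. trace_spectrum \<zeta> * cis (x \<bullet> \<zeta>) \<partial>lborel)"
        using pulled_back_trace_representation[of "fst x" "snd x"] by (simp only: prod.collapse)
      then show ?thesis by (simp only: mult_ac flip: mult.assoc)
    qed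
  qed
  also have "\<dots> = (\<integral>\<zeta>. trace_spectrum \<zeta> * (\<integral>x. fourier \<phi> x * cis (x \<bullet> \<zeta>) \<partial>lborel) \<partial>lborel)"
  proof (rule integral_bounded_kernel_swap(1)[OF i\<phi> rapidly_decreasing_integrable[OF rapidly_decreasing_trace_spectrum], where C=1])
    show "(\<lambda>z::('e \<times> real) \<times> ('e \<times> real). cis (fst z \<bullet> snd z)) \<in> borel_measurable borel"
      by (intro measurable_cis_continuous continuous_intros)
  qed simp
  also have "\<dots> = (\<integral>\<zeta>. ?c * (trace_spectrum \<zeta> * \<phi> \<zeta>) \<partial>lborel)"
  proof (intro Bochner_Integration.integral_cong refl)
    fix \<zeta> :: "'e \<times> real"
    show "trace_spectrum \<zeta> * (\<integral>x. fourier \<phi> x * cis (x \<bullet> \<zeta>) \<partial>lborel) = ?c * (trace_spectrum \<zeta> * \<phi> \<zeta>)"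
      using fourier_inversion_compact_smooth[OF \<phi>, of \<zeta>] by (simp add: inner_commute)
  qed
  also have "\<dots> = ?c * (\<integral>\<zeta>. trace_spectrum \<zeta> * \<phi> \<zeta> \<partial>lborel)" by (rule integral_mult_right_zero)
  finally show "(\<integral>x. complex_of_real (?G x) * fourier \<phi> x \<partial>lborel) = (\<integral>\<zeta>. trace_spectrum \<zeta> * \<phi> \<zeta> \<partial>lborel)"
    by simp
qed

text \<open>The spectrum and the transform of \<open>sqrt_pullback 1 f\<close> agree in modulus, and
  Plancherel contributes the same constant to both. The computation stays in \<open>ennreal\<close>,
  so square integrability of the trace is a result and not an assumption.\<close>

theorem wave_trace_isometry:
  "(\<integral>\<^sup>+x. ennreal ((wave_trace f x)\<^sup>2 / \<bar>snd x\<bar>) \<partial>lborel) = (\<integral>\<^sup>+x. ennreal ((f x)\<^sup>2 / \<bar>snd x\<bar>) \<partial>lborel)"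
proof -
  let ?c = "(2 * pi) ^ DIM('e \<times> real)"
  let ?G = "sqrt_pullback 1 (wave_trace f)" and ?g = "sqrt_pullback 1 f"
  let ?h = "fourier (\<lambda>x. complex_of_real (?g x))"
  have rg: "rapidly_decreasing ?h" by (rule rapidly_decreasing_fourier[OF compact_smooth_of_real[OF gc]])
  obtain C where C: "\<And>\<xi>. (1 + (norm \<xi>)\<^sup>2) ^ 0 * norm (?h \<xi>) \<le> C"
    using rg unfolding rapidly_decreasing_def by blast
  have hc: "AE \<zeta> in lborel. isCont ?h \<zeta>"
    by (intro AE_I2 continuous_on_UNIV_imp_isCont continuous_on_fourier compact_smooth_integrable compact_smooth_of_real gc)
  have Gm: "?G \<in> borel_measurable borel" by (intro borel_measurable_continuous_onI continuous_on_pulled_back_trace)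
  have gm: "?g \<in> borel_measurable borel" by (intro borel_measurable_continuous_onI smooth_continuous compact_smooth_smooth gc)
  have sq: "ennreal ((norm (of_real c * complex_of_real r))\<^sup>2) = ennreal (c\<^sup>2) * ennreal (r\<^sup>2)" for c r
    by (simp add: norm_mult power_mult_distrib ennreal_mult)
  have "ennreal (?c\<^sup>2) * (\<integral>\<^sup>+x. ennreal ((?G x)\<^sup>2) \<partial>lborel) = (\<integral>\<^sup>+x. ennreal ((norm (of_real ?c * complex_of_real (?G x)))\<^sup>2) \<partial>lborel)"
    unfolding sq by (rule nn_integral_cmult[symmetric]) (use Gm in simp)
  also have "\<dots> = (\<integral>\<^sup>+x. ennreal ((norm (\<integral>\<zeta>. trace_spectrum \<zeta> * cis (x \<bullet> \<zeta>) \<partial>lborel))\<^sup>2) \<partial>lborel)"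
  proof (intro nn_integral_cong)
    fix x :: "'e \<times> real"
    show "ennreal ((norm (of_real ?c * complex_of_real (?G x)))\<^sup>2) = ennreal ((norm (\<integral>\<zeta>. trace_spectrum \<zeta> * cis (x \<bullet> \<zeta>) \<partial>lborel))\<^sup>2)"
      using pulled_back_trace_representation[of "fst x" "snd x"] by (simp only: prod.collapse)
  qed
  also have "\<dots> = ennreal ?c * (\<integral>\<^sup>+\<zeta>. ennreal ((norm (trace_spectrum \<zeta>))\<^sup>2) \<partial>lborel)"
    by (rule plancherel[where C=C])
      (use C in \<open>auto simp: norm_trace_spectrum intro!: rapidly_decreasing_integrable rapidly_decreasing_trace_spectrum AE_isCont_trace_spectrum\<close>)
  also have "\<dots> = ennreal ?c * (\<integral>\<^sup>+\<zeta>. ennreal ((norm (?h \<zeta>))\<^sup>2) \<partial>lborel)" by (simp only: norm_trace_spectrum)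
  also have "\<dots> = (\<integral>\<^sup>+x. ennreal ((norm (\<integral>\<zeta>. ?h \<zeta> * cis (x \<bullet> \<zeta>) \<partial>lborel))\<^sup>2) \<partial>lborel)"
    by (rule plancherel[OF rapidly_decreasing_integrable[OF rg] _ hc, symmetric, of C]) (use C in simp)
  also have "\<dots> = (\<integral>\<^sup>+x. ennreal ((norm (of_real ?c * complex_of_real (?g x)))\<^sup>2) \<partial>lborel)"
    by (simp only: fourier_inversion_compact_smooth[OF compact_smooth_of_real[OF gc]])
  also have "\<dots> = ennreal (?c\<^sup>2) * (\<integral>\<^sup>+x. ennreal ((?g x)\<^sup>2) \<partial>lborel)"
    unfolding sq by (rule nn_integral_cmult) (use gm in simp)
  finally have "ennreal (1 / ?c\<^sup>2) * (ennreal (?c\<^sup>2) * (\<integral>\<^sup>+x. ennreal ((?G x)\<^sup>2) \<partial>lborel))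
      = ennreal (1 / ?c\<^sup>2) * (ennreal (?c\<^sup>2) * (\<integral>\<^sup>+x. ennreal ((?g x)\<^sup>2) \<partial>lborel))" by simp
  moreover have "ennreal (1 / ?c\<^sup>2) * (ennreal (?c\<^sup>2) * A) = A" for A
  proof -
    have "ennreal (1 / ?c\<^sup>2) * ennreal (?c\<^sup>2) = ennreal (1 / ?c\<^sup>2 * ?c\<^sup>2)" by (rule ennreal_mult[symmetric]) auto
    then show ?thesis by (simp add: mult.assoc[symmetric])
  qed
  ultimately have "(\<integral>\<^sup>+x. ennreal ((?G x)\<^sup>2) \<partial>lborel) = (\<integral>\<^sup>+x. ennreal ((?g x)\<^sup>2) \<partial>lborel)" by (simp only:)
  moreover have "wave_trace f \<in> borel_measurable borel" "f \<in> borel_measurable borel"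
    by (intro borel_measurable_continuous_onI smooth_continuous smooth_wave_trace compact_smooth_smooth fc)+
  ultimately show ?thesis
    using nn_integral_sqrt_pullback[of "wave_trace f"] nn_integral_sqrt_pullback[of f] wave_trace_even[OF fc] ev by simp
qed

end

section \<open>Dispersive decay\<close>

lemma emeasure_le_diameter:
  fixes A :: "real set"
  assumes d: "\<And>a b. a \<in> A \<Longrightarrow> b \<in> A \<Longrightarrow> \<bar>a - b\<bar> \<le> d"
  shows "emeasure lborel A \<le> ennreal (2 * d)"
proof (cases "A = {}")
  case False
  then obtain a where a: "a \<in> A" by blast
  have "0 \<le> d" using d[OF a a] by simp
  have "A \<subseteq> {a - d..a + d}"
  proof
    fix b assume "b \<in> A"
    then show "b \<in> {a - d..a + d}" using d[OF a, of b] by auto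
  qed
  then have "emeasure lborel A \<le> emeasure lborel {a - d..a + d}" by (rule emeasure_mono) simp
  also have "\<dots> = ennreal (2 * d)" using \<open>0 \<le> d\<close> by (simp add: emeasure_lborel_Icc_eq)
  finally show ?thesis .
qed simp

text \<open>Distances are controlled between points of equal sign only, as is natural for preimages
  under squaring; the two half lines are measured separately.\<close>

lemma emeasure_symmetric_le:
  fixes A :: "real set"
  assumes A: "A \<in> sets borel" and d: "\<And>a b. a \<in> A \<Longrightarrow> b \<in> A \<Longrightarrow> 0 \<le> a * b \<Longrightarrow> \<bar>a - b\<bar> \<le> d" and d0: "0 \<le> d"
  shows "emeasure lborel A \<le> ennreal (4 * d)"
proof -
  have "A = (A \<inter> {0..}) \<union> (A \<inter> {..0})" by auto
  then have "emeasure lborel A = emeasure lborel ((A \<inter> {0..}) \<union> (A \<inter> {..0}))" by simp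
  also have "\<dots> \<le> emeasure lborel (A \<inter> {0..}) + emeasure lborel (A \<inter> {..0})"
    by (rule emeasure_subadditive) (use A in auto)
  also have "\<dots> \<le> ennreal (2 * d) + ennreal (2 * d)"
  proof (intro add_mono emeasure_le_diameter)
    show "\<bar>a - b\<bar> \<le> d" if "a \<in> A \<inter> {0..}" "b \<in> A \<inter> {0..}" for a b
      by (rule d) (use that mult_nonneg_nonneg[of a b] in auto)
    show "\<bar>a - b\<bar> \<le> d" if "a \<in> A \<inter> {..0}" "b \<in> A \<inter> {..0}" for a b
      by (rule d) (use that mult_nonpos_nonpos[of a b] in auto)
  qed
  also have "\<dots> = ennreal (4 * d)" using d0 by (simp add: ennreal_plus[symmetric] del: ennreal_plus)
  finally show ?thesis .
qed

text \<open>For a and b of equal sign |a - b| \<le> |a + b|, so (a - b)^2 \<le> |a^2 - b^2| \<le> 2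
  L. No distance from 0 is assumed, and the bound is a square root of \<open>L\<close>.\<close>

lemma emeasure_square_shell:
  assumes "0 \<le> L"
  shows "emeasure lborel {r::real. \<bar>\<beta> - r\<^sup>2\<bar> \<le> L} \<le> ennreal (4 * sqrt (2 * L))"
proof (rule emeasure_symmetric_le)
  show "{r::real. \<bar>\<beta> - r\<^sup>2\<bar> \<le> L} \<in> sets borel"
    by (intro borel_closed closed_Collect_le continuous_intros)
  fix a b :: real assume ab: "a \<in> {r. \<bar>\<beta> - r\<^sup>2\<bar> \<le> L}" "b \<in> {r. \<bar>\<beta> - r\<^sup>2\<bar> \<le> L}" "0 \<le> a * b"
  have "\<bar>a - b\<bar> \<le> \<bar>a + b\<bar>" using ab(3) by (auto simp: zero_le_mult_iff abs_if)
  then have "(a - b)\<^sup>2 \<le> \<bar>a - b\<bar> * \<bar>a + b\<bar>"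
    by (metis abs_ge_zero abs_mult_self_eq mult_left_mono power2_eq_square)
  also have "\<dots> = \<bar>a\<^sup>2 - b\<^sup>2\<bar>" by (simp add: abs_mult[symmetric] power2_eq_square algebra_simps)
  also have "\<dots> \<le> 2 * L" using ab(1,2) by auto
  finally show "\<bar>a - b\<bar> \<le> sqrt (2 * L)" using real_sqrt_le_mono by fastforce
qed (use assms in simp)

text \<open>Away from 0 the sum |a + b| is at least 2 \<kappa>, and the bound becomes linear in
  \<open>L\<close>.\<close>

lemma emeasure_square_shell_away:
  assumes "0 \<le> L" and \<kappa>: "0 < \<kappa>"
  shows "emeasure lborel {r::real. \<kappa>\<^sup>2 \<le> r\<^sup>2 \<and> \<bar>\<beta> - r\<^sup>2\<bar> \<le> L} \<le> ennreal (4 * (L / \<kappa>))"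
proof (rule emeasure_symmetric_le)
  show "{r::real. \<kappa>\<^sup>2 \<le> r\<^sup>2 \<and> \<bar>\<beta> - r\<^sup>2\<bar> \<le> L} \<in> sets borel"
    by (intro borel_closed closed_Collect_conj closed_Collect_le continuous_intros)
  fix a b :: real assume ab: "a \<in> {r. \<kappa>\<^sup>2 \<le> r\<^sup>2 \<and> \<bar>\<beta> - r\<^sup>2\<bar> \<le> L}" "b \<in> {r. \<kappa>\<^sup>2 \<le> r\<^sup>2 \<and> \<bar>\<beta> - r\<^sup>2\<bar> \<le> L}" "0 \<le> a * b"
  have "\<kappa> \<le> \<bar>a\<bar>" "\<kappa> \<le> \<bar>b\<bar>" using ab(1,2) \<kappa> abs_le_square_iff[of \<kappa>] by auto
  moreover have "\<bar>a + b\<bar> = \<bar>a\<bar> + \<bar>b\<bar>" using ab(3) by (auto simp: zero_le_mult_iff abs_if)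
  ultimately have "\<bar>a - b\<bar> * (2 * \<kappa>) \<le> \<bar>a - b\<bar> * \<bar>a + b\<bar>" by (intro mult_left_mono) auto
  also have "\<dots> = \<bar>a\<^sup>2 - b\<^sup>2\<bar>" by (simp add: abs_mult[symmetric] power2_eq_square algebra_simps)
  also have "\<dots> \<le> 2 * L" using ab(1,2) by auto
  finally show "\<bar>a - b\<bar> \<le> L / \<kappa>" using \<kappa> by (simp add: field_simps)
qed (use assms in auto)

lemma nn_integral_lborel_translate:
  fixes f :: "'a::euclidean_space \<Rightarrow> ennreal"
  assumes "f \<in> borel_measurable borel"
  shows "(\<integral>\<^sup>+x. f (x + t) \<partial>lborel) = (\<integral>\<^sup>+x. f x \<partial>lborel)"
proof -
  have "lborel = distr lborel borel (\<lambda>x::'a. t + x)"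
    using lborel_affine[of 1 t] by (simp add: density_1)
  from arg_cong[OF this, of "\<lambda>M. integral\<^sup>N M f"] show ?thesis
    using assms by (simp add: nn_integral_distr add.commute)
qed

text \<open>The shell |w| near t has thickness O(1 / t), and the cylinder can touch it along a
  length O(sqrt t); the product is the rate. Formally, some coordinate of w is comparable to t, a
  line in its direction meets the shell in length O(1 / t), and averaging over unit translates
  reduces the rest to the thicker shell \<open>W\<close>, of measure O(sqrt t).\<close>

lemma cone_shell_measure:
  fixes R :: real
  assumes R: "1 \<le> R"
  obtains C where "0 \<le> C" "\<And>(x::'e::euclidean_space) t. 2 * R \<le> t \<Longrightarrow>
    emeasure lborel {w::'e \<times> real. norm (x + fst w) \<le> R \<and> \<bar>t\<^sup>2 - (norm w)\<^sup>2\<bar> \<le> R} \<le> ennreal (C * t powr (- 1 / 2))"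
proof -
  let ?n = "real DIM('e \<times> real)"
  define V where "V = measure lborel (cball (0::'e) (R + 1))"
  define C where "C = ?n * ((4 * (R * sqrt (2 * ?n))) * (V * (4 * sqrt 12)))"
  have n: "?n > 0" by simp
  have V0: "0 \<le> V" by (simp add: V_def)
  have C0: "0 \<le> C" using R V0 by (simp add: C_def)
  have main: "emeasure lborel {w::'e \<times> real. norm (x + fst w) \<le> R \<and> \<bar>t\<^sup>2 - (norm w)\<^sup>2\<bar> \<le> R} \<le> ennreal (C * t powr (- 1 / 2))"
    if t: "2 * R \<le> t" for x :: 'e and t
  proof -
    have t0: "t > 0" "t \<ge> 2" using t R by auto
    \<comment> \<open>For 2 R \<le> t the shell has |w|^2 at least t^2 / 2, so one of the n squared
      coordinates is at least t^2 / (2 n), the square of \<kappa>.\<close>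
    define \<kappa> where "\<kappa> = t / sqrt (2 * ?n)"
    have \<kappa>: "\<kappa> > 0" "\<kappa>\<^sup>2 = t\<^sup>2 / (2 * ?n)" using t0 n by (auto simp: \<kappa>_def power_divide)
    define S where "S b = {w::'e \<times> real. norm (x + fst w) \<le> R \<and> \<bar>t\<^sup>2 - (norm w)\<^sup>2\<bar> \<le> R \<and> \<kappa>\<^sup>2 \<le> (w \<bullet> b)\<^sup>2}" for b
    \<comment> \<open>It contains all translates of the shell by at most 1 in a coordinate
      direction: |w|^2 changes by at most 4 t + 1, and R + 4 t + 1 \<le> 6 t. The cylinder grows
      from \<open>R\<close> to \<open>R + 1\<close>.\<close>
    define W where "W = {w::'e \<times> real. norm (x + fst w) \<le> R + 1 \<and> \<bar>t\<^sup>2 - (norm w)\<^sup>2\<bar> \<le> 6 * t}"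
    have closed_S: "closed (S b)" for b unfolding S_def by (intro closed_Collect_conj closed_Collect_le continuous_intros)
    have closed_W: "closed W" unfolding W_def by (intro closed_Collect_conj closed_Collect_le continuous_intros)
    have Sm[measurable]: "S b \<in> sets borel" for b by (rule borel_closed[OF closed_S])
    have Wm: "W \<in> sets borel" by (rule borel_closed[OF closed_W])
    \<comment> \<open>Slices in the last variable may pass near 0, so the square root bound is used;
      with thickness 6 t it gives O(sqrt t) for each point of the ball.\<close>
    have W_bound: "emeasure lborel W \<le> ennreal (V * (4 * sqrt (12 * t)))"
    proof -
      have m: "(\<lambda>w. indicator W w :: ennreal) \<in> borel_measurable (lborel \<Otimes>\<^sub>M lborel)"
        using Wm by (simp add: lborel_prod)
      have "emeasure lborel W = (\<integral>\<^sup>+w. indicator W w \<partial>lborel)" using Wm by simp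
      also have "\<dots> = (\<integral>\<^sup>+y. \<integral>\<^sup>+v. indicator W (y, v) \<partial>lborel \<partial>lborel)"
        using lborel.nn_integral_fst[OF m] by (simp add: lborel_prod)
      also have "\<dots> \<le> (\<integral>\<^sup>+y. indicator (cball (- x) (R + 1)) y * ennreal (4 * sqrt (2 * (6 * t))) \<partial>lborel)"
      proof (rule nn_integral_mono)
        fix y :: 'e
        let ?A = "{r::real. \<bar>(t\<^sup>2 - (norm y)\<^sup>2) - r\<^sup>2\<bar> \<le> 6 * t}"
        have Am: "?A \<in> sets borel" by (intro borel_closed closed_Collect_le continuous_intros)
        have le: "indicator W (y, v) \<le> (indicator (cball (- x) (R + 1)) y * indicator ?A v :: ennreal)" for v
        proof (cases "(y, v) \<in> W")
          case True
          have "dist (- x) y = norm (x + y)" by (simp add: dist_commute dist_norm add.commute)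
          moreover have "(norm (y, v))\<^sup>2 = (norm y)\<^sup>2 + v\<^sup>2" by (simp add: norm_prod_def)
          ultimately have "y \<in> cball (- x) (R + 1)" "v \<in> ?A" using True by (auto simp: W_def diff_diff_eq)
          then show ?thesis by (simp add: indicator_def)
        qed simp
        have "(\<integral>\<^sup>+v. indicator W (y, v) \<partial>lborel) \<le> (\<integral>\<^sup>+v. indicator (cball (- x) (R + 1)) y * indicator ?A v \<partial>lborel)"
          by (rule nn_integral_mono) (rule le)
        also have "\<dots> = indicator (cball (- x) (R + 1)) y * emeasure lborel ?A"
          using Am by (subst nn_integral_cmult) auto
        also have "\<dots> \<le> indicator (cball (- x) (R + 1)) y * ennreal (4 * sqrt (2 * (6 * t)))"
          using t0 by (intro mult_left_mono emeasure_square_shell) auto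
        finally show "(\<integral>\<^sup>+v. indicator W (y, v) \<partial>lborel) \<le> indicator (cball (- x) (R + 1)) y * ennreal (4 * sqrt (2 * (6 * t)))" .
      qed
      also have "\<dots> = emeasure lborel (cball (- x) (R + 1)) * ennreal (4 * sqrt (12 * t))"
        by (subst nn_integral_multc) (simp_all add: borel_closed borel_measurable_indicator)
      also have "emeasure lborel (cball (- x) (R + 1)) = emeasure lborel (cball (0::'e) (R + 1))"
      proof -
        have "emeasure lborel (cball (- x) (R + 1)) = (\<integral>\<^sup>+y. indicator (cball (0::'e) (R + 1)) (y + x) \<partial>lborel)"
        proof -
          have "indicator (cball (0::'e) (R + 1)) (y + x) = (indicator (cball (- x) (R + 1)) y :: ennreal)" for y
          proof -
            have "dist (- x) y = norm (y + x)" by (subst dist_commute) (simp add: dist_norm)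
            then show ?thesis by (simp add: indicator_def)
          qed
          then show ?thesis by (simp add: borel_closed)
        qed
        also have "\<dots> = emeasure lborel (cball (0::'e) (R + 1))"
          by (subst nn_integral_lborel_translate) (simp_all add: borel_closed borel_measurable_indicator)
        finally show ?thesis .
      qed
      also have "\<dots> = ennreal V"
        unfolding V_def using emeasure_lborel_cball_finite[of "0::'e" "R + 1"]
        by (intro emeasure_eq_ennreal_measure) auto
      finally show ?thesis using V0 t0 by (simp add: ennreal_mult[symmetric] del: ennreal_mult)
    qed
    \<comment> \<open>The measure of \<open>S b\<close> is averaged over its translates by s in
      [0, 1]. After exchanging the integrals, the s-integral at a fixed w is at most 4 R / \<kappa>,
      and it vanishes outside \<open>W\<close>.\<close>
    have S_bound: "emeasure lborel (S b) \<le> ennreal (4 * (R / \<kappa>)) * emeasure lborel W" if b: "b \<in> Basis" for b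
    proof -
      have bn: "norm b = 1" "b \<bullet> b = 1" using b by auto
      define \<Phi> where "\<Phi> w s = (indicator (S b) (w + s *\<^sub>R b) * indicator {0..1} s :: ennreal)" for w and s :: real
      have \<Phi>m: "(\<lambda>z. \<Phi> (fst z) (snd z)) \<in> borel_measurable borel"
      proof -
        have "closed {z::('e \<times> real) \<times> real. fst z + snd z *\<^sub>R b \<in> S b}"
          by (intro closed_vimage[OF closed_S, unfolded vimage_def] continuous_intros)
        moreover have "closed {z::('e \<times> real) \<times> real. snd z \<in> {0..1}}"
          by (intro closed_vimage[OF closed_atLeastAtMost, unfolded vimage_def] continuous_intros)
        moreover have "(\<lambda>z. \<Phi> (fst z) (snd z)) = (\<lambda>z. indicator {z. fst z + snd z *\<^sub>R b \<in> S b} z * indicator {z. snd z \<in> {0..1}} z)"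
          by (auto simp: \<Phi>_def indicator_def)
        ultimately show ?thesis by (simp add: borel_closed)
      qed
      then have \<Phi>m': "case_prod \<Phi> \<in> borel_measurable (lborel \<Otimes>\<^sub>M lborel)" by (simp add: lborel_prod split_beta')
      have "emeasure lborel (S b) = (\<integral>\<^sup>+s\<in>{0..1::real}. emeasure lborel (S b) \<partial>lborel)"
        by (subst nn_integral_cmult_indicator) auto
      also have "\<dots> = (\<integral>\<^sup>+s. \<integral>\<^sup>+w. \<Phi> w s \<partial>lborel \<partial>lborel)"
      proof (intro nn_integral_cong)
        fix s :: real
        have "(\<integral>\<^sup>+w. \<Phi> w s \<partial>lborel) = (\<integral>\<^sup>+w. indicator (S b) (w + s *\<^sub>R b) \<partial>lborel) * indicator {0..1} s"
          unfolding \<Phi>_def by (rule nn_integral_multc) simp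
        also have "(\<integral>\<^sup>+w. indicator (S b) (w + s *\<^sub>R b) \<partial>lborel) = emeasure lborel (S b)"
          by (subst nn_integral_lborel_translate) auto
        finally show "emeasure lborel (S b) * indicator {0..1} s = (\<integral>\<^sup>+w. \<Phi> w s \<partial>lborel)" by simp
      qed
      also have "\<dots> = (\<integral>\<^sup>+w. \<integral>\<^sup>+s. \<Phi> w s \<partial>lborel \<partial>lborel)"
        by (rule lborel_pair.Fubini'[OF \<Phi>m'])
      also have "\<dots> \<le> (\<integral>\<^sup>+w. ennreal (4 * (R / \<kappa>)) * indicator W w \<partial>lborel)"
      proof (rule nn_integral_mono)
        fix w :: "'e \<times> real"
        show "(\<integral>\<^sup>+s. \<Phi> w s \<partial>lborel) \<le> ennreal (4 * (R / \<kappa>)) * indicator W w"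
        proof (cases "w \<in> W")
          case False
          have "\<Phi> w s = 0" for s
          proof (rule ccontr)
            assume "\<Phi> w s \<noteq> 0"
            then have u: "w + s *\<^sub>R b \<in> S b" and s: "0 \<le> s" "s \<le> 1" by (auto simp: \<Phi>_def indicator_def split: if_splits)
            define u' where "u' = w + s *\<^sub>R b"
            have u'S: "norm (x + fst u') \<le> R" "\<bar>t\<^sup>2 - (norm u')\<^sup>2\<bar> \<le> R" using u by (auto simp: S_def u'_def)
            have w_eq: "w = u' - s *\<^sub>R b" by (simp add: u'_def)
            have "norm (s *\<^sub>R fst b) \<le> 1"
              using s norm_fst_le[of "fst b" "snd b"] bn by (simp add: mult_le_one)
            moreover have xw: "x + fst w = (x + fst u') - s *\<^sub>R fst b" by (simp add: w_eq)
            ultimately have 1: "norm (x + fst w) \<le> R + 1"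
              unfolding xw using norm_triangle_ineq4[of "x + fst u'" "s *\<^sub>R fst b"] u'S(1) by linarith
            have "(norm u')\<^sup>2 \<le> (2 * t)\<^sup>2"
            proof -
              have "R * 1 \<le> t * t" using t t0 R by (intro mult_mono) auto
              then show ?thesis using u'S(2) zero_le_power2[of t] by (simp add: power2_eq_square abs_le_iff)
            qed
            then have nu: "norm u' \<le> 2 * t" by (rule power2_le_imp_le) (use t0 in simp)
            have "(norm w)\<^sup>2 = (norm u')\<^sup>2 - 2 * s * (u' \<bullet> b) + s\<^sup>2"
              unfolding w_eq power2_norm_eq_inner using bn
              by (simp add: inner_diff_left inner_diff_right inner_commute power2_eq_square algebra_simps)
            moreover have "\<bar>2 * s * (u' \<bullet> b)\<bar> \<le> 4 * t"
            proof -
              have "\<bar>u' \<bullet> b\<bar> \<le> 2 * t" using Cauchy_Schwarz_ineq2[of u' b] bn nu by simp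
              then have "s * \<bar>u' \<bullet> b\<bar> \<le> 1 * (2 * t)" using s by (intro mult_mono) auto
              then show ?thesis using s by (simp add: abs_mult)
            qed
            moreover have "s\<^sup>2 \<le> 1" using s by (simp add: power_le_one)
            moreover have "0 \<le> s\<^sup>2" by simp
            ultimately have "\<bar>t\<^sup>2 - (norm w)\<^sup>2\<bar> \<le> R + 4 * t + 1" using u'S(2) by linarith
            also have "\<dots> \<le> 6 * t" using t t0 R by linarith
            finally show False using 1 False by (simp add: W_def)
          qed
          then show ?thesis by simp
        next
          case True
          let ?A = "{r::real. \<kappa>\<^sup>2 \<le> r\<^sup>2 \<and> \<bar>(t\<^sup>2 - (norm w)\<^sup>2 + (w \<bullet> b)\<^sup>2) - r\<^sup>2\<bar> \<le> R}"
          have Am: "?A \<in> sets borel" by (intro borel_closed closed_Collect_conj closed_Collect_le continuous_intros)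
          have "\<Phi> w s \<le> indicator ?A (s + w \<bullet> b)" for s
          proof (cases "w + s *\<^sub>R b \<in> S b")
            case True
            have nn: "(norm (w + s *\<^sub>R b))\<^sup>2 = (norm w)\<^sup>2 - (w \<bullet> b)\<^sup>2 + (s + w \<bullet> b)\<^sup>2"
              unfolding power2_norm_eq_inner using bn
              by (simp add: inner_add_left inner_add_right inner_commute power2_eq_square algebra_simps)
            have "(w + s *\<^sub>R b) \<bullet> b = s + w \<bullet> b" using bn by (simp add: inner_add_left)
            moreover have "(t\<^sup>2 - (norm w)\<^sup>2 + (w \<bullet> b)\<^sup>2) - (s + w \<bullet> b)\<^sup>2 = t\<^sup>2 - (norm (w + s *\<^sub>R b))\<^sup>2"
              using nn by linarith
            ultimately have "s + w \<bullet> b \<in> ?A" using True by (simp only: S_def mem_Collect_eq)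
            then show ?thesis by (simp add: \<Phi>_def indicator_def)
          qed (simp add: \<Phi>_def)
          then have "(\<integral>\<^sup>+s. \<Phi> w s \<partial>lborel) \<le> (\<integral>\<^sup>+s. indicator ?A (s + w \<bullet> b) \<partial>lborel)"
            by (rule nn_integral_mono)
          also have "\<dots> = emeasure lborel ?A" using Am by (subst nn_integral_lborel_translate) auto
          also have "\<dots> \<le> ennreal (4 * (R / \<kappa>))" using R \<kappa> by (intro emeasure_square_shell_away) auto
          finally show ?thesis using True by simp
        qed
      qed
      also have "\<dots> = ennreal (4 * (R / \<kappa>)) * emeasure lborel W" using Wm by (simp add: nn_integral_cmult)
      finally show ?thesis .
    qed
    have "{w::'e \<times> real. norm (x + fst w) \<le> R \<and> \<bar>t\<^sup>2 - (norm w)\<^sup>2\<bar> \<le> R} \<subseteq> (\<Union>b\<in>Basis. S b)"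
    proof
      fix w :: "'e \<times> real" assume w: "w \<in> {w. norm (x + fst w) \<le> R \<and> \<bar>t\<^sup>2 - (norm w)\<^sup>2\<bar> \<le> R}"
      have "\<exists>b\<in>Basis. \<kappa>\<^sup>2 \<le> (w \<bullet> b)\<^sup>2"
      proof (rule ccontr)
        assume "\<not> (\<exists>b\<in>Basis. \<kappa>\<^sup>2 \<le> (w \<bullet> b)\<^sup>2)"
        then have lt: "(w \<bullet> b)\<^sup>2 < \<kappa>\<^sup>2" if "b \<in> Basis" for b using that by force
        have "(norm w)\<^sup>2 = (\<Sum>b\<in>Basis. (w \<bullet> b)\<^sup>2)"
          by (subst power2_norm_eq_inner, subst euclidean_inner) (simp add: power2_eq_square)
        also have "\<dots> < (\<Sum>b\<in>(Basis :: ('e \<times> real) set). \<kappa>\<^sup>2)" by (rule sum_strict_mono) (use lt in auto)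
        also have "\<dots> = t\<^sup>2 / 2" using n by (simp add: \<kappa>(2) field_simps)
        finally have "(norm w)\<^sup>2 < t\<^sup>2 / 2" .
        moreover have "t\<^sup>2 - R \<le> (norm w)\<^sup>2" using w by auto
        moreover have "2 * R * 1 \<le> t * t" using t R t0 by (intro mult_mono) auto
        ultimately show False by (simp add: power2_eq_square)
      qed
      then show "w \<in> (\<Union>b\<in>Basis. S b)" using w by (auto simp: S_def)
    qed
    then have "emeasure lborel {w::'e \<times> real. norm (x + fst w) \<le> R \<and> \<bar>t\<^sup>2 - (norm w)\<^sup>2\<bar> \<le> R} \<le> emeasure lborel (\<Union>b\<in>Basis. S b)"
      by (rule emeasure_mono) auto
    also have "\<dots> \<le> (\<Sum>b\<in>(Basis :: ('e \<times> real) set). emeasure lborel (S b))"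
      by (rule emeasure_subadditive_finite) auto
    also have "\<dots> \<le> (\<Sum>b\<in>(Basis :: ('e \<times> real) set). ennreal ((4 * (R / \<kappa>)) * (V * (4 * sqrt (12 * t)))))"
    proof (rule sum_mono)
      fix b :: "'e \<times> real" assume "b \<in> Basis"
      from S_bound[OF this] have "emeasure lborel (S b) \<le> ennreal (4 * (R / \<kappa>)) * emeasure lborel W" .
      also have "\<dots> \<le> ennreal (4 * (R / \<kappa>)) * ennreal (V * (4 * sqrt (12 * t)))" by (intro mult_left_mono W_bound) auto
      also have "\<dots> = ennreal ((4 * (R / \<kappa>)) * (V * (4 * sqrt (12 * t))))"
        using R \<kappa> V0 t0 by (intro ennreal_mult[symmetric]) auto
      finally show "emeasure lborel (S b) \<le> ennreal ((4 * (R / \<kappa>)) * (V * (4 * sqrt (12 * t))))" .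
    qed
    also have "\<dots> = ennreal (\<Sum>b\<in>(Basis :: ('e \<times> real) set). (4 * (R / \<kappa>)) * (V * (4 * sqrt (12 * t))))"
      using R \<kappa> V0 t0 by (intro sum_ennreal) auto
    also have "(\<Sum>b\<in>(Basis :: ('e \<times> real) set). (4 * (R / \<kappa>)) * (V * (4 * sqrt (12 * t)))) = ?n * ((4 * (R / \<kappa>)) * (V * (4 * sqrt (12 * t))))"
      by simp
    also have "\<dots> = C * t powr (- 1 / 2)"
    proof -
      have "R / \<kappa> = R * sqrt (2 * ?n) / t" using t0 by (simp add: \<kappa>_def)
      moreover have "sqrt (12 * t) / t = sqrt 12 * t powr (- 1 / 2)"
      proof -
        have "sqrt t / t = t powr (1 / 2) / t powr 1" using t0 by (simp add: powr_half_sqrt)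
        also have "\<dots> = t powr (1 / 2 - 1)" by (simp only: powr_diff)
        finally have "sqrt t / t = t powr (- 1 / 2)" by simp
        then show ?thesis unfolding real_sqrt_mult by (simp only: times_divide_eq_right[symmetric])
      qed
      moreover have "?n * ((4 * (R * sqrt (2 * ?n) / t)) * (V * (4 * sqrt (12 * t))))
          = ?n * ((4 * (R * sqrt (2 * ?n))) * (V * (4 * (sqrt (12 * t) / t))))" by (simp only: times_divide_eq_left times_divide_eq_right)
      ultimately show ?thesis unfolding C_def by (simp only: mult_ac)
    qed
    finally show ?thesis .
  qed
  show thesis by (rule that[OF C0 main])
qed

section \<open>Integrals over paraboloids and their dilations\<close>

text \<open>The variable \<open>w\<close> has one component more than \<open>x\<close>. Under the
  Laplace transform this component contributes one further factor \<open>gaussian_const p\<close>,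
  which completes the power to n = DIM('e) + 1.\<close>

definition paraboloid_mean :: "('e::euclidean_space \<times> real \<Rightarrow> real) \<Rightarrow> 'e \<Rightarrow> real \<Rightarrow> real" where
  "paraboloid_mean h x \<tau> = (\<integral>w. h (x + fst w, \<tau> - (norm w)\<^sup>2) \<partial>(lborel :: ('e \<times> real) measure))"

lemma paraboloid_continuous:
  assumes "compact_smooth h"
  shows "continuous_on UNIV (\<lambda>w::'e::euclidean_space \<times> real. h (x + l *\<^sub>R fst w, \<tau> - l\<^sup>2 * (norm w)\<^sup>2) :: real)"
  by (intro continuous_on_compose2[OF smooth_continuous[OF compact_smooth_smooth[OF assms]]] continuous_intros) auto

text \<open>For dilations l > 1 / 2 one ball contains all supports: outside it l^2 |w|^2 exceeds
  |\<tau>| + R.\<close>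

lemma paraboloid_support:
  assumes R: "\<And>p. norm p > R \<Longrightarrow> h p = 0" and l: "1 / 2 < l" and w: "norm w > 2 * sqrt (\<bar>\<tau>\<bar> + R)" and R0: "0 \<le> R"
  shows "h (x + l *\<^sub>R fst w, \<tau> - l\<^sup>2 * (norm (w :: 'e::euclidean_space \<times> real))\<^sup>2) = 0"
proof (rule R)
  have "(2 * sqrt (\<bar>\<tau>\<bar> + R))\<^sup>2 < (norm w)\<^sup>2" using w R0 by (intro power_strict_mono) auto
  then have "4 * (\<bar>\<tau>\<bar> + R) < (norm w)\<^sup>2" using R0 by (simp add: power_mult_distrib)
  moreover have "(1 / 2)\<^sup>2 * (norm w)\<^sup>2 \<le> l\<^sup>2 * (norm w)\<^sup>2" using l by (intro mult_right_mono power_mono) auto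
  ultimately have "R < \<bar>\<tau> - l\<^sup>2 * (norm w)\<^sup>2\<bar>" by (simp add: power2_eq_square[of "1/2"])
  also have "\<dots> \<le> norm (x + l *\<^sub>R fst w, \<tau> - l\<^sup>2 * (norm w)\<^sup>2)" using norm_snd_le by (metis real_norm_def)
  finally show "R < norm (x + l *\<^sub>R fst w, \<tau> - l\<^sup>2 * (norm w)\<^sup>2)" .
qed

lemma paraboloid_integrable:
  fixes h :: "'e::euclidean_space \<times> real \<Rightarrow> real"
  assumes h: "compact_smooth h" and l: "1 / 2 < l"
  shows "integrable lborel (\<lambda>w::'e \<times> real. h (x + l *\<^sub>R fst w, \<tau> - l\<^sup>2 * (norm w)\<^sup>2))"
proof -
  obtain R where R: "R > 0" "\<And>p. norm p > R \<Longrightarrow> h p = 0" using compact_smooth_supportE[OF h] by blast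
  have "0 \<le> R" using R(1) by simp
  note z = paraboloid_support[OF R(2) l _ this, where x=x and \<tau>=\<tau>]
  show ?thesis by (rule integrable_continuous_bounded_support[OF paraboloid_continuous[OF h]], rule z)
qed

lemma paraboloid_integrable_1:
  fixes h :: "'e::euclidean_space \<times> real \<Rightarrow> real"
  assumes h: "compact_smooth h"
  shows "integrable lborel (\<lambda>w::'e \<times> real. h (x + fst w, \<tau> - (norm w)\<^sup>2))"
  using paraboloid_integrable[OF h, of 1 x \<tau>] by simp

lemma
  fixes g h :: "'e::euclidean_space \<times> real \<Rightarrow> real"
  assumes g: "compact_smooth g" and h: "compact_smooth h"
  shows paraboloid_mean_add: "paraboloid_mean (\<lambda>p. g p + h p) x \<tau> = paraboloid_mean g x \<tau> + paraboloid_mean h x \<tau>"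
    and paraboloid_mean_cmult: "paraboloid_mean (\<lambda>p. c * g p) x \<tau> = c * paraboloid_mean g x \<tau>"
  unfolding paraboloid_mean_def using paraboloid_integrable_1[OF g, of x \<tau>] paraboloid_integrable_1[OF h, of x \<tau>] by auto

text \<open>The chain rule, obtained by writing \<open>h\<close> as a superposition of plane waves:
  along a curve each of them is a function of one real variable. Bounded speed gives the majorant
  for differentiating under the integral.\<close>

lemma compact_smooth_curve_derivative:
  fixes h :: "'e::euclidean_space \<times> real \<Rightarrow> real"
  assumes h: "compact_smooth h"
    and c: "\<And>s. \<bar>s - s0\<bar> < d \<Longrightarrow> (c has_vector_derivative c' s) (at s)" and d: "0 < d"
    and K: "\<And>s. \<bar>s - s0\<bar> < d \<Longrightarrow> norm (c' s) \<le> K"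
  shows "((\<lambda>s. h (c s)) has_vector_derivative (\<Sum>b\<in>Basis. (c' s0 \<bullet> b) * pdir b h (c s0))) (at s0)"
proof -
  let ?a = "wave_amplitude h"
  have rap: "rapidly_decreasing ?a" by (rule rapidly_decreasing_wave_amplitude[OF h])
  have am: "?a \<in> borel_measurable borel" using rap by (simp add: rapidly_decreasing_def)
  have ic: "integrable lborel (\<lambda>\<xi>. ?a \<xi> * cis (p \<bullet> \<xi>))" for p
    using oscillatory_integrable[OF rap continuous_on_id] by simp
  have ib: "integrable lborel (\<lambda>\<xi>. \<i> * of_real (b \<bullet> \<xi>) * ?a \<xi> * cis (p \<bullet> \<xi>))" for p b
  proof -
    have "norm \<xi> \<le> 1 * (1 + (norm \<xi>)\<^sup>2)" for \<xi> :: "'e \<times> real"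
      using zero_le_power2[of "norm \<xi> - 1 / 2"] by (simp add: power2_eq_square algebra_simps)
    from oscillatory_integrable[OF rapidly_decreasing_phase_mult[OF rap continuous_on_id this] continuous_on_id]
    show ?thesis by simp
  qed
  have "((\<lambda>s. \<integral>\<xi>. ?a \<xi> * cis (c s \<bullet> \<xi>) \<partial>lborel) has_vector_derivative
      (\<integral>\<xi>. (\<i> * of_real (c' s0 \<bullet> \<xi>)) * ?a \<xi> * cis (c s0 \<bullet> \<xi>) \<partial>lborel)) (at s0)"
  proof (rule has_vector_derivative_integral[OF d, where w="\<lambda>\<xi>. K * ((1 + (norm \<xi>)\<^sup>2) ^ 1 * norm (?a \<xi>))"])
    fix s \<xi> assume s: "\<bar>s - s0\<bar> < d"
    show "integrable lborel (\<lambda>\<xi>. ?a \<xi> * cis (c s \<bullet> \<xi>))" by (rule ic)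
    have "((\<lambda>s. c s \<bullet> \<xi>) has_vector_derivative c' s \<bullet> \<xi>) (at s)"
      by (rule bounded_linear.has_vector_derivative[OF bounded_linear_inner_left c[OF s]])
    from vector_diff_chain_at[OF this has_vector_derivative_cis[of 1 "c s \<bullet> \<xi>" UNIV, simplified]]
    have "((\<lambda>s. cis (c s \<bullet> \<xi>)) has_vector_derivative (c' s \<bullet> \<xi>) *\<^sub>R (\<i> * cis (c s \<bullet> \<xi>))) (at s)"
      by (simp add: comp_def)
    from has_vector_derivative_mult_right[OF this, of "?a \<xi>"]
    show "((\<lambda>s. ?a \<xi> * cis (c s \<bullet> \<xi>)) has_vector_derivative (\<i> * of_real (c' s \<bullet> \<xi>)) * ?a \<xi> * cis (c s \<bullet> \<xi>)) (at s)"
      by (simp add: scaleR_conv_of_real mult_ac)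
    have "\<bar>c' s \<bullet> \<xi>\<bar> \<le> norm (c' s) * norm \<xi>" by (rule Cauchy_Schwarz_ineq2)
    also have "\<dots> \<le> K * (1 + (norm \<xi>)\<^sup>2)"
    proof (rule mult_mono[OF K[OF s]])
      show "norm \<xi> \<le> 1 + (norm \<xi>)\<^sup>2"
        using zero_le_power2[of "norm \<xi> - 1 / 2"] by (simp add: power2_eq_square algebra_simps)
    qed (use order_trans[OF norm_ge_zero K[OF s]] in auto)
    finally have "\<bar>c' s \<bullet> \<xi>\<bar> * norm (?a \<xi>) \<le> K * (1 + (norm \<xi>)\<^sup>2) * norm (?a \<xi>)" by (intro mult_right_mono) auto
    then show "norm ((\<i> * of_real (c' s \<bullet> \<xi>)) * ?a \<xi> * cis (c s \<bullet> \<xi>)) \<le> K * ((1 + (norm \<xi>)\<^sup>2) ^ 1 * norm (?a \<xi>))"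
      by (simp add: norm_mult mult.assoc)
  next
    show "(\<lambda>\<xi>. (\<i> * of_real (c' s0 \<bullet> \<xi>)) * ?a \<xi> * cis (c s0 \<bullet> \<xi>)) \<in> borel_measurable lborel"
      using borel_measurable_integrable[OF ib] by simp
    show "integrable lborel (\<lambda>\<xi>. K * ((1 + (norm \<xi>)\<^sup>2) ^ 1 * norm (?a \<xi>)))"
      by (intro integrable_mult_right rapidly_decreasing_integrable_weight rap)
  qed
  moreover have "(\<integral>\<xi>. (\<i> * of_real (c' s0 \<bullet> \<xi>)) * ?a \<xi> * cis (c s0 \<bullet> \<xi>) \<partial>lborel)
      = of_real (\<Sum>b\<in>Basis. (c' s0 \<bullet> b) * pdir b h (c s0))"
  proof -
    have "(\<i> * of_real (c' s0 \<bullet> \<xi>)) * ?a \<xi> * cis (c s0 \<bullet> \<xi>)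
        = (\<Sum>b\<in>Basis. of_real (c' s0 \<bullet> b) * (\<i> * of_real (b \<bullet> \<xi>) * ?a \<xi> * cis (c s0 \<bullet> \<xi>)))" for \<xi>
      by (subst euclidean_inner) (simp add: sum_distrib_left sum_distrib_right mult_ac inner_commute)
    then have "(\<integral>\<xi>. (\<i> * of_real (c' s0 \<bullet> \<xi>)) * ?a \<xi> * cis (c s0 \<bullet> \<xi>) \<partial>lborel)
        = (\<integral>\<xi>. (\<Sum>b\<in>Basis. of_real (c' s0 \<bullet> b) * (\<i> * of_real (b \<bullet> \<xi>) * ?a \<xi> * cis (c s0 \<bullet> \<xi>))) \<partial>lborel)" by (simp only:)
    also have "\<dots> = (\<Sum>b\<in>Basis. of_real (c' s0 \<bullet> b) * (\<integral>\<xi>. \<i> * of_real (b \<bullet> \<xi>) * ?a \<xi> * cis (c s0 \<bullet> \<xi>) \<partial>lborel))"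
      by (subst Bochner_Integration.integral_sum) (use ib in \<open>simp_all only: integral_mult_right_zero integrable_mult_right\<close>)
    also have "\<dots> = (\<Sum>b\<in>Basis. of_real (c' s0 \<bullet> b) * of_real (pdir b h (c s0)))"
    proof (intro sum.cong refl)
      fix b :: "'e \<times> real" assume b: "b \<in> Basis"
      show "of_real (c' s0 \<bullet> b) * (\<integral>\<xi>. \<i> * of_real (b \<bullet> \<xi>) * ?a \<xi> * cis (c s0 \<bullet> \<xi>) \<partial>lborel) = of_real (c' s0 \<bullet> b) * of_real (pdir b h (c s0))"
        unfolding wave_amplitude_pdir[OF h b, symmetric] wave_amplitude_inversion[OF compact_smooth_pdir[OF h b]] ..
    qed
    finally show ?thesis by simp
  qed
  ultimately have "((\<lambda>s. complex_of_real (h (c s))) has_vector_derivative of_real (\<Sum>b\<in>Basis. (c' s0 \<bullet> b) * pdir b h (c s0))) (at s0)"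
    by (simp add: wave_amplitude_inversion[OF h])
  from bounded_linear.has_vector_derivative[OF bounded_linear_Re this] show ?thesis by simp
qed

text \<open>The integral of h (x + l w', \<tau> - l^2 |w|^2) is differentiated at l = 1 in two ways:
  under the integral sign, and after scaling, where it is l^(-n) times a constant.\<close>

lemma paraboloid_mean_dilation:
  fixes h :: "'e::euclidean_space \<times> real \<Rightarrow> real"
  assumes h: "compact_smooth h"
  shows "(\<integral>w. (\<Sum>b\<in>Basis. ((fst w, - 2 * (norm w)\<^sup>2) \<bullet> b) * pdir b h (x + fst w, \<tau> - (norm w)\<^sup>2)) \<partial>(lborel :: ('e \<times> real) measure))
    = - real DIM('e \<times> real) * paraboloid_mean h x \<tau>"
proof -
  let ?n = "DIM('e \<times> real)"
  obtain R where R: "R > 0" "\<And>p. norm p > R \<Longrightarrow> h p = 0" using compact_smooth_supportE[OF h] by blast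
  define c where "c w l = (x + l *\<^sub>R fst w, \<tau> - l\<^sup>2 * (norm w)\<^sup>2)" for l and w :: "'e \<times> real"
  define c' where "c' w l = (fst w, - 2 * l * (norm w)\<^sup>2)" for l and w :: "'e \<times> real"
  define \<rho> where "\<rho> = 2 * sqrt (\<bar>\<tau>\<bar> + R)"
  have \<rho>0: "0 \<le> \<rho>" using R(1) by (simp add: \<rho>_def)
  have dc: "(c w has_vector_derivative c' w l) (at l)" for w l
    unfolding c_def c'_def
    by (intro has_vector_derivative_Pair) (auto intro!: derivative_eq_intros simp: has_real_derivative_iff_has_vector_derivative[symmetric])
  have c'b: "norm (c' w l) \<le> norm w + 3 * (norm w)\<^sup>2" if "\<bar>l - 1\<bar> < 1 / 2" for w l
  proof -
    have "norm (c' w l) \<le> norm (fst w) + norm (- 2 * l * (norm w)\<^sup>2)" unfolding c'_def by (rule norm_Pair_le)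
    also have "norm (fst w) \<le> norm w" using norm_fst_le[of "fst w" "snd w"] by simp
    also have "norm (- 2 * l * (norm w)\<^sup>2) \<le> 3 * (norm w)\<^sup>2"
    proof -
      have "\<bar>l\<bar> \<le> 3 / 2" using that by linarith
      then have "2 * \<bar>l\<bar> * (norm w)\<^sup>2 \<le> 3 * (norm w)\<^sup>2" by (intro mult_right_mono) auto
      then show ?thesis by (simp add: abs_mult)
    qed
    finally show ?thesis by simp
  qed
  define D where "D l w = (\<Sum>b\<in>Basis. (c' w l \<bullet> b) * pdir b h (c w l))" for l w
  have "\<exists>C>0. \<forall>p. \<bar>pdir b h p\<bar> \<le> C" if "b \<in> Basis" for b
    using compact_smooth_boundE[OF compact_smooth_pdir[OF h that]] by (metis real_norm_def)
  then obtain C where C: "\<And>b. b \<in> Basis \<Longrightarrow> C b > 0" "\<And>b p. b \<in> Basis \<Longrightarrow> \<bar>pdir b h p\<bar> \<le> C b" by metis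
  have cz: "pdir b h (c w l) = 0" if "\<bar>l - 1\<bar> < 1 / 2" "norm w > \<rho>" for b w l
  proof -
    have "1 / 2 < l" using that(1) by linarith
    from paraboloid_support[of R "pdir b h", OF pdir_eq_0_outside[of R h, OF R(2)] this] that(2) R(1)
    show ?thesis by (simp add: c_def \<rho>_def)
  qed
  have "((\<lambda>l. \<integral>w. h (c w l) \<partial>lborel) has_vector_derivative (\<integral>w. D 1 w \<partial>lborel)) (at 1)"
  proof (rule has_vector_derivative_integral[where d="1 / 2" and w="\<lambda>w. ((\<rho> + 3 * \<rho>\<^sup>2) * (\<Sum>b\<in>Basis. C b)) * indicator (cball 0 \<rho>) w"])
    fix l :: real and w :: "'e \<times> real" assume l: "\<bar>l - 1\<bar> < 1 / 2"
    show "integrable lborel (\<lambda>w. h (c w l))" unfolding c_def by (rule paraboloid_integrable[OF h]) (use l in linarith)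
    show "((\<lambda>l. h (c w l)) has_vector_derivative D l w) (at l)"
      unfolding D_def
    \<comment> \<open>The radius \<open>1/2 - \<bar>l - 1\<bar>\<close> keeps nearby parameters
      within 1 / 2 of 1, where the speed bound holds.\<close>
    proof (rule compact_smooth_curve_derivative[where c="c w" and c'="c' w" and d="1/2 - \<bar>l - 1\<bar>" and K="norm w + 3 * (norm w)\<^sup>2", OF h dc])
      show "0 < 1 / 2 - \<bar>l - 1\<bar>" using l by simp
      show "norm (c' w s) \<le> norm w + 3 * (norm w)\<^sup>2" if "\<bar>s - l\<bar> < 1 / 2 - \<bar>l - 1\<bar>" for s
        using that by (intro c'b) linarith
    qed
    show "norm (D l w) \<le> ((\<rho> + 3 * \<rho>\<^sup>2) * (\<Sum>b\<in>Basis. C b)) * indicator (cball 0 \<rho>) w"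
    proof (cases "norm w \<le> \<rho>")
      case True
      have "norm (c' w l) \<le> \<rho> + 3 * \<rho>\<^sup>2"
        using c'b[OF l, of w] True power_mono[OF True norm_ge_zero, of 2] by linarith
      then have "\<bar>c' w l \<bullet> b\<bar> \<le> \<rho> + 3 * \<rho>\<^sup>2" if "b \<in> Basis" for b
        using Basis_le_norm[OF that, of "c' w l"] by linarith
      then have "\<bar>(c' w l \<bullet> b) * pdir b h (c w l)\<bar> \<le> (\<rho> + 3 * \<rho>\<^sup>2) * C b" if "b \<in> Basis" for b
        unfolding abs_mult using that C \<rho>0 by (intro mult_mono) auto
      then have "norm (D l w) \<le> (\<Sum>b\<in>Basis. (\<rho> + 3 * \<rho>\<^sup>2) * C b)"
        unfolding D_def by (intro sum_norm_le) auto
      then show ?thesis using True by (simp add: sum_distrib_left)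
    next
      case False
      then show ?thesis using cz[OF l] by (simp add: D_def)
    qed
  next
    have "continuous_on UNIV (D 1)"
      unfolding D_def c_def c'_def
      by (intro continuous_intros continuous_on_compose2[OF smooth_continuous[OF smooth_pdir[OF compact_smooth_smooth[OF h]]]]) auto
    then show "D 1 \<in> borel_measurable lborel" unfolding measurable_lborel2 by (rule borel_measurable_continuous_onI)
    show "integrable lborel (\<lambda>w::'e \<times> real. ((\<rho> + 3 * \<rho>\<^sup>2) * (\<Sum>b\<in>Basis. C b)) * indicator (cball 0 \<rho>) w)"
      using emeasure_lborel_cball_finite[of "0 :: 'e \<times> real" \<rho>] by (intro integrable_mult_right integrable_real_indicator) auto
  qed simp
  moreover have "((\<lambda>l. \<integral>w. h (c w l) \<partial>lborel) has_vector_derivative - real ?n * paraboloid_mean h x \<tau>) (at 1)"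
  proof -
    have "(\<integral>w. h (c w l) \<partial>lborel) = inverse (l ^ ?n) * paraboloid_mean h x \<tau>" if l: "l > 0" for l
    proof -
      have m: "(\<lambda>w::'e \<times> real. h (x + fst w, \<tau> - (norm w)\<^sup>2)) \<in> borel_measurable borel"
        using borel_measurable_integrable[OF paraboloid_integrable_1[OF h, of x \<tau>]] by simp
      have "paraboloid_mean h x \<tau> = l ^ ?n * (\<integral>w. h (x + fst (l *\<^sub>R w), \<tau> - (norm (l *\<^sub>R w))\<^sup>2) \<partial>(lborel :: ('e \<times> real) measure))"
        unfolding paraboloid_mean_def using lborel_integral_scale[of l, OF _ m] l by simp
      also have "\<dots> = l ^ ?n * (\<integral>w. h (c w l) \<partial>lborel)" by (simp add: c_def power_mult_distrib)
      finally show ?thesis using l by (simp add: field_simps)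
    qed
    moreover have "((\<lambda>l. inverse (l ^ ?n) * paraboloid_mean h x \<tau>) has_real_derivative - real ?n * paraboloid_mean h x \<tau>) (at 1)"
      by (auto intro!: derivative_eq_intros)
    ultimately have "((\<lambda>l. \<integral>w. h (c w l) \<partial>lborel) has_real_derivative - real ?n * paraboloid_mean h x \<tau>) (at 1)"
      by (elim has_field_derivative_transform_within_open[where S="{0<..}"]) (simp_all del: power_Suc DIM_prod)
    then show ?thesis by (simp add: has_real_derivative_iff_has_vector_derivative)
  qed
  ultimately have "(\<integral>w. D 1 w \<partial>lborel) = - real ?n * paraboloid_mean h x \<tau>" by (rule vector_derivative_unique_at)
  then show ?thesis by (simp add: D_def c_def c'_def)
qed

text \<open>The infinitesimal form of the invariance of the Lebesgue measure under dilations of \<open>w\<close>.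
  It trades a time derivative for a factor \<open>1 / sqrt \<tau>\<close>, since \<open>norm x\<close> is at most about \<open>sqrt \<tau>\<close>
  wherever the mean does not vanish.\<close>

lemma paraboloid_mean_time_derivative:
  fixes h :: "'e::euclidean_space \<times> real \<Rightarrow> real"
  assumes h: "compact_smooth h"
  shows "2 * \<tau> * paraboloid_mean (pdir (0,1) h) x \<tau> =
    real DIM('e \<times> real) * paraboloid_mean h x \<tau>
    + 2 * paraboloid_mean (\<lambda>p. (p \<bullet> (0,1)) * pdir (0,1) h p) x \<tau>
    + (\<Sum>b\<in>Basis. paraboloid_mean (\<lambda>p. (p \<bullet> (b,0)) * pdir (b,0) h p) x \<tau>)
    - (\<Sum>b\<in>Basis. (x \<bullet> b) * paraboloid_mean (pdir (b,0) h) x \<tau>)"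
proof -
  define k where "k b = pdir (b, 0::real) h" for b :: 'e
  define z where "z = pdir (0::'e, 1::real) h"
  have kc: "compact_smooth (k b)" if "b \<in> Basis" for b unfolding k_def by (intro compact_smooth_pdir h Basis_space that)
  have zc: "compact_smooth z" unfolding z_def by (intro compact_smooth_pdir h Basis_time)
  have ykc: "compact_smooth (\<lambda>p. (p \<bullet> (b, 0)) * k b p)" if "b \<in> Basis" for b
    using compact_smooth_coordinate_mult[OF kc[OF that], of "(b, 0)"] by simp
  have zzc: "compact_smooth (\<lambda>p. (p \<bullet> (0, 1)) * z p)"
    using compact_smooth_coordinate_mult[OF zc, of "(0, 1)"] by simp
  let ?P = "\<lambda>w::'e \<times> real. (x + fst w, \<tau> - (norm w)\<^sup>2)"
  have Bs: "(\<Sum>b\<in>Basis. F b) = (\<Sum>b\<in>Basis. F (b, 0)) + F (0, 1)" for F :: "'e \<times> real \<Rightarrow> real"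
    unfolding Basis_prod_def
    by (subst sum.union_disjoint) (auto simp: sum.reindex inj_on_def)
  \<comment> \<open>Rewrite fst w as (x + fst w) - x and - 2 |w|^2 as 2 (\<tau> - |w|^2) - 2 \<tau>.
    The unbounded factors become coordinates of the point at which the derivatives are taken, so the
    products are compactly supported again, while x and \<tau> come out of the integrals.\<close>
  have pw: "(\<Sum>b\<in>Basis. ((fst w, - 2 * (norm w)\<^sup>2) \<bullet> b) * pdir b h (?P w))
      = (\<Sum>b\<in>Basis. (?P w \<bullet> (b, 0)) * k b (?P w) - (x \<bullet> b) * k b (?P w)) + (2 * ((?P w \<bullet> (0, 1)) * z (?P w)) - 2 * \<tau> * z (?P w))" for w
    unfolding Bs k_def z_def by (simp add: inner_add_left algebra_simps)
  have ik: "integrable lborel (\<lambda>w. k b (?P w))" "integrable lborel (\<lambda>w. (?P w \<bullet> (b, 0)) * k b (?P w))" if "b \<in> Basis" for b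
    using paraboloid_integrable_1[OF kc[OF that], of x \<tau>] paraboloid_integrable_1[OF ykc[OF that], of x \<tau>] by auto
  have iz: "integrable lborel (\<lambda>w. z (?P w))" "integrable lborel (\<lambda>w. (?P w \<bullet> (0, 1)) * z (?P w))"
    using paraboloid_integrable_1[OF zc, of x \<tau>] paraboloid_integrable_1[OF zzc, of x \<tau>] by auto
  have "- real DIM('e \<times> real) * paraboloid_mean h x \<tau>
      = (\<integral>w. (\<Sum>b\<in>Basis. (?P w \<bullet> (b, 0)) * k b (?P w) - (x \<bullet> b) * k b (?P w)) + (2 * ((?P w \<bullet> (0, 1)) * z (?P w)) - 2 * \<tau> * z (?P w)) \<partial>lborel)"
    unfolding paraboloid_mean_dilation[OF h, of x \<tau>, symmetric] pw ..
  also have "\<dots> = (\<integral>w. (\<Sum>b\<in>Basis. (?P w \<bullet> (b, 0)) * k b (?P w) - (x \<bullet> b) * k b (?P w)) \<partial>lborel)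
      + (\<integral>w. 2 * ((?P w \<bullet> (0, 1)) * z (?P w)) - 2 * \<tau> * z (?P w) \<partial>lborel)"
    by (intro Bochner_Integration.integral_add Bochner_Integration.integrable_sum Bochner_Integration.integrable_diff integrable_mult_right ik iz)
  also have "(\<integral>w. (\<Sum>b\<in>Basis. (?P w \<bullet> (b, 0)) * k b (?P w) - (x \<bullet> b) * k b (?P w)) \<partial>lborel)
      = (\<Sum>b\<in>Basis. \<integral>w. (?P w \<bullet> (b, 0)) * k b (?P w) - (x \<bullet> b) * k b (?P w) \<partial>lborel)"
    by (intro Bochner_Integration.integral_sum Bochner_Integration.integrable_diff integrable_mult_right ik)
  also have "\<dots> = (\<Sum>b\<in>Basis. paraboloid_mean (\<lambda>p. (p \<bullet> (b, 0)) * k b p) x \<tau> - (x \<bullet> b) * paraboloid_mean (k b) x \<tau>)"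
    unfolding paraboloid_mean_def
    by (intro sum.cong refl, subst Bochner_Integration.integral_diff) (use ik in \<open>simp_all only: integral_mult_right_zero integrable_mult_right\<close>)
  also have "(\<integral>w. 2 * ((?P w \<bullet> (0, 1)) * z (?P w)) - 2 * \<tau> * z (?P w) \<partial>lborel)
      = 2 * paraboloid_mean (\<lambda>p. (p \<bullet> (0, 1)) * z p) x \<tau> - 2 * \<tau> * paraboloid_mean z x \<tau>"
    unfolding paraboloid_mean_def
    by (subst Bochner_Integration.integral_diff) (use iz in \<open>simp_all only: integral_mult_right_zero integrable_mult_right\<close>)
  finally show ?thesis unfolding sum_subtractf k_def z_def by linarith
qed

section \<open>Decay of means of time derivatives\<close>

abbreviation time_derivatives :: "nat \<Rightarrow> ('e::euclidean_space \<times> real \<Rightarrow> real) \<Rightarrow> 'e \<times> real \<Rightarrow> real" where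
  "time_derivatives k \<equiv> iter_pd (replicate k (0, 1))"

lemma compact_smooth_time_derivatives: "compact_smooth g \<Longrightarrow> compact_smooth (time_derivatives k g)"
  by (rule compact_smooth_iter_pd) (auto simp: Basis_time)

lemma time_derivatives_space_derivative:
  assumes g: "compact_smooth g" and b: "b \<in> Basis"
  shows "pdir (b, 0) (time_derivatives k g) = time_derivatives k (pdir (b, 0) g)"
proof (induction k)
  case (Suc k)
  have "pdir (b, 0) (pdir (0, 1) (time_derivatives k g)) = pdir (0, 1) (pdir (b, 0) (time_derivatives k g))"
    by (rule ext) (intro pdir_commute compact_smooth_smooth compact_smooth_time_derivatives g Basis_space b Basis_time)
  then show ?case by (simp add: Suc.IH)
qed simp

lemma time_derivatives_space_coordinate:
  assumes g: "compact_smooth g"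
  shows "time_derivatives k (\<lambda>p. (p \<bullet> (b, 0)) * g p) = (\<lambda>p. (p \<bullet> (b, 0)) * time_derivatives k g p)"
proof (induction k)
  case (Suc k)
  then show ?case
    using pdir_coordinate_mult[OF compact_smooth_smooth[OF compact_smooth_time_derivatives[OF g]] Basis_time, of "(b, 0)" k] by simp
qed simp

text \<open>By Leibniz at most one of the \<open>k\<close> derivatives can fall on the linear
  coordinate, which accounts for the term with \<open>real k\<close>.\<close>

lemma time_derivatives_time_coordinate:
  assumes g: "compact_smooth g"
  shows "time_derivatives k (\<lambda>p. (p \<bullet> (0, 1)) * pdir (0, 1) g p)
    = (\<lambda>p. (p \<bullet> (0, 1)) * pdir (0, 1) (time_derivatives k g) p + real k * time_derivatives k g p)"
proof (induction k)
  case (Suc k)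
  have s: "smooth (time_derivatives k g)" "smooth (pdir (0,1) (time_derivatives k g))"
    by (intro compact_smooth_smooth compact_smooth_pdir compact_smooth_time_derivatives g Basis_time)+
  have s2: "smooth (\<lambda>p. (p \<bullet> (0, 1)) * pdir (0, 1) (time_derivatives k g) p)"
    using smooth_coordinate_mult[OF s(2), of "(0,1)"] by simp
  have s3: "smooth (\<lambda>p. real k * time_derivatives k g p)"
    by (rule smooth_bounded_linear[OF bounded_linear_mult_right s(1)])
  show ?case
    unfolding replicate_Suc iter_pd.simps Suc.IH pdir_add[OF s2 s3 Basis_time]
      pdir_bounded_linear[OF bounded_linear_mult_right s(1) Basis_time]
    using pdir_coordinate_mult[OF s(2) Basis_time, of "(0,1)"] by (simp add: fun_eq_iff algebra_simps)
qed simp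

text \<open>The base case is the measure of the shell. In the step the dilation identity carries the
  factor \<tau> = t^2 on the left and at most |x| = O(t) on the right, a net gain of 1 / t. It
  replaces \<open>g\<close> by derivatives and coordinate multiples, so the induction is over all
  \<open>g\<close>.\<close>

lemma paraboloid_mean_decay:
  fixes g :: "'e::euclidean_space \<times> real \<Rightarrow> real"
  assumes "compact_smooth g"
  shows "\<exists>C t0. 0 \<le> C \<and> (\<forall>x t. t0 \<le> t \<longrightarrow> \<bar>paraboloid_mean (time_derivatives k g) x (t\<^sup>2)\<bar> \<le> C * t powr (- 1 / 2 - real k))"
  using assms
proof (induction k arbitrary: g)
  case 0
  obtain C R0 where R0: "C > 0" "R0 > 0" "\<And>p. norm p > R0 \<Longrightarrow> g p = 0" "\<And>p. norm (g p) \<le> C"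
    using compact_smooth_boundE[OF 0] by metis
  define R where "R = max 1 R0"
  have R: "1 \<le> R" "\<And>p. norm p > R \<Longrightarrow> g p = 0" using R0 by (auto simp: R_def)
  obtain B where B: "0 \<le> B" "\<And>(x::'e) t. 2 * R \<le> t \<Longrightarrow>
    emeasure lborel {w::'e \<times> real. norm (x + fst w) \<le> R \<and> \<bar>t\<^sup>2 - (norm w)\<^sup>2\<bar> \<le> R} \<le> ennreal (B * t powr (- 1 / 2))"
    using cone_shell_measure[OF R(1), where 'e='e] by blast
  have "\<bar>paraboloid_mean g x (t\<^sup>2)\<bar> \<le> (C * B) * t powr (- 1 / 2)" if t: "2 * R \<le> t" for x t
  proof -
    let ?S = "{w::'e \<times> real. norm (x + fst w) \<le> R \<and> \<bar>t\<^sup>2 - (norm w)\<^sup>2\<bar> \<le> R}"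
    have Sm: "?S \<in> sets borel" by (intro borel_closed closed_Collect_conj closed_Collect_le continuous_intros)
    have Sf: "emeasure lborel ?S < \<infinity>" using B(2)[OF t, of x] by (auto intro: le_less_trans)
    have le: "norm (g (x + fst w, t\<^sup>2 - (norm w)\<^sup>2)) \<le> C * indicator ?S w" for w
    proof (cases "w \<in> ?S")
      case False
      have "norm (x + fst w) \<le> norm (x + fst w, t\<^sup>2 - (norm w)\<^sup>2)" by (rule norm_fst_le)
      moreover have "\<bar>t\<^sup>2 - (norm w)\<^sup>2\<bar> \<le> norm (x + fst w, t\<^sup>2 - (norm w)\<^sup>2)" using norm_snd_le by (metis real_norm_def)
      ultimately have "g (x + fst w, t\<^sup>2 - (norm w)\<^sup>2) = 0" using False by (intro R(2)) auto
      then show ?thesis using R0(1) by simp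
    qed (use R0(4) in simp)
    have "norm (paraboloid_mean g x (t\<^sup>2)) \<le> (\<integral>w. C * indicator ?S w \<partial>lborel)"
      unfolding paraboloid_mean_def
      by (rule norm_lebesgue_integral_le[OF paraboloid_integrable_1[OF 0] _ le])
        (intro integrable_mult_right integrable_real_indicator, use Sm Sf in auto)
    also have "\<dots> = C * measure lborel ?S" using Sm by simp
    also have "measure lborel ?S \<le> B * t powr (- 1 / 2)"
      unfolding measure_def using B(2)[OF t, of x] B(1) by (intro enn2real_leI) auto
    finally show ?thesis using R0(1) by (simp add: mult.assoc)
  qed
  then show ?case using R0(1) B(1) by (intro exI[of _ "C * B"] exI[of _ "2 * R"]) auto
next
  case (Suc k)
  note g = Suc.prems
  have zc: "compact_smooth (\<lambda>p. (p \<bullet> (0,1)) * pdir (0,1) g p)"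
    using compact_smooth_coordinate_mult[OF compact_smooth_pdir[OF g Basis_time], of "(0,1)"] by simp
  have yc: "compact_smooth (\<lambda>p. (p \<bullet> (b,0)) * pdir (b,0) g p)" if "b \<in> Basis" for b
    using compact_smooth_coordinate_mult[OF compact_smooth_pdir[OF g Basis_space[OF that]], of "(b,0)"] by simp
  let ?M = "\<lambda>g x t. paraboloid_mean (time_derivatives k g) x (t\<^sup>2)"
  let ?q = "- 1 / 2 - real k"
  obtain C1 t1 where C1: "0 \<le> C1" "\<And>x t. t1 \<le> t \<Longrightarrow> \<bar>?M g x t\<bar> \<le> C1 * t powr ?q" using Suc.IH[OF g] by blast
  obtain C2 t2 where C2: "0 \<le> C2" "\<And>x t. t2 \<le> t \<Longrightarrow> \<bar>?M (\<lambda>p. (p \<bullet> (0,1)) * pdir (0,1) g p) x t\<bar> \<le> C2 * t powr ?q"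
    using Suc.IH[OF zc] by blast
  have "\<exists>C t0. 0 \<le> C \<and> (\<forall>x t. t0 \<le> t \<longrightarrow> \<bar>?M (\<lambda>p. (p \<bullet> (b,0)) * pdir (b,0) g p) x t\<bar> \<le> C * t powr ?q)" if "b \<in> Basis" for b
    by (rule Suc.IH[OF yc[OF that]])
  from bchoice[OF ballI, OF this] obtain C3 where
    "\<forall>b\<in>Basis. \<exists>t0. 0 \<le> C3 b \<and> (\<forall>x t. t0 \<le> t \<longrightarrow> \<bar>?M (\<lambda>p. (p \<bullet> (b,0)) * pdir (b,0) g p) x t\<bar> \<le> C3 b * t powr ?q)" ..
  from bchoice[OF this] obtain t3 where C3: "\<And>b. b \<in> Basis \<Longrightarrow> 0 \<le> C3 b"
    "\<And>b x t. b \<in> Basis \<Longrightarrow> t3 b \<le> t \<Longrightarrow> \<bar>?M (\<lambda>p. (p \<bullet> (b,0)) * pdir (b,0) g p) x t\<bar> \<le> C3 b * t powr ?q" by blast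
  have "\<exists>C t0. 0 \<le> C \<and> (\<forall>x t. t0 \<le> t \<longrightarrow> \<bar>?M (pdir (b,0) g) x t\<bar> \<le> C * t powr ?q)" if "b \<in> Basis" for b
    by (rule Suc.IH[OF compact_smooth_pdir[OF g Basis_space[OF that]]])
  from bchoice[OF ballI, OF this] obtain C4 where
    "\<forall>b\<in>Basis. \<exists>t0. 0 \<le> C4 b \<and> (\<forall>x t. t0 \<le> t \<longrightarrow> \<bar>?M (pdir (b,0) g) x t\<bar> \<le> C4 b * t powr ?q)" ..
  from bchoice[OF this] obtain t4 where C4: "\<And>b. b \<in> Basis \<Longrightarrow> 0 \<le> C4 b"
    "\<And>b x t. b \<in> Basis \<Longrightarrow> t4 b \<le> t \<Longrightarrow> \<bar>?M (pdir (b,0) g) x t\<bar> \<le> C4 b * t powr ?q" by blast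
  have hc: "compact_smooth (time_derivatives k g)" by (rule compact_smooth_time_derivatives[OF g])
  obtain R where R: "R > 0" "\<And>p. norm p > R \<Longrightarrow> time_derivatives (Suc k) g p = 0"
    using compact_smooth_supportE[OF compact_smooth_time_derivatives[OF g]] by blast
  define n where "n = real DIM('e \<times> real)"
  define t0 where "t0 = 1 + \<bar>t1\<bar> + \<bar>t2\<bar> + (\<Sum>b\<in>(Basis::'e set). \<bar>t3 b\<bar>) + (\<Sum>b\<in>(Basis::'e set). \<bar>t4 b\<bar>) + 4 * R"
  have t34: "\<bar>t3 b\<bar> \<le> (\<Sum>b\<in>(Basis::'e set). \<bar>t3 b\<bar>)" "\<bar>t4 b\<bar> \<le> (\<Sum>b\<in>(Basis::'e set). \<bar>t4 b\<bar>)" if "b \<in> Basis" for b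
    using that by (auto intro: member_le_sum)
  have s34: "0 \<le> (\<Sum>b\<in>(Basis::'e set). \<bar>t3 b\<bar>)" "0 \<le> (\<Sum>b\<in>(Basis::'e set). \<bar>t4 b\<bar>)" by (auto intro: sum_nonneg)
  define C where "C = n * C1 + 2 * (C2 + real k * C1) + (\<Sum>b\<in>(Basis::'e set). C3 b) + 2 * (\<Sum>b\<in>(Basis::'e set). C4 b)"
  have C0: "0 \<le> C" unfolding C_def n_def using C1 C2 C3 C4
    by (intro add_nonneg_nonneg mult_nonneg_nonneg sum_nonneg) auto
  have "\<bar>paraboloid_mean (time_derivatives (Suc k) g) x (t\<^sup>2)\<bar> \<le> C * t powr (- 1 / 2 - real (Suc k))" if t: "t0 \<le> t" for x t
  proof (cases "norm x \<le> 2 * t")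
    case False
    \<comment> \<open>If |x| > 2 t, then x + w' within \<open>R\<close> of the origin forces |w|
      \<ge> t + R. Hence |w|^2 - t^2 exceeds \<open>R\<close>, and the paraboloid misses the
      support.\<close>
    have tR: "4 * R \<le> t" "1 \<le> t" using t s34 R(1) unfolding t0_def by linarith+
    have "time_derivatives (Suc k) g (x + fst w, t\<^sup>2 - (norm w)\<^sup>2) = 0" for w :: "'e \<times> real"
    proof (rule ccontr)
      assume "time_derivatives (Suc k) g (x + fst w, t\<^sup>2 - (norm w)\<^sup>2) \<noteq> 0"
      then have le: "norm (x + fst w, t\<^sup>2 - (norm w)\<^sup>2) \<le> R" using R(2) not_less by blast
      have 1: "norm (x + fst w) \<le> R" using order_trans[OF norm_fst_le le] .
      have 2: "\<bar>t\<^sup>2 - (norm w)\<^sup>2\<bar> \<le> R" using order_trans[OF norm_snd_le le] by simp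
      have "norm x \<le> norm (x + fst w) + norm (fst w)" by (metis add_diff_cancel norm_triangle_ineq4)
      moreover have "norm (fst w) \<le> norm w" using norm_fst_le[of "fst w" "snd w"] by simp
      ultimately have nw: "t + R \<le> norm w" using 1 False tR R(1) by linarith
      then have "(t + R)\<^sup>2 \<le> (norm w)\<^sup>2" using tR R(1) by (intro power_mono) auto
      moreover have "R * 1 \<le> R * t" using tR R(1) by (intro mult_left_mono) auto
      moreover have "0 < R * t" using tR R(1) by simp
      moreover have "(t + R)\<^sup>2 = t\<^sup>2 + 2 * (R * t) + R\<^sup>2" by (simp add: power2_eq_square algebra_simps)
      moreover have "0 < R\<^sup>2" using R(1) by simp
      ultimately show False using 2 by linarith
    qed
    then have "paraboloid_mean (time_derivatives (Suc k) g) x (t\<^sup>2) = 0" by (simp add: paraboloid_mean_def)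
    then show ?thesis using C0 by simp
  next
    case True
    have tt: "t1 \<le> t" "t2 \<le> t" "1 \<le> t" using t s34 R(1) unfolding t0_def by linarith+
    have tb: "t3 b \<le> t" "t4 b \<le> t" if "b \<in> Basis" for b
      using t t34[OF that] s34 R(1) unfolding t0_def by linarith+
    let ?T = "t powr ?q"
    have T0: "0 \<le> ?T" by simp
    have e1: "paraboloid_mean (\<lambda>p. (p \<bullet> (0,1)) * pdir (0,1) (time_derivatives k g) p) x (t\<^sup>2)
        = ?M (\<lambda>p. (p \<bullet> (0,1)) * pdir (0,1) g p) x t - real k * ?M g x t"
    proof -
      have c: "compact_smooth (\<lambda>p. (p \<bullet> (0,1)) * pdir (0,1) (time_derivatives k g) p)"
        using compact_smooth_coordinate_mult[OF compact_smooth_pdir[OF hc Basis_time], of "(0,1)"] by simp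
      have ck: "compact_smooth (\<lambda>p. real k * time_derivatives k g p)"
        by (rule compact_smooth_bounded_linear[OF bounded_linear_mult_right hc])
      show ?thesis
        unfolding time_derivatives_time_coordinate[OF g] paraboloid_mean_add[OF c ck] paraboloid_mean_cmult[OF hc hc] by simp
    qed
    have e2: "paraboloid_mean (\<lambda>p. (p \<bullet> (b,0)) * pdir (b,0) (time_derivatives k g) p) x (t\<^sup>2)
        = ?M (\<lambda>p. (p \<bullet> (b,0)) * pdir (b,0) g p) x t" if "b \<in> Basis" for b
      unfolding time_derivatives_space_coordinate[OF compact_smooth_pdir[OF g Basis_space[OF that]]]
        time_derivatives_space_derivative[OF g that] ..
    have e3: "paraboloid_mean (pdir (b,0) (time_derivatives k g)) x (t\<^sup>2) = ?M (pdir (b,0) g) x t" if "b \<in> Basis" for b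
      unfolding time_derivatives_space_derivative[OF g that] ..
    have "2 * t\<^sup>2 * paraboloid_mean (time_derivatives (Suc k) g) x (t\<^sup>2)
        = n * ?M g x t + 2 * (?M (\<lambda>p. (p \<bullet> (0,1)) * pdir (0,1) g p) x t - real k * ?M g x t)
          + (\<Sum>b\<in>Basis. ?M (\<lambda>p. (p \<bullet> (b,0)) * pdir (b,0) g p) x t) - (\<Sum>b\<in>Basis. (x \<bullet> b) * ?M (pdir (b,0) g) x t)"
      using paraboloid_mean_time_derivative[OF hc, of "t\<^sup>2" x] by (simp add: e1 e2 e3 n_def)
    moreover have "\<bar>n * ?M g x t\<bar> \<le> (n * C1) * ?T"
      unfolding n_def abs_mult using C1(2)[OF tt(1), of x] by (simp add: mult.assoc mult_left_mono)
    moreover have "\<bar>2 * (?M (\<lambda>p. (p \<bullet> (0,1)) * pdir (0,1) g p) x t - real k * ?M g x t)\<bar> \<le> (2 * (C2 + real k * C1)) * ?T"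
    proof -
      have "\<bar>real k * ?M g x t\<bar> \<le> real k * (C1 * ?T)"
        unfolding abs_mult using C1(2)[OF tt(1), of x] by (simp add: mult_left_mono)
      then show ?thesis using C2(2)[OF tt(2), of x] by (simp add: algebra_simps)
    qed
    moreover have "\<bar>\<Sum>b\<in>Basis. ?M (\<lambda>p. (p \<bullet> (b,0)) * pdir (b,0) g p) x t\<bar> \<le> (\<Sum>b\<in>Basis. C3 b) * ?T"
      unfolding sum_distrib_right by (rule order_trans[OF sum_abs sum_mono]) (use C3(2) tb in auto)
    \<comment> \<open>The critical terms: here |x . b| \<le> 2 t costs one power of t, while all
      other terms are smaller by that power.\<close>
    moreover have "\<bar>\<Sum>b\<in>Basis. (x \<bullet> b) * ?M (pdir (b,0) g) x t\<bar> \<le> (\<Sum>b\<in>Basis. (2 * t) * (C4 b * ?T))"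
    proof (rule order_trans[OF sum_abs sum_mono])
      fix b :: 'e assume b: "b \<in> Basis"
      have "\<bar>x \<bullet> b\<bar> \<le> 2 * t" using Basis_le_norm[OF b, of x] True by simp
      then show "\<bar>(x \<bullet> b) * ?M (pdir (b,0) g) x t\<bar> \<le> (2 * t) * (C4 b * ?T)"
        unfolding abs_mult using C4(2)[OF b tb(2)[OF b], of x] tt by (intro mult_mono) auto
    qed
    moreover have "(\<Sum>b\<in>Basis. (2 * t) * (C4 b * ?T)) = 2 * (\<Sum>b\<in>(Basis::'e set). C4 b) * (t * ?T)"
      by (simp add: sum_distrib_left sum_distrib_right mult_ac)
    ultimately have "\<bar>2 * t\<^sup>2 * paraboloid_mean (time_derivatives (Suc k) g) x (t\<^sup>2)\<bar>
        \<le> (n * C1) * ?T + (2 * (C2 + real k * C1)) * ?T + (\<Sum>b\<in>Basis. C3 b) * ?T + 2 * (\<Sum>b\<in>(Basis::'e set). C4 b) * (t * ?T)"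
      by linarith
    also have "\<dots> \<le> (n * C1) * (t * ?T) + (2 * (C2 + real k * C1)) * (t * ?T) + (\<Sum>b\<in>Basis. C3 b) * (t * ?T) + 2 * (\<Sum>b\<in>(Basis::'e set). C4 b) * (t * ?T)"
    proof -
      have "?T \<le> t * ?T" using mult_right_mono[OF tt(3) T0] by simp
      then show ?thesis unfolding n_def using C1 C2 C3 by (intro add_mono mult_left_mono order_refl) (auto intro: sum_nonneg)
    qed
    also have "\<dots> = C * (t * ?T)" by (simp add: C_def algebra_simps)
    finally have "2 * t\<^sup>2 * \<bar>paraboloid_mean (time_derivatives (Suc k) g) x (t\<^sup>2)\<bar> \<le> C * (t * ?T)" by (simp add: abs_mult)
    moreover have "1 * t\<^sup>2 * \<bar>paraboloid_mean (time_derivatives (Suc k) g) x (t\<^sup>2)\<bar> \<le> 2 * t\<^sup>2 * \<bar>paraboloid_mean (time_derivatives (Suc k) g) x (t\<^sup>2)\<bar>"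
      by (intro mult_right_mono) auto
    ultimately have "t\<^sup>2 * \<bar>paraboloid_mean (time_derivatives (Suc k) g) x (t\<^sup>2)\<bar> \<le> C * (t * ?T)" by linarith
    then have "\<bar>paraboloid_mean (time_derivatives (Suc k) g) x (t\<^sup>2)\<bar> \<le> C * (t * ?T) / t\<^sup>2"
      using tt by (simp add: field_simps)
    also have "t * ?T / t\<^sup>2 = t powr (- 1 / 2 - real (Suc k))"
    proof -
      have "t * ?T / t\<^sup>2 = ?T / t powr 1" using tt by (simp add: power2_eq_square)
      also have "\<dots> = t powr (?q - 1)" by (simp only: powr_diff)
      finally show ?thesis by (simp add: algebra_simps)
    qed
    then have "C * (t * ?T) / t\<^sup>2 = C * t powr (- 1 / 2 - real (Suc k))" by (simp only: times_divide_eq_right[symmetric])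
    finally show ?thesis .
  qed
  then show ?case using C0 by blast
qed

section \<open>Laplace transforms of paraboloid means\<close>

lemma time_laplace_time_derivative:
  fixes g :: "'e::euclidean_space \<times> real \<Rightarrow> real"
  assumes g: "compact_smooth g"
  shows "time_laplace (pdir (0,1) g) p y = p * time_laplace g p y"
proof -
  obtain R where R: "R > 0" "\<And>x. norm x > R \<Longrightarrow> g x = 0" using compact_smooth_supportE[OF g] by blast
  let ?E = "\<lambda>z::real. exp (- p * complex_of_real z)"
  have cont: "continuous_on UNIV (\<lambda>z. ?E z * of_real (k (y, z)))" if "smooth k" for k :: "'e \<times> real \<Rightarrow> real"
    by (intro continuous_intros continuous_on_compose2[OF smooth_continuous[OF that]]) auto
  note cg = cont[OF compact_smooth_smooth[OF g]]
  note cd = cont[OF smooth_pdir[OF compact_smooth_smooth[OF g] Basis_time]]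
  have z: "g (y, z) = 0" "pdir (0,1) g (y, z) = 0" if "norm z > R" for z
  proof -
    have "norm (y, z) > R" using that norm_snd_le[of z y] by simp
    then show "g (y, z) = 0" "pdir (0,1) g (y, z) = 0" using R(2) pdir_eq_0_outside[of R g, OF R(2)] by auto
  qed
  have ig: "integrable lborel (\<lambda>z. ?E z * of_real (g (y, z)))"
    by (rule integrable_continuous_bounded_support[OF cg, of R]) (simp add: z)
  have id: "integrable lborel (\<lambda>z. ?E z * of_real (pdir (0,1) g (y, z)))"
    by (rule integrable_continuous_bounded_support[OF cd, of R]) (simp add: z)
  have "(\<integral>z. ?E z * of_real (pdir (0,1) g (y, z)) + (- p) * (?E z * of_real (g (y, z))) \<partial>lborel) = 0"
  proof (rule integral_directional_derivative_eq_0[where R=R and e=1 and f="\<lambda>z. ?E z * of_real (g (y, z))"])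
    show "continuous_on UNIV (\<lambda>z. ?E z * of_real (pdir (0,1) g (y, z)) + (- p) * (?E z * of_real (g (y, z))))"
      by (rule continuous_on_add[OF cd continuous_on_mult_left[OF cg]])
    fix z :: real
    have "((\<lambda>w. exp (- p * (complex_of_real z + w))) has_field_derivative - p * ?E z) (at (complex_of_real 0))"
      by (auto intro!: derivative_eq_intros)
    from has_vector_derivative_real_field[OF this]
    have 1: "((\<lambda>s. ?E (z + s *\<^sub>R 1)) has_vector_derivative - p * ?E z) (at 0)" by simp
    have 2: "((\<lambda>s. complex_of_real (g (y, z + s *\<^sub>R 1))) has_vector_derivative of_real (pdir (0,1) g (y, z))) (at 0)"
      using bounded_linear.has_vector_derivative[OF bounded_linear_of_real has_pdir_at_0[OF compact_smooth_smooth[OF g] Basis_time, of "(y, z)"]]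
      by simp
    show "((\<lambda>s. ?E (z + s *\<^sub>R 1) * of_real (g (y, z + s *\<^sub>R 1))) has_vector_derivative
        ?E z * of_real (pdir (0,1) g (y, z)) + (- p) * (?E z * of_real (g (y, z)))) (at 0)"
      using has_vector_derivative_mult[OF 1 2] by (simp add: algebra_simps)
  qed (use cg z in auto)
  then have "(\<integral>z. ?E z * of_real (pdir (0,1) g (y, z)) \<partial>lborel) + (- p) * (\<integral>z. ?E z * of_real (g (y, z)) \<partial>lborel) = 0"
    by (subst (asm) Bochner_Integration.integral_add) (use ig id in \<open>simp_all only: integral_mult_right_zero integrable_mult_right\<close>)
  then show ?thesis by (simp add: time_laplace_def)
qed

lemma time_laplace_time_derivatives:
  fixes g :: "'e::euclidean_space \<times> real \<Rightarrow> real"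
  assumes g: "compact_smooth g"
  shows "time_laplace (time_derivatives k g) p y = p ^ k * time_laplace g p y"
  by (induction k) (simp_all add: time_laplace_time_derivative[OF compact_smooth_time_derivatives[OF g]])

text \<open>At fixed w, translating \<tau> by |w|^2 splits exp (- p \<tau>) into a Gaussian in w and
  the kernel of \<open>time_laplace\<close>. As \<open>h\<close> sees only fst w, the component snd
  w integrates to \<open>gaussian_const p\<close>.\<close>

lemma
  fixes h :: "'e::euclidean_space \<times> real \<Rightarrow> real"
  assumes h: "compact_smooth h" and p: "0 < Re p"
  shows laplace_paraboloid_mean: "(\<integral>\<tau>. exp (- p * complex_of_real \<tau>) * of_real (paraboloid_mean h x \<tau>) \<partial>lborel)
      = gaussian_const p * (\<integral>w. exp (- p * complex_of_real ((norm w)\<^sup>2)) * time_laplace h p (x + w) \<partial>lborel)"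
    and integrable_laplace_paraboloid_mean: "integrable lborel (\<lambda>\<tau>. exp (- p * complex_of_real \<tau>) * of_real (paraboloid_mean h x \<tau>))"
proof -
  obtain C R where C: "C > 0" "R > 0" "\<And>p. norm p > R \<Longrightarrow> h p = 0" "\<And>p. norm (h p) \<le> C"
    using compact_smooth_boundE[OF h] by metis
  define \<Phi> where "\<Phi> z = exp (- p * complex_of_real (snd z)) * of_real (h (x + fst (fst z), snd z - (norm (fst z))\<^sup>2))"
    for z :: "('e \<times> real) \<times> real"
  define L where "L = time_laplace h p"
  define B where "B z = exp (- Re p * z) * C * indicator (cball 0 R) z" for z :: real
  have \<Phi>m: "\<Phi> \<in> borel_measurable borel"
    unfolding \<Phi>_def
    by (intro borel_measurable_continuous_onI continuous_intros continuous_on_compose2[OF smooth_continuous[OF compact_smooth_smooth[OF h]]]) auto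
  have sh: "\<Phi> (w, (norm w)\<^sup>2 + z) = exp (- p * complex_of_real ((norm w)\<^sup>2)) * (exp (- p * complex_of_real z) * of_real (h (x + fst w, z)))" for w z
    by (simp add: \<Phi>_def algebra_simps exp_add[symmetric] mult_exp_exp)
  have ih: "integrable lborel (\<lambda>z. exp (- p * complex_of_real z) * of_real (h (y, z)))" for y
  proof (rule integrable_continuous_bounded_support[where R=R])
    show "continuous_on UNIV (\<lambda>z. exp (- p * complex_of_real z) * of_real (h (y, z)))"
      by (intro continuous_intros continuous_on_compose2[OF smooth_continuous[OF compact_smooth_smooth[OF h]]]) auto
    show "exp (- p * complex_of_real z) * of_real (h (y, z)) = 0" if "norm z > R" for z
      using that norm_snd_le[of z y] C(3)[of "(y, z)"] by simp
  qed
  have i1: "integrable lborel (\<lambda>\<tau>. \<Phi> (w, \<tau>))" for w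
    using lborel_integrable_translate[where t="(norm w)\<^sup>2" and f="\<lambda>\<tau>. \<Phi> (w, \<tau>)"] ih[of "x + fst w"]
    by (simp add: sh integrable_mult_right del: mult_eq_0_iff)
  have iB: "integrable lborel B"
  proof -
    have "integrable lborel (\<lambda>z. indicator (cball 0 R) z *\<^sub>R (exp (- Re p * z) * C))"
      by (rule borel_integrable_compact[OF compact_cball]) (intro continuous_intros)
    then show ?thesis by (simp add: B_def[abs_def] mult_ac)
  qed
  have \<Phi>i: "integrable lborel \<Phi>"
  proof (rule integrable_lborel_pairI[OF \<Phi>m i1, where w="\<lambda>w. norm (exp (- p * complex_of_real ((norm w)\<^sup>2))) * integral\<^sup>L lborel B"])
    fix w :: "'e \<times> real"
    have "(\<integral>\<tau>. norm (\<Phi> (w, \<tau>)) \<partial>lborel) = (\<integral>z. norm (\<Phi> (w, (norm w)\<^sup>2 + z)) \<partial>lborel)"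
      by (rule lborel_integral_translate[symmetric])
    also have "\<dots> = norm (exp (- p * complex_of_real ((norm w)\<^sup>2))) * (\<integral>z. norm (exp (- p * complex_of_real z) * of_real (h (x + fst w, z))) \<partial>lborel)"
      unfolding sh norm_mult by (simp only: integral_mult_right_zero)
    also have "(\<integral>z. norm (exp (- p * complex_of_real z) * of_real (h (x + fst w, z))) \<partial>lborel) \<le> integral\<^sup>L lborel B"
    proof (rule integral_mono[OF integrable_norm[OF ih] iB])
      fix z :: real
      show "norm (exp (- p * complex_of_real z) * of_real (h (x + fst w, z))) \<le> B z"
      proof (cases "norm z \<le> R")
        case True
        then show ?thesis using C(4)[of "(x + fst w, z)"] by (simp add: B_def norm_mult)
      next
        case False
        then have "h (x + fst w, z) = 0" using norm_snd_le[of z "x + fst w"] by (intro C(3)) simp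
        then show ?thesis using C(1) by (simp add: B_def)
      qed
    qed
    finally show "(\<integral>\<tau>. norm (\<Phi> (w, \<tau>)) \<partial>lborel) \<le> norm (exp (- p * complex_of_real ((norm w)\<^sup>2))) * integral\<^sup>L lborel B"
      by (simp add: mult_left_mono)
  next
    show "integrable lborel (\<lambda>w::'e \<times> real. norm (exp (- p * complex_of_real ((norm w)\<^sup>2))) * integral\<^sup>L lborel B)"
      by (intro integrable_mult_left integrable_norm integrable_complex_gaussian p)
  qed
  have snd\<Phi>: "(\<integral>w. \<Phi> (w, \<tau>) \<partial>lborel) = exp (- p * complex_of_real \<tau>) * of_real (paraboloid_mean h x \<tau>)" for \<tau>
    unfolding \<Phi>_def paraboloid_mean_def by simp
  show "integrable lborel (\<lambda>\<tau>. exp (- p * complex_of_real \<tau>) * of_real (paraboloid_mean h x \<tau>))"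
    using integrable_lborel_snd[OF \<Phi>i] unfolding snd\<Phi> .
  have fst\<Phi>: "(\<integral>\<tau>. \<Phi> (w, \<tau>) \<partial>lborel) = exp (- p * complex_of_real ((norm w)\<^sup>2)) * L (x + fst w)" for w
  proof -
    have "(\<integral>\<tau>. \<Phi> (w, \<tau>) \<partial>lborel) = (\<integral>z. \<Phi> (w, (norm w)\<^sup>2 + z) \<partial>lborel)" by (rule lborel_integral_translate[symmetric])
    then show ?thesis unfolding sh by (simp add: L_def time_laplace_def)
  qed
  have "(\<integral>\<tau>. exp (- p * complex_of_real \<tau>) * of_real (paraboloid_mean h x \<tau>) \<partial>lborel) = (\<integral>w. exp (- p * complex_of_real ((norm w)\<^sup>2)) * L (x + fst w) \<partial>(lborel :: ('e \<times> real) measure))"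
    using trans[OF integral_lborel_pair_swap[OF \<Phi>i, symmetric] integral_lborel_pair[OF \<Phi>i]] by (simp only: snd\<Phi> fst\<Phi>)
  also have "\<dots> = (\<integral>y. (\<integral>v. exp (- p * complex_of_real ((norm (y, v))\<^sup>2)) * L (x + fst (y, v)) \<partial>(lborel :: real measure)) \<partial>lborel)"
    by (rule integral_lborel_pair) (use integrable_lborel_fst[OF \<Phi>i] in \<open>simp only: fst\<Phi>\<close>)
  also have "\<dots> = (\<integral>y. (exp (- p * complex_of_real ((norm y)\<^sup>2)) * L (x + y)) * gaussian_const p \<partial>lborel)"
  proof (intro Bochner_Integration.integral_cong refl)
    fix y :: 'e
    have split: "exp (- p * complex_of_real ((norm (y, v))\<^sup>2)) * L (x + fst (y, v))
        = (exp (- p * complex_of_real ((norm y)\<^sup>2)) * L (x + y)) * exp (- p * complex_of_real (v\<^sup>2))" for v :: real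
      by (simp add: norm_prod_def ring_distribs exp_add mult_ac exp_diff exp_minus divide_inverse)
    show "(\<integral>v. exp (- p * complex_of_real ((norm (y, v))\<^sup>2)) * L (x + fst (y, v)) \<partial>(lborel :: real measure))
        = (exp (- p * complex_of_real ((norm y)\<^sup>2)) * L (x + y)) * gaussian_const p"
      unfolding gaussian_const_def split by (rule integral_mult_right_zero)
  qed
  also have "\<dots> = gaussian_const p * (\<integral>w. exp (- p * complex_of_real ((norm w)\<^sup>2)) * time_laplace h p (x + w) \<partial>lborel)"
    unfolding L_def integral_mult_left_zero by (rule mult.commute)
  finally show "(\<integral>\<tau>. exp (- p * complex_of_real \<tau>) * of_real (paraboloid_mean h x \<tau>) \<partial>lborel)
      = gaussian_const p * (\<integral>w. exp (- p * complex_of_real ((norm w)\<^sup>2)) * time_laplace h p (x + w) \<partial>lborel)" .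
qed

text \<open>On the support \<tau> \<ge> |w|^2 - R, so exp (- \<tau>) \<le> exp (R - |w|^2). This is
  one Gaussian majorant for all \<tau>, negative ones included.\<close>

lemma
  fixes h :: "'e::euclidean_space \<times> real \<Rightarrow> real"
  assumes h: "compact_smooth h"
  shows continuous_on_exp_paraboloid_mean: "continuous_on UNIV (\<lambda>\<tau>. exp (- \<tau>) * paraboloid_mean h x \<tau>)"
    and exp_paraboloid_mean_bounded: "\<exists>B. \<forall>\<tau>. \<bar>exp (- \<tau>) * paraboloid_mean h x \<tau>\<bar> \<le> B"
proof -
  obtain C R where C: "C > 0" "R > 0" "\<And>p. norm p > R \<Longrightarrow> h p = 0" "\<And>p. norm (h p) \<le> C"
    using compact_smooth_boundE[OF h] by metis
  define \<Phi> where "\<Phi> \<tau> w = exp (- \<tau>) * h (x + fst w, \<tau> - (norm w)\<^sup>2)" for \<tau> and w :: "'e \<times> real"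
  define W where "W w = (exp R * C) * norm (exp (- 1 * complex_of_real ((norm w)\<^sup>2)))" for w :: "'e \<times> real"
  have Wi: "integrable lborel W"
    unfolding W_def by (intro integrable_mult_right integrable_norm integrable_complex_gaussian) simp
  have \<Phi>W: "norm (\<Phi> \<tau> w) \<le> W w" for \<tau> w
  proof (cases "norm (x + fst w, \<tau> - (norm w)\<^sup>2) > R")
    case False
    then have "\<bar>\<tau> - (norm w)\<^sup>2\<bar> \<le> R" using norm_snd_le[of "\<tau> - (norm w)\<^sup>2" "x + fst w"] by simp
    then have "exp (- \<tau>) \<le> exp (R - (norm w)\<^sup>2)" by simp
    then have "exp (- \<tau>) * norm (h (x + fst w, \<tau> - (norm w)\<^sup>2)) \<le> exp (R - (norm w)\<^sup>2) * C"
      using C by (intro mult_mono) auto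
    moreover have "norm (exp (- 1 * complex_of_real ((norm w)\<^sup>2))) = exp (- 1 * (norm w)\<^sup>2)"
      by (simp only: norm_complex_gaussian complex_Re_numeral uminus_complex.sel one_complex.sel)
    ultimately show ?thesis by (simp add: \<Phi>_def W_def abs_mult exp_diff exp_minus divide_inverse mult_ac del: norm_exp_eq_Re)
  qed (use C(1,3) in \<open>simp add: \<Phi>_def W_def\<close>)
  have \<Phi>c: "continuous_on UNIV (\<lambda>z. \<Phi> (fst z) (snd z))"
    unfolding \<Phi>_def
    by (intro continuous_intros continuous_on_compose2[OF smooth_continuous[OF compact_smooth_smooth[OF h]]]) auto
  have \<Phi>m: "\<Phi> \<tau> \<in> borel_measurable lborel" for \<tau>
    unfolding measurable_lborel2
    by (intro borel_measurable_continuous_onI continuous_on_compose2[OF \<Phi>c, of UNIV "\<lambda>w. (\<tau>, w)", simplified] continuous_intros)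
  have eq: "exp (- \<tau>) * paraboloid_mean h x \<tau> = (\<integral>w. \<Phi> \<tau> w \<partial>lborel)" for \<tau> by (simp add: \<Phi>_def paraboloid_mean_def)
  show "continuous_on UNIV (\<lambda>\<tau>. exp (- \<tau>) * paraboloid_mean h x \<tau>)"
    unfolding eq
  proof (rule continuous_on_integral_dominated)
    show "continuous_on UNIV (\<lambda>\<tau>. \<Phi> \<tau> w)" for w
      using continuous_on_compose2[OF \<Phi>c, of UNIV "\<lambda>\<tau>. (\<tau>, w)"] by (simp add: continuous_intros)
    show "\<exists>w d. 0 < d \<and> integrable lborel w \<and> (\<forall>\<tau>\<in>UNIV. dist \<tau> \<tau>0 < d \<longrightarrow> (\<forall>x\<in>space lborel. norm (\<Phi> \<tau> x) \<le> w x))" for \<tau>0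
      by (intro exI[of _ W] exI[of _ 1]) (use Wi \<Phi>W in auto)
  qed (rule \<Phi>m)
  have "\<bar>exp (- \<tau>) * paraboloid_mean h x \<tau>\<bar> \<le> integral\<^sup>L lborel W" for \<tau>
  proof -
    have "integrable lborel (\<Phi> \<tau>)"
      by (rule Bochner_Integration.integrable_bound[OF Wi \<Phi>m]) (intro AE_I2, use order_trans[OF \<Phi>W abs_ge_self] in simp)
    from norm_lebesgue_integral_le[OF this Wi \<Phi>W] show ?thesis unfolding eq by simp
  qed
  then show "\<exists>B. \<forall>\<tau>. \<bar>exp (- \<tau>) * paraboloid_mean h x \<tau>\<bar> \<le> B" by blast
qed

text \<open>Both sides have the same Laplace transform in \<open>\<tau>\<close>: with \<open>\<gamma> = gaussian_const p\<close> and the Gaussian average \<open>J\<close>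
  of the Laplace transform of \<open>sqrt_pullback 1 f\<close> they are \<open>J / \<gamma> ^ DIM('e)\<close> and \<open>\<gamma> * (p / pi) ^ \<nu> * J\<close>,
  and \<open>\<gamma>\<^sup>2 = pi / p\<close>. For even \<open>DIM('e)\<close> a fractional number of derivatives would be needed.\<close>

lemma pulled_back_trace_paraboloid:
  fixes f :: "'e::euclidean_space \<times> real \<Rightarrow> real"
  assumes f: "flat_compact_smooth f" and ev: "\<And>x y. f (x, - y) = f (x, y)" and dim: "DIM('e) + 1 = 2 * \<nu>"
  shows "sqrt_pullback 1 (wave_trace f) (x, \<tau>) = paraboloid_mean (time_derivatives \<nu> (sqrt_pullback 1 f)) x \<tau> / pi ^ \<nu>"
proof -
  let ?F = "wave_trace f" and ?g = "sqrt_pullback 1 f"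
  let ?G = "\<lambda>\<tau>. sqrt_pullback 1 (wave_trace f) (x, \<tau>)"
  let ?M = "\<lambda>\<tau>. paraboloid_mean (time_derivatives \<nu> ?g) x \<tau> / pi ^ \<nu>"
  have gc: "compact_smooth ?g" by (rule compact_smooth_sqrt_pullback[OF f])
  note hc = compact_smooth_time_derivatives[OF gc, of \<nu>]
  have fc: "compact_smooth f" using f by (simp add: flat_compact_smooth_def)
  have Fm: "(\<lambda>t. ?F (x, t)) \<in> borel_measurable borel"
    by (intro borel_measurable_continuous_onI continuous_on_compose2[OF smooth_continuous[OF smooth_wave_trace[OF fc]]] continuous_intros) auto
  \<comment> \<open>On the line Re p = 1 a Laplace transform is the Fourier transform of the
    function damped by exp (- \<tau>), so equality of the two Laplace transforms makes the transform
    of \<open>q\<close> vanish.\<close>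
  define q where "q \<tau> = complex_of_real (exp (- \<tau>) * (?G \<tau> - ?M \<tau>))" for \<tau>
  have laplace: "(\<integral>\<tau>. exp (- p * complex_of_real \<tau>) * of_real (?G \<tau>) \<partial>lborel)
        = (\<integral>\<tau>. exp (- p * complex_of_real \<tau>) * of_real (?M \<tau>) \<partial>lborel)"
    and iG: "integrable lborel (\<lambda>\<tau>. exp (- p * complex_of_real \<tau>) * of_real (?G \<tau>))"
    and iM: "integrable lborel (\<lambda>\<tau>. exp (- p * complex_of_real \<tau>) * of_real (?M \<tau>))"
    if p: "0 < Re p" for p
  proof -
    have p0: "p \<noteq> 0" using p by auto
    define J where "J = (\<integral>w. exp (- p * complex_of_real ((norm w)\<^sup>2)) * time_laplace ?g p (x + w) \<partial>lborel)"
    have \<gamma>: "gaussian_const p \<noteq> 0" using gaussian_const_square[OF p] p0 by auto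
    have "gaussian_const p ^ (DIM('e) + 1) = (of_real pi / p) ^ \<nu>"
      unfolding dim power_mult gaussian_const_square[OF p] ..
    then have \<gamma>p: "gaussian_const p ^ DIM('e) * gaussian_const p = (of_real pi / p) ^ \<nu>" by (simp add: mult.commute)
    note i = integrable_laplace_wave_trace[OF fc p, of x]
    show "integrable lborel (\<lambda>\<tau>. exp (- p * complex_of_real \<tau>) * of_real (?G \<tau>))"
      unfolding sqrt_pullback_1 by (rule integrable_laplace_sqrt_substitution[OF Fm wave_trace_even[OF fc] i])
    have "(\<integral>\<tau>. exp (- p * complex_of_real \<tau>) * of_real (?G \<tau>) \<partial>lborel)
        = (\<integral>t. exp (- p * complex_of_real (t\<^sup>2)) * of_real (?F (x, t)) \<partial>lborel)"
      unfolding sqrt_pullback_1 by (rule laplace_sqrt_substitution[OF Fm wave_trace_even[OF fc] i])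
    then have 1: "gaussian_const p ^ DIM('e) * (\<integral>\<tau>. exp (- p * complex_of_real \<tau>) * of_real (?G \<tau>) \<partial>lborel) = J"
      unfolding J_def using laplace_wave_trace[OF fc p, of x] gaussian_integral_time_laplace[OF f ev p, of x] by simp
    have "exp (- p * complex_of_real \<tau>) * of_real (?M \<tau>)
        = (exp (- p * complex_of_real \<tau>) * of_real (paraboloid_mean (time_derivatives \<nu> ?g) x \<tau>)) / of_real pi ^ \<nu>" for \<tau>
      by simp
    note M = this
    show "integrable lborel (\<lambda>\<tau>. exp (- p * complex_of_real \<tau>) * of_real (?M \<tau>))"
      unfolding M by (intro integrable_divide integrable_laplace_paraboloid_mean[OF hc p])
    have "(\<integral>\<tau>. exp (- p * complex_of_real \<tau>) * of_real (?M \<tau>) \<partial>lborel) = gaussian_const p * (p ^ \<nu> * J) / of_real pi ^ \<nu>"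
      unfolding M integral_divide_zero laplace_paraboloid_mean[OF hc p] time_laplace_time_derivatives[OF gc] J_def
      by (simp only: mult.left_commute[of _ "p ^ \<nu>"] integral_mult_right_zero)
    then have "gaussian_const p ^ DIM('e) * (\<integral>\<tau>. exp (- p * complex_of_real \<tau>) * of_real (?M \<tau>) \<partial>lborel)
        = (gaussian_const p ^ DIM('e) * gaussian_const p) * (p ^ \<nu> * J) / of_real pi ^ \<nu>" by simp
    also have "\<dots> = J" unfolding \<gamma>p using p0 by (simp add: power_divide)
    finally show "(\<integral>\<tau>. exp (- p * complex_of_real \<tau>) * of_real (?G \<tau>) \<partial>lborel)
        = (\<integral>\<tau>. exp (- p * complex_of_real \<tau>) * of_real (?M \<tau>) \<partial>lborel)" using 1 \<gamma>
      by (metis (no_types, lifting) mult_left_cancel power_not_zero)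
  qed
  have q: "q \<tau> * cis (- (\<sigma> * \<tau>)) = exp (- Complex 1 \<sigma> * complex_of_real \<tau>) * of_real (?G \<tau>) - exp (- Complex 1 \<sigma> * complex_of_real \<tau>) * of_real (?M \<tau>)" for \<sigma> \<tau>
  proof -
    have "exp (- Complex 1 \<sigma> * complex_of_real \<tau>) = of_real (exp (- \<tau>)) * cis (- (\<sigma> * \<tau>))"
      unfolding exp_eq_polar[of "- Complex 1 \<sigma> * complex_of_real \<tau>"] by simp
    then show ?thesis unfolding q_def by (simp add: algebra_simps)
  qed
  have fq: "fourier q \<sigma> = 0" for \<sigma>
    unfolding fourier_def inner_real_def q using laplace[of "Complex 1 \<sigma>"] iG[of "Complex 1 \<sigma>"] iM[of "Complex 1 \<sigma>"]
    by (subst Bochner_Integration.integral_diff) simp_all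
  have qi: "integrable lborel q"
  proof -
    have "q = (\<lambda>\<tau>. exp (- Complex 1 0 * complex_of_real \<tau>) * of_real (?G \<tau>) - exp (- Complex 1 0 * complex_of_real \<tau>) * of_real (?M \<tau>))"
      using q[of _ 0] by (intro ext) (simp only: mult_zero_left minus_zero cis_zero mult_1_right)
    moreover have "integrable lborel \<dots>" by (intro Bochner_Integration.integrable_diff iG iM) simp_all
    ultimately show ?thesis by simp
  qed
  have qsplit: "exp (- \<tau>) * (?G \<tau> - ?M \<tau>) = exp (- \<tau>) * ?G \<tau> - (exp (- \<tau>) * paraboloid_mean (time_derivatives \<nu> ?g) x \<tau>) / pi ^ \<nu>" for \<tau>
    by (simp add: algebra_simps)
  have qc: "continuous_on UNIV q"
    unfolding q_def qsplit
    by (intro continuous_intros continuous_on_exp_paraboloid_mean[OF hc] continuous_on_compose2[OF continuous_on_pulled_back_trace[OF f ev]]) auto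
  obtain B1 where B1: "B1 \<ge> 0" "\<And>p. \<bar>sqrt_pullback 1 ?F p\<bar> \<le> B1" using pulled_back_trace_bounded[OF f ev] by blast
  obtain B2 where B2: "\<And>\<tau>. \<bar>exp (- \<tau>) * paraboloid_mean (time_derivatives \<nu> ?g) x \<tau>\<bar> \<le> B2" using exp_paraboloid_mean_bounded[OF hc] by blast
  have qb: "norm (q \<tau>) \<le> B1 + B2 / pi ^ \<nu>" for \<tau>
  proof -
    have "\<bar>exp (- \<tau>) * ?G \<tau>\<bar> \<le> B1"
    proof (cases "\<tau> > 0")
      case True
      then have "exp (- \<tau>) * \<bar>?G \<tau>\<bar> \<le> 1 * B1" using B1 by (intro mult_mono) auto
      then show ?thesis by (simp add: abs_mult)
    qed (use B1 in \<open>simp add: sqrt_pullback_nonpos\<close>)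
    moreover have "\<bar>(exp (- \<tau>) * paraboloid_mean (time_derivatives \<nu> ?g) x \<tau>) / pi ^ \<nu>\<bar> \<le> B2 / pi ^ \<nu>"
      using B2[of \<tau>] by (simp add: divide_right_mono)
    ultimately show ?thesis unfolding q_def qsplit norm_of_real by linarith
  qed
  \<comment> \<open>The zero transform is integrable, so inversion applies to \<open>q\<close>;
    continuity makes the conclusion hold at every \<tau>.\<close>
  have "fourier q = (\<lambda>_. 0)" using fq by (rule ext)
  then have "of_real ((2 * pi) ^ DIM(real)) * q \<tau> = 0" using fourier_inversion[OF qi qc qb, of \<tau>] by simp
  then have "q \<tau> = 0" by simp
  then show ?thesis by (simp add: q_def del: of_real_mult of_real_diff of_real_divide)
qed

lemma wave_trace_decay:
  fixes f :: "'e::euclidean_space \<times> real \<Rightarrow> real"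
  assumes f: "flat_compact_smooth f" and ev: "\<And>x y. f (x, - y) = f (x, y)" and dim: "DIM('e) + 1 = 2 * \<nu>"
  shows "\<exists>C. \<forall>x t. \<bar>wave_trace f (x, t)\<bar> \<le> C * (1 + \<bar>t\<bar>) powr (- (real DIM('e) / 2))"
proof -
  have gc: "compact_smooth (sqrt_pullback 1 f)" by (rule compact_smooth_sqrt_pullback[OF f])
  have fc: "compact_smooth f" using f by (simp add: flat_compact_smooth_def)
  obtain C t0 where C: "0 \<le> C" "\<And>x t. t0 \<le> t \<Longrightarrow>
      \<bar>paraboloid_mean (time_derivatives \<nu> (sqrt_pullback 1 f)) x (t\<^sup>2)\<bar> \<le> C * t powr (- 1 / 2 - real \<nu>)"
    using paraboloid_mean_decay[OF gc] by blast
  define a where "a = real DIM('e) / 2"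
  define T where "T = max 1 t0"
  define B where "B = (\<integral>\<xi>. norm (wave_amplitude f \<xi>) \<partial>lborel)"
  have a0: "0 \<le> a" by (simp add: a_def)
  have \<nu>: "1 + (- 1 / 2 - real \<nu>) = - a" using arg_cong[OF dim, of real] by (simp add: a_def)
  have B: "0 \<le> B" "\<And>p. \<bar>wave_trace f p\<bar> \<le> B" using wave_trace_bounded[OF fc] by (auto simp: B_def)
  have "\<bar>wave_trace f (x, t)\<bar> \<le> (C / pi ^ \<nu> * 2 powr a + B * (1 + T) powr a) * (1 + \<bar>t\<bar>) powr (- a)" for x t
  proof (cases "T \<le> \<bar>t\<bar>")
    case True
    define s where "s = \<bar>t\<bar>"
    have s: "1 \<le> s" "t0 \<le> s" using True by (auto simp: T_def s_def)
    have "\<bar>wave_trace f (x, t)\<bar> = \<bar>wave_trace f (x, s)\<bar>"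
      using wave_trace_even[OF fc, of x t] by (simp add: s_def abs_if)
    also have "\<dots> = s * \<bar>sqrt_pullback 1 (wave_trace f) (x, s\<^sup>2)\<bar>"
      unfolding sqrt_pullback_1 using s by (simp add: abs_divide)
    also have "\<dots> \<le> s * (C * s powr (- 1 / 2 - real \<nu>) / pi ^ \<nu>)"
      unfolding pulled_back_trace_paraboloid[OF f ev dim] using s C(2)[OF s(2), of x]
      by (intro mult_left_mono) (simp_all add: abs_divide divide_right_mono)
    also have "\<dots> = C / pi ^ \<nu> * (s powr 1 * s powr (- 1 / 2 - real \<nu>))" using s by simp
    also have "\<dots> = C / pi ^ \<nu> * s powr (- a)" unfolding powr_add[symmetric] \<nu> ..
    \<comment> \<open>As s \<ge> 1 gives 1 + s \<le> 2 s, replacing s by 1 + s costs the factor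
      \<open>2 powr a\<close>.\<close>
    also have "\<dots> = C / pi ^ \<nu> * 2 powr a * (2 * s) powr (- a)" using s by (simp add: powr_mult powr_minus)
    also have "\<dots> \<le> C / pi ^ \<nu> * 2 powr a * (1 + s) powr (- a)"
      using s a0 C(1) by (intro mult_left_mono powr_mono2') auto
    also have "\<dots> \<le> (C / pi ^ \<nu> * 2 powr a + B * (1 + T) powr a) * (1 + s) powr (- a)"
      using B by (intro mult_right_mono) auto
    finally show ?thesis by (simp add: s_def)
  next
    case False
    \<comment> \<open>For |t| < T boundedness is enough, because the weight there is at least
      \<open>(1 + T) powr (- a)\<close>.\<close>
    have T0: "0 < 1 + T" by (simp add: T_def)
    have "\<bar>wave_trace f (x, t)\<bar> \<le> B * ((1 + T) powr a * (1 + T) powr (- a))" using B T0 by (simp add: powr_minus)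
    also have "\<dots> \<le> B * ((1 + T) powr a * (1 + \<bar>t\<bar>) powr (- a))"
      using False a0 B by (intro mult_left_mono powr_mono2') auto
    also have "\<dots> \<le> (C / pi ^ \<nu> * 2 powr a + B * (1 + T) powr a) * (1 + \<bar>t\<bar>) powr (- a)"
      using C(1) by (simp add: algebra_simps)
    finally show ?thesis .
  qed
  then show ?thesis unfolding a_def by blast
qed

section \<open>The weighted space and the range\<close>

lemma measurable_wdist2:
  fixes g h :: "(real^'n) \<times> real \<Rightarrow> real"
  assumes "g \<in> borel_measurable borel" "h \<in> borel_measurable borel"
  shows "(\<lambda>x. ennreal ((g x - h x)\<^sup>2 / \<bar>snd x\<bar>)) \<in> borel_measurable lborel"
proof -
  have "(\<lambda>x::(real^'n) \<times> real. \<bar>snd x\<bar>) \<in> borel_measurable borel"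
    by (intro borel_measurable_continuous_onI continuous_intros)
  then show ?thesis unfolding measurable_lborel2
    by (intro measurable_compose[OF _ measurable_ennreal] borel_measurable_divide borel_measurable_power borel_measurable_diff assms)
qed

lemma wdist2_commute: "wdist2 g h = wdist2 h g"
  by (simp add: wdist2_def power2_commute)

text \<open>\<open>wdist2\<close> is a squared distance with values in \<open>ennreal\<close>; (A +
  B)^2 \<le> 2 A^2 + 2 B^2 replaces the triangle inequality, and the factor 2 does not affect
  limits.\<close>

lemma wdist2_add_le:
  fixes a b c d :: "(real^'n) \<times> real \<Rightarrow> real"
  assumes m: "a \<in> borel_measurable borel" "b \<in> borel_measurable borel" "c \<in> borel_measurable borel" "d \<in> borel_measurable borel"
  shows "wdist2 (\<lambda>x. a x + b x) (\<lambda>x. c x + d x) \<le> 2 * wdist2 a c + 2 * wdist2 b d"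
proof -
  have le: "ennreal ((a x + b x - (c x + d x))\<^sup>2 / \<bar>snd x\<bar>)
      \<le> 2 * ennreal ((a x - c x)\<^sup>2 / \<bar>snd x\<bar>) + 2 * ennreal ((b x - d x)\<^sup>2 / \<bar>snd x\<bar>)" for x
  proof -
    have "(a x + b x - (c x + d x))\<^sup>2 \<le> 2 * (a x - c x)\<^sup>2 + 2 * (b x - d x)\<^sup>2"
      using zero_le_power2[of "(a x - c x) - (b x - d x)"] by (simp add: power2_eq_square algebra_simps)
    then have "(a x + b x - (c x + d x))\<^sup>2 / \<bar>snd x\<bar> \<le> 2 * ((a x - c x)\<^sup>2 / \<bar>snd x\<bar>) + 2 * ((b x - d x)\<^sup>2 / \<bar>snd x\<bar>)"
      using divide_right_mono[of _ _ "\<bar>snd x\<bar>"] by (fastforce simp: add_divide_distrib)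
    then have "ennreal ((a x + b x - (c x + d x))\<^sup>2 / \<bar>snd x\<bar>)
        \<le> ennreal (2 * ((a x - c x)\<^sup>2 / \<bar>snd x\<bar>) + 2 * ((b x - d x)\<^sup>2 / \<bar>snd x\<bar>))" by (rule ennreal_leI)
    also have "ennreal (2 * A + 2 * B) = 2 * ennreal A + 2 * ennreal B" if "0 \<le> A" "0 \<le> B" for A B
      using that by (simp add: ennreal_mult)
    finally show ?thesis by simp
  qed
  have "wdist2 (\<lambda>x. a x + b x) (\<lambda>x. c x + d x)
      \<le> (\<integral>\<^sup>+x. 2 * ennreal ((a x - c x)\<^sup>2 / \<bar>snd x\<bar>) + 2 * ennreal ((b x - d x)\<^sup>2 / \<bar>snd x\<bar>) \<partial>lborel)"
    unfolding wdist2_def by (rule nn_integral_mono) (rule le)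
  also have "\<dots> = 2 * wdist2 a c + 2 * wdist2 b d"
    unfolding wdist2_def using measurable_wdist2[OF m(1,3)] measurable_wdist2[OF m(2,4)]
    by (subst nn_integral_add) (simp_all add: nn_integral_cmult)
  finally show ?thesis .
qed

lemma wdist2_triangle:
  fixes g h k :: "(real^'n) \<times> real \<Rightarrow> real"
  assumes m: "g \<in> borel_measurable borel" "h \<in> borel_measurable borel" "k \<in> borel_measurable borel"
  shows "wdist2 g k \<le> 2 * wdist2 g h + 2 * wdist2 h k"
proof -
  have "wdist2 g k = wdist2 (\<lambda>x. (g x - h x) + h x) (\<lambda>x. 0 + k x)" by simp
  also have "\<dots> \<le> 2 * wdist2 (\<lambda>x. g x - h x) (\<lambda>_. 0) + 2 * wdist2 h k"
    by (rule wdist2_add_le) (use m in measurable)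
  also have "wdist2 (\<lambda>x. g x - h x) (\<lambda>_. 0) = wdist2 g h" by (simp add: wdist2_def)
  finally show ?thesis .
qed

lemma wdist2_cmult:
  fixes g h :: "(real^'n) \<times> real \<Rightarrow> real"
  assumes m: "g \<in> borel_measurable borel" "h \<in> borel_measurable borel"
  shows "wdist2 (\<lambda>x. c * g x) (\<lambda>x. c * h x) = ennreal (c\<^sup>2) * wdist2 g h"
proof -
  have "ennreal ((c * g x - c * h x)\<^sup>2 / \<bar>snd x\<bar>) = ennreal (c\<^sup>2) * ennreal ((g x - h x)\<^sup>2 / \<bar>snd x\<bar>)" for x
    by (simp add: ennreal_mult[symmetric] right_diff_distrib[symmetric] power_mult_distrib del: ennreal_mult)
  then show ?thesis unfolding wdist2_def using measurable_wdist2[OF m] by (simp add: nn_integral_cmult)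
qed

lemma L2ew_measurable: "g \<in> L2ew \<Longrightarrow> g \<in> borel_measurable borel"
  by (simp add: L2ew_def)

lemma L2ew_add:
  assumes g: "g \<in> L2ew" and h: "h \<in> L2ew"
  shows "(\<lambda>x. g x + h x) \<in> L2ew"
proof -
  have "wdist2 (\<lambda>x. g x + h x) (\<lambda>x. 0 + 0) \<le> 2 * wdist2 g (\<lambda>_. 0) + 2 * wdist2 h (\<lambda>_. 0)"
    by (rule wdist2_add_le) (use L2ew_measurable[OF g] L2ew_measurable[OF h] in auto)
  also have "\<dots> < \<infinity>" using g h by (auto simp: L2ew_def ennreal_mult_less_top)
  finally show ?thesis using g h by (simp add: L2ew_def even_last_def borel_measurable_add)
qed

lemma L2ew_cmult:
  assumes g: "g \<in> L2ew"
  shows "(\<lambda>x. c * g x) \<in> L2ew"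
  using g wdist2_cmult[OF L2ew_measurable[OF g], of "\<lambda>_. 0" c]
  by (simp add: L2ew_def even_last_def ennreal_mult_less_top borel_measurable_times)

lemma L2ew_0: "(\<lambda>_. 0) \<in> L2ew"
  by (simp add: L2ew_def even_last_def wdist2_def)

section \<open>Completeness of the weighted space\<close>

text \<open>The increments are summable, so \<open>lim a\<close> is a genuine limit; the constant 2
  is the sum of the geometric series.\<close>

lemma geometric_increments_limit:
  fixes a :: "nat \<Rightarrow> real"
  assumes a: "\<And>j. \<bar>a j - a (Suc j)\<bar> \<le> s * (1 / 2) ^ j"
  shows "\<bar>a k - lim a\<bar> \<le> 2 * s * (1 / 2) ^ k"
proof -
  have s0: "0 \<le> s" using a[of 0] by simp
  have "summable (\<lambda>j. a (Suc j) - a j)"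
    by (rule summable_comparison_test'[of "\<lambda>j. s * (1 / 2) ^ j" 0]) (use a in \<open>auto simp: abs_minus_commute intro!: summable_mult summable_geometric\<close>)
  from summable_LIMSEQ[OF this] have "(\<lambda>n. a n - a 0) \<longlonglongrightarrow> (\<Sum>j. a (Suc j) - a j)" by (simp add: sum_lessThan_telescope)
  from tendsto_add[OF this tendsto_const[of "a 0"]] have "convergent a" by (auto simp: convergent_def)
  then have lim: "(\<lambda>n. a (n + k)) \<longlonglongrightarrow> lim a" by (simp add: convergent_LIMSEQ_iff LIMSEQ_ignore_initial_segment)
  have "\<bar>a k - a (n + k)\<bar> \<le> 2 * s * ((1 / 2) ^ k - (1 / 2) ^ (n + k))" for n
  proof (induction n)
    case (Suc n)
    have "\<bar>a k - a (Suc n + k)\<bar> \<le> 2 * s * ((1 / 2) ^ k - (1 / 2) ^ (n + k)) + s * (1 / 2) ^ (n + k)"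
      using Suc a[of "n + k"] by simp
    then show ?case by (simp add: algebra_simps)
  qed simp
  moreover have "2 * s * ((1 / 2) ^ k - (1 / 2) ^ (n + k)) \<le> 2 * s * (1 / 2) ^ k" for n
    using s0 by (intro mult_left_mono) auto
  ultimately have "\<bar>a k - a (n + k)\<bar> \<le> 2 * s * (1 / 2) ^ k" for n by (rule order_trans)
  with tendsto_rabs[OF tendsto_diff[OF tendsto_const[of "a k"] lim]] show ?thesis
    by (intro LIMSEQ_le_const2) auto
qed

lemma ennreal_tendsto_0_le:
  fixes u v :: "nat \<Rightarrow> ennreal"
  assumes "\<And>k. u k \<le> v k" "v \<longlonglongrightarrow> 0"
  shows "u \<longlonglongrightarrow> 0"
  by (rule tendsto_sandwich[of "\<lambda>_. 0" u sequentially v 0]) (use assms in auto)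

text \<open>The argument of Riesz and Fischer: summability of weighted squared increments in the
  mean gives geometric convergence at almost every point, with a rate that controls the distance to
  the limit.\<close>

lemma wdist2_complete:
  fixes \<phi> :: "nat \<Rightarrow> (real^'n) \<times> real \<Rightarrow> real"
  assumes m: "\<And>k. \<phi> k \<in> borel_measurable borel" and ev: "\<And>k. even_last (\<phi> k)"
    and step: "\<And>k. wdist2 (\<phi> k) (\<phi> (Suc k)) \<le> ennreal ((1 / 8) ^ k)" and fin: "wdist2 (\<phi> 0) (\<lambda>_. 0) < \<infinity>"
  shows "\<exists>f\<in>L2ew. (\<lambda>k. wdist2 (\<phi> k) f) \<longlonglongrightarrow> 0"
proof -
  define D where "D k x = (\<phi> k x - \<phi> (Suc k) x)\<^sup>2 / \<bar>snd x\<bar>" for k x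
  \<comment> \<open>The weights 4^k divide the rate 8^(-k): 2^(-k) remains for the integral of
    \<open>S\<close>, and 4^(-k) under the square root bounds the pointwise increments by multiples
    of 2^(-k).\<close>
  define S where "S x = (\<Sum>k. ennreal (4 ^ k) * ennreal (D k x))" for x
  \<comment> \<open>\<open>lim\<close> is total and depends on the sequence of values alone, so
    \<open>f\<close> is even at points of divergence too.\<close>
  define f where "f x = lim (\<lambda>k. \<phi> k x)" for x
  have fm: "f \<in> borel_measurable borel" unfolding f_def[abs_def] by (rule borel_measurable_lim_metric) (rule m)
  have D0: "0 \<le> D k x" for k x by (simp add: D_def)
  have Dm: "(\<lambda>x. ennreal (D k x)) \<in> borel_measurable lborel" for k
    unfolding D_def by (rule measurable_wdist2[OF m m])
  have Sm: "S \<in> borel_measurable lborel"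
    unfolding S_def[abs_def] by (intro borel_measurable_suminf_order borel_measurable_times_ennreal borel_measurable_const Dm)
  have "integral\<^sup>N lborel S = (\<Sum>k. \<integral>\<^sup>+x. ennreal (4 ^ k) * ennreal (D k x) \<partial>lborel)"
    unfolding S_def by (intro nn_integral_suminf borel_measurable_times_ennreal borel_measurable_const Dm)
  also have "\<dots> = (\<Sum>k. ennreal (4 ^ k) * wdist2 (\<phi> k) (\<phi> (Suc k)))"
    unfolding wdist2_def D_def[symmetric] by (subst nn_integral_cmult[OF Dm]) (rule refl)
  also have "\<dots> \<le> (\<Sum>k. ennreal ((1 / 2) ^ k))"
  proof (rule suminf_le)
    fix k
    have "ennreal (4 ^ k) * wdist2 (\<phi> k) (\<phi> (Suc k)) \<le> ennreal (4 ^ k) * ennreal ((1 / 8) ^ k)" by (intro mult_left_mono step) simp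
    also have "\<dots> = ennreal ((1 / 2) ^ k)" by (subst ennreal_mult[symmetric]) (simp_all add: power_mult_distrib[symmetric])
    finally show "ennreal (4 ^ k) * wdist2 (\<phi> k) (\<phi> (Suc k)) \<le> ennreal ((1 / 2) ^ k)" .
  qed auto
  also have "\<dots> = ennreal (\<Sum>k. (1 / 2) ^ k)" by (rule suminf_ennreal2) (auto intro!: summable_geometric)
  also have "\<dots> = 2" by (subst suminf_geometric) auto
  finally have Si: "integral\<^sup>N lborel S \<le> 2" .
  then have "integral\<^sup>N lborel S \<noteq> \<infinity>" by (auto simp: top_unique)
  from nn_integral_PInf_AE[OF Sm this] have SAE: "AE x in lborel. S x \<noteq> \<infinity>" .
  have bound: "ennreal ((\<phi> k x - f x)\<^sup>2 / \<bar>snd x\<bar>) \<le> ennreal (4 * (1 / 4) ^ k) * S x" if fx: "S x \<noteq> \<infinity>" and x: "snd x \<noteq> 0" for k x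
  proof -
    obtain s where s: "0 \<le> s" "S x = ennreal s" using fx by (cases "S x") auto
    have "\<bar>\<phi> j x - \<phi> (Suc j) x\<bar> \<le> sqrt (s * \<bar>snd x\<bar>) * (1 / 2) ^ j" for j
    proof (rule power2_le_imp_le)
      have "ennreal (4 ^ j * D j x) \<le> ennreal s"
        using sum_le_suminf[of "\<lambda>k. ennreal (4 ^ k) * ennreal (D k x)" "{j}"] unfolding s(2)[symmetric] S_def
        by (simp add: ennreal_mult D0)
      then have "4 ^ j * D j x \<le> s" using s(1) by simp
      then have "(\<phi> j x - \<phi> (Suc j) x)\<^sup>2 * 4 ^ j \<le> s * \<bar>snd x\<bar>" using x by (simp add: D_def field_simps)
      then have "(\<phi> j x - \<phi> (Suc j) x)\<^sup>2 \<le> s * \<bar>snd x\<bar> * (1 / 4) ^ j" by (simp add: power_divide field_simps)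
      also have "(1 / 4 :: real) ^ j = ((1 / 2) ^ j)\<^sup>2" by (simp add: power2_eq_square power_mult_distrib[symmetric])
      finally show "(\<bar>\<phi> j x - \<phi> (Suc j) x\<bar>)\<^sup>2 \<le> (sqrt (s * \<bar>snd x\<bar>) * (1 / 2) ^ j)\<^sup>2"
        using s by (simp add: power_mult_distrib)
    qed (use s in simp)
    from geometric_increments_limit[OF this, of k] have "\<bar>\<phi> k x - f x\<bar> \<le> 2 * sqrt (s * \<bar>snd x\<bar>) * (1 / 2) ^ k"
      by (simp add: f_def)
    then have "\<bar>\<phi> k x - f x\<bar>\<^sup>2 \<le> (2 * sqrt (s * \<bar>snd x\<bar>) * (1 / 2) ^ k)\<^sup>2" by (rule power_mono) simp
    also have "\<dots> = (4 * (1 / 4) ^ k * s) * \<bar>snd x\<bar>"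
      using s by (simp add: power_mult_distrib power2_eq_square[of "(1 / 2) ^ k"] power_mult_distrib[symmetric] mult_ac)
    finally have "(\<phi> k x - f x)\<^sup>2 / \<bar>snd x\<bar> \<le> 4 * (1 / 4) ^ k * s" using x by (simp add: pos_divide_le_eq)
    then show ?thesis unfolding s(2) by (subst ennreal_mult[symmetric]) (use s in \<open>auto intro: ennreal_leI\<close>)
  qed
  have wk: "wdist2 (\<phi> k) f \<le> ennreal (8 * (1 / 4) ^ k)" for k
  proof -
    have "wdist2 (\<phi> k) f \<le> (\<integral>\<^sup>+x. ennreal (4 * (1 / 4) ^ k) * S x \<partial>lborel)"
      unfolding wdist2_def
    proof (rule nn_integral_mono_AE)
      show "AE x in lborel. ennreal ((\<phi> k x - f x)\<^sup>2 / \<bar>snd x\<bar>) \<le> ennreal (4 * (1 / 4) ^ k) * S x"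
        using SAE AE_snd_neq_0 by eventually_elim (rule bound)
    qed
    also have "\<dots> \<le> ennreal (4 * (1 / 4) ^ k) * 2" unfolding nn_integral_cmult[OF Sm] by (intro mult_left_mono Si) simp
    also have "\<dots> = ennreal (8 * (1 / 4) ^ k)" by (subst ennreal_numeral[symmetric], subst ennreal_mult[symmetric]) simp_all
    finally show ?thesis .
  qed
  have "(\<lambda>k. ennreal (8 * (1 / 4) ^ k)) \<longlonglongrightarrow> ennreal (8 * 0)"
    by (rule tendsto_ennrealI[OF tendsto_mult[OF tendsto_const LIMSEQ_power_zero]]) simp
  from ennreal_tendsto_0_le[OF wk, OF this[simplified]] have "(\<lambda>k. wdist2 (\<phi> k) f) \<longlonglongrightarrow> 0" .
  moreover have "f \<in> L2ew"
  proof -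
    have "wdist2 f (\<lambda>_. 0) \<le> 2 * wdist2 f (\<phi> 0) + 2 * wdist2 (\<phi> 0) (\<lambda>_. 0)" by (rule wdist2_triangle[OF fm m]) simp
    also have "\<dots> < \<infinity>"
      using wk[of 0] fin by (auto simp: wdist2_commute[of f] ennreal_mult_less_top intro: le_less_trans)
    finally show ?thesis using fm ev by (simp add: L2ew_def even_last_def f_def)
  qed
  ultimately show ?thesis by blast
qed

lemma C0e_tilde_flat_compact_smooth:
  assumes "f \<in> C0e_tilde"
  shows "flat_compact_smooth f" "compact_smooth f" "\<And>x y. f (x, - y) = f (x, y)"
  using assms by (auto simp: C0e_tilde_iff flat_compact_smooth_def even_last_def)

lemma wave_U_C0e_tilde: "f \<in> C0e_tilde \<Longrightarrow> wave_U f = wave_trace f"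
  by (rule wave_U_eq_wave_trace[OF C0e_tilde_flat_compact_smooth(2)])

lemma wave_U_measurable: "f \<in> C0e_tilde \<Longrightarrow> wave_U f \<in> borel_measurable borel"
  by (simp add: wave_U_C0e_tilde borel_measurable_continuous_onI smooth_continuous smooth_wave_trace C0e_tilde_flat_compact_smooth)

lemma wave_U_0: "wave_U (\<lambda>_. 0) = (\<lambda>_::(real^'n) \<times> real. 0)"
  using wave_trace_cmult[where c=0 and f="\<lambda>_::(real^'n) \<times> real. 0"]
  by (simp add: wave_U_C0e_tilde[OF C0e_tilde_0] fun_eq_iff)

section \<open>The range of the extension\<close>

lemma wdist2_wave_U:
  assumes f: "f \<in> C0e_tilde" and g: "g \<in> C0e_tilde"
  shows "wdist2 (wave_U f) (wave_U g) = wdist2 f g"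
proof -
  define h where "h x = f x - g x" for x
  have h: "h \<in> C0e_tilde" unfolding h_def by (rule C0e_tilde_diff[OF f g])
  have "wave_trace f p = wave_trace g p + wave_trace h p" for p
    using wave_trace_add[OF C0e_tilde_flat_compact_smooth(2)[OF g] C0e_tilde_flat_compact_smooth(2)[OF h], of p] by (simp add: h_def)
  then have "wdist2 (wave_U f) (wave_U g) = (\<integral>\<^sup>+x. ennreal ((wave_trace h x)\<^sup>2 / \<bar>snd x\<bar>) \<partial>lborel)"
    by (simp add: wdist2_def wave_U_C0e_tilde f g)
  also have "\<dots> = wdist2 f g"
    unfolding wave_trace_isometry[OF C0e_tilde_flat_compact_smooth(1,3)[OF h]] by (simp add: wdist2_def h_def)
  finally show ?thesis .
qed

text \<open>\<open>U_ext_range\<close> also demands a limit of the data. The isometry makes a fast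
  subsequence of the data Cauchy and completeness provides the limit, so membership can be tested on
  the images alone. Sums, multiples and limits below all use this.\<close>

lemma U_ext_rangeI:
  assumes g: "g \<in> L2ew" and \<phi>: "\<And>k. \<phi> k \<in> C0e_tilde" and lim: "(\<lambda>k. wdist2 (wave_U (\<phi> k)) g) \<longlonglongrightarrow> 0"
  shows "g \<in> U_ext_range"
proof -
  \<comment> \<open>A quarter of 8^(-k), since two terms with factor 2 from the triangle inequality
    must add up to at most 8^(-k).\<close>
  have "\<exists>n. wdist2 (wave_U (\<phi> n)) g < ennreal ((1 / 8) ^ k / 4)" for k
    using order_tendstoD(2)[OF lim, of "ennreal ((1 / 8) ^ k / 4)"] by (auto simp: eventually_sequentially)
  then obtain r where r: "\<And>k. wdist2 (wave_U (\<phi> (r k))) g < ennreal ((1 / 8) ^ k / 4)" by metis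
  define \<psi> where "\<psi> k = \<phi> (r k)" for k
  have \<psi>: "\<psi> k \<in> C0e_tilde" for k unfolding \<psi>_def by (rule \<phi>)
  have U\<psi>: "wdist2 (wave_U (\<psi> k)) g \<le> ennreal ((1 / 8) ^ k / 4)" for k unfolding \<psi>_def using r by (rule less_imp_le)
  note m = wave_U_measurable[OF \<psi>] L2ew_measurable[OF g]
  have step: "wdist2 (\<psi> k) (\<psi> (Suc k)) \<le> ennreal ((1 / 8) ^ k)" for k
  proof -
    have "wdist2 (\<psi> k) (\<psi> (Suc k)) \<le> 2 * wdist2 (wave_U (\<psi> k)) g + 2 * wdist2 g (wave_U (\<psi> (Suc k)))"
      unfolding wdist2_wave_U[OF \<psi> \<psi>, symmetric] by (rule wdist2_triangle[OF m(1) m(2) m(1)])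
    also have "\<dots> \<le> 2 * ennreal ((1 / 8) ^ k / 4) + 2 * ennreal ((1 / 8) ^ k / 4)"
    proof (intro add_mono mult_left_mono U\<psi>)
      have "wdist2 g (wave_U (\<psi> (Suc k))) \<le> ennreal ((1 / 8) ^ Suc k / 4)" using U\<psi>[of "Suc k"] by (simp only: wdist2_commute)
      also have "\<dots> \<le> ennreal ((1 / 8) ^ k / 4)" by (intro ennreal_leI) simp
      finally show "wdist2 g (wave_U (\<psi> (Suc k))) \<le> ennreal ((1 / 8) ^ k / 4)" .
    qed auto
    also have "\<dots> = ennreal ((1 / 8) ^ k)"
      by (simp add: ennreal_numeral[symmetric] ennreal_mult[symmetric] ennreal_plus[symmetric] del: ennreal_numeral ennreal_plus ennreal_mult)
    finally show ?thesis .
  qed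
  have "wdist2 (\<psi> 0) (\<lambda>_. 0) \<le> 2 * wdist2 (wave_U (\<psi> 0)) g + 2 * wdist2 g (\<lambda>_. 0)"
    unfolding wdist2_wave_U[OF \<psi> C0e_tilde_0, symmetric] wave_U_0 by (rule wdist2_triangle[OF m]) simp
  also have "\<dots> < \<infinity>" using U\<psi>[of 0] g by (auto simp: L2ew_def ennreal_mult_less_top intro: le_less_trans)
  finally have fin: "wdist2 (\<psi> 0) (\<lambda>_. 0) < \<infinity>" .
  have \<psi>m: "\<psi> k \<in> borel_measurable borel" "even_last (\<psi> k)" for k
    using \<psi>[of k] smooth_continuous[OF compact_smooth_smooth] by (auto simp: C0e_tilde_iff intro: borel_measurable_continuous_onI)
  obtain f where f: "f \<in> L2ew" "(\<lambda>k. wdist2 (\<psi> k) f) \<longlonglongrightarrow> 0"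
    using wdist2_complete[of \<psi>, OF \<psi>m step fin] by blast
  have "(\<lambda>k. ennreal ((1 / 8) ^ k / 4)) \<longlonglongrightarrow> ennreal (0 / 4)"
    by (rule tendsto_ennrealI[OF tendsto_divide[OF LIMSEQ_power_zero tendsto_const]]) simp_all
  from ennreal_tendsto_0_le[OF U\<psi>, OF this[simplified]] have "(\<lambda>k. wdist2 (wave_U (\<psi> k)) g) \<longlonglongrightarrow> 0" .
  then show ?thesis using g \<psi> f by (auto simp: U_ext_range_def)
qed

lemma U_ext_rangeE:
  assumes "g \<in> U_ext_range"
  obtains \<phi> where "g \<in> L2ew" "\<And>k. \<phi> k \<in> C0e_tilde" "(\<lambda>k. wdist2 (wave_U (\<phi> k)) g) \<longlonglongrightarrow> 0"
  using assms by (auto simp: U_ext_range_def)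

lemma U_ext_range_0: "(\<lambda>_::(real^'n) \<times> real. 0) \<in> U_ext_range"
proof (rule U_ext_rangeI[of _ "\<lambda>_ _. 0"])
  show "(\<lambda>k. wdist2 (wave_U (\<lambda>_. 0)) (\<lambda>_::(real^'n) \<times> real. 0)) \<longlonglongrightarrow> 0" by (simp add: wave_U_0 wdist2_def)
qed (rule L2ew_0 C0e_tilde_0)+

lemma ennreal_tendsto_cmult_0:
  fixes u :: "nat \<Rightarrow> ennreal"
  shows "c < \<infinity> \<Longrightarrow> u \<longlonglongrightarrow> 0 \<Longrightarrow> (\<lambda>k. c * u k) \<longlonglongrightarrow> 0"
  using ennreal_tendsto_cmult[of c u 0] by simp

lemma U_ext_range_add:
  fixes g h :: "(real^'n) \<times> real \<Rightarrow> real"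
  assumes g: "g \<in> U_ext_range" and h: "h \<in> U_ext_range"
  shows "(\<lambda>x. g x + h x) \<in> U_ext_range"
proof -
  obtain \<phi> where \<phi>: "g \<in> L2ew" "\<And>k. \<phi> k \<in> C0e_tilde" "(\<lambda>k. wdist2 (wave_U (\<phi> k)) g) \<longlonglongrightarrow> 0" using U_ext_rangeE[OF g] by metis
  obtain \<psi> where \<psi>: "h \<in> L2ew" "\<And>k. \<psi> k \<in> C0e_tilde" "(\<lambda>k. wdist2 (wave_U (\<psi> k)) h) \<longlonglongrightarrow> 0" using U_ext_rangeE[OF h] by metis
  have c: "(\<lambda>x. \<phi> k x + \<psi> k x) \<in> C0e_tilde" for k by (rule C0e_tilde_add[OF \<phi>(2) \<psi>(2)])
  have "wave_U (\<lambda>x. \<phi> k x + \<psi> k x) = (\<lambda>x. wave_U (\<phi> k) x + wave_U (\<psi> k) x)" for k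
    by (simp add: wave_U_C0e_tilde c \<phi>(2) \<psi>(2) fun_eq_iff wave_trace_add C0e_tilde_flat_compact_smooth(2))
  then have le: "wdist2 (wave_U (\<lambda>x. \<phi> k x + \<psi> k x)) (\<lambda>x. g x + h x) \<le> 2 * wdist2 (wave_U (\<phi> k)) g + 2 * wdist2 (wave_U (\<psi> k)) h" for k
    using wdist2_add_le[OF wave_U_measurable[OF \<phi>(2)] wave_U_measurable[OF \<psi>(2)] L2ew_measurable[OF \<phi>(1)] L2ew_measurable[OF \<psi>(1)]] by simp
  have "(\<lambda>k. 2 * wdist2 (wave_U (\<phi> k)) g + 2 * wdist2 (wave_U (\<psi> k)) h) \<longlonglongrightarrow> 0 + 0"
    by (intro tendsto_add ennreal_tendsto_cmult_0 \<phi> \<psi>) auto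
  from ennreal_tendsto_0_le[OF le, OF this[simplified]]
  have "(\<lambda>k. wdist2 (wave_U (\<lambda>x. \<phi> k x + \<psi> k x)) (\<lambda>x. g x + h x)) \<longlonglongrightarrow> 0" .
  from U_ext_rangeI[OF L2ew_add[OF \<phi>(1) \<psi>(1)] c this] show ?thesis .
qed

lemma U_ext_range_cmult:
  fixes g :: "(real^'n) \<times> real \<Rightarrow> real"
  assumes g: "g \<in> U_ext_range"
  shows "(\<lambda>x. c * g x) \<in> U_ext_range"
proof -
  obtain \<phi> where \<phi>: "g \<in> L2ew" "\<And>k. \<phi> k \<in> C0e_tilde" "(\<lambda>k. wdist2 (wave_U (\<phi> k)) g) \<longlonglongrightarrow> 0" using U_ext_rangeE[OF g] by metis
  have c: "(\<lambda>x. c * \<phi> k x) \<in> C0e_tilde" for k by (rule C0e_tilde_cmult[OF \<phi>(2)])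
  have "wave_U (\<lambda>x. c * \<phi> k x) = (\<lambda>x. c * wave_U (\<phi> k) x)" for k
    by (simp add: wave_U_C0e_tilde c \<phi>(2) fun_eq_iff wave_trace_cmult C0e_tilde_flat_compact_smooth(2))
  then have "wdist2 (wave_U (\<lambda>x. c * \<phi> k x)) (\<lambda>x. c * g x) = ennreal (c\<^sup>2) * wdist2 (wave_U (\<phi> k)) g" for k
    using wdist2_cmult[OF wave_U_measurable[OF \<phi>(2)] L2ew_measurable[OF \<phi>(1)]] by simp
  moreover have "(\<lambda>k. ennreal (c\<^sup>2) * wdist2 (wave_U (\<phi> k)) g) \<longlonglongrightarrow> 0" by (rule ennreal_tendsto_cmult_0[OF _ \<phi>(3)]) simp
  ultimately have "(\<lambda>k. wdist2 (wave_U (\<lambda>x. c * \<phi> k x)) (\<lambda>x. c * g x)) \<longlonglongrightarrow> 0" by simp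
  from U_ext_rangeI[OF L2ew_cmult[OF \<phi>(1)] c this] show ?thesis .
qed

lemma U_ext_range_closed:
  fixes g :: "(real^'n) \<times> real \<Rightarrow> real"
  assumes h: "\<And>k. h k \<in> U_ext_range" and g: "g \<in> L2ew" and lim: "(\<lambda>k. wdist2 (h k) g) \<longlonglongrightarrow> 0"
  shows "g \<in> U_ext_range"
proof -
  have hL: "h k \<in> L2ew" for k using U_ext_rangeE[OF h] by metis
  \<comment> \<open>A diagonal choice: one image close to each \<open>h k\<close>, with error
    tending to 0.\<close>
  have "\<exists>\<phi>\<in>C0e_tilde. wdist2 (wave_U \<phi>) (h k) \<le> ennreal (inverse (real (Suc k)))" for k
  proof -
    obtain \<phi> where \<phi>: "\<And>j. \<phi> j \<in> C0e_tilde" "(\<lambda>j. wdist2 (wave_U (\<phi> j)) (h k)) \<longlonglongrightarrow> 0" using U_ext_rangeE[OF h] by metis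
    from order_tendstoD(2)[OF \<phi>(2), of "ennreal (inverse (real (Suc k)))"] obtain j where
      "wdist2 (wave_U (\<phi> j)) (h k) < ennreal (inverse (real (Suc k)))" by (auto simp: eventually_sequentially)
    then show ?thesis using \<phi>(1) less_imp_le by blast
  qed
  then obtain \<phi> where \<phi>: "\<And>k. \<phi> k \<in> C0e_tilde" "\<And>k. wdist2 (wave_U (\<phi> k)) (h k) \<le> ennreal (inverse (real (Suc k)))" by metis
  have "(\<lambda>k. ennreal (inverse (real (Suc k)))) \<longlonglongrightarrow> ennreal 0" by (intro tendsto_ennrealI LIMSEQ_inverse_real_of_nat)
  then have lim': "(\<lambda>k. 2 * ennreal (inverse (real (Suc k))) + 2 * wdist2 (h k) g) \<longlonglongrightarrow> 0 + 0"
    by (intro tendsto_add ennreal_tendsto_cmult_0 lim) auto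
  have le: "wdist2 (wave_U (\<phi> k)) g \<le> 2 * ennreal (inverse (real (Suc k))) + 2 * wdist2 (h k) g" for k
    using wdist2_triangle[OF wave_U_measurable[OF \<phi>(1)] L2ew_measurable[OF hL] L2ew_measurable[OF g], of k k]
    by (rule order_trans) (intro add_mono mult_left_mono \<phi>(2) order_refl, simp)
  from ennreal_tendsto_0_le[OF le, OF lim'[unfolded add_0]] have "(\<lambda>k. wdist2 (wave_U (\<phi> k)) g) \<longlonglongrightarrow> 0" .
  from U_ext_rangeI[OF g \<phi>(1) this] show ?thesis .
qed

theorem theorem1:
  fixes f :: "(real^'n) \<times> real \<Rightarrow> real"
  assumes n_even: "even (CARD('n) + 1)"
    and f: "f \<in> C0e_tilde"
  shows "wave_U f \<in> Ce_tilde
    \<and> (\<forall>s::real. sobolev s (\<lambda>(x', \<tau>). heaviside \<tau> * wave_U f (x', sqrt \<tau>) / sqrt \<tau>))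
    \<and> (\<forall>(j::nat) (\<alpha>::(real^'n) list). set \<alpha> \<subseteq> Basis \<longrightarrow>
         (\<exists>C. \<forall>x' t. \<bar>iter_pd (map (\<lambda>b. (b, 0)) \<alpha> @ replicate j (0, 1)) (wave_U f) (x', t)\<bar>
                 \<le> C * (1 + \<bar>t\<bar>) powr (- (real (CARD('n) + 1) - 1) / 2)))
    \<and> ((\<lambda>_::(real^'n) \<times> real. 0::real) \<in> U_ext_range
       \<and> (\<forall>g h :: (real^'n) \<times> real \<Rightarrow> real. g \<in> U_ext_range \<longrightarrow> h \<in> U_ext_range \<longrightarrow> (\<lambda>x. g x + h x) \<in> U_ext_range)
       \<and> (\<forall>(c::real) (g :: (real^'n) \<times> real \<Rightarrow> real). g \<in> U_ext_range \<longrightarrow> (\<lambda>x. c * g x) \<in> U_ext_range)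
       \<and> (\<forall>gk g. (\<forall>k. gk k \<in> (U_ext_range :: ((real^'n) \<times> real \<Rightarrow> real) set)) \<longrightarrow> g \<in> L2ew \<longrightarrow>
              (\<lambda>k. wdist2 (gk k) g) \<longlonglongrightarrow> 0 \<longrightarrow> g \<in> U_ext_range))"
proof (intro conjI allI impI)
  note U = wave_U_C0e_tilde[OF f]
  show "wave_U f \<in> Ce_tilde" unfolding U by (rule wave_trace_in_Ce_tilde[OF f])
  have "(\<lambda>(x', \<tau>). heaviside \<tau> * wave_U f (x', sqrt \<tau>) / sqrt \<tau>) = sqrt_pullback 1 (wave_trace f)"
  proof (rule ext, clarify)
    fix x' :: "real^'n" and \<tau> :: real
    \<comment> \<open>At \<tau> = 0 the Heaviside factor is 1, but division by sqrt 0 = 0 yields 0,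
      which agrees with the pullback.\<close>
    show "heaviside \<tau> * wave_U f (x', sqrt \<tau>) / sqrt \<tau> = sqrt_pullback 1 (wave_trace f) (x', \<tau>)"
      unfolding U sqrt_pullback_1 by (cases "\<tau> = 0") (auto simp: heaviside_def)
  qed
  then show "sobolev s (\<lambda>(x', \<tau>). heaviside \<tau> * wave_U f (x', sqrt \<tau>) / sqrt \<tau>)" for s
    using sobolev_pulled_back_trace[OF C0e_tilde_flat_compact_smooth(1,3)[OF f]] by simp
  show "\<exists>C. \<forall>x' t. \<bar>iter_pd (map (\<lambda>b. (b, 0)) \<alpha> @ replicate j (0, 1)) (wave_U f) (x', t)\<bar>
      \<le> C * (1 + \<bar>t\<bar>) powr (- (real (CARD('n) + 1) - 1) / 2)" if "set \<alpha> \<subseteq> Basis" for j and \<alpha> :: "(real^'n) list"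
  proof -
    \<comment> \<open>Evenness of n supplies the whole number \<nu> = n / 2 of z-derivatives in the
      paraboloid formula.\<close>
    obtain \<nu> where "CARD('n) + 1 = 2 * \<nu>" using n_even by (blast elim: evenE)
    then have dim: "DIM(real^'n) + 1 = 2 * \<nu>" by simp
    have vs: "map (\<lambda>b. (b, 0)) \<alpha> @ replicate j (0, 1) \<in> lists (Basis :: ((real^'n) \<times> real) set)"
      using that by (auto simp: Basis_time intro!: Basis_space)
    have "\<exists>C. \<forall>x t. \<bar>iter_pd (map (\<lambda>b. (b, 0)) \<alpha> @ replicate j (0, 1)) (wave_trace f) (x, t)\<bar>
        \<le> C * (1 + \<bar>t\<bar>) powr (- (real DIM(real^'n) / 2))"
    proof (rule wave_trace_derivatives_decay[OF _ _ f vs])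
      fix h :: "(real^'n) \<times> real \<Rightarrow> real" assume "h \<in> C0e_tilde"
      from wave_trace_decay[OF C0e_tilde_flat_compact_smooth(1,3)[OF this] dim]
      show "\<exists>C. \<forall>x t. \<bar>wave_trace h (x, t)\<bar> \<le> C * (1 + \<bar>t\<bar>) powr (- (real DIM(real^'n) / 2))" .
    qed simp
    then show ?thesis by (simp add: U)
  qed
  show "(\<lambda>_::(real^'n) \<times> real. 0::real) \<in> U_ext_range" by (rule U_ext_range_0)
  show "(\<lambda>x. g x + h x) \<in> U_ext_range" if "g \<in> U_ext_range" "h \<in> U_ext_range" for g h :: "(real^'n) \<times> real \<Rightarrow> real"
    by (rule U_ext_range_add[OF that])
  show "(\<lambda>x. c * g x) \<in> U_ext_range" if "g \<in> U_ext_range" for c and g :: "(real^'n) \<times> real \<Rightarrow> real"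
    by (rule U_ext_range_cmult[OF that])
  show "g \<in> U_ext_range" if "\<forall>k. gk k \<in> U_ext_range" "g \<in> L2ew" "(\<lambda>k. wdist2 (gk k) g) \<longlonglongrightarrow> 0"
    for gk and g :: "(real^'n) \<times> real \<Rightarrow> real"
    using that by (intro U_ext_range_closed[of gk g]) auto
qed

end
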